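(* Let $f$ be a rational map of $\widehat{\mathbb{C}}$ with $\deg f\ge 2$ and with disconnected Julia set. Then either the Fatou set $F_f$ contains at least two critical values of $f$, or the union of the periodic Julia components of $f$ contains at least two critical values of $f$.
   Context: A Julia component of a rational map $f$ is a connected component of its Julia set $J_f$. A Julia component $K$ is periodic if $f^p(K)=K$ for some integer $p\ge 1$. The Fatou set is $F_f=\widehat{\mathbb{C}}\setminus J_f$. Critical values are counted as points, without multiplicity. *)

theory Defs
  imports "HOL-Analysis.Analysis" "HOL-Computational_Algebra.Polynomial"
begin

section \<open>The Riemann sphere\<close>

datatype riemann_sphere = Fin complex | Infty

primrec stereographic :: "riemann_sphere \<Rightarrow> complex \<times> real" where
  "stereographic (Fin z) =
     ((2 / (1 + (cmod z)\<^sup>2)) *\<^sub>R z, ((cmod z)\<^sup>2 - 1) / ((cmod z)\<^sup>2 + 1))"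
| "stereographic Infty = (0, 1)"

lemma inj_stereographic: "inj stereographic"
proof (rule injI)
  define c where "c z = 2 / (1 + (cmod z)\<^sup>2)" for z
  have pos: "1 + (cmod z)\<^sup>2 > 0" for z
    by (simp add: add_pos_nonneg)
  have c: "c z \<noteq> 0" for z
    using pos[of z] by (simp add: c_def)
  have Fin: "stereographic (Fin z) = (c z *\<^sub>R z, 1 - c z)" for z
    using pos[of z] by (simp add: c_def field_simps)
  fix x y
  assume "stereographic x = stereographic y"
  then show "x = y"
    by (cases x; cases y) (auto simp: Fin c simp del: stereographic.simps(1))
qed

text \<open>The chordal metric: the Euclidean distance of the images on the unit sphere of
  \<open>\<complex> \<times> \<real>\<close>.\<close>

instantiation riemann_sphere :: metric_space
begin

definition dist_riemann_sphere :: "riemann_sphere \<Rightarrow> riemann_sphere \<Rightarrow> real" where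
  "dist x y = dist (stereographic x) (stereographic y)"

definition uniformity_riemann_sphere :: "(riemann_sphere \<times> riemann_sphere) filter" where
  "uniformity = (INF e\<in>{0<..}. principal {(x, y). dist (x::riemann_sphere) y < e})"

definition open_riemann_sphere :: "riemann_sphere set \<Rightarrow> bool" where
  "open (U :: riemann_sphere set) = (\<forall>x\<in>U. \<forall>\<^sub>F (x', y) in uniformity. x' = x \<longrightarrow> y \<in> U)"

instance
proof
  fix x y z :: riemann_sphere
  show "dist x y = 0 \<longleftrightarrow> x = y"
    using inj_stereographic by (auto simp: dist_riemann_sphere_def dest: injD)
  show "dist x y \<le> dist x z + dist y z"
    unfolding dist_riemann_sphere_def by (rule dist_triangle2)
qed (simp_all only: uniformity_riemann_sphere_def open_riemann_sphere_def)

end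

section \<open>Rational maps\<close>

text \<open>The value of $p/q$ at infinity is read off from the coefficients of formal degree
  $d = \max(\deg p, \deg q)$, that is, from the homogenisations of $p$ and $q$.\<close>

definition ratfun :: "complex poly \<Rightarrow> complex poly \<Rightarrow> riemann_sphere \<Rightarrow> riemann_sphere" where
  "ratfun p q x =
     (case x of
        Fin z \<Rightarrow> if poly q z = 0 then Infty else Fin (poly p z / poly q z)
      | Infty \<Rightarrow> let d = max (degree p) (degree q) in
          if coeff q d = 0 then Infty else Fin (coeff p d / coeff q d))"

definition rational_map_of_degree :: "nat \<Rightarrow> (riemann_sphere \<Rightarrow> riemann_sphere) \<Rightarrow> bool" where
  "rational_map_of_degree d f \<longleftrightarrow>
     (\<exists>p q. coprime p q \<and> f = ratfun p q \<and> d = max (degree p) (degree q))"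

section \<open>Critical values\<close>

text \<open>Local coordinates around a point: $z$ around a finite point and $1/z$ around infinity.
  The value of a coordinate at the single point outside its domain is irrelevant.\<close>

primrec sphere_inverse :: "riemann_sphere \<Rightarrow> riemann_sphere" where
  "sphere_inverse (Fin z) = (if z = 0 then Infty else Fin (1 / z))"
| "sphere_inverse Infty = Fin 0"

primrec finite_part :: "riemann_sphere \<Rightarrow> complex" where
  "finite_part (Fin z) = z"
| "finite_part Infty = 0"

definition coord_at :: "riemann_sphere \<Rightarrow> riemann_sphere \<Rightarrow> complex" where
  "coord_at c = (if c = Infty then finite_part \<circ> sphere_inverse else finite_part)"

definition param_at :: "riemann_sphere \<Rightarrow> complex \<Rightarrow> riemann_sphere" where
  "param_at c = (if c = Infty then sphere_inverse \<circ> Fin else Fin)"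

definition critical_point :: "(riemann_sphere \<Rightarrow> riemann_sphere) \<Rightarrow> riemann_sphere \<Rightarrow> bool" where
  "critical_point f c \<longleftrightarrow>
     ((coord_at (f c) \<circ> f \<circ> param_at c) has_field_derivative 0) (at (coord_at c c))"

definition critical_values :: "(riemann_sphere \<Rightarrow> riemann_sphere) \<Rightarrow> riemann_sphere set" where
  "critical_values f = f ` {c. critical_point f c}"

section \<open>Fatou and Julia sets\<close>

text \<open>Convergence is with respect to the chordal metric, so limits may take the value infinity.\<close>

definition normal_family_on ::
    "('a::topological_space \<Rightarrow> 'b::metric_space) set \<Rightarrow> 'a set \<Rightarrow> bool" where
  "normal_family_on \<F> U \<longleftrightarrow>
     (\<forall>g :: nat \<Rightarrow> 'a \<Rightarrow> 'b. (\<forall>n. g n \<in> \<F>) \<longrightarrow>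
        (\<exists>r h. strict_mono r \<and>
           (\<forall>K. compact K \<and> K \<subseteq> U \<longrightarrow> uniform_limit K (g \<circ> r) h sequentially)))"

definition fatou_set :: "(riemann_sphere \<Rightarrow> riemann_sphere) \<Rightarrow> riemann_sphere set" where
  "fatou_set f = {x. \<exists>U. open U \<and> x \<in> U \<and> normal_family_on (range (\<lambda>n. f ^^ n)) U}"

definition julia_set :: "(riemann_sphere \<Rightarrow> riemann_sphere) \<Rightarrow> riemann_sphere set" where
  "julia_set f = - fatou_set f"

definition periodic_julia_components ::
    "(riemann_sphere \<Rightarrow> riemann_sphere) \<Rightarrow> riemann_sphere set set" where
  "periodic_julia_components f =
     {K \<in> components (julia_set f). \<exists>p\<ge>1. (f ^^ p) ` K = K}"

end

theory Submission
  imports Defs "HOL-Complex_Analysis.Complex_Analysis" "HOL-Computational_Algebra.Field_as_Ring"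
     "HOL-Computational_Algebra.Polynomial_Factorial" "HOL-Computational_Algebra.Fundamental_Theorem_Algebra"
begin

text \<open>Suppose that the Fatou set contains at most one critical value \<open>b\<close>. As the Julia set is disconnected, some
 Fatou component has a disconnected complement. Such a component is not contracted by the iterates: otherwise it
 would be exhausted by iterated preimages of small discs, which have connected complements since each disc contains at
 most one critical value. Hence it is mapped to a recurrent component \<open>V\<close>, on which iterates \<open>f ^^ m j\<close> tend to the
 identity. Limits of averages of pullbacks of \<open>dz / (z - a)\<close> are invariant forms on \<open>V\<close>; comparing their periods
 shows that the complement of \<open>V\<close> has exactly two components and that no return map interchanges them. So the Julia
 components at the two sides of \<open>V\<close> lie in two disjoint periodic cycles. If one of these cycles contained no
 critical value, the inverse branches of the iterates along \<open>V\<close> would extend across a frontier point of \<open>V\<close>, near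
 which \<open>f ^^ m j\<close> would again tend to the identity, or, if the orbit of \<open>b\<close> accumulates on the whole side, branches
 at its closest approaches to the cycle would map a neighbourhood of a Julia point into ever smaller sets.\<close>

text \<open>Neither the classification of periodic Fatou components nor the absence of wandering
  domains is invoked; the alternative between contracting and recurrent components replaces both,
  and this is why a wandering component carrying \<open>b\<close> has to be treated by hand. In
  hindsight \<open>V\<close> is a Herman ring and the invariant form a multiple of dx / x in a
  uniformizing coordinate x, but only periods are used: those of dz / (z - a) are winding numbers,
  and these survive pullback by maps close to the identity. The degree enters through a Fatou
  component \<open>W\<close> outside the orbit of \<open>V\<close> that is mapped into it: an open
  set that iterates may omit, so that Montel's theorem applies. Extending inverse branches across
  the Julia set requires keeping them off the critical values. This is the purpose of a barrier, a
  closed forward invariant subset \<open>E\<close> of the Fatou set: branches that start off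
  \<open>E\<close> never enter it, hence cannot pass from the part of the sphere around the cycle to
  the part with the critical values of the Julia set. Then only \<open>b\<close> can stop
  them.\<close>

section \<open>Topology of the Riemann sphere\<close>

lemma norm_stereographic [simp]: "norm (stereographic x) = 1"
proof (cases x)
 case (Fin z)
 define c where "c = 2 / (1 + (cmod z)\<^sup>2)"
 have pos: "1 + (cmod z)\<^sup>2 > 0" by (simp add: add_pos_nonneg)
 have st: "stereographic x = (c *\<^sub>R z, 1 - c)" using pos by (simp add: Fin c_def field_simps)
 have "c * (1 + (cmod z)\<^sup>2) = 2" unfolding c_def using pos by (metis nonzero_eq_divide_eq less_irrefl)
 hence "c * (c * (1 + (cmod z)\<^sup>2)) = c * 2" by simp
 hence "c\<^sup>2 * (cmod z)\<^sup>2 + (1 - c)\<^sup>2 = 1" by (simp add: power2_eq_square algebra_simps)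
 thus ?thesis unfolding st norm_Pair by (simp add: power_mult_distrib)
qed auto

lemma range_stereographic: "range stereographic = sphere 0 1"
proof
 show "range stereographic \<subseteq> sphere 0 1" by auto
 show "sphere 0 1 \<subseteq> range stereographic"
 proof
  fix p :: "complex \<times> real"
  assume "p \<in> sphere 0 1"
  obtain w t where p: "p = (w, t)" by fastforce
  have nrm: "(cmod w)\<^sup>2 + t\<^sup>2 = 1" using \<open>p \<in> sphere 0 1\<close> by (simp add: p norm_Pair)
  show "p \<in> range stereographic"
  proof (cases "t = 1")
   case True
   hence "p = stereographic Infty" using nrm by (simp add: p)
   thus ?thesis by blast
  next
   case False
   define z where "z = w /\<^sub>R (1 - t)"
   have "t\<^sup>2 \<le> 1" using nrm by (smt (verit) zero_le_power2)
   hence "t < 1" using False by (simp add: abs_square_le_1)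
   have z2: "(cmod z)\<^sup>2 * (1 - t)\<^sup>2 = 1 - t\<^sup>2"
    using nrm \<open>t < 1\<close> by (simp add: z_def power_mult_distrib power_divide field_simps)
   hence "(cmod z)\<^sup>2 * (1 - t) * (1 - t) = (1 + t) * (1 - t)" by algebra
   hence z3: "(cmod z)\<^sup>2 * (1 - t) = 1 + t" using \<open>t < 1\<close> by simp
   hence "(1 + (cmod z)\<^sup>2) * (1 - t) = 2" by (simp add: algebra_simps)
   hence c: "2 / (1 + (cmod z)\<^sup>2) = 1 - t"
    by (metis add_pos_nonneg less_irrefl mult.commute nonzero_mult_div_cancel_right
      zero_le_power2 zero_less_one mult_zero_left)
   have "((cmod z)\<^sup>2 - 1) / ((cmod z)\<^sup>2 + 1) = 1 - 2 / (1 + (cmod z)\<^sup>2)"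
    by (simp add: field_simps add_nonneg_eq_0_iff)
   hence "stereographic (Fin z) = ((1 - t) *\<^sub>R z, t)" unfolding stereographic.simps c by simp
   also have "\<dots> = p" using \<open>t < 1\<close> by (simp add: p z_def)
   finally have "stereographic (Fin z) = p" .
   thus ?thesis by blast
  qed
 qed
qed

lemma continuous_stereographic: "continuous_on A stereographic"
 unfolding continuous_on_iff dist_riemann_sphere_def by auto

lemma homeomorphism_stereographic:
 "homeomorphism UNIV (sphere 0 1) stereographic (inv stereographic)"
proof
 show "continuous_on (sphere 0 1) (inv stereographic)"
  unfolding continuous_on_iff dist_riemann_sphere_def range_stereographic [symmetric] by (metis f_inv_into_f)
qed (auto simp: continuous_stereographic range_stereographic [symmetric] inj_stereographic)

lemma stereographic_inv [simp]: "p \<in> sphere 0 1 \<Longrightarrow> stereographic (inv stereographic p) = p"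
 by (metis homeomorphism_stereographic homeomorphism_def)

lemma inv_stereographic [simp]: "inv stereographic (stereographic x) = x"
 by (simp add: inj_stereographic)

lemma continuous_inv_stereographic: "A \<subseteq> sphere 0 1 \<Longrightarrow> continuous_on A (inv stereographic)"
 using continuous_on_subset homeomorphism_cont2 [OF homeomorphism_stereographic] by blast

lemma compact_UNIV_sphere: "compact (UNIV :: riemann_sphere set)"
 using homeomorphism_stereographic homeomorphic_compactness homeomorphic_def by (metis compact_sphere)

instance riemann_sphere :: heine_borel
proof
 fix u :: "nat \<Rightarrow> riemann_sphere"
 have "seq_compact (UNIV :: riemann_sphere set)"
  using compact_UNIV_sphere by (simp add: compact_eq_seq_compact_metric)
 thus "\<exists>l r. strict_mono r \<and> (u \<circ> r) \<longlonglongrightarrow> l" unfolding seq_compact_def by blast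
qed

lemma compact_ball_cover:
 fixes C :: "'a::metric_space set"
 assumes "compact C" "\<And>x. x \<in> C \<Longrightarrow> 0 < r x"
 obtains F where "F \<subseteq> C" "finite F" "C \<subseteq> (\<Union>x\<in>F. ball x (r x))"
proof (rule compactE_image [OF assms(1), of C "\<lambda>x. ball x (r x)"])
 show "C \<subseteq> (\<Union>x\<in>C. ball x (r x))" using assms(2) by fastforce
qed auto

lemma compact_nbhd:
 fixes C U :: "'a::heine_borel set"
 assumes "compact C" "open U" "C \<subseteq> U"
 obtains e K where "e > 0" "compact K" "K \<subseteq> U" "\<And>x. x \<in> C \<Longrightarrow> cball x e \<subseteq> K"
proof (cases "C = {}")
 case False
 obtain e where e: "e > 0" "(\<Union>x\<in>C. cball x e) \<subseteq> U"
  using compact_subset_open_imp_cball_epsilon_subset [OF assms] by blast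
 show thesis
 proof (rule that [OF e(1) compact_infdist_le [OF False assms(1) e(1)]])
  show "{x. infdist x C \<le> e} \<subseteq> U"
  proof clarify
   fix x assume "infdist x C \<le> e"
   moreover obtain y where "y \<in> C" "infdist x C = dist x y"
    using infdist_attains_inf [OF compact_imp_closed [OF assms(1)] False] by blast
   ultimately have "x \<in> cball y e" by (simp add: dist_commute)
   thus "x \<in> U" using e(2) \<open>y \<in> C\<close> by blast
  qed
  show "cball x e \<subseteq> {x. infdist x C \<le> e}" if "x \<in> C" for x using infdist_le2 [OF that] by (auto simp: dist_commute)
 qed
qed (use that [of 1 "{}"] in auto)

lemma closed_imp_compact_sphere: "closed A \<Longrightarrow> compact (A :: riemann_sphere set)"
 using compact_Int_closed [OF compact_UNIV_sphere] by simp

text \<open>Unicoherence turns connectedness of a domain and its complement into connectedness of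
  the frontier: two closed connected sets that cover the sphere meet in a connected set.\<close>

lemma unicoherent_UNIV_sphere: "unicoherent (UNIV :: riemann_sphere set)"
proof -
 have "unicoherent (sphere (0 :: complex \<times> real) 1)" by (intro Borsukian_imp_unicoherent Borsukian_sphere) simp
 thus ?thesis using homeomorphism_stereographic homeomorphic_unicoherent_eq homeomorphic_def by metis
qed

section \<open>Connectedness of spherical discs and their complements\<close>

lemma cos_law_unit:
 fixes p q :: "'a::real_inner"
 assumes "norm p = 1" "norm q = 1"
 shows "(dist p q)\<^sup>2 = 2 - 2 * (p \<bullet> q)"
 using assms by (simp add: dist_norm power2_norm_eq_inner inner_diff algebra_simps norm_eq_1 inner_commute)

text \<open>An upward closed \<open>P\<close> covers open and closed caps around \<open>p\<close> at
  once. A point \<open>q\<close> of the cap is joined to \<open>p\<close> along a great circle, on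
  which the inner product with \<open>p\<close> only increases.\<close>

lemma connected_spherical_cap:
 fixes p :: "'a::euclidean_space"
 assumes p: "norm p = 1" and dim: "2 \<le> DIM('a)"
  and up: "\<And>s t. P s \<Longrightarrow> s \<le> t \<Longrightarrow> P t"
 shows "connected {q \<in> sphere 0 1. P (p \<bullet> q)}"
proof (cases "P (-1)")
 case True
 have "-1 \<le> p \<bullet> q" if "norm q = 1" for q using Cauchy_Schwarz_ineq2 [of p q] p that by simp
 hence "{q \<in> sphere 0 1. P (p \<bullet> q)} = sphere 0 1" using True up by fastforce
 thus ?thesis using connected_sphere [OF dim] by simp
next
 case False
 let ?C = "{q \<in> sphere 0 1. P (p \<bullet> q)}"
 have "connected_component ?C q p" if q: "q \<in> ?C" for q
 proof (cases "q = p")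
  case True
  thus ?thesis using q by auto
 next
  case False
  define s where "s = p \<bullet> q"
  have nq: "norm q = 1" and Ps: "P s" using q by (auto simp: s_def)
  have "s \<noteq> 1" using cos_law_unit [OF p nq] False by (auto simp: s_def)
  moreover have "s \<le> 1" using norm_cauchy_schwarz [of p q] p nq by (simp add: s_def)
  \<comment> \<open>Since \<open>P (-1)\<close> fails, \<open>q\<close> is not the antipode of
    \<open>p\<close>, and the great circle through both is determined.\<close>
  moreover have "-1 < s" using up Ps \<open>\<not> P (-1)\<close> by (meson not_le)
  ultimately have s: "-1 < s" "s < 1" by auto
  hence "0 < (1 - s) * (1 + s)" by simp
  hence s2: "0 < 1 - s\<^sup>2" by (simp add: power2_eq_square algebra_simps)
  define v where "v = q - s *\<^sub>R p"
  define \<rho> where "\<rho> t = sqrt (1 - t\<^sup>2) / sqrt (1 - s\<^sup>2)" for t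
  define k where "k t = t *\<^sub>R p + \<rho> t *\<^sub>R v" for t
  have pp: "p \<bullet> p = 1" "q \<bullet> q = 1" "q \<bullet> p = s" using p nq by (auto simp: norm_eq_1 s_def inner_commute)
  have pv: "p \<bullet> v = 0" "v \<bullet> p = 0" by (simp_all add: v_def inner_diff pp s_def inner_commute)
  have vv: "v \<bullet> v = 1 - s\<^sup>2"
   by (simp add: v_def inner_diff pp inner_commute [of p q] power2_eq_square algebra_simps)
  have pk: "p \<bullet> k t = t" for t by (simp add: k_def inner_add_right pv pp)
  have nk: "norm (k t) = 1" if "t \<in> {s..1}" for t
  proof -
   have "\<bar>t\<bar> \<le> 1" using that s by auto
   hence t2: "t\<^sup>2 \<le> 1" by (simp add: abs_square_le_1)
   have "k t \<bullet> k t = t\<^sup>2 + (\<rho> t)\<^sup>2 * (1 - s\<^sup>2)"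
    by (simp add: k_def inner_add_left inner_add_right pv vv pp power2_eq_square)
   also have "\<dots> = 1" using t2 s2 by (simp add: \<rho>_def power_divide)
   finally show ?thesis by (simp add: norm_eq_1)
  qed
  have "continuous_on {s..1} k" unfolding k_def \<rho>_def by (intro continuous_intros) (use s2 in auto)
  hence "connected (k ` {s..1})" by (intro connected_continuous_image) auto
  moreover have "k ` {s..1} \<subseteq> ?C" using nk pk up [OF Ps] by auto
  moreover have "k s = q" "k 1 = p" using s2 by (auto simp: k_def \<rho>_def v_def)
  hence "q \<in> k ` {s..1}" "p \<in> k ` {s..1}" using s by (metis atLeastAtMost_iff imageI order_refl less_imp_le)+
  ultimately show ?thesis unfolding connected_component_def by blast
 qed
 thus ?thesis unfolding connected_iff_connected_component
  by (meson connected_component_sym connected_component_trans)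
qed

lemma connected_image_stereographic_iff:
 "connected (stereographic ` A) \<longleftrightarrow> connected A"
proof
 assume "connected (stereographic ` A)"
 hence "connected (inv stereographic ` stereographic ` A)"
  by (intro connected_continuous_image [OF continuous_inv_stereographic]) auto
 thus "connected A" by (simp add: image_image)
next
 assume "connected A"
 thus "connected (stereographic ` A)" using connected_continuous_image continuous_stereographic by blast
qed

text \<open>The chordal distance decreases with the inner product. So a ball is a cap around
  \<open>stereographic x\<close>, and its complement a cap around the antipode.\<close>

lemma
 fixes x :: riemann_sphere
 shows connected_ball_sphere: "connected (ball x r)"
  and connected_compl_ball_sphere: "connected (- ball x r)"
proof -
 have dim: "2 \<le> DIM(complex \<times> real)" by simp
 have dist_less: "dist x y < r \<longleftrightarrow> 0 < r \<and> 2 - 2 * (stereographic x \<bullet> stereographic y) < r\<^sup>2" for y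
 proof -
  have "dist x y < r \<longleftrightarrow> 0 < r \<and> (dist x y)\<^sup>2 < r\<^sup>2"
   by (metis abs_of_nonneg abs_of_pos dual_order.strict_trans2 power2_less_imp_less
     power_strict_mono zero_le_dist zero_less_numeral less_imp_le)
  thus ?thesis by (simp add: dist_riemann_sphere_def cos_law_unit)
 qed
 have sph: "stereographic ` {y. Q (stereographic y)} = {q \<in> sphere 0 1. Q q}" for Q
  unfolding range_stereographic [symmetric] by auto
 show "connected (ball x r)"
 proof (cases "0 < r")
  case True
  hence "ball x r = {y. 2 - 2 * (stereographic x \<bullet> stereographic y) < r\<^sup>2}" by (auto simp: dist_less)
  moreover have "connected {q \<in> sphere 0 1. 2 - 2 * (stereographic x \<bullet> q) < r\<^sup>2}"
   by (rule connected_spherical_cap [OF norm_stereographic dim]) auto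
  ultimately show ?thesis unfolding sph [symmetric] by (simp add: connected_image_stereographic_iff)
 qed (auto simp: not_less ball_empty)
 show "connected (- ball x r)"
 proof (cases "0 < r")
  case True
  hence "- ball x r = {y. r\<^sup>2 \<le> 2 + 2 * (- stereographic x \<bullet> stereographic y)}" by (auto simp: dist_less)
  moreover have "connected {q \<in> sphere 0 1. r\<^sup>2 \<le> 2 + 2 * (- stereographic x \<bullet> q)}"
   by (rule connected_spherical_cap [OF _ dim]) auto
  ultimately show ?thesis unfolding sph [symmetric] by (simp add: connected_image_stereographic_iff)
 next
  case False
  have "connected (sphere (0 :: complex \<times> real) 1)" using connected_sphere [OF dim] .
  hence "connected (UNIV :: riemann_sphere set)" by (metis connected_image_stereographic_iff range_stereographic)
  thus ?thesis using False by (simp add: ball_empty)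
 qed
qed

lemma connected_UNIV_sphere: "connected (UNIV :: riemann_sphere set)"
 using connected_compl_ball_sphere [of _ 0] by (simp add: ball_empty)

lemma open_component_sphere:
 fixes U :: "riemann_sphere set"
 assumes "open U" "C \<in> components U"
 shows "open C"
 unfolding open_contains_ball
proof
 fix x assume "x \<in> C"
 hence "x \<in> U" using assms in_components_subset by blast
 then obtain r where r: "r > 0" "ball x r \<subseteq> U" using assms open_contains_ball by blast
 hence "ball x r \<subseteq> C" using \<open>x \<in> C\<close> assms connected_ball_sphere [of x r]
  by (meson centre_in_ball components_maximal disjoint_iff)
 thus "\<exists>r>0. ball x r \<subseteq> C" using r by blast
qed

lemma component_image_stereographic:
 assumes "C \<in> components J"
 shows "stereographic ` C \<in> components (stereographic ` J)"
 unfolding in_components_maximal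
proof (intro conjI allI impI)
 show "stereographic ` C \<noteq> {}" "connected (stereographic ` C)"
  using assms by (auto simp: in_components_maximal connected_image_stereographic_iff)
 show "stereographic ` C \<subseteq> stereographic ` J" using in_components_subset [OF assms] by blast
 fix D assume D: "D \<noteq> {} \<and> stereographic ` C \<subseteq> D \<and> D \<subseteq> stereographic ` J \<and> connected D"
 then obtain D' where D': "D = stereographic ` D'" "D' \<subseteq> J" by (meson subset_imageE)
 hence "C \<subseteq> D'" "connected D'" "D' \<noteq> {}"
  using D inj_stereographic by (auto simp: inj_image_subset_iff connected_image_stereographic_iff)
 thus "D = stereographic ` C" using assms D' unfolding in_components_maximal by blast
qed

text \<open>The Sura-Bura theorem: components of a compact set have arbitrarily small neighbourhoods
  that are open and closed in that set. It is applied to the image of \<open>J\<close> in \<complex>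
  \<times> \<real> and carried back.\<close>

lemma clopen_neighbourhood_sphere:
 fixes J :: "riemann_sphere set"
 assumes "closed J" and C: "C \<in> components J" and U: "open U" "C \<subseteq> U"
 obtains A where "openin (top_of_set J) A" "closed A" "C \<subseteq> A" "A \<subseteq> U"
proof -
 let ?s = "stereographic" and ?i = "inv stereographic"
 have cJ: "compact J" using assms(1) closed_imp_compact_sphere by blast
 hence csJ: "compact (?s ` J)" by (simp add: compact_continuous_image continuous_stereographic)
 have hom: "homeomorphism J (?s ` J) ?s ?i" using homeomorphism_stereographic by (rule homeomorphism_of_subsets) auto
 have sC: "?s ` C \<in> components (?s ` J)" by (rule component_image_stereographic [OF C])
 have "openin (top_of_set (sphere 0 1)) (?s ` U)"
  by (metis homeomorphism_imp_open_map homeomorphism_stereographic open_openin subtopology_UNIV U(1))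
 then obtain T where T: "open T" "?s ` U = sphere 0 1 \<inter> T" by (metis openin_open)
 have "?s ` C \<subseteq> T" using T U by blast
 moreover have "compact (?s ` C)"
  using C assms(1) closed_components closed_imp_compact_sphere compact_continuous_image
   continuous_stereographic by blast
 ultimately obtain K where K: "openin (top_of_set (?s ` J)) K" "compact K" "?s ` C \<subseteq> K" "K \<subseteq> T"
  using Sura_Bura_clopen_subset [OF closed_imp_locally_compact [OF compact_imp_closed [OF csJ]] sC] T(1) by metis
 have KJ: "K \<subseteq> ?s ` J" using K openin_imp_subset by blast
 show thesis
 proof
  show "openin (top_of_set J) (?i ` K)" using K(1) hom homeomorphism_imp_open_map homeomorphism_symD by blast
  have "compact (?i ` K)" using K(2) KJ by (intro compact_continuous_image continuous_inv_stereographic) auto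
  thus "closed (?i ` K)" by (simp add: compact_imp_closed)
  show "C \<subseteq> ?i ` K" using K(3) by (metis image_subset_iff inv_stereographic image_eqI subsetI)
  show "?i ` K \<subseteq> U"
  proof
   fix x assume "x \<in> ?i ` K"
   hence "?s x \<in> K" using KJ by auto
   hence "?s x \<in> ?s ` U" using K(4) T KJ by auto
   thus "x \<in> U" using inj_stereographic by (simp add: inj_image_mem_iff)
  qed
 qed
qed

section \<open>Charts and holomorphic maps into the sphere\<close>

text \<open>The point with homogeneous coordinates [x : y]; the pair (0, 0) gets the junk value
  \<open>Infty\<close>.\<close>

definition proj :: "complex \<Rightarrow> complex \<Rightarrow> riemann_sphere" where
 "proj x y = (if y = 0 then Infty else Fin (x / y))"

text \<open>The right-hand side has no case distinction at infinity, so the continuity of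
  \<open>proj\<close> along nonvanishing pairs can be read off.\<close>

lemma stereographic_proj:
 assumes "x \<noteq> 0 \<or> y \<noteq> 0"
 shows "stereographic (proj x y) =
  ((2 / ((cmod x)\<^sup>2 + (cmod y)\<^sup>2)) *\<^sub>R (x * cnj y),
   ((cmod x)\<^sup>2 - (cmod y)\<^sup>2) / ((cmod x)\<^sup>2 + (cmod y)\<^sup>2))"
proof (cases "y = 0")
 case True
 thus ?thesis using assms by (simp add: proj_def)
next
 case False
 define r where "r = cmod y"
 define s where "s = cmod x"
 have r: "r > 0" using False by (simp add: r_def)
 have rs: "s\<^sup>2 + r\<^sup>2 > 0" using r by (simp add: add_nonneg_pos)
 have xy: "x / y = (1 / r\<^sup>2) *\<^sub>R (x * cnj y)" by (subst complex_div_cnj) (simp add: r_def scaleR_conv_of_real)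
 have 1: "2 / (1 + (s / r)\<^sup>2) * (1 / r\<^sup>2) = 2 / (s\<^sup>2 + r\<^sup>2)" using r rs by (simp add: power_divide field_simps)
 have "(s / r)\<^sup>2 - 1 = (s\<^sup>2 - r\<^sup>2) / r\<^sup>2" "(s / r)\<^sup>2 + 1 = (s\<^sup>2 + r\<^sup>2) / r\<^sup>2"
  using r by (simp_all add: power_divide field_simps)
 hence 2: "((s / r)\<^sup>2 - 1) / ((s / r)\<^sup>2 + 1) = (s\<^sup>2 - r\<^sup>2) / (s\<^sup>2 + r\<^sup>2)" using r by simp
 have "stereographic (proj x y) = ((2 / (1 + (s / r)\<^sup>2)) *\<^sub>R (x / y), ((s / r)\<^sup>2 - 1) / ((s / r)\<^sup>2 + 1))"
  using False by (simp add: proj_def norm_divide r_def s_def)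
 thus ?thesis unfolding xy scaleR_scaleR 1 2 by (simp add: r_def s_def)
qed

lemma continuous_on_sphere_iff: "continuous_on A g \<longleftrightarrow> continuous_on A (\<lambda>x. stereographic (g x))"
proof
 assume "continuous_on A (\<lambda>x. stereographic (g x))"
 hence "continuous_on A (\<lambda>x. inv stereographic (stereographic (g x)))"
  by (rule continuous_on_compose2 [OF continuous_inv_stereographic [OF order_refl]]) auto
 thus "continuous_on A g" by simp
qed (rule continuous_on_compose2 [OF continuous_stereographic], auto)

lemma continuous_on_proj:
 assumes "continuous_on A P" "continuous_on A Q" "\<And>z. z \<in> A \<Longrightarrow> P z \<noteq> 0 \<or> Q z \<noteq> 0"
 shows "continuous_on A (\<lambda>z. proj (P z) (Q z))"
proof -
 have "(cmod (P z))\<^sup>2 + (cmod (Q z))\<^sup>2 \<noteq> 0" if "z \<in> A" for z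
  using assms(3) [OF that] by (simp add: sum_power2_eq_zero_iff)
 hence "continuous_on A (\<lambda>z.
  ((2 / ((cmod (P z))\<^sup>2 + (cmod (Q z))\<^sup>2)) *\<^sub>R (P z * cnj (Q z)),
   ((cmod (P z))\<^sup>2 - (cmod (Q z))\<^sup>2) / ((cmod (P z))\<^sup>2 + (cmod (Q z))\<^sup>2)))"
  by (intro continuous_intros assms) auto
 thus ?thesis unfolding continuous_on_sphere_iff [of A]
  by (rule continuous_on_eq) (simp add: stereographic_proj [OF assms(3)])
qed

text \<open>The sphere is the union of the closed discs of points [z : 1] and [1 : z] with z in the
  closed unit disc. Each is parametrised homeomorphically by a compact disc, and there
  \<open>g\<close> is given by a pair of continuous functions.\<close>

lemma continuous_homogeneous:
 assumes g: "\<And>x y. x \<noteq> 0 \<or> y \<noteq> 0 \<Longrightarrow> g (proj x y) = proj (P x y) (Q x y)"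
  and nz: "\<And>x y. x \<noteq> 0 \<or> y \<noteq> 0 \<Longrightarrow> P x y \<noteq> 0 \<or> Q x y \<noteq> 0"
  and P: "continuous_on UNIV (\<lambda>(x, y). P x y)" and Q: "continuous_on UNIV (\<lambda>(x, y). Q x y)"
 shows "continuous_on UNIV g"
proof -
 have main: "continuous_on (k ` cball 0 1) g"
  if k: "k = (\<lambda>z. proj (X z) (Y z))" and inj: "inj k" and XY: "continuous_on UNIV X" "continuous_on UNIV Y"
   and nzXY: "\<And>z. X z \<noteq> 0 \<or> Y z \<noteq> 0" for k and X Y :: "complex \<Rightarrow> complex"
 proof -
  have ck: "continuous_on (cball 0 1) k"
   unfolding k by (intro continuous_on_proj continuous_on_subset [OF XY(1)] continuous_on_subset [OF XY(2)] nzXY) auto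
  have cP: "continuous_on UNIV (\<lambda>z. P (X z) (Y z))" and cQ: "continuous_on UNIV (\<lambda>z. Q (X z) (Y z))"
   using continuous_on_compose2 [OF P continuous_on_Pair [OF XY]]
    continuous_on_compose2 [OF Q continuous_on_Pair [OF XY]] by auto
  have "continuous_on (cball 0 1) (\<lambda>z. proj (P (X z) (Y z)) (Q (X z) (Y z)))"
   by (intro continuous_on_proj continuous_on_subset [OF cP] continuous_on_subset [OF cQ] nz nzXY) auto
  hence "continuous_on (cball 0 1) (g \<circ> k)" by (rule continuous_on_eq) (simp add: k g [OF nzXY])
  moreover have "continuous_on (k ` cball 0 1) (inv k)"
   using ck by (rule continuous_on_inv [OF _ compact_cball]) (use inj in auto)
  moreover have "inv k ` k ` cball 0 1 \<subseteq> cball 0 1" using inj by (simp add: image_image)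
  ultimately have "continuous_on (k ` cball 0 1) ((g \<circ> k) \<circ> inv k)"
   using continuous_on_compose continuous_on_subset by blast
  thus ?thesis by (rule continuous_on_eq) (use inj in auto)
 qed
 let ?A = "(\<lambda>z. proj z 1) ` cball 0 1" and ?B = "(\<lambda>z. proj 1 z) ` cball 0 1"
 have "continuous_on ?A g" by (rule main [OF refl]) (auto simp: inj_def proj_def)
 moreover have "continuous_on ?B g" by (rule main [OF refl]) (auto simp: inj_def proj_def split: if_splits)
 moreover have "closed ?A" "closed ?B"
  by (intro compact_imp_closed compact_continuous_image continuous_on_proj continuous_on_id
    continuous_on_const compact_cball; simp)+
 moreover have "?A \<union> ?B = UNIV"
 proof -
  have "P \<in> ?A \<union> ?B" for P
  proof (cases P)
   case (Fin z)
   hence "P = proj z 1" "z \<noteq> 0 \<Longrightarrow> P = proj 1 (1 / z)" by (auto simp: proj_def)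
   moreover have "cmod (1 / z) \<le> 1" if "\<not> cmod z \<le> 1" using that by (simp add: norm_divide divide_le_eq)
   ultimately show ?thesis by (cases "cmod z \<le> 1") force+
  next
   case Infty
   hence "P = proj 1 0" by (simp add: proj_def)
   thus ?thesis by force
  qed
  thus ?thesis by blast
 qed
 ultimately show ?thesis by (metis continuous_on_closed_Un)
qed

text \<open>\<open>chart w\<close> maps \<open>- {w}\<close> onto the plane, with inverse \<open>par w\<close>; the value at \<open>w\<close> itself is junk.\<close>

primrec par :: "riemann_sphere \<Rightarrow> complex \<Rightarrow> riemann_sphere" where
 "par Infty = (\<lambda>z. proj z 1)"
| "par (Fin b) = (\<lambda>z. proj (b * z + 1) z)"

text \<open>The Moebius map x -> 1 / (x - b), which moves the base point to infinity.\<close>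

primrec to_infinity :: "riemann_sphere \<Rightarrow> riemann_sphere \<Rightarrow> riemann_sphere" where
 "to_infinity Infty = (\<lambda>x. x)"
| "to_infinity (Fin b) = (\<lambda>x. case x of Infty \<Rightarrow> Fin 0 | Fin z \<Rightarrow> proj 1 (z - b))"

definition chart :: "riemann_sphere \<Rightarrow> riemann_sphere \<Rightarrow> complex" where
 "chart w x = finite_part (to_infinity w x)"

lemma chart_Infty_proj [simp]: "chart Infty (proj x y) = x / y"
 by (simp add: chart_def proj_def)

lemma chart_Fin_proj [simp]: "x \<noteq> 0 \<or> y \<noteq> 0 \<Longrightarrow> chart (Fin b) (proj x y) = y / (x - b * y)"
proof (cases "y = 0")
 case False
 hence "x / y - b = (x - b * y) / y" by (simp add: diff_divide_distrib)
 thus ?thesis using False by (simp add: chart_def proj_def)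
qed (simp add: chart_def proj_def)

lemma proj_eq_Infty_iff: "proj x y = Infty \<longleftrightarrow> y = 0"
 by (simp add: proj_def)

lemma proj_eq_Fin_iff: "x \<noteq> 0 \<or> y \<noteq> 0 \<Longrightarrow> proj x y = Fin b \<longleftrightarrow> x = b * y"
 by (auto simp: proj_def divide_eq_eq)

lemma chart_par [simp]: "chart w (par w z) = z"
proof (cases w)
 case (Fin b)
 have "b * z + 1 \<noteq> 0 \<or> z \<noteq> 0" by auto
 thus ?thesis by (simp add: Fin)
qed auto

lemma par_chart [simp]:
 assumes "x \<noteq> w"
 shows "par w (chart w x) = x"
proof (cases w)
 case (Fin b)
 show ?thesis
 proof (cases x)
  case (Fin z)
  hence "z - b \<noteq> 0" using assms \<open>w = Fin b\<close> by auto
  hence "(b * (1 / (z - b)) + 1) / (1 / (z - b)) = z" by (simp add: divide_simps)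
  thus ?thesis using \<open>z - b \<noteq> 0\<close> by (simp add: Fin \<open>w = Fin b\<close> chart_def proj_def)
 qed (simp add: Fin chart_def proj_def)
qed (use assms in \<open>cases x; simp add: chart_def proj_def\<close>)

lemma par_neq [simp]: "par w z \<noteq> w" "w \<noteq> par w z"
proof -
 show "par w z \<noteq> w"
 proof (cases w)
  case (Fin b)
  have "(b * z + 1) / z \<noteq> b" if "z \<noteq> 0" using that by (simp add: divide_eq_eq)
  thus ?thesis by (simp add: Fin proj_def)
 qed (simp add: proj_def)
 thus "w \<noteq> par w z" by metis
qed

lemma par_eq_iff [simp]: "par w z = par w z' \<longleftrightarrow> z = z'"
 by (metis chart_par)

lemma continuous_par: "continuous_on A (par w)"
 by (cases w) (auto intro!: continuous_on_proj continuous_intros)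

lemma continuous_to_infinity: "continuous_on A (to_infinity w)"
proof (rule continuous_on_subset [OF _ subset_UNIV])
 show "continuous_on UNIV (to_infinity w)"
 proof (cases w)
  case (Fin b)
  have "continuous_on UNIV (\<lambda>x. case x of Infty \<Rightarrow> Fin 0 | Fin z \<Rightarrow> proj 1 (z - b))"
  proof (rule continuous_homogeneous)
   show "(case proj x y of Infty \<Rightarrow> Fin 0 | Fin z \<Rightarrow> proj 1 (z - b)) = proj y (x - b * y)"
    if "x \<noteq> 0 \<or> y \<noteq> 0" for x y
    using that by (auto simp: proj_def field_simps)
  qed (auto intro!: continuous_intros simp: case_prod_unfold)
  thus ?thesis by (simp add: Fin)
 qed auto
qed

lemma to_infinity_eq_Infty_iff: "to_infinity w x = Infty \<longleftrightarrow> x = w"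
 by (cases w; cases x) (auto simp: proj_def)

lemma continuous_chart: "w \<notin> A \<Longrightarrow> continuous_on A (chart w)"
proof -
 assume "w \<notin> A"
 \<comment> \<open>Off the north pole, \<open>finite_part\<close> is the projection of the unit
   sphere from that pole, hence continuous.\<close>
 have "finite_part x = fst (stereographic x) / of_real (1 - snd (stereographic x))" if "x \<noteq> Infty" for x
 proof (cases x)
  case (Fin z)
  have "1 + (cmod z)\<^sup>2 \<noteq> 0" by (simp add: add_nonneg_eq_0_iff)
  hence "1 - ((cmod z)\<^sup>2 - 1) / ((cmod z)\<^sup>2 + 1) = 2 / (1 + (cmod z)\<^sup>2)" by (simp add: field_simps)
  thus ?thesis using \<open>1 + (cmod z)\<^sup>2 \<noteq> 0\<close>
   by (simp add: Fin scaleR_conv_of_real del: of_real_diff of_real_divide of_real_add)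
 qed (use that in auto)
 moreover have "snd (stereographic x) \<noteq> 1" if "x \<noteq> Infty" for x
 proof
  assume s: "snd (stereographic x) = 1"
  have "(norm (fst (stereographic x)))\<^sup>2 + (snd (stereographic x))\<^sup>2 = 1"
   using norm_stereographic [of x] by (metis norm_Pair prod.collapse real_sqrt_eq_1_iff real_norm_def power2_abs)
  hence "stereographic x = stereographic Infty" using s by (simp add: prod_eq_iff)
  thus False using that inj_stereographic by (meson injD)
 qed
 moreover have "continuous_on (- {Infty}) (\<lambda>x. fst (stereographic x) / of_real (1 - snd (stereographic x)))"
  by (intro continuous_intros continuous_stereographic) (use calculation(2) in auto)
 ultimately have "continuous_on (- {Infty}) finite_part"
  by (metis (no_types, lifting) ComplD continuous_on_eq insertI1)
 hence "continuous_on A (\<lambda>x. finite_part (to_infinity w x))"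
  by (rule continuous_on_compose2 [OF _ continuous_to_infinity])
   (use \<open>w \<notin> A\<close> to_infinity_eq_Infty_iff in \<open>auto dest: sym\<close>)
 thus ?thesis by (simp add: chart_def[abs_def])
qed

lemma open_par_image: "open A \<Longrightarrow> open (par w ` A)"
proof -
 assume "open A"
 have "par w ` A = chart w -` A \<inter> (- {w})" by (auto simp: image_iff) (metis par_chart)
 thus ?thesis using continuous_open_preimage [OF continuous_chart [of w "- {w}"] _ \<open>open A\<close>]
  by (simp add: Int_commute open_Compl)
qed

lemma open_par_vimage: "open U \<Longrightarrow> open (par w -` U)"
 by (intro open_vimage continuous_par)

lemma open_chart_image:
 assumes "open U" "w \<notin> U"
 shows "open (chart w ` U)"
proof -
 have "chart w ` U = par w -` U"
 proof (intro equalityI subsetI)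
  fix z assume "z \<in> chart w ` U"
  then obtain x where "x \<in> U" "z = chart w x" by blast
  thus "z \<in> par w -` U" using assms(2) par_chart [of x w] by (metis vimageI)
 next
  fix z assume "z \<in> par w -` U"
  thus "z \<in> chart w ` U" by (metis chart_par image_eqI vimageE)
 qed
 thus ?thesis using open_par_vimage assms by metis
qed

lemma bounded_chart_image:
 assumes "w \<notin> closure A"
 shows "bounded (chart w ` A)"
proof -
 have "compact (chart w ` closure A)"
  using assms by (intro compact_continuous_image continuous_chart closed_imp_compact_sphere) auto
 thus ?thesis using bounded_subset closure_subset compact_imp_bounded image_mono by metis
qed

text \<open>This is how omitting an open set becomes uniform boundedness, the hypothesis of Montel's
  theorem.\<close>

lemma bounded_chart_compl:
 assumes "open W" "w \<in> W"
 obtains B where "\<And>x. x \<notin> W \<Longrightarrow> norm (chart w x) \<le> B"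
proof -
 have "bounded (chart w ` (- W))" using assms by (intro bounded_chart_image) (simp add: closure_closed closed_Compl)
 thus thesis using that unfolding bounded_iff by blast
qed

section \<open>Holomorphic maps into the sphere\<close>

definition homogeneous_lift ::
  "(complex \<Rightarrow> riemann_sphere) \<Rightarrow> complex set \<Rightarrow> complex set \<Rightarrow> (complex \<Rightarrow> complex) \<Rightarrow> (complex \<Rightarrow> complex) \<Rightarrow> bool" where
 "homogeneous_lift g D N P Q \<longleftrightarrow> open N \<and> P holomorphic_on N \<and> Q holomorphic_on N \<and>
   (\<forall>y\<in>N \<inter> D. (P y \<noteq> 0 \<or> Q y \<noteq> 0) \<and> g y = proj (P y) (Q y))"

lemma homogeneous_liftD:
 assumes "homogeneous_lift g D N P Q"
 shows "open N" "P holomorphic_on N" "Q holomorphic_on N"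
  "y \<in> N \<inter> D \<Longrightarrow> P y \<noteq> 0 \<or> Q y \<noteq> 0" "y \<in> N \<inter> D \<Longrightarrow> g y = proj (P y) (Q y)"
 using assms by (auto simp: homogeneous_lift_def)

text \<open>Holomorphy is encoded by local homogeneous coordinates [P : Q] rather than by charts of
  the target: poles need no separate treatment, and composing with a rational map only substitutes
  \<open>P\<close> and \<open>Q\<close> into its homogenisations.\<close>

definition sphere_holomorphic_on :: "(complex \<Rightarrow> riemann_sphere) \<Rightarrow> complex set \<Rightarrow> bool"
  (infixl "sphere'_holomorphic'_on" 50) where
 "g sphere_holomorphic_on D \<longleftrightarrow> (\<forall>z\<in>D. \<exists>N P Q. z \<in> N \<and> homogeneous_lift g D N P Q)"

lemma sphere_holomorphic_on_subset:
 "g sphere_holomorphic_on D \<Longrightarrow> E \<subseteq> D \<Longrightarrow> g sphere_holomorphic_on E"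
proof -
 assume "E \<subseteq> D"
 hence "homogeneous_lift g D N P Q \<Longrightarrow> homogeneous_lift g E N P Q" for N P Q by (auto simp: homogeneous_lift_def)
 thus "g sphere_holomorphic_on D \<Longrightarrow> g sphere_holomorphic_on E"
  unfolding sphere_holomorphic_on_def using \<open>E \<subseteq> D\<close> by (meson subsetD)
qed

lemma holomorphic_on_chart:
 assumes g: "g sphere_holomorphic_on D" and w: "\<And>z. z \<in> D \<Longrightarrow> g z \<noteq> w" and "open D"
 shows "(\<lambda>z. chart w (g z)) holomorphic_on D"
proof -
 have "(\<lambda>z. chart w (g z)) field_differentiable at z" if zD: "z \<in> D" for z
 proof -
  obtain N P Q where "z \<in> N" and lift: "homogeneous_lift g D N P Q"
   using g \<open>z \<in> D\<close> unfolding sphere_holomorphic_on_def by meson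
  note N = homogeneous_liftD(1) [OF lift] \<open>z \<in> N\<close> and PQ = homogeneous_liftD(2,3) [OF lift]
   and gz = homogeneous_liftD(4,5) [OF lift]
  let ?N = "N \<inter> D"
  have PQ': "P holomorphic_on ?N" "Q holomorphic_on ?N" using PQ holomorphic_on_subset by blast+
  have "(\<lambda>y. chart w (g y)) holomorphic_on ?N"
  proof (cases w)
   case (Fin b)
   have "(\<lambda>y. Q y / (P y - b * Q y)) holomorphic_on ?N"
    by (intro holomorphic_intros PQ') (metis Fin Int_iff eq_iff_diff_eq_0 gz proj_eq_Fin_iff w)
   thus ?thesis by (rule holomorphic_transform) (use gz Fin in auto)
  next
   case Infty
   have "(\<lambda>y. P y / Q y) holomorphic_on ?N"
    by (intro holomorphic_intros PQ') (metis Infty Int_iff gz proj_eq_Infty_iff w)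
   thus ?thesis by (rule holomorphic_transform) (use gz Infty in auto)
  qed
  thus ?thesis using N \<open>open D\<close> zD holomorphic_on_imp_differentiable_at by (metis Int_iff open_Int)
 qed
 thus ?thesis by (simp add: holomorphic_on_def field_differentiable_at_within)
qed

lemma sphere_holomorphic_on_par:
 assumes "k holomorphic_on D" "open D"
 shows "(\<lambda>z. par w (k z)) sphere_holomorphic_on D"
proof (cases w)
 case (Fin b)
 have "(\<lambda>z. b * k z + 1) holomorphic_on D" by (intro holomorphic_intros assms)
 moreover have "b * k z + 1 \<noteq> 0 \<or> k z \<noteq> 0" for z by auto
 ultimately show ?thesis unfolding sphere_holomorphic_on_def using assms
  by (intro ballI exI [of _ D] exI [of _ "\<lambda>z. b * k z + 1"] exI [of _ k]) (simp add: Fin homogeneous_lift_def)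
next
 case Infty
 show ?thesis unfolding sphere_holomorphic_on_def using assms
  by (intro ballI exI [of _ D] exI [of _ k] exI [of _ "\<lambda>_. 1"]) (simp add: Infty homogeneous_lift_def)
qed

section \<open>Rational maps\<close>

definition homogenization :: "complex poly \<Rightarrow> nat \<Rightarrow> complex \<Rightarrow> complex \<Rightarrow> complex" where
 "homogenization p d x y = (\<Sum>i\<le>d. coeff p i * x ^ i * y ^ (d - i))"

lemma poly_eq_sum: "degree p \<le> d \<Longrightarrow> poly p (z::complex) = (\<Sum>i\<le>d. coeff p i * z ^ i)"
 unfolding poly_altdef by (rule sum.mono_neutral_left) (auto simp: coeff_eq_0)

lemma homogenization_finite:
 assumes "y \<noteq> 0" "degree p \<le> d"
 shows "homogenization p d x y = y ^ d * poly p (x / y)"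
proof -
 have term_eq: "y ^ d * (coeff p i * (x / y) ^ i) = coeff p i * x ^ i * y ^ (d - i)" if "i \<le> d" for i
 proof -
  have "y ^ d = y ^ i * y ^ (d - i)" using that by (simp flip: power_add)
  thus ?thesis using assms(1) by (simp add: power_divide)
 qed
 show ?thesis unfolding homogenization_def poly_eq_sum [OF assms(2)] sum_distrib_left
  by (intro sum.cong refl) (simp only: term_eq atMost_iff)
qed

lemma homogenization_infinite: "homogenization p d x 0 = coeff p d * x ^ d"
proof -
 have "homogenization p d x 0 = (\<Sum>i\<le>d. if i = d then coeff p d * x ^ d else 0)"
  unfolding homogenization_def by (rule sum.cong) auto
 thus ?thesis by simp
qed

lemma continuous_homogenization: "continuous_on UNIV (\<lambda>(x, y). homogenization p d x y)"
 unfolding homogenization_def case_prod_unfold by (intro continuous_intros)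

lemma holomorphic_homogenization:
 "P holomorphic_on N \<Longrightarrow> Q holomorphic_on N \<Longrightarrow> (\<lambda>z. homogenization p d (P z) (Q z)) holomorphic_on N"
 unfolding homogenization_def by (intro holomorphic_intros)

locale rational_map =
 fixes f :: "riemann_sphere \<Rightarrow> riemann_sphere" and p q :: "complex poly" and d :: nat
 assumes coprime: "coprime p q" and f_eq: "f = ratfun p q"
  and d_eq: "d = max (degree p) (degree q)" and d2: "2 \<le> d"
begin

lemma no_common_root: "poly p z \<noteq> 0 \<or> poly q z \<noteq> 0"
proof (rule ccontr)
 assume "\<not> ?thesis"
 hence "[:- z, 1:] dvd p" "[:- z, 1:] dvd q" by (simp_all add: poly_eq_0_iff_dvd)
 hence "is_unit [:- z, 1:]" using coprime coprime_common_divisor by blast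
 thus False by (simp add: is_unit_iff_degree)
qed

lemma homogenization_nonzero:
 assumes "x \<noteq> 0 \<or> y \<noteq> 0"
 shows "homogenization p d x y \<noteq> 0 \<or> homogenization q d x y \<noteq> 0"
proof (cases "y = 0")
 case True
 have "coeff p d \<noteq> 0 \<or> coeff q d \<noteq> 0"
 proof (cases "degree p \<le> degree q")
  case True
  hence "d = degree q" "q \<noteq> 0" using d_eq d2 by auto
  thus ?thesis by simp
 next
  case False
  hence "d = degree p" "p \<noteq> 0" using d_eq d2 by auto
  thus ?thesis by simp
 qed
 thus ?thesis using True assms by (simp add: homogenization_infinite)
next
 case False
 thus ?thesis using no_common_root [of "x / y"] d_eq by (simp add: homogenization_finite)
qed

text \<open>The value prescribed by \<open>ratfun\<close> at infinity is that of the action on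
  homogeneous coordinates, so one formula covers finite points, poles and
  \<open>Infty\<close>.\<close>

lemma f_proj:
 assumes "x \<noteq> 0 \<or> y \<noteq> 0"
 shows "f (proj x y) = proj (homogenization p d x y) (homogenization q d x y)"
proof (cases "y = 0")
 case True
 hence "x ^ d \<noteq> 0" using assms by simp
 thus ?thesis using True by (simp add: f_eq proj_def ratfun_def homogenization_infinite Let_def flip: d_eq)
next
 case False
 hence "y ^ d \<noteq> 0" by simp
 thus ?thesis using False d_eq by (simp add: f_eq proj_def ratfun_def homogenization_finite)
qed

lemma continuous_on_UNIV_f: "continuous_on UNIV f"
 by (rule continuous_homogeneous [OF f_proj homogenization_nonzero continuous_homogenization continuous_homogenization])

lemma continuous_f: "continuous_on A f"
 using continuous_on_UNIV_f continuous_on_subset by blast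

lemma continuous_iterate: "continuous_on A (f ^^ n)"
proof -
 have "continuous_on UNIV (f ^^ n)"
 proof (induction n)
  case (Suc n)
  hence "continuous_on UNIV (f \<circ> f ^^ n)" by (intro continuous_on_compose continuous_f)
  thus ?case by simp
 qed (simp add: id_def)
 thus ?thesis using continuous_on_subset by blast
qed

lemma holomorphic_f:
 assumes "g sphere_holomorphic_on D"
 shows "(\<lambda>z. f (g z)) sphere_holomorphic_on D"
 unfolding sphere_holomorphic_on_def
proof
 fix z assume z: "z \<in> D"
 then obtain N P Q where "z \<in> N" and lift: "homogeneous_lift g D N P Q"
  using assms unfolding sphere_holomorphic_on_def by meson
 have "homogeneous_lift (\<lambda>z. f (g z)) D N (\<lambda>z. homogenization p d (P z) (Q z)) (\<lambda>z. homogenization q d (P z) (Q z))"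
  unfolding homogeneous_lift_def using homogeneous_liftD [OF lift]
  by (auto intro!: holomorphic_homogenization simp: f_proj homogenization_nonzero)
    (use homogenization_nonzero in blast)
 thus "\<exists>N P Q. z \<in> N \<and> homogeneous_lift (\<lambda>z. f (g z)) D N P Q" using \<open>z \<in> N\<close> by blast
qed

lemma holomorphic_iterate:
 assumes "g sphere_holomorphic_on D"
 shows "(\<lambda>z. (f ^^ n) (g z)) sphere_holomorphic_on D"
proof (induction n)
 case (Suc n)
 thus ?case using holomorphic_f [OF Suc.IH] by simp
qed (simp add: assms)

lemma holomorphic_iterate_par: "(\<lambda>z. (f ^^ n) (par w z)) sphere_holomorphic_on UNIV"
 by (rule holomorphic_iterate [OF sphere_holomorphic_on_par [of "\<lambda>z. z"]]) (auto intro: holomorphic_on_ident)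

section \<open>Fibres, critical points and the open mapping property\<close>

lemma degree_pencil: "p - smult c q \<noteq> 0"
proof
 assume "p - smult c q = 0"
 hence "p = smult c q" by simp
 hence "q dvd p" by (simp add: dvd_smult)
 hence "is_unit q" using coprime by (metis coprime_common_divisor dvd_refl)
 hence "degree q = 0" by (metis is_unit_iff_degree not_is_unit_0)
 hence "degree p = 0" using \<open>p = smult c q\<close> by simp
 thus False using \<open>degree q = 0\<close> d_eq d2 by simp
qed

lemma q_nonzero: "q \<noteq> 0"
proof
 assume "q = 0"
 hence "is_unit p" using coprime by simp
 hence "degree p = 0" by (metis is_unit_iff_degree not_is_unit_0)
 thus False using \<open>q = 0\<close> d_eq d2 by simp
qed

lemma finite_fibre: "finite {x. f x = y}"
proof (cases y)
 case (Fin c)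
 have "{x. f x = y} \<subseteq> insert Infty (Fin ` {z. poly (p - smult c q) z = 0})"
 proof
  fix x assume "x \<in> {x. f x = y}"
  thus "x \<in> insert Infty (Fin ` {z. poly (p - smult c q) z = 0})"
   by (cases x) (auto simp: f_eq ratfun_def Fin field_simps split: if_splits)
 qed
 thus ?thesis using poly_roots_finite [OF degree_pencil] by (meson finite.insertI finite_imageI finite_subset)
next
 case Infty
 have "{x. f x = y} \<subseteq> insert Infty (Fin ` {z. poly q z = 0})"
 proof
  fix x assume "x \<in> {x. f x = y}"
  thus "x \<in> insert Infty (Fin ` {z. poly q z = 0})" by (cases x) (auto simp: f_eq ratfun_def Infty split: if_splits)
 qed
 thus ?thesis using poly_roots_finite [OF q_nonzero] by (meson finite.insertI finite_imageI finite_subset)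
qed

definition "wronskian = pderiv p * q - p * pderiv q"

text \<open>From p' q = p q' and coprimality, each of \<open>p\<close> and \<open>q\<close> divides
  its own derivative, which forces both to be constant.\<close>

lemma wronskian_nonzero: "wronskian \<noteq> 0"
proof
 assume "wronskian = 0"
 hence eq: "pderiv p * q = p * pderiv q" by (simp add: wronskian_def)
 have "q dvd p * pderiv q" "p dvd q * pderiv p" using eq by (metis dvd_triv_right, metis dvd_triv_left mult.commute)
 moreover have "coprime q p" using coprime by (simp only: coprime_commute)
 ultimately have "q dvd pderiv q" "p dvd pderiv p"
  using coprime_dvd_mult_right_iff [OF \<open>coprime q p\<close>] coprime_dvd_mult_right_iff [OF coprime] by (simp_all only:)
 hence "degree q = 0" "degree p = 0" using not_dvd_pderiv by blast+
 thus False using d_eq d2 by simp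
qed

lemma finite_critical_points: "finite {c. critical_point f c}"
proof -
 have "c \<in> insert Infty (Fin ` {z. poly q z = 0} \<union> Fin ` {z. poly wronskian z = 0})" if c: "critical_point f c" for c
 proof (cases c)
  case (Fin z)
  show ?thesis
  proof (cases "poly q z = 0")
   case False
   have fc: "f c \<noteq> Infty" using False by (simp add: Fin f_eq ratfun_def)
   have der: "((finite_part \<circ> f \<circ> Fin) has_field_derivative 0) (at z)"
    using c fc by (simp add: critical_point_def Fin coord_at_def param_at_def)
   have "open {w. poly q w \<noteq> 0}" by (intro open_Collect_neq continuous_intros)
   moreover have "(finite_part \<circ> f \<circ> Fin) w = poly p w / poly q w" if "w \<in> {w. poly q w \<noteq> 0}" for w
    using that by (simp add: f_eq ratfun_def)
   ultimately have "((\<lambda>w. poly p w / poly q w) has_field_derivative 0) (at z)"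
    using has_field_derivative_transform_within_open [OF der, of "{w. poly q w \<noteq> 0}"] False by simp
   moreover have "((\<lambda>w. poly p w / poly q w) has_field_derivative
     (poly (pderiv p) z * poly q z - poly p z * poly (pderiv q) z) / (poly q z * poly q z)) (at z)"
    by (intro DERIV_divide poly_DERIV False)
   ultimately have "(poly (pderiv p) z * poly q z - poly p z * poly (pderiv q) z) / (poly q z * poly q z) = 0"
    using DERIV_unique by blast
   thus ?thesis using False by (simp add: Fin wronskian_def)
  qed (simp add: Fin)
 qed auto
 hence "{c. critical_point f c} \<subseteq> insert Infty (Fin ` {z. poly q z = 0} \<union> Fin ` {z. poly wronskian z = 0})" by blast
 thus ?thesis by (rule finite_subset) (simp add: poly_roots_finite q_nonzero wronskian_nonzero)
qed

lemma finite_critical_values: "finite (critical_values f)"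
 unfolding critical_values_def using finite_critical_points by blast

text \<open>The coordinates in the definition of critical points are charts with base point
  \<open>Fin 0\<close> or \<open>Infty\<close>, so the general facts on charts apply to
  them.\<close>

lemma coord_at_eq: "coord_at c = chart (if c = Infty then Fin 0 else Infty)"
 and param_at_eq: "param_at c = par (if c = Infty then Fin 0 else Infty)"
proof -
 have *: "sphere_inverse x = to_infinity (Fin 0) x" for x by (cases x) (auto simp: proj_def)
 show "coord_at c = chart (if c = Infty then Fin 0 else Infty)" by (auto simp: coord_at_def fun_eq_iff chart_def *)
 show "param_at c = par (if c = Infty then Fin 0 else Infty)" by (auto simp: param_at_def fun_eq_iff proj_def)
qed

lemma locally_injective:
 assumes "\<not> critical_point f c"
 obtains U where "open U" "c \<in> U" "inj_on f U"
proof -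
 define w where "w = (if c = Infty then Fin 0 else Infty)"
 define w' where "w' = (if f c = Infty then Fin 0 else Infty)"
 have cw: "c \<noteq> w" "f c \<noteq> w'" by (auto simp: w_def w'_def)
 define D where "D = {z. f (par w z) \<noteq> w'}"
 have "open D"
 proof -
  have "D = par w -` f -` (- {w'})" by (auto simp: D_def)
  thus ?thesis by (metis open_Compl closed_singleton open_vimage continuous_f continuous_par)
 qed
 define k where "k z = chart w' (f (par w z))" for z
 have "k holomorphic_on D" unfolding k_def
  by (rule holomorphic_on_chart [OF sphere_holomorphic_on_subset [OF holomorphic_iterate_par [of 1, simplified] subset_UNIV]])
   (auto simp: D_def \<open>open D\<close> [unfolded D_def])
 moreover have "chart w c \<in> D" using cw by (simp add: D_def)
 moreover have "deriv k (chart w c) \<noteq> 0"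
 proof
  assume "deriv k (chart w c) = 0"
  hence "(k has_field_derivative 0) (at (chart w c))" using calculation \<open>open D\<close> holomorphic_derivI by metis
  hence "critical_point f c"
   by (simp add: critical_point_def coord_at_eq param_at_eq k_def[abs_def] o_def flip: w_def w'_def)
  thus False using assms by blast
 qed
 ultimately obtain r where r: "r > 0" "ball (chart w c) r \<subseteq> D" "inj_on k (ball (chart w c) r)"
  using has_complex_derivative_locally_injective \<open>open D\<close> by metis
 show thesis
 proof
  show "open (par w ` ball (chart w c) r)" by (intro open_par_image open_ball)
  show "c \<in> par w ` ball (chart w c) r" using r(1) cw by (intro image_eqI [of _ _ "chart w c"]) auto
  show "inj_on f (par w ` ball (chart w c) r)"
  proof (rule inj_onI)
   fix x y assume "x \<in> par w ` ball (chart w c) r" "y \<in> par w ` ball (chart w c) r" "f x = f y"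
   then obtain z z' where "z \<in> ball (chart w c) r" "z' \<in> ball (chart w c) r" "x = par w z" "y = par w z'" "k z = k z'"
    by (auto simp: k_def)
   thus "x = y" using r(3) by (metis inj_onD)
  qed
 qed
qed

text \<open>The open mapping theorem in charts; a chart expression cannot be constant because fibres
  are finite.\<close>

lemma open_image:
 assumes "open U"
 shows "open (f ` U)"
proof -
 have "\<exists>T. open T \<and> f x \<in> T \<and> T \<subseteq> f ` U" if "x \<in> U" for x
 proof -
  obtain w w' where w: "x \<noteq> w" "f x \<noteq> w'" by (metis riemann_sphere.distinct(1))
  define D where "D = {z. f (par w z) \<noteq> w'} \<inter> par w -` U"
  have "open D"
  proof -
   have "D = par w -` (f -` (- {w'}) \<inter> U)" by (auto simp: D_def)
   thus ?thesis by (metis assms open_Int open_Compl closed_singleton open_vimage continuous_f continuous_par)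
  qed
  have "chart w x \<in> D" using w that by (simp add: D_def)
  then obtain r where r: "r > 0" "ball (chart w x) r \<subseteq> D" using \<open>open D\<close> open_contains_ball by blast
  define k where "k z = chart w' (f (par w z))" for z
  have hol: "k holomorphic_on ball (chart w x) r" unfolding k_def
   by (rule holomorphic_on_chart [OF sphere_holomorphic_on_subset [OF holomorphic_iterate_par [of 1, simplified] subset_UNIV]])
    (use r in \<open>auto simp: D_def\<close>)
  have "\<not> k constant_on ball (chart w x) r"
  proof
   assume "k constant_on ball (chart w x) r"
   then obtain c where c: "\<And>z. z \<in> ball (chart w x) r \<Longrightarrow> k z = c" unfolding constant_on_def by blast
   have "par w ` ball (chart w x) r \<subseteq> {y. f y = par w' c}"
   proof clarify
    fix z assume z: "z \<in> ball (chart w x) r"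
    hence "f (par w z) \<noteq> w'" using r D_def by auto
    thus "f (par w z) = par w' c" using c [OF z] by (auto simp: k_def)
   qed
   hence "finite (par w ` ball (chart w x) r)" using finite_fibre finite_subset by blast
   hence "finite (ball (chart w x) r)" by (rule finite_imageD) (simp add: inj_on_def)
   thus False using r(1) by (metis finite_imp_not_open centre_in_ball empty_iff open_ball)
  qed
  hence "open (k ` ball (chart w x) r)" by (intro open_mapping_thm [OF hol]) auto
  hence "open (par w' ` k ` ball (chart w x) r)" by (rule open_par_image)
  moreover have "f x \<in> par w' ` k ` ball (chart w x) r"
   using w r by (intro image_eqI [of _ _ "k (chart w x)"] imageI) (auto simp: k_def)
  moreover have "par w' ` k ` ball (chart w x) r \<subseteq> f ` U"
  proof clarify
   fix z assume "z \<in> ball (chart w x) r"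
   hence "z \<in> D" using r by blast
   thus "par w' (k z) \<in> f ` U" by (simp add: k_def D_def)
  qed
  ultimately show ?thesis by blast
 qed
 thus ?thesis by (subst open_subopen) blast
qed

lemma surj_f: "surj f"
proof -
 have "closed (range f)" by (intro compact_imp_closed compact_continuous_image continuous_f compact_UNIV_sphere)
 moreover have "open (range f)" by (simp add: open_image)
 ultimately have "range f = {} \<or> range f = UNIV"
  using connected_UNIV_sphere connected_clopen by (metis open_openin closed_closedin subtopology_UNIV)
 thus ?thesis by auto
qed

text \<open>A value \<open>c\<close> with a single finite preimage \<open>a\<close> forces \<open>p - c q\<close> to be a power of \<open>z - a\<close>,
 so that \<open>a\<close> is a root of the Wronskian.\<close>

lemma two_preimages:
 assumes "open V" "V \<noteq> {}"
 obtains x y where "x \<noteq> y" "f x = f y" "f x \<in> V"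
proof -
 \<comment> \<open>Avoiding infinity and its image makes the value \<open>c\<close> finite and
   \<open>p - c q\<close> of full degree \<open>d\<close>; avoiding the images of the zeros of the
   Wronskian makes its roots simple.\<close>
 define B where "B = insert Infty (insert (f Infty) (f ` Fin ` {z. poly wronskian z = 0}))"
 have "finite B" by (simp add: B_def poly_roots_finite wronskian_nonzero)
 have "infinite V"
 proof
  assume "finite V"
  obtain x w where x: "x \<in> V" "x \<noteq> w" using assms(2) by (metis ex_in_conv riemann_sphere.distinct(1))
  have "finite (par w -` V)" using \<open>finite V\<close> by (rule finite_vimageI) (simp add: inj_def)
  hence "par w -` V = {}" using finite_imp_not_open open_par_vimage [OF assms(1)] by blast
  moreover have "chart w x \<in> par w -` V" using x by simp
  ultimately show False by blast
 qed
 then obtain v where v: "v \<in> V" "v \<notin> B" using \<open>finite B\<close> by (meson finite_subset subsetI)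
 then obtain c where c: "v = Fin c" by (cases v) (auto simp: B_def)
 define g where "g = p - smult c q"
 have "degree g = d"
 proof -
  have "coeff p d - c * coeff q d \<noteq> 0"
  proof
   assume 0: "coeff p d - c * coeff q d = 0"
   have "coeff q d \<noteq> 0"
   proof
    assume "coeff q d = 0"
    hence "coeff p d = 0" "coeff q d = 0" using 0 by auto
    thus False using homogenization_nonzero [of 1 0] by (simp add: homogenization_infinite)
   qed
   hence "f Infty = Fin c" using 0 by (simp add: f_eq ratfun_def Let_def field_simps flip: d_eq)
   thus False using v c by (simp add: B_def)
  qed
  hence "degree g \<ge> d" unfolding g_def by (intro le_degree) simp
  moreover have "degree g \<le> d"
   unfolding g_def using d_eq by (intro degree_diff_le) (auto intro: order_trans [OF degree_smult_le])
  ultimately show ?thesis by simp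
 qed
 have fz: "f (Fin z) = v" if "poly g z = 0" for z
 proof -
  have "poly p z = c * poly q z" using that by (simp add: g_def)
  moreover have "poly q z \<noteq> 0" using calculation no_common_root [of z] by auto
  ultimately show ?thesis by (simp add: f_eq ratfun_def c)
 qed
 obtain a where a: "poly g a = 0"
  using Fundamental_Theorem_Algebra.fundamental_theorem_of_algebra [of g] \<open>degree g = d\<close> d2 by (auto simp: constant_degree)
 obtain h where h: "g = [:- a, 1:] * h" using a poly_eq_0_iff_dvd by (metis dvdE)
 hence "h \<noteq> 0" using \<open>degree g = d\<close> d2 by auto
 hence "degree g = 1 + degree h" unfolding h by (subst degree_mult_eq) auto
 hence "degree h \<ge> 1" using \<open>degree g = d\<close> d2 by simp
 then obtain b where b: "poly h b = 0"
  using Fundamental_Theorem_Algebra.fundamental_theorem_of_algebra [of h] by (auto simp: constant_degree)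
 have "a \<noteq> b"
 proof
  assume "a = b"
  hence "poly (pderiv g) a = 0" using b unfolding h pderiv_mult by (simp add: \<open>a = b\<close> del: mult_pCons_left)
  hence "poly (pderiv p) a = c * poly (pderiv q) a" "poly p a = c * poly q a"
   using a by (auto simp: g_def pderiv_diff pderiv_smult)
  hence "poly wronskian a = 0" by (simp add: wronskian_def)
  hence "v \<in> B" using fz [OF a] by (force simp: B_def)
  thus False using v by blast
 qed
 moreover have "poly g b = 0" using b by (simp add: h)
 ultimately show thesis using that [of "Fin a" "Fin b"] fz a v by (metis riemann_sphere.inject)
qed

end

section \<open>The covering away from the critical values\<close>

lemma homeomorphism_stereographic_image:
 "homeomorphism A (stereographic ` A) stereographic (inv stereographic)"
 using homeomorphism_stereographic by (rule homeomorphism_of_subsets) auto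

lemma openin_stereographic_image:
 assumes "open W" "W \<subseteq> A"
 shows "openin (top_of_set (stereographic ` A)) (stereographic ` W)"
 using homeomorphism_imp_open_map [OF homeomorphism_stereographic_image [of A]] assms by (simp add: open_subset)

context rational_map
begin

lemma closed_image: "closed A \<Longrightarrow> closed (f ` A)"
 using closed_imp_compact_sphere compact_continuous_image [OF continuous_f] compact_imp_closed by metis

lemma evenly_covered:
 assumes y: "y \<notin> critical_values f"
 obtains N \<U> where "open N" "y \<in> N" "N \<inter> critical_values f = {}" "\<Union>\<U> = f -` N" "pairwise disjnt \<U>"
  "\<And>U. U \<in> \<U> \<Longrightarrow> open U" "\<And>U. U \<in> \<U> \<Longrightarrow> \<exists>g. homeomorphism U N f g"
proof -
 define A where "A = {x. f x = y}"
 have finA: "finite A" by (simp add: A_def finite_fibre)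
 have "\<exists>U. open U \<and> x \<in> U \<and> inj_on f U" if "x \<in> A" for x
 proof -
  have "\<not> critical_point f x" using that y by (auto simp: A_def critical_values_def)
  thus ?thesis by (metis locally_injective)
 qed
 then obtain V where V: "\<And>x. x \<in> A \<Longrightarrow> open (V x) \<and> x \<in> V x \<and> inj_on f (V x)" by metis
 obtain e where e: "e > 0" "\<And>x x'. x \<in> A \<Longrightarrow> x' \<in> A \<Longrightarrow> x \<noteq> x' \<Longrightarrow> 2 * e \<le> dist x x'"
 proof -
  define D where "D = insert 1 ((\<lambda>(x, x'). dist x x') ` {(x, x'). x \<in> A \<and> x' \<in> A \<and> x \<noteq> x'})"
  have "finite {(x, x'). x \<in> A \<and> x' \<in> A \<and> x \<noteq> x'}" by (rule finite_subset [of _ "A \<times> A"]) (use finA in auto)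
  hence "finite D" by (simp add: D_def)
  moreover have "\<And>t. t \<in> D \<Longrightarrow> t > 0" by (auto simp: D_def)
  ultimately have "Min D > 0" by (subst Min_gr_iff) (auto simp: D_def)
  moreover have "Min D \<le> dist x x'" if "x \<in> A" "x' \<in> A" "x \<noteq> x'" for x x'
   using \<open>finite D\<close> by (rule Min_le) (use that in \<open>force simp: D_def\<close>)
  ultimately show thesis by (intro that [of "Min D / 2"]) auto
 qed
 define U where "U x = V x \<inter> ball x e" for x
 have U: "open (U x)" "x \<in> U x" "inj_on f (U x)" if "x \<in> A" for x
  using V [OF that] e(1) by (auto simp: U_def intro: inj_on_subset)
 have disj: "U x \<inter> U x' = {}" if "x \<in> A" "x' \<in> A" "x \<noteq> x'" for x x'
 proof -
  have "False" if "z \<in> U x" "z \<in> U x'" for z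
   using e(2) [OF \<open>x \<in> A\<close> \<open>x' \<in> A\<close> \<open>x \<noteq> x'\<close>] that dist_triangle2 [of x x' z] by (auto simp: U_def)
  thus ?thesis by blast
 qed
 \<comment> \<open>Removing the image of the complement of the discs \<open>U x\<close> leaves only
   values all of whose preimages lie in these discs.\<close>
 define N where "N = (\<Inter>x\<in>A. f ` U x) - (f ` (- (\<Union>x\<in>A. U x)) \<union> critical_values f)"
 have cl: "closed (f ` (- (\<Union>x\<in>A. U x)))" using U by (intro closed_image closed_Compl open_UN) auto
 have "open N" unfolding N_def using finA U
  by (intro open_Diff open_INT closed_Un [OF cl] finite_imp_closed [OF finite_critical_values])
   (auto intro: open_image)
 moreover have "y \<in> N"
 proof -
  have "y \<in> f ` U x" if "x \<in> A" for x using U(2) [OF that] that by (force simp: A_def)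
  moreover have "y \<notin> f ` (- (\<Union>x\<in>A. U x))" using U(2) by (force simp: A_def)
  ultimately show ?thesis using y by (simp add: N_def)
 qed
 moreover have "N \<inter> critical_values f = {}" by (auto simp: N_def)
 moreover have "\<Union>((\<lambda>x. U x \<inter> f -` N) ` A) = f -` N" by (auto simp: N_def)
 moreover have "pairwise disjnt ((\<lambda>x. U x \<inter> f -` N) ` A)" unfolding pairwise_def disjnt_def using disj by auto
 moreover have "open W" if "W \<in> (\<lambda>x. U x \<inter> f -` N) ` A" for W
  using that U(1) \<open>open N\<close> by (auto intro!: open_Int open_vimage continuous_f)
 moreover have "\<exists>g. homeomorphism W N f g" if W: "W \<in> (\<lambda>x. U x \<inter> f -` N) ` A" for W
 proof -
  obtain x where x: "x \<in> A" "W = U x \<inter> f -` N" using W by blast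
  have "f ` W = N"
  proof
   show "N \<subseteq> f ` W"
   proof
    fix z assume z: "z \<in> N"
    hence "z \<in> f ` U x" using x by (auto simp: N_def)
    thus "z \<in> f ` W" using z x by auto
   qed
  qed (use x in auto)
  moreover have "inj_on f W" using U(3) x by (auto intro: inj_on_subset)
  moreover have "openin (top_of_set N) (f ` T)" if T: "openin (top_of_set W) T" for T
  proof -
   have "open W" using x U(1) \<open>open N\<close> by (auto intro!: open_Int open_vimage continuous_f)
   hence "open T" using T openin_open_trans by blast
   moreover have "T \<subseteq> W" using T openin_imp_subset by blast
   ultimately show ?thesis using \<open>f ` W = N\<close> open_image by (metis image_mono open_subset)
  qed
  ultimately show ?thesis by (metis homeomorphism_injective_open_map continuous_f)
 qed
 ultimately show thesis by (rule that)
qed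

abbreviation "CV \<equiv> critical_values f"
abbreviation "FS \<equiv> fatou_set f"
abbreviation "JS \<equiv> julia_set f"

text \<open>Conjugation by \<open>stereographic\<close> places the covering between subsets of the
  normed space \<complex> \<times> \<real>, as the lifting theorems require.\<close>

lemma covering_space_stereographic:
 "covering_space (stereographic ` (- (f -` CV))) (stereographic \<circ> f \<circ> inv stereographic) (stereographic ` (- CV))"
proof
 let ?s = stereographic
 have "continuous_on (?s ` (- (f -` CV))) (inv ?s)" by (rule continuous_inv_stereographic) auto
 thus "continuous_on (?s ` (- (f -` CV))) (?s \<circ> f \<circ> inv ?s)"
  by (intro continuous_on_compose continuous_f continuous_stereographic) auto
 have "f ` (- (f -` CV)) = - CV" using surj_f by (metis surj_image_vimage_eq vimage_Compl)
 moreover have "(?s \<circ> f \<circ> inv ?s) ` ?s ` (- (f -` CV)) = ?s ` f ` (- (f -` CV))" by (simp add: image_image)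
 ultimately show "(?s \<circ> f \<circ> inv ?s) ` ?s ` (- (f -` CV)) = ?s ` (- CV)" by (simp only:)
next
 let ?s = stereographic
 fix x assume "x \<in> ?s ` (- CV)"
 then obtain y where y: "y \<notin> CV" "x = ?s y" by blast
 obtain N \<U> where N: "open N" "y \<in> N" "N \<inter> CV = {}" "\<Union>\<U> = f -` N" "pairwise disjnt \<U>"
  and U: "\<And>U. U \<in> \<U> \<Longrightarrow> open U" "\<And>U. U \<in> \<U> \<Longrightarrow> \<exists>g. homeomorphism U N f g"
  using evenly_covered [OF y(1)] by metis
 have sub: "U \<subseteq> - (f -` CV)" if "U \<in> \<U>" for U using that N(3,4) by blast
 show "\<exists>T. x \<in> T \<and> openin (top_of_set (?s ` (- CV))) T \<and>
    (\<exists>v. \<Union>v = ?s ` (- (f -` CV)) \<inter> (?s \<circ> f \<circ> inv ?s) -` T \<and>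
     (\<forall>u\<in>v. openin (top_of_set (?s ` (- (f -` CV)))) u) \<and>
     pairwise disjnt v \<and> (\<forall>u\<in>v. \<exists>q. homeomorphism u T (?s \<circ> f \<circ> inv ?s) q))"
 proof (intro exI [of _ "?s ` N"] conjI exI [of _ "(`) ?s ` \<U>"] ballI)
  show "x \<in> ?s ` N" using N y by blast
  show "openin (top_of_set (?s ` (- CV))) (?s ` N)" using N by (intro openin_stereographic_image) auto
  show "\<Union> ((`) ?s ` \<U>) = ?s ` (- (f -` CV)) \<inter> (?s \<circ> f \<circ> inv ?s) -` ?s ` N"
  proof -
   have "\<Union> ((`) ?s ` \<U>) = ?s ` (f -` N)" by (simp flip: N(4) add: image_Union)
   also have "\<dots> = ?s ` (- (f -` CV)) \<inter> (?s \<circ> f \<circ> inv ?s) -` ?s ` N"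
   proof (intro equalityI subsetI)
    fix u assume "u \<in> ?s ` (f -` N)"
    then obtain z where "f z \<in> N" "u = ?s z" by blast
    thus "u \<in> ?s ` (- (f -` CV)) \<inter> (?s \<circ> f \<circ> inv ?s) -` ?s ` N"
     using N(3) by (intro IntI imageI) (auto simp del: stereographic.simps)
   next
    fix u assume "u \<in> ?s ` (- (f -` CV)) \<inter> (?s \<circ> f \<circ> inv ?s) -` ?s ` N"
    then obtain z where "u = ?s z" "?s (f z) \<in> ?s ` N" by auto
    hence "f z \<in> N" by (simp add: inj_image_mem_iff [OF inj_stereographic])
    thus "u \<in> ?s ` (f -` N)" using \<open>u = ?s z\<close> by blast
   qed
   finally show ?thesis .
  qed
  show "pairwise disjnt ((`) ?s ` \<U>)" using N(5) inj_stereographic unfolding pairwise_def disjnt_def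
   by (auto simp flip: image_Int)
 next
  fix u assume "u \<in> (`) ?s ` \<U>"
  then obtain U' where U': "U' \<in> \<U>" "u = ?s ` U'" by blast
  show "openin (top_of_set (?s ` (- (f -` CV)))) u"
   unfolding U'(2) by (rule openin_stereographic_image [OF U(1) [OF U'(1)] sub [OF U'(1)]])
  obtain g where g: "homeomorphism U' N f g" using U U' by blast
  have "homeomorphism u N (f \<circ> inv ?s) (?s \<circ> g)"
   unfolding U' by (rule homeomorphism_compose [OF homeomorphism_symD [OF homeomorphism_stereographic_image] g])
  hence "homeomorphism u (?s ` N) (?s \<circ> (f \<circ> inv ?s)) (?s \<circ> g \<circ> inv ?s)"
   by (rule homeomorphism_compose [OF _ homeomorphism_stereographic_image])
  thus "\<exists>q. homeomorphism u (?s ` N) (?s \<circ> f \<circ> inv ?s) q" by (auto simp: o_assoc)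
 qed
qed

lemma lift:
 fixes g :: "'c::real_normed_vector \<Rightarrow> riemann_sphere"
 assumes U: "simply_connected U" "locally path_connected U" and g: "continuous_on U g"
  and avoid: "\<And>u. u \<in> U \<Longrightarrow> g u \<notin> CV" and z: "z \<in> U" and a: "f a = g z"
 obtains h where "continuous_on U h" "h z = a" "\<And>u. u \<in> U \<Longrightarrow> f (h u) = g u"
proof -
 let ?s = stereographic
 have "a \<in> - (f -` CV)" using avoid [OF z] a by simp
 obtain k where k: "continuous_on U k" "k \<in> U \<rightarrow> ?s ` (- (f -` CV))" "k z = ?s a"
   "\<And>u. u \<in> U \<Longrightarrow> (?s \<circ> f \<circ> inv ?s) (k u) = (?s \<circ> g) u"
 proof (rule covering_space_lift_strong [OF covering_space_stereographic _ z U])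
  show "?s a \<in> ?s ` (- (f -` CV))" using \<open>a \<in> - (f -` CV)\<close> by blast
  show "continuous_on U (?s \<circ> g)" by (intro continuous_on_compose g continuous_stereographic)
  show "?s \<circ> g \<in> U \<rightarrow> ?s ` (- CV)" using avoid by auto
  show "(?s \<circ> g) z = (?s \<circ> f \<circ> inv ?s) (?s a)" using a by simp
 qed (rule that)
 show thesis
 proof
  have "k ` U \<subseteq> range ?s" using k(2) by blast
  hence "k ` U \<subseteq> sphere 0 1" by (simp only: range_stereographic)
  thus "continuous_on U (inv ?s \<circ> k)" by (intro continuous_on_compose k(1) continuous_inv_stereographic)
  show "(inv ?s \<circ> k) z = a" by (simp add: k)
  show "f ((inv ?s \<circ> k) u) = g u" if "u \<in> U" for u using k(4) [OF that] inj_stereographic by (auto dest: injD)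
 qed
qed

lemma lift_unique:
 fixes h1 h2 :: "'c::topological_space \<Rightarrow> riemann_sphere"
 assumes "connected T" "continuous_on T h1" "continuous_on T h2"
  and eq: "\<And>u. u \<in> T \<Longrightarrow> f (h1 u) = f (h2 u)" and avoid: "\<And>u. u \<in> T \<Longrightarrow> f (h1 u) \<notin> CV"
  and "a \<in> T" "h1 a = h2 a" "u \<in> T"
 shows "h1 u = h2 u"
proof -
 let ?s = stereographic
 have "(?s \<circ> h1) u = (?s \<circ> h2) u"
 proof (rule covering_space_lift_unique [OF covering_space_stereographic, of _ a _ T "?s \<circ> f \<circ> h1"])
  show "continuous_on T (?s \<circ> f \<circ> h1)" by (intro continuous_on_compose assms continuous_stereographic continuous_f)
  show "continuous_on T (?s \<circ> h1)" "continuous_on T (?s \<circ> h2)"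
   by (intro continuous_on_compose assms continuous_stereographic)+
  show "?s \<circ> f \<circ> h1 \<in> T \<rightarrow> ?s ` (- CV)" using avoid by auto
  show "?s \<circ> h1 \<in> T \<rightarrow> ?s ` (- (f -` CV))" using avoid by auto
  show "?s \<circ> h2 \<in> T \<rightarrow> ?s ` (- (f -` CV))" using avoid eq by auto
 qed (use assms in auto)
 thus ?thesis using inj_stereographic by (auto dest: injD)
qed

text \<open>The image of \<open>W\<close> is open, and it is closed in the component of
  \<open>E\<close> around it: a limit of the image inside \<open>E\<close> comes from a point of the
  closure of \<open>W\<close>, which can be adjoined to \<open>W\<close>.\<close>

lemma image_component_vimage:
 assumes "open E" and W: "W \<in> components (f -` E)"
 shows "f ` W \<in> components E"
proof -
 have "open (f -` E)" by (intro open_vimage assms continuous_f)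
 hence "open W" using W open_component_sphere by blast
 have WE: "W \<subseteq> f -` E" "W \<noteq> {}" "connected W" using W by (auto simp: in_components_maximal)
 have conn: "connected (f ` W)" using WE(3) by (intro connected_continuous_image continuous_f)
 obtain C where C: "C \<in> components E" "f ` W \<subseteq> C"
  using WE conn by (metis exists_component_superset image_is_empty image_subset_iff_subset_vimage components_eq_empty ex_in_conv subset_empty)
 have "closure (f ` W) \<inter> C \<subseteq> f ` W"
 proof clarify
  fix y assume y: "y \<in> closure (f ` W)" "y \<in> C"
  have "closed (f ` closure W)" by (simp add: closed_image)
  hence "closure (f ` W) \<subseteq> f ` closure W" by (intro closure_minimal image_mono closure_subset)
  then obtain x where x: "x \<in> closure W" "y = f x" using y by blast
  have "connected (insert x W)"
   using WE(3) x(1) closure_subset by (intro connected_intermediate_closure [OF WE(3)]) auto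
  moreover have "insert x W \<subseteq> f -` E" using WE(1) x y in_components_subset [OF C(1)] by auto
  ultimately have "insert x W \<subseteq> W" using WE(2) by (intro components_maximal [OF W]) auto
  thus "y \<in> f ` W" using x by auto
 qed
 hence "f ` W = C \<inter> closure (f ` W)" using C(2) closure_subset by blast
 hence "closedin (top_of_set C) (f ` W)" using closedin_closed_Int [OF closed_closure] by metis
 moreover have "openin (top_of_set C) (f ` W)" using C(2) \<open>open W\<close> open_image open_subset by blast
 ultimately have "f ` W = C" using in_components_connected [OF C(1)] WE(2) unfolding connected_clopen by blast
 thus ?thesis using C(1) by simp
qed

section \<open>Equicontinuity and the Fatou set\<close>

text \<open>Equicontinuity in the chordal metric is the working form of normality: the Fatou set is
  the interior of the set of such points.\<close>

definition equicontinuous_at :: "riemann_sphere \<Rightarrow> bool" where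
 "equicontinuous_at x \<longleftrightarrow> (\<forall>e>0. \<exists>\<delta>>0. \<forall>y. dist x y < \<delta> \<longrightarrow> (\<forall>n. dist ((f ^^ n) x) ((f ^^ n) y) < e))"

text \<open>Arzela-Ascoli for the iterates followed by \<open>stereographic\<close>. The limit takes
  its values in the unit sphere because that is closed, so it can be pulled back to the Riemann
  sphere.\<close>

lemma subsequence_uniform_limit:
 assumes "compact K" and eq: "\<And>x. x \<in> K \<Longrightarrow> equicontinuous_at x"
 obtains r h where "strict_mono (r :: nat \<Rightarrow> nat)" "continuous_on K h"
  "uniform_limit K (\<lambda>n. f ^^ (k (r n))) h sequentially"
proof -
 let ?s = stereographic
 have cK: "compact (?s ` K)" using assms(1) by (intro compact_continuous_image continuous_stereographic)
 have eqc: "\<exists>\<delta>>0. \<forall>n y. y \<in> ?s ` K \<and> norm (x - y) < \<delta> \<longrightarrow>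
   norm (?s ((f ^^ k n) (inv ?s x)) - ?s ((f ^^ k n) (inv ?s y))) < e" if x: "x \<in> ?s ` K" and "e > 0" for x e
 proof -
  obtain x' where x': "x' \<in> K" "x = ?s x'" using x by blast
  obtain \<delta> where \<delta>: "\<delta> > 0" "\<And>y n. dist x' y < \<delta> \<Longrightarrow> dist ((f ^^ n) x') ((f ^^ n) y) < e"
   using eq [OF x'(1)] \<open>e > 0\<close> unfolding equicontinuous_at_def by metis
  have "norm (?s ((f ^^ k n) (inv ?s x)) - ?s ((f ^^ k n) (inv ?s y))) < e"
   if "y \<in> ?s ` K" "norm (x - y) < \<delta>" for n y
   using that \<delta>(2) [of "inv ?s y" "k n"] x' by (auto simp: dist_riemann_sphere_def dist_norm)
  thus ?thesis using \<delta>(1) by blast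
 qed
 obtain g r where g: "continuous_on (?s ` K) g" "strict_mono (r :: nat \<Rightarrow> nat)"
   "\<And>e. 0 < e \<Longrightarrow> \<exists>N. \<forall>n x. n \<ge> N \<and> x \<in> ?s ` K \<longrightarrow> norm (?s ((f ^^ k (r n)) (inv ?s x)) - g x) < e"
 proof (rule Arzela_Ascoli [of "?s ` K" "\<lambda>n x. ?s ((f ^^ k n) (inv ?s x))" 1])
  show "norm (?s ((f ^^ k n) (inv ?s x))) \<le> 1" for n x by simp
 qed (use cK eqc that in blast)+
 have sph: "g (?s x) \<in> sphere 0 1" if "x \<in> K" for x
 proof -
  have "(\<lambda>n. ?s ((f ^^ k (r n)) x)) \<longlonglongrightarrow> g (?s x)" unfolding LIMSEQ_iff
  proof (intro allI impI)
   fix e :: real assume "e > 0"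
   then obtain N where "\<forall>n x. n \<ge> N \<and> x \<in> ?s ` K \<longrightarrow> norm (?s ((f ^^ k (r n)) (inv ?s x)) - g x) < e"
    using g(3) by meson
   hence "norm (?s ((f ^^ k (r n)) (inv ?s (?s x))) - g (?s x)) < e" if "n \<ge> N" for n using that \<open>x \<in> K\<close> by blast
   thus "\<exists>N. \<forall>n\<ge>N. norm (?s ((f ^^ k (r n)) x) - g (?s x)) < e" by auto
  qed
  thus ?thesis by (rule closed_sequentially [OF closed_sphere, rotated]) auto
 qed
 show thesis
 proof
  show "strict_mono r" by fact
  show "continuous_on K (inv ?s \<circ> (g \<circ> ?s))"
   by (intro continuous_on_compose continuous_stereographic g(1) continuous_inv_stereographic) (use sph in auto)
  show "uniform_limit K (\<lambda>n. f ^^ (k (r n))) (inv ?s \<circ> (g \<circ> ?s)) sequentially"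
   unfolding uniform_limit_iff eventually_sequentially
  proof (intro allI impI)
   fix e :: real assume "e > 0"
   then obtain N where "\<forall>n x. n \<ge> N \<and> x \<in> ?s ` K \<longrightarrow> norm (?s ((f ^^ k (r n)) (inv ?s x)) - g x) < e"
    using g(3) by meson
   hence "norm (?s ((f ^^ k (r n)) (inv ?s (?s x))) - g (?s x)) < e" if "n \<ge> N" "x \<in> K" for n x using that by blast
   thus "\<exists>N. \<forall>n\<ge>N. \<forall>x\<in>K. dist ((f ^^ k (r n)) x) ((inv ?s \<circ> (g \<circ> ?s)) x) < e"
    using sph by (intro exI [of _ N]) (auto simp: dist_riemann_sphere_def dist_norm)
  qed
 qed
qed

text \<open>A failure of equicontinuity at \<open>y\<close> gives points \<open>z m\<close> tending
  to \<open>y\<close> and iterates keeping them at distance \<open>e\<close> from the image of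
  \<open>y\<close>; this contradicts the continuity of a uniform limit. The converse is
  Arzela-Ascoli on a closed ball.\<close>

lemma fatou_set_iff: "x \<in> FS \<longleftrightarrow> (\<exists>U. open U \<and> x \<in> U \<and> (\<forall>y\<in>U. equicontinuous_at y))"
proof
 assume "x \<in> FS"
 then obtain U where U: "open U" "x \<in> U" and norm: "normal_family_on (range (\<lambda>n. f ^^ n)) U"
  unfolding fatou_set_def by blast
 have "equicontinuous_at y" if yU: "y \<in> U" for y
 proof (rule ccontr)
  assume "\<not> equicontinuous_at y"
  then obtain e where e: "e > 0" "\<And>\<delta>. \<delta> > 0 \<Longrightarrow> \<exists>z n. dist y z < \<delta> \<and> \<not> dist ((f ^^ n) y) ((f ^^ n) z) < e"
   unfolding equicontinuous_at_def by metis
  have "\<exists>z n. dist y z < inverse (real (Suc m)) \<and> \<not> dist ((f ^^ n) y) ((f ^^ n) z) < e" for m by (rule e(2)) simp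
  then obtain z n where zn: "\<And>m. dist y (z m) < inverse (real (Suc m))"
    "\<And>m. \<not> dist ((f ^^ n m) y) ((f ^^ n m) (z m)) < e"
   by metis
  obtain \<rho> where \<rho>: "\<rho> > 0" "cball y \<rho> \<subseteq> U" using U(1) yU open_contains_cball by blast
  have "compact (cball y \<rho>)" by (simp add: closed_imp_compact_sphere)
  moreover obtain r h where r: "strict_mono (r :: nat \<Rightarrow> nat)"
   and lim: "\<And>K. compact K \<Longrightarrow> K \<subseteq> U \<Longrightarrow> uniform_limit K ((\<lambda>m. f ^^ n m) \<circ> r) h sequentially"
   using norm unfolding normal_family_on_def by (metis rangeI)
  ultimately have ul: "uniform_limit (cball y \<rho>) ((\<lambda>m. f ^^ n m) \<circ> r) h sequentially" using \<rho> by blast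
  hence "continuous_on (cball y \<rho>) h" by (rule uniform_limit_theorem [rotated]) (auto simp: continuous_iterate)
  then obtain \<delta> where \<delta>: "\<delta> > 0" "\<And>v. v \<in> cball y \<rho> \<Longrightarrow> dist v y < \<delta> \<Longrightarrow> dist (h v) (h y) < e / 3"
   using e(1) \<rho>(1) unfolding continuous_on_iff by (metis centre_in_cball less_imp_le divide_pos_pos zero_less_numeral)
  have "\<forall>\<^sub>F m in sequentially. \<forall>v\<in>cball y \<rho>. dist (((\<lambda>m. f ^^ n m) \<circ> r) m v) (h v) < e / 3"
   using ul e(1) unfolding uniform_limit_iff by (meson divide_pos_pos zero_less_numeral)
  then obtain M where "\<forall>m\<ge>M. \<forall>v\<in>cball y \<rho>. dist (((\<lambda>m. f ^^ n m) \<circ> r) m v) (h v) < e / 3"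
   unfolding eventually_sequentially by blast
  hence M: "dist ((f ^^ n (r m)) v) (h v) < e / 3" if "m \<ge> M" "v \<in> cball y \<rho>" for m v using that by simp
  obtain M' :: nat where M': "inverse (real (Suc M')) < min \<delta> \<rho>" using reals_Archimedean [of "min \<delta> \<rho>"] \<delta> \<rho> by auto
  define m where "m = max M M'"
  have "M' \<le> r m" using seq_suble [OF r, of m] by (simp add: m_def)
  hence "inverse (real (Suc (r m))) \<le> inverse (real (Suc M'))" by simp
  hence "dist y (z (r m)) < min \<delta> \<rho>" using zn(1) [of "r m"] M' by linarith
  hence zb: "z (r m) \<in> cball y \<rho>" "dist (z (r m)) y < \<delta>" by (auto simp: dist_commute)
  have "dist ((f ^^ n (r m)) y) ((f ^^ n (r m)) (z (r m))) < e"
  proof -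
   have "dist ((f ^^ n (r m)) y) (h y) < e / 3" "dist ((f ^^ n (r m)) (z (r m))) (h (z (r m))) < e / 3"
    using M [of m] zb \<rho> by (auto simp: m_def)
   moreover have "dist (h (z (r m))) (h y) < e / 3" using \<delta>(2) zb by blast
   ultimately show ?thesis by metric
  qed
  thus False using zn(2) by blast
 qed
 thus "\<exists>U. open U \<and> x \<in> U \<and> (\<forall>y\<in>U. equicontinuous_at y)" using U by blast
next
 assume "\<exists>U. open U \<and> x \<in> U \<and> (\<forall>y\<in>U. equicontinuous_at y)"
 then obtain U where U: "open U" "x \<in> U" "\<And>y. y \<in> U \<Longrightarrow> equicontinuous_at y" by blast
 obtain \<rho> where \<rho>: "\<rho> > 0" "cball x \<rho> \<subseteq> U" using U open_contains_cball by blast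
 have "compact (cball x \<rho>)" by (simp add: closed_imp_compact_sphere)
 have "normal_family_on (range (\<lambda>n. f ^^ n)) (ball x \<rho>)" unfolding normal_family_on_def
 proof (intro allI impI)
  fix g :: "nat \<Rightarrow> riemann_sphere \<Rightarrow> riemann_sphere" assume "\<forall>n. g n \<in> range (\<lambda>n. f ^^ n)"
  then obtain k where k: "\<And>n. g n = f ^^ k n" unfolding image_iff by metis
  obtain r h where r: "strict_mono (r :: nat \<Rightarrow> nat)" and ul: "uniform_limit (cball x \<rho>) (\<lambda>n. f ^^ (k (r n))) h sequentially"
  proof (rule subsequence_uniform_limit [OF \<open>compact (cball x \<rho>)\<close>, of k])
   show "equicontinuous_at y" if "y \<in> cball x \<rho>" for y using U(3) \<rho>(2) that by blast
  qed blast
  have "g \<circ> r = (\<lambda>n. f ^^ (k (r n)))" by (auto simp: k)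
  hence "\<forall>K. compact K \<and> K \<subseteq> ball x \<rho> \<longrightarrow> uniform_limit K (g \<circ> r) h sequentially"
   using uniform_limit_on_subset [OF ul] ball_subset_cball by (metis order_trans)
  thus "\<exists>r h. strict_mono r \<and> (\<forall>K. compact K \<and> K \<subseteq> ball x \<rho> \<longrightarrow> uniform_limit K (g \<circ> r) h sequentially)"
   using r by blast
 qed
 thus "x \<in> FS" unfolding fatou_set_def using \<rho> by (intro CollectI exI [of _ "ball x \<rho>"]) auto
qed

lemma open_fatou: "open FS"
proof -
 have "FS = \<Union>{U. open U \<and> (\<forall>y\<in>U. equicontinuous_at y)}" by (auto simp: fatou_set_iff)
 thus ?thesis by (metis (no_types, lifting) mem_Collect_eq open_Union)
qed

lemma open_fatou_component: "U \<in> components FS \<Longrightarrow> open U"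
 by (rule open_component_sphere [OF open_fatou])

lemma closed_julia: "closed JS"
 by (simp add: julia_set_def open_fatou closed_Compl)

lemma compact_julia: "compact JS"
 by (simp add: closed_julia closed_imp_compact_sphere)

lemma fatou_equicontinuous: "x \<in> FS \<Longrightarrow> equicontinuous_at x"
 by (auto simp: fatou_set_iff)

lemma fatouI: "open U \<Longrightarrow> (\<And>y. y \<in> U \<Longrightarrow> equicontinuous_at y) \<Longrightarrow> U \<subseteq> FS"
 unfolding subset_iff fatou_set_iff by blast

text \<open>One direction uses the continuity of \<open>f\<close>, the other its openness; together
  they give complete invariance of the Fatou set.\<close>

lemma equicontinuous_at_f: "equicontinuous_at (f x) \<longleftrightarrow> equicontinuous_at x"
proof
 assume eq: "equicontinuous_at (f x)"
 show "equicontinuous_at x" unfolding equicontinuous_at_def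
 proof (intro allI impI)
  fix e :: real assume "e > 0"
  then obtain \<delta> where \<delta>: "\<delta> > 0" "\<And>y n. dist (f x) y < \<delta> \<Longrightarrow> dist ((f ^^ n) (f x)) ((f ^^ n) y) < e"
   using eq unfolding equicontinuous_at_def by metis
  obtain \<eta> where \<eta>: "\<eta> > 0" "\<And>y. dist y x < \<eta> \<Longrightarrow> dist (f y) (f x) < \<delta>"
   using continuous_f [of UNIV] \<delta>(1) unfolding continuous_on_iff by (metis UNIV_I)
  have "dist ((f ^^ n) x) ((f ^^ n) y) < e" if "dist x y < min e \<eta>" for y n
  proof (cases n)
   case 0
   thus ?thesis using that by simp
  next
   case (Suc m)
   have "dist (f x) (f y) < \<delta>" using \<eta>(2) [of y] that by (simp add: dist_commute)
   thus ?thesis using \<delta>(2) [of "f y" m] by (simp add: Suc funpow_swap1)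
  qed
  thus "\<exists>\<delta>>0. \<forall>y. dist x y < \<delta> \<longrightarrow> (\<forall>n. dist ((f ^^ n) x) ((f ^^ n) y) < e)"
   using \<open>e > 0\<close> \<eta>(1) by (intro exI [of _ "min e \<eta>"]) auto
 qed
next
 assume eq: "equicontinuous_at x"
 show "equicontinuous_at (f x)" unfolding equicontinuous_at_def
 proof (intro allI impI)
  fix e :: real assume "e > 0"
  then obtain \<delta> where \<delta>: "\<delta> > 0" "\<And>y n. dist x y < \<delta> \<Longrightarrow> dist ((f ^^ n) x) ((f ^^ n) y) < e"
   using eq unfolding equicontinuous_at_def by metis
  have "open (f ` ball x \<delta>)" "f x \<in> f ` ball x \<delta>" using open_image \<delta>(1) by auto
  then obtain \<eta> where \<eta>: "\<eta> > 0" "ball (f x) \<eta> \<subseteq> f ` ball x \<delta>" using open_contains_ball by blast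
  have "dist ((f ^^ n) (f x)) ((f ^^ n) y) < e" if y: "dist (f x) y < \<eta>" for y n
  proof -
   obtain z where z: "z \<in> ball x \<delta>" "y = f z" using y \<eta>(2) by (meson imageE mem_ball subsetD)
   thus ?thesis using \<delta>(2) [of z "Suc n"] by (simp add: funpow_swap1)
  qed
  thus "\<exists>\<delta>>0. \<forall>y. dist (f x) y < \<delta> \<longrightarrow> (\<forall>n. dist ((f ^^ n) (f x)) ((f ^^ n) y) < e)" using \<eta>(1) by blast
 qed
qed

lemma f_in_fatou_iff [simp]: "f x \<in> FS \<longleftrightarrow> x \<in> FS"
proof
 assume "f x \<in> FS"
 then obtain U where "open U" "f x \<in> U" "\<And>y. y \<in> U \<Longrightarrow> equicontinuous_at y" by (auto simp: fatou_set_iff)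
 thus "x \<in> FS" unfolding fatou_set_iff using equicontinuous_at_f
  by (intro exI [of _ "f -` U"]) (auto intro!: open_vimage continuous_f)
next
 assume "x \<in> FS"
 then obtain U where "open U" "x \<in> U" "\<And>y. y \<in> U \<Longrightarrow> equicontinuous_at y" by (auto simp: fatou_set_iff)
 thus "f x \<in> FS" unfolding fatou_set_iff using equicontinuous_at_f
  by (intro exI [of _ "f ` U"]) (auto intro!: open_image)
qed

lemma iterate_in_fatou_iff [simp]: "(f ^^ n) x \<in> FS \<longleftrightarrow> x \<in> FS"
 by (induction n) auto

lemma f_in_julia_iff [simp]: "f x \<in> JS \<longleftrightarrow> x \<in> JS"
 by (simp add: julia_set_def)

lemma iterate_in_julia_iff [simp]: "(f ^^ n) x \<in> JS \<longleftrightarrow> x \<in> JS"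
 by (simp add: julia_set_def)

lemma vimage_fatou: "f -` FS = FS"
 by auto

lemma open_iterate_image: "open U \<Longrightarrow> open ((f ^^ n) ` U)"
proof (induction n)
 case (Suc n)
 hence "open (f ` (f ^^ n) ` U)" by (simp add: open_image)
 thus ?case by (simp add: image_comp)
qed simp

lemma image_fatou_component: "U \<in> components FS \<Longrightarrow> f ` U \<in> components FS"
 using image_component_vimage [OF open_fatou] vimage_fatou by simp

lemma iterate_fatou_component:
 "U \<in> components FS \<Longrightarrow> (f ^^ n) ` U \<in> components FS"
proof (induction n)
 case (Suc n)
 hence "f ` (f ^^ n) ` U \<in> components FS" by (simp add: image_fatou_component)
 thus ?case by (simp add: image_comp)
qed simp

end

section \<open>Connected sets in the sphere\<close>

lemma connected_subset_closed_partition: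
 assumes "connected D" "D \<subseteq> P \<union> Q" "closed P" "closed Q" "P \<inter> Q = {}" "D \<inter> Q \<noteq> {}"
 shows "D \<subseteq> Q"
proof -
 have "D \<inter> P = {}" using assms connected_closedD [OF assms(1), of P Q] by blast
 thus ?thesis using assms(2) by blast
qed

lemma connected_subset_open_partition:
 assumes "connected D" "D \<subseteq> P \<union> Q" "open P" "open Q" "P \<inter> Q = {}" "D \<inter> Q \<noteq> {}"
 shows "D \<subseteq> Q"
proof -
 have "D \<inter> P = {}" using assms connectedD [OF assms(1), of P Q] by blast
 thus ?thesis using assms(2) by blast
qed

lemma clopen_sphere:
 fixes A :: "riemann_sphere set"
 assumes "open A" "closed A"
 shows "A = {} \<or> A = UNIV"
 using connected_UNIV_sphere assms unfolding connected_clopen by (metis closed_closedin open_openin subtopology_UNIV)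

lemma closed_not_connectedE:
 assumes "closed S" "\<not> connected S"
 obtains P Q where "closed P" "closed Q" "P \<noteq> {}" "Q \<noteq> {}" "P \<union> Q = S" "P \<inter> Q = {}"
 using connected_closed_set [OF assms(1)] assms(2) by blast

lemma separation_sphere:
 fixes P Q :: "riemann_sphere set"
 assumes "closed P" "closed Q" "P \<inter> Q = {}"
 obtains U V where "open U" "open V" "P \<subseteq> U" "Q \<subseteq> V" "U \<inter> V = {}"
 using t4_space [OF assms] by blast

text \<open>If \<open>- C\<close> split, the part not meeting \<open>Y\<close> would be a union of
  other components of \<open>- Y\<close>, hence open as well as closed.\<close>

lemma connected_compl_component:
 fixes Y :: "riemann_sphere set"
 assumes Y: "closed Y" "connected Y" "Y \<noteq> {}" and C: "C \<in> components (- Y)"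
 shows "connected (- C)"
proof (rule ccontr)
 assume "\<not> connected (- C)"
 have "open (- Y)" using Y(1) by blast
 hence opC: "open (- Y)" "open C" using open_component_sphere [OF _ C] by blast+
 have CY: "C \<inter> Y = {}" "C \<noteq> {}" using in_components_subset [OF C] in_components_nonempty [OF C] by auto
 have *: False if PQ: "closed P" "closed Q" "P \<noteq> {}" "Q \<noteq> {}" "P \<union> Q = - C" "P \<inter> Q = {}" "Y \<inter> P \<noteq> {}" for P Q
 proof -
  have "Y \<subseteq> Q \<union> P" using CY PQ by blast
  hence "Y \<subseteq> P" by (rule connected_subset_closed_partition [OF Y(2)]) (use PQ in auto)
  have "\<exists>T. open T \<and> x \<in> T \<and> T \<subseteq> Q" if "x \<in> Q" for x
  proof -
   have "x \<in> - Y" using \<open>x \<in> Q\<close> \<open>Y \<subseteq> P\<close> PQ by blast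
   then obtain D where D: "D \<in> components (- Y)" "x \<in> D" by (metis UnionE Union_components)
   have "D \<inter> C = {}" using C D PQ \<open>x \<in> Q\<close> components_nonoverlap by (metis ComplD UnI2)
   hence "D \<subseteq> P \<union> Q" using PQ by blast
   hence "D \<subseteq> Q"
    by (rule connected_subset_closed_partition [OF in_components_connected [OF D(1)]]) (use PQ D \<open>x \<in> Q\<close> in auto)
   thus ?thesis using D open_component_sphere [OF opC(1)] by blast
  qed
  hence "open Q" by (subst open_subopen) blast
  hence "Q = UNIV" using clopen_sphere PQ by blast
  thus False using PQ by blast
 qed
 obtain P Q where PQ: "closed P" "closed Q" "P \<noteq> {}" "Q \<noteq> {}" "P \<union> Q = - C" "P \<inter> Q = {}"
  using closed_not_connectedE [OF _ \<open>\<not> connected (- C)\<close>] opC by (metis closed_Compl)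
 have "Y \<inter> P \<noteq> {} \<or> Y \<inter> Q \<noteq> {}" using CY Y(3) PQ(5) by blast
 thus False using * [OF PQ] * [OF PQ(2,1,4,3)] PQ by (metis Int_commute Un_commute)
qed

lemma path_connected_open_sphere:
 fixes U :: "riemann_sphere set"
 assumes "open U" "connected U"
 shows "path_connected U"
 unfolding path_connected_component
proof (intro ballI)
 fix x y assume "x \<in> U" "y \<in> U"
 show "path_component U x y"
 proof (rule connected_equivalence_relation [OF assms(2) \<open>x \<in> U\<close> \<open>y \<in> U\<close>])
  show "\<exists>T. openin (top_of_set U) T \<and> a \<in> T \<and> (\<forall>x\<in>T. path_component U a x)" if aU: "a \<in> U" for a
  proof -
   obtain w where w: "a \<noteq> w" by (metis riemann_sphere.distinct(1))
   have "open (par w -` U)" "chart w a \<in> par w -` U" using assms(1) aU w by (auto intro: open_par_vimage)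
   then obtain r where r: "r > 0" "ball (chart w a) r \<subseteq> par w -` U" using open_contains_ball by blast
   let ?T = "par w ` ball (chart w a) r"
   have "path_connected ?T"
    by (intro path_connected_continuous_image continuous_par convex_imp_path_connected convex_ball)
   moreover have aT: "a \<in> ?T" using r w by (intro image_eqI [of _ _ "chart w a"]) auto
   moreover have TU: "?T \<subseteq> U" using r by auto
   ultimately have "path_component U a x" if "x \<in> ?T" for x
    using that unfolding path_connected_component by (meson path_component_of_subset)
   moreover have "openin (top_of_set U) ?T" using TU by (intro open_subset open_par_image) auto
   ultimately show ?thesis using aT by blast
  qed
 qed (auto intro: path_component_sym path_component_trans)
qed

text \<open>Stated for any type with connected balls because it serves both the sphere and the
  plane. Finitely many balls covering \<open>K\<close> are joined to a base point by paths.\<close>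

lemma compact_connected_superset:
 fixes U :: "'a::heine_borel set"
 assumes ball: "\<And>x r. connected (ball (x::'a) r)" and U: "open U" "path_connected U" and K: "compact K" "K \<subseteq> U"
 obtains C where "compact C" "connected C" "K \<subseteq> C" "C \<subseteq> U"
proof (cases "K = {}")
 case False
 then obtain x0 where x0: "x0 \<in> K" by blast
 have "\<exists>r C. r > 0 \<and> compact C \<and> connected C \<and> C \<subseteq> U \<and> x0 \<in> C \<and> ball y r \<subseteq> C" if y: "y \<in> K" for y
 proof -
  obtain r where r: "r > 0" "cball y r \<subseteq> U" using U(1) y K(2) open_contains_cball by blast
  have B: "closure (ball y r) \<subseteq> U" "ball y r \<subseteq> closure (ball y r)" "y \<in> closure (ball y r)"
   using closure_minimal [OF ball_subset_cball closed_cball, of y r] r closure_subset [of "ball y r"] by auto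
  obtain g where g: "path g" "path_image g \<subseteq> U" "pathstart g = x0" "pathfinish g = y"
   using U(2) x0 y K(2) unfolding path_connected_def by blast
  have gy: "x0 \<in> path_image g" "y \<in> path_image g" using g(3,4) by auto
  hence "connected (path_image g \<union> closure (ball y r))"
   using B(3) g(1) by (intro connected_Un connected_path_image connected_imp_connected_closure ball) auto
  moreover have "compact (path_image g \<union> closure (ball y r))"
   using g(1) by (intro compact_Un compact_path_image) auto
  ultimately show ?thesis
   using r(1) B(1,2) g(2) gy(1) by (intro exI [of _ r] exI [of _ "path_image g \<union> closure (ball y r)"] conjI Un_least) auto
 qed
 then obtain r C where C: "\<And>y. y \<in> K \<Longrightarrow> r y > 0 \<and> compact (C y) \<and> connected (C y) \<and> C y \<subseteq> U \<and> x0 \<in> C y \<and> ball y (r y) \<subseteq> C y"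
  by metis
 obtain F where F: "F \<subseteq> K" "finite F" "K \<subseteq> (\<Union>y\<in>F. ball y (r y))" using compact_ball_cover [OF K(1), of r] C by metis
 show ?thesis
 proof
  show "compact (\<Union> (C ` F))" using F C by (intro compact_Union) auto
  show "connected (\<Union> (C ` F))"
  proof (rule connected_Union)
   have "x0 \<in> \<Inter> (C ` F)" using C F(1) by auto
   thus "\<Inter> (C ` F) \<noteq> {}" by blast
  qed (use C F(1) in auto)
  have "(\<Union>y\<in>F. ball y (r y)) \<subseteq> \<Union> (C ` F)" using C F(1) by (intro UN_mono) auto
  thus "K \<subseteq> \<Union> (C ` F)" using F(3) by (rule order_trans [rotated])
  show "\<Union> (C ` F) \<subseteq> U" using F(1) C by (intro UN_least) auto
 qed
qed (use that [of "{}"] in auto)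

lemmas compact_connected_superset_sphere =
 compact_connected_superset [OF connected_ball_sphere _ path_connected_open_sphere]

lemma connected_open_delete_sphere:
 fixes U :: "riemann_sphere set"
 assumes U: "open U" "connected U"
 shows "connected (U - {x})"
proof (cases "x \<in> U")
 case True
 obtain w where w: "x \<noteq> w" by (metis riemann_sphere.distinct(1))
 have "open (par w -` U)" "chart w x \<in> par w -` U" using U(1) True w by (auto intro: open_par_vimage)
 then obtain r where r: "r > 0" "ball (chart w x) r \<subseteq> par w -` U" using open_contains_ball by blast
 define N where "N = par w ` ball (chart w x) r"
 have N: "open N" "x \<in> N" "N \<subseteq> U"
  using r w unfolding N_def by (auto intro: open_par_image intro!: image_eqI [of _ _ "chart w x"])
 have "N - {x} = par w ` (ball (chart w x) r - {chart w x})"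
 proof -
  have "par w (chart w x) = x" using w by simp
  moreover have "inj (par w)" by (simp add: inj_def)
  ultimately show ?thesis unfolding N_def by (simp add: image_set_diff)
 qed
 moreover have "connected (ball (chart w x) r - {chart w x})" by (rule connected_punctured_ball) simp
 ultimately have cN: "connected (N - {x})" by (metis connected_continuous_image continuous_par)
 show ?thesis
 proof (rule connectedI)
  fix A B assume AB: "open A" "open B" "A \<inter> (U - {x}) \<noteq> {}" "B \<inter> (U - {x}) \<noteq> {}" "A \<inter> B \<inter> (U - {x}) = {}" "U - {x} \<subseteq> A \<union> B"
  have *: False if AB: "open A" "open B" "A \<inter> (U - {x}) \<noteq> {}" "B \<inter> (U - {x}) \<noteq> {}" "A \<inter> B \<inter> (U - {x}) = {}" "U - {x} \<subseteq> A \<union> B"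
   and NA: "(N - {x}) \<inter> B = {}" for A B
  proof -
   have "open (A \<union> N)" "open (B - {x})" using AB N by auto
   moreover have "(A \<union> N) \<inter> (B - {x}) \<inter> U = {}" using AB NA by blast
   moreover have "U \<subseteq> (A \<union> N) \<union> (B - {x})" using AB N by blast
   ultimately have "(A \<union> N) \<inter> U = {} \<or> (B - {x}) \<inter> U = {}" using connectedD [OF U(2)] by blast
   thus False using AB by blast
  qed
  have "(N - {x}) \<inter> A = {} \<or> (N - {x}) \<inter> B = {}" using connectedD [OF cN AB(1,2)] AB N by blast
  thus False using * [OF AB] * [OF AB(2,1,4,3)] AB(5,6) by (metis Int_commute Un_commute)
 qed
qed (simp add: U)

lemma connected_open_diff_finite_sphere:
 fixes U :: "riemann_sphere set"
 assumes "finite F" "open U" "connected U"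
 shows "connected (U - F)"
 using assms(1)
proof (induction F rule: finite_induct)
 case (insert x F)
 have "open (U - F)" using assms insert by (simp add: finite_imp_closed open_Diff)
 hence "connected ((U - F) - {x})" by (rule connected_open_delete_sphere) (rule insert)
 thus ?case by (subst Diff_insert)
qed (use assms in simp)

text \<open>In the chart at a point outside \<open>E\<close> this is the characterisation of simply
  connected plane domains by vanishing winding numbers. The normalisation
  \<open>\<phi> 0 = b\<close> serves to put a critical value at the centre of the disc.\<close>

lemma homeomorphic_disc_of_connected_compl:
 fixes E :: "riemann_sphere set"
 assumes E: "open E" "connected E" "connected (- E)" "- E \<noteq> {}" and b: "b \<in> E"
 obtains \<phi> \<psi> where "homeomorphism (ball (0::complex) 1) E \<phi> \<psi>" "\<phi> 0 = b"
proof -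
 obtain w where w: "w \<notin> E" using E by blast
 define E' where "E' = chart w ` E"
 have oE': "open E'" unfolding E'_def using open_chart_image E(1) w by blast
 have EE': "par w ` E' = E"
 proof -
  have "(\<lambda>x. par w (chart w x)) ` E = (\<lambda>x. x) ` E" using w by (intro image_cong refl par_chart) auto
  thus ?thesis by (simp add: E'_def image_image)
 qed
 have homE: "homeomorphism E' E (par w) (chart w)" unfolding homeomorphism_def
  using w EE' by (auto simp: E'_def continuous_par continuous_chart intro!: par_chart)
 have inE': "z \<in> E' \<longleftrightarrow> par w z \<in> E" for z using EE' by (metis chart_par imageE imageI)
 have "simply_connected E'"
 proof (subst simply_connected_eq_winding_number_zero [OF oE'], intro conjI allI impI)
  show "connected E'" unfolding E'_def using E(2) w by (intro connected_continuous_image continuous_chart)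
  fix g z assume g: "path g \<and> path_image g \<subseteq> E' \<and> pathfinish g = pathstart g \<and> z \<notin> E'"
  define G where "G = par w ` path_image g"
  have "compact G" unfolding G_def using g by (intro compact_continuous_image continuous_par compact_path_image) auto
  hence clG: "closed G" by (rule compact_imp_closed)
  have GE: "G \<subseteq> E" using g EE' by (auto simp: G_def)
  \<comment> \<open>The set \<open>- E\<close> is connected, so one component of the complement of
    the loop contains all of it. That component contains \<open>w\<close>, which is infinity in the
    chart; hence the points of the chart outside \<open>E'\<close> lie outside the loop.\<close>
  define O' where "O' = connected_component_set (- G) w"
  have wG: "w \<in> - G" using GE w by blast
  have O_comp: "O' \<in> components (- G)" unfolding O'_def using wG by (simp add: componentsI)
  have "open O'" using O_comp clG open_component_sphere by blast
  have wO: "w \<in> O'" using wG by (simp add: O'_def)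
  have "- E \<subseteq> O'" by (rule components_maximal [OF O_comp E(3)]) (use GE wO w in auto)
  define D where "D = chart w ` (O' - {w})"
  have "connected (O' - {w})"
   using \<open>open O'\<close> by (intro connected_open_delete_sphere) (use O_comp in_components_connected in auto)
  hence cD: "connected D" unfolding D_def by (intro connected_continuous_image continuous_chart) auto
  have zD: "z \<in> D"
  proof -
   have "par w z \<in> O' - {w}" using g inE' \<open>- E \<subseteq> O'\<close> by auto
   thus ?thesis unfolding D_def by (metis chart_par imageI)
  qed
  have Dg: "D \<inter> path_image g = {}"
  proof -
   have "O' \<inter> G = {}" using in_components_subset [OF O_comp] by blast
   thus ?thesis unfolding D_def G_def by (force simp: image_iff)
  qed
  have "\<not> bounded D"
  proof
   assume "bounded D"
   hence "compact (closure D)" by simp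
   hence "compact (par w ` closure D)" by (intro compact_continuous_image continuous_par)
   hence "closed (par w ` closure D)" by (rule compact_imp_closed)
   moreover have "par w ` D = O' - {w}"
   proof -
    have "par w ` D = (\<lambda>x. x) ` (O' - {w})" unfolding D_def image_image by (intro image_cong) auto
    thus ?thesis by simp
   qed
   hence "O' - {w} \<subseteq> par w ` closure D" using closure_subset by blast
   ultimately have "closure (O' - {w}) \<subseteq> par w ` closure D" by (simp add: closure_minimal)
   moreover have "w \<in> closure (O' - {w})"
   proof (rule ccontr)
    assume "w \<notin> closure (O' - {w})"
    hence "open (- closure (O' - {w}) \<inter> O')" "- closure (O' - {w}) \<inter> O' = {w}"
     using \<open>open O'\<close> wO closure_subset [of "O' - {w}"] by auto
    hence "open {w}" by simp
    hence "{w} = UNIV" using clopen_sphere [of "{w}"] by auto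
    thus False by (metis UNIV_I riemann_sphere.distinct(1) singletonD)
   qed
   ultimately have "w \<in> par w ` closure D" by blast
   thus False by auto
  qed
  moreover have "D \<subseteq> connected_component_set (- path_image g) z"
   using Dg by (intro connected_component_maximal zD cD) blast
  ultimately have "\<not> bounded (connected_component_set (- path_image g) z)" using bounded_subset by blast
  hence "z \<in> outside (path_image g)" using zD Dg by (auto simp: outside_def)
  thus "winding_number g z = 0" using g by (intro winding_number_zero_in_outside) auto
 qed
 moreover have "E' \<noteq> {}" using b by (auto simp: E'_def)
 ultimately have "E' homeomorphic ball (0::complex) 1"
  using simply_connected_eq_homeomorphic_to_disc [OF oE'] by blast
 hence "ball (0::complex) 1 homeomorphic E'" by (subst homeomorphic_sym)
 then obtain k k' where k: "homeomorphism (ball (0::complex) 1) E' k k'" unfolding homeomorphic_def by blast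
 define c where "c = k' (chart w b)"
 have bE': "chart w b \<in> E'" using b by (simp add: E'_def)
 have c: "c \<in> ball 0 1" "k c = chart w b" using k bE' unfolding c_def homeomorphism_def by auto
 obtain F G where FG: "F c = 0" "F holomorphic_on ball 0 1" "F ` ball 0 1 \<subseteq> ball 0 1"
   "G holomorphic_on ball 0 1" "G ` ball 0 1 \<subseteq> ball 0 1"
   "\<And>z. z \<in> ball 0 1 \<Longrightarrow> F (G z) = z" "\<And>z. z \<in> ball 0 1 \<Longrightarrow> G (F z) = z"
 proof (rule ball_biholomorphism_exists [OF c(1)])
 qed (rule that)
 have "homeomorphism (ball 0 1) (ball 0 1) G F"
  by (rule homeomorphismI) (use FG in \<open>auto intro: holomorphic_on_imp_continuous_on\<close>)
 hence "homeomorphism (ball 0 1) E (par w \<circ> (k \<circ> G)) (F \<circ> k' \<circ> chart w)"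
  by (intro homeomorphism_compose [OF _ homE] homeomorphism_compose [OF _ k])
 moreover have "(par w \<circ> (k \<circ> G)) 0 = b"
 proof -
  have "G 0 = c" using FG(1,7) c(1) by metis
  thus ?thesis using c(2) w b by (auto intro!: par_chart)
 qed
 ultimately show thesis by (rule that)
qed

section \<open>Components with multiply connected complement\<close>

text \<open>A covering of a punctured disc extends over the annulus near the boundary: pushing paths radially
 outwards shows that the preimage of the annulus in a component is connected.\<close>

lemma (in rational_map) connected_annulus_preimage:
 assumes E: "open E" and hom: "homeomorphism (ball (0::complex) 1) E \<phi> \<psi>" and CVE: "CV \<inter> E \<subseteq> {\<phi> 0}"
  and W: "W \<in> components (f -` E)" and t: "0 < t" "t < 1"
 shows "connected (W \<inter> f -` \<phi> ` {z. t \<le> norm z \<and> norm z < 1})"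
proof -
 let ?A = "W \<inter> f -` \<phi> ` {z. t \<le> norm z \<and> norm z < 1}"
 define b where "b = \<phi> 0"
 have \<phi>\<psi>: "\<And>z. norm z < 1 \<Longrightarrow> \<psi> (\<phi> z) = z" "\<And>y. y \<in> E \<Longrightarrow> \<phi> (\<psi> y) = y" "\<And>y. y \<in> E \<Longrightarrow> norm (\<psi> y) < 1"
   "\<And>z. norm z < 1 \<Longrightarrow> \<phi> z \<in> E"
  using hom unfolding homeomorphism_def by auto
 have cont: "continuous_on (ball 0 1) \<phi>" "continuous_on E \<psi>"
  using hom homeomorphism_cont1 homeomorphism_cont2 by blast+
 have oW: "open W" using W E open_component_sphere open_vimage continuous_f by blast
 have WE: "\<And>x. x \<in> W \<Longrightarrow> f x \<in> E" "connected W"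
  using in_components_subset [OF W] in_components_connected [OF W] by auto
 define W' where "W' = W - {x. f x = b}"
 have oW': "open W'" and cW': "connected W'" unfolding W'_def using oW WE(2) finite_fibre [of b]
  by (auto intro!: connected_open_diff_finite_sphere open_Diff finite_imp_closed)
 have pW': "path_connected W'" by (rule path_connected_open_sphere [OF oW' cW'])
 have nz: "\<psi> (f x) \<noteq> 0" if "x \<in> W'" for x
  using \<phi>\<psi>(2) [OF WE(1)] that by (metis (mono_tags) DiffE W'_def b_def mem_Collect_eq)
 have "\<exists>T. connected T \<and> T \<subseteq> ?A \<and> x \<in> T \<and> y \<in> T" if x: "x \<in> ?A" and y: "y \<in> ?A" for x y
 proof -
  have mod: "t \<le> norm (\<psi> (f v))" if "v \<in> ?A" for v using that \<phi>\<psi>(1) by auto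
  have AW': "v \<in> W'" if "v \<in> ?A" for v
  proof -
   have "norm (\<psi> (f v)) > 0" using mod [OF that] t by linarith
   hence "f v \<noteq> b" using \<phi>\<psi>(1) [of 0] by (auto simp: b_def)
   thus ?thesis using that by (auto simp: W'_def)
  qed
  obtain g where g: "path g" "path_image g \<subseteq> W'" "pathstart g = x" "pathfinish g = y"
   using pW' AW' [OF x] AW' [OF y] unfolding path_connected_def by meson
  have gW: "g \<tau> \<in> W'" if "\<tau> \<in> {0..1}" for \<tau> using g(2) that by (auto simp: path_image_def)
  have g01: "g 0 = x" "g 1 = y" using g by (auto simp: pathstart_def pathfinish_def)
  define u where "u \<tau> = \<psi> (f (g \<tau>))" for \<tau>
  have cu: "continuous_on {0..1} u"
  proof -
   have "continuous_on {0..1} g" using g(1) by (simp add: path_def)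
   hence "continuous_on {0..1} (\<lambda>\<tau>. f (g \<tau>))" by (rule continuous_on_compose2 [OF continuous_f]) auto
   thus ?thesis unfolding u_def by (rule continuous_on_compose2 [OF cont(2)]) (use gW WE in \<open>auto simp: W'_def\<close>)
  qed
  have u: "u \<tau> \<noteq> 0" "norm (u \<tau>) < 1" if "\<tau> \<in> {0..1}" for \<tau>
   using nz [OF gW [OF that]] \<phi>\<psi>(3) WE(1) gW [OF that] by (auto simp: u_def W'_def)
  \<comment> \<open>At \<open>s = 0\<close> nothing moves; at \<open>s = 1\<close> the modulus is at
    least \<open>t\<close>. The movement is radial and outwards, so it avoids the centre, and the
    square can be lifted through \<open>f\<close>.\<close>
  define \<sigma> where "\<sigma> s \<tau> = (1 - s + s * max 1 (t / norm (u \<tau>))) *\<^sub>R u \<tau>" for s \<tau>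
  have norm_\<sigma>: "norm (\<sigma> s \<tau>) = (1 - s) * norm (u \<tau>) + s * max (norm (u \<tau>)) t" if "s \<in> {0..1}" "\<tau> \<in> {0..1}" for s \<tau>
  proof -
   have "norm (u \<tau>) > 0" using u(1) [OF that(2)] by simp
   hence "max 1 (t / norm (u \<tau>)) * norm (u \<tau>) = max (norm (u \<tau>)) t" by (simp add: max_def field_simps)
   moreover have "0 \<le> 1 - s + s * max 1 (t / norm (u \<tau>))" using that by simp
   ultimately show ?thesis by (simp add: \<sigma>_def distrib_right mult.assoc)
  qed
  have \<sigma>1: "norm (\<sigma> s \<tau>) < 1" "norm (u \<tau>) \<le> norm (\<sigma> s \<tau>)" if "s \<in> {0..1}" "\<tau> \<in> {0..1}" for s \<tau>
  proof -
   have m: "max (norm (u \<tau>)) t < 1" "norm (u \<tau>) \<le> max (norm (u \<tau>)) t" using u(2) [OF that(2)] t by auto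
   have "norm (\<sigma> s \<tau>) \<le> (1 - s) * max (norm (u \<tau>)) t + s * max (norm (u \<tau>)) t"
    unfolding norm_\<sigma> [OF that] using that m(2) by (intro add_right_mono mult_left_mono) auto
   hence "norm (\<sigma> s \<tau>) \<le> max (norm (u \<tau>)) t" by (simp add: algebra_simps)
   thus "norm (\<sigma> s \<tau>) < 1" using m(1) by linarith
   have "(1 - s) * norm (u \<tau>) + s * norm (u \<tau>) \<le> norm (\<sigma> s \<tau>)"
    unfolding norm_\<sigma> [OF that] using that m(2) by (intro add_left_mono mult_left_mono) auto
   thus "norm (u \<tau>) \<le> norm (\<sigma> s \<tau>)" by (simp add: algebra_simps)
  qed
  define Q where "Q = {0..1::real} \<times> {0..1::real}"
  define k where "k p = \<phi> (\<sigma> (fst p) (snd p))" for p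
  have cu2: "continuous_on Q (\<lambda>p. u (snd p))"
   by (rule continuous_on_compose2 [OF cu]) (auto simp: Q_def intro: continuous_intros)
  have c\<sigma>: "continuous_on Q (\<lambda>p. \<sigma> (fst p) (snd p))"
   unfolding \<sigma>_def by (intro continuous_intros cu2) (use u(1) in \<open>auto simp: Q_def\<close>)
  have ck: "continuous_on Q k"
   unfolding k_def by (rule continuous_on_compose2 [OF cont(1) c\<sigma>]) (use \<sigma>1 in \<open>auto simp: Q_def\<close>)
  have kE: "k p \<in> E" "k p \<notin> CV" if "p \<in> Q" for p
  proof -
   have p: "fst p \<in> {0..1}" "snd p \<in> {0..1}" using that by (auto simp: Q_def)
   show "k p \<in> E" using \<sigma>1(1) [OF p] \<phi>\<psi>(4) by (simp add: k_def)
   have "\<sigma> (fst p) (snd p) \<noteq> 0" using \<sigma>1(2) [OF p] u(1) [OF p(2)] by auto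
   hence "k p \<noteq> b" using \<phi>\<psi>(1) \<sigma>1(1) [OF p] unfolding k_def b_def by (metis norm_zero zero_less_one)
   thus "k p \<notin> CV" using CVE \<open>k p \<in> E\<close> by (auto simp: b_def)
  qed
  have cvx: "convex Q" unfolding Q_def by (intro convex_Times convex_real_interval)
  have k0: "k (0, \<tau>) = f (g \<tau>)" if "\<tau> \<in> {0..1}" for \<tau>
   using gW [OF that] WE(1) \<phi>\<psi>(2) by (auto simp: k_def \<sigma>_def u_def W'_def)
  obtain h where h: "continuous_on Q h" "h (0, 0) = x" "\<And>p. p \<in> Q \<Longrightarrow> f (h p) = k p"
  proof (rule lift [OF convex_imp_simply_connected [OF cvx] convex_imp_locally_path_connected [OF cvx] ck])
   show "k p \<notin> CV" if "p \<in> Q" for p using kE that by blast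
   show "(0, 0) \<in> Q" by (simp add: Q_def)
   show "f x = k (0, 0)" using k0 [of 0] g01 by simp
  qed (rule that)
  have h0: "h (0, \<tau>) = g \<tau>" if \<tau>: "\<tau> \<in> {0..1}" for \<tau>
  proof (rule lift_unique [of "{0..1}" "\<lambda>\<tau>. h (0, \<tau>)" g 0])
   show "continuous_on {0..1} (\<lambda>\<tau>. h (0, \<tau>))"
    by (rule continuous_on_compose2 [OF h(1)]) (auto simp: Q_def intro!: continuous_intros)
   show "continuous_on {0..1} g" using g(1) by (simp add: path_def)
   show "f (h (0, u)) = f (g u)" if "u \<in> {0..1}" for u
    using h(3) [of "(0, u)"] k0 [OF that] that by (simp add: Q_def)
   show "f (h (0, u)) \<notin> CV" if "u \<in> {0..1}" for u
    using h(3) [of "(0, u)"] kE(2) [of "(0, u)"] that by (simp add: Q_def)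
  qed (use \<tau> h(2) g01 in auto)
  have "h ` Q \<subseteq> W"
  proof (rule components_maximal [OF W])
   show "connected (h ` Q)" using cvx h(1) by (intro connected_continuous_image convex_connected)
   show "h ` Q \<subseteq> f -` E" using h(3) kE by auto
   have "x \<in> h ` Q" using h(2) by (force simp: Q_def)
   thus "W \<inter> h ` Q \<noteq> {}" using x by blast
  qed
  have A: "h p \<in> ?A" if "p \<in> Q" "t \<le> norm (\<sigma> (fst p) (snd p))" for p
  proof -
   have "norm (\<sigma> (fst p) (snd p)) < 1" using \<sigma>1(1) that(1) by (auto simp: Q_def)
   hence "f (h p) \<in> \<phi> ` {z. t \<le> norm z \<and> norm z < 1}" using h(3) [OF that(1)] that(2) by (auto simp: k_def)
   thus ?thesis using \<open>h ` Q \<subseteq> W\<close> that(1) by auto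
  qed
  \<comment> \<open>Three sides of the lifted square: outwards from \<open>x\<close>, along the path
    pushed outwards, and back inwards to \<open>y\<close>.\<close>
  define T where "T = h ` ({0..1} \<times> {0}) \<union> (h ` ({1} \<times> {0..1}) \<union> h ` ({0..1} \<times> {1}))"
  have hc: "connected (h ` S)" if "S \<subseteq> Q" "convex S" for S
   using that h(1) by (intro connected_continuous_image convex_connected) (auto intro: continuous_on_subset)
  have c: "connected (h ` ({0..1} \<times> {0}))" "connected (h ` ({1} \<times> {0..1}))" "connected (h ` ({0..1} \<times> {1}))"
   by (rule hc; auto simp: Q_def intro!: convex_Times)+
  have i1: "h (1, 1) \<in> h ` ({1} \<times> {0..1}) \<inter> h ` ({0..1} \<times> {1})" by auto
  have i2: "h (1, 0) \<in> h ` ({0..1} \<times> {0}) \<inter> (h ` ({1} \<times> {0..1}) \<union> h ` ({0..1} \<times> {1}))" by auto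
  have "connected (h ` ({1} \<times> {0..1}) \<union> h ` ({0..1} \<times> {1}))" by (rule connected_Un [OF c(2,3)]) (use i1 in blast)
  hence "connected T" unfolding T_def by (rule connected_Un [OF c(1)]) (use i2 in blast)
  moreover have "T \<subseteq> ?A"
  proof -
   have e0: "t \<le> norm (u 0)" "t \<le> norm (u 1)" using mod [OF x] mod [OF y] g01 by (auto simp: u_def)
   have "t \<le> norm (\<sigma> s 0)" "t \<le> norm (\<sigma> s 1)" if "s \<in> {0..1}" for s
    using \<sigma>1(2) [OF that, of 0] \<sigma>1(2) [OF that, of 1] e0 by auto
   moreover have "t \<le> norm (\<sigma> 1 \<tau>)" if "\<tau> \<in> {0..1}" for \<tau> using norm_\<sigma> [of 1 \<tau>] that by simp
   ultimately show ?thesis unfolding T_def by (intro Un_least image_subsetI A) (auto simp: Q_def)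
  qed
  moreover have "x \<in> T" using h(2) unfolding T_def by (intro UnI1 image_eqI [of _ _ "(0, 0)"]) auto
  moreover have "y \<in> T" using h0 [of 1] g01 unfolding T_def by (intro UnI2 image_eqI [of _ _ "(0, 1)"]) auto
  ultimately show ?thesis by blast
 qed
 hence "connected_component ?A x y" if "x \<in> ?A" "y \<in> ?A" for x y
  using that unfolding connected_component_def by blast
 thus ?thesis by (simp add: connected_iff_connected_component)
qed

text \<open>Near its boundary \<open>W\<close> is the preimage of an annulus, and this collar is
  connected as \<open>E\<close> has at most one critical value. If \<open>- W\<close> split into
  \<open>P\<close> and \<open>Q\<close>, the collar would stay near only one of them, although it
  accumulates at every boundary point of \<open>W\<close>; the other one would then be open.\<close>

lemma (in rational_map) connected_compl_preimage_component:
 assumes E: "open E" "connected E" "connected (- E)" "- E \<noteq> {}" and CVE: "CV \<inter> E \<subseteq> {b}"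
  and W: "W \<in> components (f -` E)"
 shows "connected (- W)"
proof (rule ccontr)
 assume nc: "\<not> connected (- W)"
 have "f ` W \<subseteq> E" using in_components_subset [OF W] by blast
 have "W \<noteq> {}" by (rule in_components_nonempty [OF W])
 then obtain y0 where "y0 \<in> E" using \<open>f ` W \<subseteq> E\<close> by blast
 \<comment> \<open>If \<open>b\<close> is not in \<open>E\<close>, there is no critical value in
   \<open>E\<close> and any of its points may serve as centre.\<close>
 obtain b' where b': "b' \<in> E" "CV \<inter> E \<subseteq> {b'}" using CVE \<open>y0 \<in> E\<close> by (cases "b \<in> E") auto
 obtain \<phi> \<psi> where hom: "homeomorphism (ball (0::complex) 1) E \<phi> \<psi>" and \<phi>0: "\<phi> 0 = b'"
  by (rule homeomorphic_disc_of_connected_compl [OF E b'(1)])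
 have \<phi>\<psi>: "\<And>z. norm z < 1 \<Longrightarrow> \<psi> (\<phi> z) = z" "\<And>y. y \<in> E \<Longrightarrow> \<phi> (\<psi> y) = y" "\<And>y. y \<in> E \<Longrightarrow> norm (\<psi> y) < 1"
   "\<And>z. norm z < 1 \<Longrightarrow> \<phi> z \<in> E"
  using hom unfolding homeomorphism_def by auto
 have oW: "open W" using W E open_component_sphere open_vimage continuous_f by blast
 obtain P Q where PQ: "closed P" "closed Q" "P \<noteq> {}" "Q \<noteq> {}" "P \<union> Q = - W" "P \<inter> Q = {}"
  using closed_not_connectedE [OF _ nc] oW by (metis closed_Compl)
 obtain U V where UV: "open U" "open V" "P \<subseteq> U" "Q \<subseteq> V" "U \<inter> V = {}" using separation_sphere [OF PQ(1,2,6)] by blast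
 define M where "M = - (U \<union> V)"
 have "compact M" unfolding M_def using UV by (intro closed_imp_compact_sphere closed_Compl open_Un)
 have MW: "M \<subseteq> W" using UV PQ unfolding M_def by blast
 have "compact (\<psi> ` f ` M)"
 proof (intro compact_continuous_image continuous_f \<open>compact M\<close>)
  show "continuous_on (f ` M) \<psi>"
   using homeomorphism_cont2 [OF hom] MW \<open>f ` W \<subseteq> E\<close> by (meson continuous_on_subset image_mono order_trans)
 qed
 \<comment> \<open>The radius \<open>t\<close> is such that the points outside both \<open>U\<close>
   and \<open>V\<close>, which form a compact part of \<open>W\<close>, map into the inner disc. The
   collar then avoids them.\<close>
 then obtain t where t: "0 < t" "t < 1" "\<psi> ` f ` M \<subseteq> ball 0 t"
 proof (cases "\<psi> ` f ` M = {}")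
  case False
  then obtain z where z: "z \<in> \<psi> ` f ` M" "\<forall>w\<in>\<psi> ` f ` M. norm w \<le> norm z"
   using continuous_attains_sup [OF \<open>compact (\<psi> ` f ` M)\<close> False continuous_on_norm [OF continuous_on_id]] by auto
  have "norm z < 1" using z(1) \<phi>\<psi>(3) MW \<open>f ` W \<subseteq> E\<close> by auto
  have "\<psi> ` f ` M \<subseteq> ball 0 ((1 + norm z) / 2)"
  proof
   fix w assume "w \<in> \<psi> ` f ` M"
   hence "norm w \<le> norm z" using z(2) by blast
   thus "w \<in> ball 0 ((1 + norm z) / 2)" using \<open>norm z < 1\<close> by simp
  qed
  moreover have "0 < (1 + norm z) / 2" by (simp add: add_pos_nonneg)
  moreover have "(1 + norm z) / 2 < 1" using \<open>norm z < 1\<close> by simp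
  ultimately show thesis by (rule that [rotated 2])
 qed (use that [of "1/2"] in auto)
 define A where "A = W \<inter> f -` \<phi> ` {z. t \<le> norm z \<and> norm z < 1}"
 have cA: "connected A"
  unfolding A_def by (rule connected_annulus_preimage [OF E(1) hom _ W t(1,2)]) (use b' \<phi>0 in auto)
 have "A \<subseteq> U \<union> V"
 proof
  fix x assume x: "x \<in> A"
  then obtain z where z: "t \<le> norm z" "norm z < 1" "f x = \<phi> z" by (auto simp: A_def)
  have "x \<notin> M"
  proof
   assume "x \<in> M"
   hence "\<psi> (f x) \<in> ball 0 t" using t(3) by blast
   hence "norm (\<psi> (f x)) < t" by simp
   thus False using z \<phi>\<psi>(1) by simp
  qed
  thus "x \<in> U \<union> V" by (auto simp: M_def)
 qed
 have "f ` W = E"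
 proof
  show "E \<subseteq> f ` W" by (rule components_maximal [OF image_component_vimage [OF E(1) W] E(2) order_refl])
    (use \<open>f ` W \<subseteq> E\<close> \<open>W \<noteq> {}\<close> in blast)
 qed fact
 \<comment> \<open>A boundary point of \<open>W\<close> that is not a limit of the collar would map
   into the closed inner disc, hence into \<open>E\<close>, and could be adjoined to the component
   \<open>W\<close>.\<close>
 have bdry: "x \<in> closure A" if x: "x \<in> closure W" "x \<notin> W" for x
 proof (rule ccontr)
  assume nx: "x \<notin> closure A"
  have "W \<subseteq> A \<union> (W \<inter> f -` \<phi> ` cball 0 t)"
  proof
   fix y assume y: "y \<in> W"
   hence "f y \<in> E" using \<open>f ` W \<subseteq> E\<close> by blast
   hence "f y = \<phi> (\<psi> (f y))" "norm (\<psi> (f y)) < 1" using \<phi>\<psi> by auto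
   thus "y \<in> A \<union> (W \<inter> f -` \<phi> ` cball 0 t)" using y by (cases "t \<le> norm (\<psi> (f y))") (auto simp: A_def)
  qed
  hence "closure W \<subseteq> closure A \<union> closure (W \<inter> f -` \<phi> ` cball 0 t)" by (metis closure_Un closure_mono)
  hence "x \<in> closure (f -` \<phi> ` cball 0 t)" using x nx closure_mono [of "W \<inter> f -` \<phi> ` cball 0 t" "f -` \<phi> ` cball 0 t"] by auto
  moreover have "closed (\<phi> ` cball 0 t)"
   using t by (intro compact_imp_closed compact_continuous_image continuous_on_subset [OF homeomorphism_cont1 [OF hom]]) auto
  hence "closed (f -` \<phi> ` cball 0 t)" by (rule closed_vimage [OF _ continuous_f])
  ultimately have "f x \<in> \<phi> ` cball 0 t" by (simp add: closure_closed)
  hence "f x \<in> E" using t \<phi>\<psi>(4) by auto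
  have "insert x W \<subseteq> W"
  proof (rule components_maximal [OF W])
   show "connected (insert x W)"
    using x(1) closure_subset by (intro connected_intermediate_closure [OF in_components_connected [OF W]]) auto
   show "insert x W \<subseteq> f -` E" using \<open>f x \<in> E\<close> in_components_subset [OF W] by auto
  qed (use \<open>W \<noteq> {}\<close> in auto)
  thus False using x by blast
 qed
 have *: False if PQ: "closed P" "closed Q" "P \<noteq> {}" "Q \<noteq> {}" "P \<union> Q = - W" "P \<inter> Q = {}"
  and UV: "open U" "open V" "P \<subseteq> U" "Q \<subseteq> V" "U \<inter> V = {}" and AU: "A \<subseteq> U" for P Q U V
 proof -
  have "closure A \<subseteq> - V" using UV AU by (intro closure_minimal) auto
  hence "closure W \<subseteq> W \<union> P" using bdry PQ(5) UV by blast
  have "closed (P \<union> W)"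
  proof -
   have "P \<union> W = P \<union> closure W" using \<open>closure W \<subseteq> W \<union> P\<close> closure_subset by blast
   thus ?thesis using PQ by (metis closed_Un closed_closure)
  qed
  moreover have "P \<union> W = - Q" using PQ by blast
  ultimately have "open Q" by (simp add: closed_def)
  thus False using clopen_sphere [of Q] PQ by blast
 qed
 show False
 proof (cases "A \<inter> V = {}")
  case True
  hence "A \<subseteq> U" using \<open>A \<subseteq> U \<union> V\<close> by blast
  thus False using * [OF PQ UV] by blast
 next
  case False
  hence "A \<subseteq> V" using connected_subset_open_partition [OF cA \<open>A \<subseteq> U \<union> V\<close> UV(1,2,5)] by blast
  thus False using * [OF PQ(2,1,4,3) _ _ UV(2,1,4,3)] PQ UV by (metis Int_commute Un_commute)
 qed
qed

section \<open>Contracting components\<close>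

context rational_map
begin

text \<open>Restricting to connected \<open>C\<close> ensures that, if contraction fails, there is a
  limit of iterates that is not locally constant at some point of \<open>C\<close>.\<close>

definition contracting :: "riemann_sphere set \<Rightarrow> bool" where
 "contracting U \<longleftrightarrow> (\<forall>C e. compact C \<and> connected C \<and> C \<subseteq> U \<and> e > 0 \<longrightarrow>
   (\<exists>N. \<forall>n\<ge>N. \<forall>x\<in>C. \<forall>y\<in>C. dist ((f ^^ n) x) ((f ^^ n) y) < e))"

lemma julia_nonempty: "V \<in> components FS \<Longrightarrow> - V \<noteq> {} \<Longrightarrow> JS \<noteq> {}"
proof
 assume V: "V \<in> components FS" "- V \<noteq> {}" and "JS = {}"
 hence "FS = UNIV" by (auto simp: julia_set_def)
 hence "UNIV \<subseteq> V"
  using V in_components_nonempty [OF V(1)] by (intro components_maximal [OF V(1) connected_UNIV_sphere]) auto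
 thus False using V by blast
qed

text \<open>A compact connected \<open>C\<close> in \<open>U\<close> separating the two parts of
  \<open>- U\<close> is followed until its image is small. Filling the holes of the image does not
  leave the Fatou set, so a disc in the Fatou set surrounds it; pulled back along the orbit, this
  disc becomes a set around \<open>C\<close> with connected complement, which is absurd.\<close>

lemma contracting_imp_connected_compl:
 assumes U: "U \<in> components FS" and contr: "contracting U" and CVF: "CV \<inter> FS \<subseteq> {b}"
 shows "connected (- U)"
proof (rule ccontr)
 assume nc: "\<not> connected (- U)"
 have oU: "open U" and cU: "connected U" and UF: "U \<subseteq> FS" and "U \<noteq> {}"
  using open_fatou_component [OF U] in_components_connected [OF U] in_components_subset [OF U]
   in_components_nonempty [OF U] by auto
 obtain P Q where PQ: "closed P" "closed Q" "P \<noteq> {}" "Q \<noteq> {}" "P \<union> Q = - U" "P \<inter> Q = {}"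
  using closed_not_connectedE [OF _ nc] oU by (metis closed_Compl)
 have Jne: "JS \<noteq> {}" using julia_nonempty [OF U] PQ by blast
 obtain OP OQ where O: "open OP" "open OQ" "P \<subseteq> OP" "Q \<subseteq> OQ" "OP \<inter> OQ = {}"
  using separation_sphere [OF PQ(1,2,6)] by blast
 obtain x0 where x0: "x0 \<in> U" using \<open>U \<noteq> {}\<close> by blast
 have "compact (insert x0 (- (OP \<union> OQ)))"
  using O by (intro closed_imp_compact_sphere closed_insert closed_Compl open_Un)
 moreover have "insert x0 (- (OP \<union> OQ)) \<subseteq> U" using O PQ x0 by blast
 ultimately obtain C where C: "compact C" "connected C" "insert x0 (- (OP \<union> OQ)) \<subseteq> C" "C \<subseteq> U"
  using compact_connected_superset_sphere [OF oU oU cU] by blast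
 have small: "\<exists>N. \<forall>n\<ge>N. (f ^^ n) ` C \<subseteq> ball ((f ^^ n) x0) e" if "e > 0" for e
 proof -
  have "\<exists>N. \<forall>n\<ge>N. \<forall>x\<in>C. \<forall>y\<in>C. dist ((f ^^ n) x) ((f ^^ n) y) < e"
   using contr C that unfolding contracting_def by blast
  then obtain N where "\<And>n x y. n \<ge> N \<Longrightarrow> x \<in> C \<Longrightarrow> y \<in> C \<Longrightarrow> dist ((f ^^ n) x) ((f ^^ n) y) < e" by blast
  thus ?thesis using C(3) by (intro exI [of _ N]) auto
 qed
 have "uniformly_continuous_on UNIV f" by (rule compact_uniformly_continuous [OF continuous_f compact_UNIV_sphere])
 then obtain e1 where e1: "e1 > 0" "\<And>x y. dist x y < e1 \<Longrightarrow> dist (f x) (f y) < 1/2"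
  unfolding uniformly_continuous_on_def by (metis UNIV_I half_gt_zero zero_less_one)
 \<comment> \<open>Every point of the sphere has another one at distance more than 1/2. A ball of
   radius \<open>e0\<close>, and also its image under \<open>f\<close>, therefore leaves out
   something far away.\<close>
 define e0 where "e0 = min e1 (1/2)"
 have e0: "e0 > 0" "e0 \<le> 1/2" "\<And>x y. dist x y < e0 \<Longrightarrow> dist (f x) (f y) < 1/2" using e1 by (auto simp: e0_def)
 have far: "\<exists>y. 1/2 < dist x y" for x :: riemann_sphere
 proof -
  have "dist Infty (Fin 0) = 2" by (simp add: dist_riemann_sphere_def dist_Pair_Pair dist_real_def)
  hence "dist x Infty \<ge> 1 \<or> dist x (Fin 0) \<ge> 1" using dist_triangle3 [of Infty "Fin 0" x] by linarith
  thus ?thesis by (metis less_le_trans half_gt_zero zero_less_one field_sum_of_halves less_add_same_cancel1)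
 qed
 define x where "x n = (f ^^ n) x0" for n
 define D where "D n = (f ^^ n) ` C" for n
 have D: "compact (D n)" "connected (D n)" "x n \<in> D n" "closed (D n)" for n using C unfolding D_def x_def
  by (auto intro!: compact_continuous_image connected_continuous_image continuous_iterate compact_imp_closed)
 have fD: "f ` D n = D (Suc n)" "f (x n) = x (Suc n)" for n by (auto simp: D_def x_def image_comp)
 \<comment> \<open>For late \<open>n\<close>, \<open>W n\<close> is the component of the complement
   of \<open>D n\<close> that contains the points far away, and \<open>H n\<close> is
   \<open>D n\<close> with its holes filled.\<close>
 define W where "W n = connected_component_set (- D n) (SOME y. 1/2 < dist (x n) y)" for n
 define H where "H n = - W n" for n
 have W_big: "- ball (x n) e \<subseteq> W n" if "D n \<subseteq> ball (x n) e" "e \<le> 1/2" for n e unfolding W_def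
 proof (rule connected_component_maximal)
  have "1/2 < dist (x n) (SOME y. 1/2 < dist (x n) y)" using far by (rule someI_ex)
  thus "(SOME y. 1/2 < dist (x n) y) \<in> - ball (x n) e" using that by auto
  show "connected (- ball (x n) e)" by (rule connected_compl_ball_sphere)
 qed (use that in auto)
 obtain N where N: "\<And>n. n \<ge> N \<Longrightarrow> D n \<subseteq> ball (x n) e0" using small [OF e0(1)] unfolding D_def x_def by blast
 have W_comp: "W n \<in> components (- D n)" if "n \<ge> N" for n
 proof -
  have "1/2 < dist (x n) (SOME y. 1/2 < dist (x n) y)" using far by (rule someI_ex)
  hence "(SOME y. 1/2 < dist (x n) y) \<in> - D n" using N [OF that] e0(2) by force
  thus ?thesis unfolding W_def by (simp add: componentsI)
 qed
 have oW: "open (W n)" if "n \<ge> N" for n using open_component_sphere [OF _ W_comp [OF that]] D(4) by blast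
 have DH: "D n \<subseteq> H n" if "n \<ge> N" for n using in_components_subset [OF W_comp [OF that]] by (auto simp: H_def)
 have H_int: "open (H n - D n)" if n: "n \<ge> N" for n
 proof -
  have "H n - D n = \<Union> (components (- D n) - {W n})"
   using in_components_unions_complement [OF W_comp [OF n]] by (auto simp: H_def)
  thus ?thesis using open_component_sphere D(4) by (metis DiffD1 open_Compl open_Union)
 qed
 have H_small: "H n \<subseteq> ball (x n) e" if "D n \<subseteq> ball (x n) e" "e \<le> 1/2" for n e
  using W_big [OF that] by (auto simp: H_def)
 \<comment> \<open>If the image of \<open>H n\<close> met \<open>W (Suc n)\<close>, it would be open
   and closed relative to it and so contain it; but the image lies in a ball of radius 1/2, and
   \<open>W (Suc n)\<close> does not.\<close>
 have fH: "f ` H n \<subseteq> H (Suc n)" if n: "n \<ge> N" for n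
 proof (rule ccontr)
  assume "\<not> f ` H n \<subseteq> H (Suc n)"
  hence ne: "f ` H n \<inter> W (Suc n) \<noteq> {}" by (auto simp: H_def)
  have Sn: "Suc n \<ge> N" using n by simp
  have WD: "W (Suc n) \<inter> D (Suc n) = {}" using in_components_subset [OF W_comp [OF Sn]] by blast
  have eq: "f ` H n \<inter> W (Suc n) = f ` (H n - D n) \<inter> W (Suc n)" using WD fD(1) [of n] by blast
  have "openin (top_of_set (W (Suc n))) (f ` H n \<inter> W (Suc n))"
   unfolding eq using open_image [OF H_int [OF n]] oW [OF Sn] by (intro open_subset) auto
  moreover have "closed (f ` H n)" using oW [OF n] by (intro closed_image) (simp add: H_def closed_Compl)
  hence "closedin (top_of_set (W (Suc n))) (f ` H n \<inter> W (Suc n))" by (metis closedin_closed_Int Int_commute)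
  ultimately have "f ` H n \<inter> W (Suc n) = W (Suc n)"
   using in_components_connected [OF W_comp [OF Sn]] ne unfolding connected_clopen by blast
  hence "W (Suc n) \<subseteq> f ` H n" by blast
  also have "f ` H n \<subseteq> ball (x (Suc n)) (1/2)"
   using H_small [OF N [OF n] e0(2)] e0(3) by (auto simp: fD(2) [symmetric])
  finally have sub: "W (Suc n) \<subseteq> ball (x (Suc n)) (1/2)" .
  obtain y where y: "1/2 < dist (x (Suc n)) y" using far by blast
  hence "y \<in> - ball (x (Suc n)) e0" using e0(2) by simp
  hence "y \<in> ball (x (Suc n)) (1/2)" using W_big [OF N [OF Sn] e0(2)] sub by blast
  thus False using y by simp
 qed
 have fkH: "(f ^^ k) ` H N \<subseteq> H (N + k)" for k
 proof (induction k)
  case (Suc k)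
  have "(f ^^ Suc k) ` H N = f ` (f ^^ k) ` H N" by (simp add: image_comp)
  thus ?case using Suc fH [of "N + k"] by auto
 qed simp
 \<comment> \<open>The iterates map \<open>H N\<close> into the sets \<open>H (N + n)\<close>, which
   shrink together with \<open>D\<close>. So late iterates have small images, and the finitely many
   early ones are continuous.\<close>
 have "equicontinuous_at y" if y: "y \<in> interior (H N)" for y unfolding equicontinuous_at_def
 proof (intro allI impI)
  fix e :: real assume "e > 0"
  define e' where "e' = min (e/2) (1/2)"
  have e': "e' > 0" "e' \<le> 1/2" "e' \<le> e/2" using \<open>e > 0\<close> by (auto simp: e'_def)
  obtain M where M: "\<And>n. n \<ge> M \<Longrightarrow> D n \<subseteq> ball (x n) e'" using small [OF e'(1)] unfolding D_def x_def by blast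
  have big: "dist ((f ^^ n) y) ((f ^^ n) z) < e" if "n \<ge> M" "z \<in> H N" for n z
  proof -
   have "N + n \<ge> M" using that by simp
   hence "H (N + n) \<subseteq> ball (x (N + n)) e'" using H_small M e' by blast
   hence "(f ^^ n) y \<in> ball (x (N + n)) e'" "(f ^^ n) z \<in> ball (x (N + n)) e'"
    using fkH [of n] y interior_subset that by blast+
   hence "dist (x (N + n)) ((f ^^ n) y) < e/2" "dist (x (N + n)) ((f ^^ n) z) < e/2" using e' by auto
   thus ?thesis by metric
  qed
  have "\<exists>\<delta>>0. \<forall>z. dist y z < \<delta> \<longrightarrow> dist ((f ^^ n) y) ((f ^^ n) z) < e" for n
   using continuous_iterate [of UNIV n] \<open>e > 0\<close> unfolding continuous_on_iff by (metis UNIV_I dist_commute)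
  then obtain \<delta> where \<delta>: "\<And>n. \<delta> n > 0" "\<And>n z. dist y z < \<delta> n \<Longrightarrow> dist ((f ^^ n) y) ((f ^^ n) z) < e" by metis
  obtain \<rho> where \<rho>: "\<rho> > 0" "ball y \<rho> \<subseteq> H N" using y by (meson mem_interior)
  define \<eta> where "\<eta> = Min (insert \<rho> (\<delta> ` {..M}))"
  have "\<eta> > 0" unfolding \<eta>_def using \<delta>(1) \<rho>(1) by (subst Min_gr_iff) auto
  moreover have "dist ((f ^^ n) y) ((f ^^ n) z) < e" if "dist y z < \<eta>" for z n
  proof (cases "n \<ge> M")
   case True
   have "\<eta> \<le> \<rho>" unfolding \<eta>_def by (rule Min_le) auto
   hence "z \<in> H N" using that \<rho>(2) by auto
   thus ?thesis using big True by blast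
  next
   case False
   hence "\<eta> \<le> \<delta> n" unfolding \<eta>_def by (intro Min_le) auto
   thus ?thesis using \<delta>(2) that by auto
  qed
  ultimately show "\<exists>\<delta>>0. \<forall>z. dist y z < \<delta> \<longrightarrow> (\<forall>n. dist ((f ^^ n) y) ((f ^^ n) z) < e)" by blast
 qed
 hence "interior (H N) \<subseteq> FS" by (intro fatouI) auto
 moreover have "H N - D N \<subseteq> interior (H N)" using H_int [of N] by (simp add: interior_maximal)
 moreover have DF: "D n \<subseteq> FS" for n using C(4) UF by (auto simp: D_def)
 ultimately have "H N \<subseteq> FS" by blast
 hence JW: "JS \<subseteq> W N" by (auto simp: H_def julia_set_def)
 \<comment> \<open>A component of the complement of a connected compact set around the Julia set
   lies in the Fatou set and has connected complement.\<close>
 obtain Y where Y: "compact Y" "connected Y" "JS \<subseteq> Y" "Y \<subseteq> W N"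
  using compact_connected_superset_sphere [OF oW [of N] oW [of N] in_components_connected [OF W_comp [of N]] compact_julia JW] by auto
 have DY: "D N \<subseteq> - Y" using Y DH [of N] by (auto simp: H_def)
 have clY: "closed Y" using Y compact_imp_closed by blast
 obtain E0 where E0: "E0 \<in> components (- Y)" "D N \<subseteq> E0"
  using exists_component_superset [OF DY _ D(2)] D(3) DY by blast
 have "\<exists>E. open E \<and> connected E \<and> connected (- E) \<and> E \<subseteq> FS \<and> D (N - k) \<subseteq> E" if "k \<le> N" for k using that
 proof (induction k)
  case 0
  have "open E0" using open_component_sphere [OF _ E0(1)] clY by blast
  moreover have "connected (- E0)" using connected_compl_component [OF clY Y(2) _ E0(1)] Y(3) Jne by blast
  moreover have "E0 \<subseteq> FS" using in_components_subset [OF E0(1)] Y(3) by (auto simp: julia_set_def)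
  ultimately show ?case using E0 in_components_connected by (intro exI [of _ E0]) auto
 next
  case (Suc k)
  then obtain E where E: "open E" "connected E" "connected (- E)" "E \<subseteq> FS" "D (N - k) \<subseteq> E" by auto
  have eq: "D (N - k) = f ` D (N - Suc k)" using fD(1) [of "N - Suc k"] Suc.prems by (simp add: Suc_diff_Suc)
  hence sub: "D (N - Suc k) \<subseteq> f -` E" using E by auto
  obtain W' where W': "W' \<in> components (f -` E)" "D (N - Suc k) \<subseteq> W'"
   using exists_component_superset [OF sub _ D(2)] D(3) sub by blast
  have "open (f -` E)" by (intro open_vimage E continuous_f)
  hence "open W'" using W'(1) open_component_sphere by blast
  moreover have "- E \<noteq> {}" using E(4) Jne by (auto simp: julia_set_def)
  hence "connected (- W')" using connected_compl_preimage_component [OF E(1-3) _ _ W'(1), of b] CVF E(4) by blast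
  moreover have "W' \<subseteq> FS" using in_components_subset [OF W'(1)] E(4) by auto
  ultimately show ?case using W' in_components_connected by (intro exI [of _ W']) auto
 qed
 from this [of N] obtain E where E: "open E" "connected E" "connected (- E)" "E \<subseteq> FS" "C \<subseteq> E" by (auto simp: D_def)
 have "E \<subseteq> U" by (rule components_maximal [OF U E(2,4)]) (use E C x0 in blast)
 hence "- E \<subseteq> OP \<union> OQ" "P \<union> Q \<subseteq> - E" using E C PQ by auto
 hence "- E \<subseteq> OQ" using connected_subset_open_partition [OF E(3) _ O(1,2,5)] O PQ by blast
 thus False using \<open>P \<union> Q \<subseteq> - E\<close> O PQ by blast
qed

end

section \<open>Sequences of holomorphic functions\<close>

text \<open>Otherwise Montel's theorem, applied to a subsequence that stays away from
  \<open>g\<close> somewhere on \<open>K\<close>, yields a limit that agrees with \<open>g\<close>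
  on \<open>G\<close> and hence on \<open>D\<close>.\<close>

lemma vitali:
 fixes u :: "nat \<Rightarrow> complex \<Rightarrow> complex"
 assumes D: "open D" "connected D" and hol: "\<And>j. u j holomorphic_on D"
  and bnd: "\<And>j z. z \<in> D \<Longrightarrow> norm (u j z) \<le> B" and g: "g holomorphic_on D"
  and G: "open G" "G \<noteq> {}" "G \<subseteq> D" "\<And>z. z \<in> G \<Longrightarrow> (\<lambda>j. u j z) \<longlonglongrightarrow> g z"
  and K: "compact K" "K \<subseteq> D"
 shows "uniform_limit K u g sequentially"
proof (rule ccontr)
 assume "\<not> ?thesis"
 then obtain e where e: "e > 0" "\<not> (\<forall>\<^sub>F n in sequentially. \<forall>x\<in>K. dist (u n x) (g x) < e)"
  unfolding uniform_limit_iff by blast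
 define A where "A = {n. \<exists>x\<in>K. \<not> dist (u n x) (g x) < e}"
 have "infinite A"
 proof
  assume "finite A"
  then obtain N where "A \<subseteq> {..<N}" by (metis finite_nat_iff_bounded)
  hence "\<forall>n\<ge>N. \<forall>x\<in>K. dist (u n x) (g x) < e" by (auto simp: A_def)
  thus False using e(2) unfolding eventually_sequentially by blast
 qed
 then obtain s :: "nat \<Rightarrow> nat" where s: "strict_mono s" "\<And>n. s n \<in> A" using infinite_enumerate by blast
 obtain g' r where g': "g' holomorphic_on D" "strict_mono r" "\<And>x. x \<in> D \<Longrightarrow> (\<lambda>n. u (s (r n)) x) \<longlonglongrightarrow> g' x"
   "\<And>K. compact K \<Longrightarrow> K \<subseteq> D \<Longrightarrow> uniform_limit K ((\<lambda>n. u (s n)) \<circ> r) g' sequentially"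
 proof (rule Montel [OF D(1), of "range u" "\<lambda>n. u (s n)"])
  show "h holomorphic_on D" if "h \<in> range u" for h using that hol by blast
  show "\<exists>B. \<forall>h\<in>range u. \<forall>z\<in>K. norm (h z) \<le> B" if "K \<subseteq> D" for K using that bnd by (intro exI [of _ B]) auto
  show "range (\<lambda>n. u (s n)) \<subseteq> range u" by blast
 qed (rule that)
 have "g' z = g z" if "z \<in> G" for z
 proof (rule LIMSEQ_unique)
  show "(\<lambda>n. u (s (r n)) z) \<longlonglongrightarrow> g' z" using g'(3) G(3) that by blast
  have "strict_mono (s \<circ> r)" using s(1) g'(2) by (rule strict_mono_o)
  thus "(\<lambda>n. u (s (r n)) z) \<longlonglongrightarrow> g z" using LIMSEQ_subseq_LIMSEQ [OF G(4) [OF that], of "s \<circ> r"] by (simp add: o_def)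
 qed
 hence eq: "g' z = g z" if "z \<in> D" for z
  by (rule analytic_continuation_open [OF G(1) D(1) G(2) D(2) G(3) g'(1) g _ that])
 have "\<forall>\<^sub>F n in sequentially. \<forall>x\<in>K. dist (((\<lambda>n. u (s n)) \<circ> r) n x) (g' x) < e"
  using g'(4) [OF K] e(1) unfolding uniform_limit_iff by blast
 then obtain N where "\<forall>x\<in>K. dist (u (s (r N)) x) (g' x) < e" unfolding eventually_sequentially by auto
 moreover have "g' x = g x" if "x \<in> K" for x using that K(2) eq by blast
 ultimately have "dist (u (s (r N)) x) (g x) < e" if "x \<in> K" for x using that by metis
 hence "s (r N) \<notin> A" by (simp add: A_def)
 thus False using s(2) by blast
qed

text \<open>Otherwise \<open>u j - y j\<close> has no zero for infinitely many \<open>j\<close>,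
  while its limit \<open>g - g z\<close> is not constant and vanishes at \<open>z\<close>.\<close>

lemma hurwitz_value:
 fixes u :: "nat \<Rightarrow> complex \<Rightarrow> complex"
 assumes D: "open D" "connected D" and hol: "\<And>j. u j holomorphic_on D" and g: "g holomorphic_on D"
  and ul: "\<And>K. compact K \<Longrightarrow> K \<subseteq> D \<Longrightarrow> uniform_limit K u g sequentially"
  and nc: "\<not> g constant_on D" and z: "z \<in> D" and y: "y \<longlonglongrightarrow> g z"
 shows "\<forall>\<^sub>F j in sequentially. y j \<in> u j ` D"
proof (rule ccontr)
 assume ne: "\<not> ?thesis"
 define A where "A = {j. y j \<notin> u j ` D}"
 have "infinite A"
 proof
  assume "finite A"
  then obtain N where "A \<subseteq> {..<N}" by (metis finite_nat_iff_bounded)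
  hence "\<forall>n\<ge>N. y n \<in> u n ` D" unfolding A_def by (metis (mono_tags) lessThan_iff mem_Collect_eq not_less subsetD)
  thus False using ne unfolding eventually_sequentially by blast
 qed
 then obtain s :: "nat \<Rightarrow> nat" where s: "strict_mono s" "\<And>n. s n \<in> A" using infinite_enumerate by blast
 have "(\<lambda>x. g x - g z) z \<noteq> 0"
 proof (rule Hurwitz_no_zeros [OF D, of "\<lambda>n x. u (s n) x - y (s n)" "\<lambda>x. g x - g z"])
  show "(\<lambda>x. u (s n) x - y (s n)) holomorphic_on D" for n by (intro holomorphic_intros hol)
  show "(\<lambda>x. g x - g z) holomorphic_on D" by (intro holomorphic_intros g)
  show "uniform_limit K (\<lambda>n x. u (s n) x - y (s n)) (\<lambda>x. g x - g z) sequentially" if K: "compact K" "K \<subseteq> D" for K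
  proof (rule uniform_limit_minus)
   show "uniform_limit K (\<lambda>n. u (s n)) g sequentially"
    using filterlim_compose [OF ul [OF K] filterlim_subseq [OF s(1)]] by simp
   have "(\<lambda>n. y (s n)) \<longlonglongrightarrow> g z" using LIMSEQ_subseq_LIMSEQ [OF y s(1)] by (simp add: o_def)
   thus "uniform_limit K (\<lambda>n x. y (s n)) (\<lambda>x. g z) sequentially"
    unfolding uniform_limit_iff tendsto_iff by (auto elim: eventually_mono)
  qed
  show "\<not> (\<lambda>x. g x - g z) constant_on D"
  proof
   assume "(\<lambda>x. g x - g z) constant_on D"
   then obtain c where "\<And>x. x \<in> D \<Longrightarrow> g x - g z = c" unfolding constant_on_def by blast
   hence "\<And>x. x \<in> D \<Longrightarrow> g x = c + g z" by (metis diff_add_cancel)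
   thus False using nc unfolding constant_on_def by blast
  qed
  show "u (s n) x - y (s n) \<noteq> 0" if "x \<in> D" for n x
  proof
   assume "u (s n) x - y (s n) = 0"
   hence "y (s n) \<in> u (s n) ` D" using that by (intro image_eqI [of _ _ x]) auto
   thus False using s(2) [of n] by (simp add: A_def)
  qed
 qed (rule z)
 thus False by simp
qed

text \<open>The uniform radius follows from the version with moving values: values missed at radii 1
  / (m + 1), along increasing indices, would converge to \<open>g z\<close>.\<close>

lemma hurwitz_ball:
 fixes u :: "nat \<Rightarrow> complex \<Rightarrow> complex"
 assumes D: "open D" "connected D" and hol: "\<And>j. u j holomorphic_on D" and g: "g holomorphic_on D"
  and ul: "\<And>K. compact K \<Longrightarrow> K \<subseteq> D \<Longrightarrow> uniform_limit K u g sequentially"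
  and nc: "\<not> g constant_on D" and z: "z \<in> D"
 obtains \<eta> where "\<eta> > 0" "\<forall>\<^sub>F j in sequentially. ball (g z) \<eta> \<subseteq> u j ` D"
proof -
 have "\<exists>m. \<forall>\<^sub>F j in sequentially. ball (g z) (inverse (real (Suc m))) \<subseteq> u j ` D"
 proof (rule ccontr)
  assume ne: "\<not> ?thesis"
  have bad: "\<exists>j\<ge>N. \<exists>y. y \<in> ball (g z) (inverse (real (Suc m))) \<and> y \<notin> u j ` D" for m N
   using ne unfolding eventually_sequentially by blast
  have "\<exists>s. \<forall>m. (\<exists>y. y \<in> ball (g z) (inverse (real (Suc m))) \<and> y \<notin> u (s m) ` D) \<and> s m < s (Suc m)"
  proof (rule dependent_nat_choice)
   show "\<exists>x. \<exists>y. y \<in> ball (g z) (inverse (real (Suc 0))) \<and> y \<notin> u x ` D" using bad by blast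
   show "\<exists>x'. (\<exists>y. y \<in> ball (g z) (inverse (real (Suc (Suc n)))) \<and> y \<notin> u x' ` D) \<and> x < x'" for x n
    using bad [of "Suc x" "Suc n"] by (metis Suc_le_lessD)
  qed
  then obtain s where s: "\<And>m. \<exists>y. y \<in> ball (g z) (inverse (real (Suc m))) \<and> y \<notin> u (s m) ` D" "\<And>m. s m < s (Suc m)"
   by blast
  obtain y where y: "\<And>m. y m \<in> ball (g z) (inverse (real (Suc m)))" "\<And>m. y m \<notin> u (s m) ` D" using s(1) by metis
  have "strict_mono s" using s(2) by (simp add: strict_mono_Suc_iff)
  have "y \<longlonglongrightarrow> g z"
  proof (rule tendsto_dist_iff [THEN iffD2], rule tendsto_sandwich [of "\<lambda>_. 0" _ _ "\<lambda>m. inverse (real (Suc m))"])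
   show "\<forall>\<^sub>F m in sequentially. dist (y m) (g z) \<le> inverse (real (Suc m))"
    using y(1) by (intro always_eventually allI) (auto simp: dist_commute intro: less_imp_le)
  qed (auto intro: LIMSEQ_inverse_real_of_nat simp del: of_nat_Suc)
  moreover have "uniform_limit K (\<lambda>m. u (s m)) g sequentially" if K: "compact K" "K \<subseteq> D" for K
   using filterlim_compose [OF ul [OF K] filterlim_subseq [OF \<open>strict_mono s\<close>]] by simp
  ultimately have "\<forall>\<^sub>F m in sequentially. y m \<in> u (s m) ` D" by (intro hurwitz_value [OF D hol g _ nc z])
  thus False using y(2) by (simp add: eventually_sequentially)
 qed
 thus thesis using that by (metis inverse_positive_iff_positive of_nat_0_less_iff zero_less_Suc)
qed

section \<open>Recurrent components\<close>

context rational_map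
begin

text \<open>Convergence to the identity along some times \<open>m j\<close> replaces a normal form
  as a rotation; periodicity of \<open>V\<close> and injectivity on its orbit are
  consequences.\<close>

definition recurrent :: "riemann_sphere set \<Rightarrow> bool" where
 "recurrent V \<longleftrightarrow> V \<in> components FS \<and>
   (\<exists>m. filterlim m at_top sequentially \<and> (\<forall>x\<in>V. (\<lambda>j. (f ^^ m j) x) \<longlonglongrightarrow> x))"

lemma fatou_equicontinuousE:
 assumes "x \<in> FS" "e > 0"
 obtains \<delta> where "\<delta> > 0" "\<And>y n. dist x y < \<delta> \<Longrightarrow> dist ((f ^^ n) x) ((f ^^ n) y) < e"
 using fatou_equicontinuous [OF assms(1)] assms(2) unfolding equicontinuous_at_def by blast

lemma chart_iterate_holomorphic:
 assumes "open D" "\<And>z. z \<in> D \<Longrightarrow> (f ^^ n) (par w z) \<noteq> w'"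
 shows "(\<lambda>z. chart w' ((f ^^ n) (par w z))) holomorphic_on D"
 by (rule holomorphic_on_chart [OF sphere_holomorphic_on_subset [OF holomorphic_iterate_par subset_UNIV] assms(2,1)])

text \<open>The interior of the set of convergence is closed in \<open>V\<close>: near a limit point
  equicontinuity keeps the iterates in one chart, and Vitali's theorem spreads the convergence over
  a whole ball.\<close>

lemma iterates_tendsto_self_spread:
 assumes V: "V \<in> components FS" and G: "open G" "G \<noteq> {}" "G \<subseteq> V"
  and lim: "\<And>x. x \<in> G \<Longrightarrow> (\<lambda>j. (f ^^ m j) x) \<longlonglongrightarrow> x" and "x \<in> V"
 shows "(\<lambda>j. (f ^^ m j) x) \<longlonglongrightarrow> x"
proof -
 define A where "A = {y \<in> V. (\<lambda>j. (f ^^ m j) y) \<longlonglongrightarrow> y}"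
 define I where "I = interior A"
 have oV: "open V" and cV: "connected V" and VF: "V \<subseteq> FS"
  using open_fatou_component [OF V] in_components_connected [OF V] in_components_subset [OF V] by auto
 have "G \<subseteq> A" using G(3) lim by (auto simp: A_def)
 hence "G \<subseteq> I" unfolding I_def using G(1) interior_maximal by blast
 have "I \<subseteq> A" "open I" by (simp_all add: I_def interior_subset)
 hence "I \<subseteq> V" by (auto simp: A_def)
 have "y \<in> I" if y: "y \<in> V" "y \<in> closure I" for y
 proof -
  obtain w where w: "y \<noteq> w" by (metis riemann_sphere.distinct(1))
  \<comment> \<open>Four distances below \<open>e\<close> add up in the estimate
    \<open>near\<close>; the fifth part keeps the iterates away from \<open>w\<close>.\<close>
  define e where "e = dist y w / 5"
  have e: "e > 0" "5 * e = dist y w" using w by (auto simp: e_def)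
  have yF: "y \<in> FS" using y(1) VF by blast
  obtain \<delta>1 where \<delta>1: "\<delta>1 > 0" "\<And>z n. dist y z < \<delta>1 \<Longrightarrow> dist ((f ^^ n) y) ((f ^^ n) z) < e"
   using fatou_equicontinuousE [OF yF e(1)] by blast
  obtain \<delta>2 where \<delta>2: "\<delta>2 > 0" "ball y \<delta>2 \<subseteq> V" using oV y(1) open_contains_ball by blast
  define \<delta> where "\<delta> = min e (min \<delta>1 \<delta>2)"
  have \<delta>: "\<delta> > 0" "\<delta> \<le> e" "\<delta> \<le> \<delta>1" "ball y \<delta> \<subseteq> V" using \<delta>1 \<delta>2 e by (auto simp: \<delta>_def)
  obtain y' where y': "y' \<in> I" "dist y' y < \<delta>" using y(2) \<delta>(1) unfolding closure_approachable by blast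
  hence "(\<lambda>j. (f ^^ m j) y') \<longlonglongrightarrow> y'" using \<open>I \<subseteq> A\<close> by (auto simp: A_def)
  then obtain J where J: "\<And>j. j \<ge> J \<Longrightarrow> dist ((f ^^ m j) y') y' < e" using e(1) unfolding lim_sequentially by blast
  have near: "dist y ((f ^^ m (j + J)) z) < 4 * e" if "z \<in> ball y \<delta>" for z j
  proof -
   have "dist ((f ^^ m (j + J)) y) ((f ^^ m (j + J)) z) < e" "dist ((f ^^ m (j + J)) y) ((f ^^ m (j + J)) y') < e"
    using \<delta>1(2) [of z "m (j + J)"] \<delta>1(2) [of y' "m (j + J)"] that y'(2) \<delta>(3) by (auto simp: dist_commute [of y'])
   moreover have "dist ((f ^^ m (j + J)) y') y' < e" using J by simp
   moreover have "dist y' y < e" using y'(2) \<delta>(2) by simp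
   ultimately show ?thesis by metric
  qed
  have nw: "(f ^^ m (j + J)) z \<noteq> w" if "z \<in> ball y \<delta>" for z j using near [OF that, of j] e by auto
  have "w \<notin> closure (ball y (4 * e))"
  proof -
   have "closure (ball y (4 * e)) \<subseteq> cball y (4 * e)" by (rule closure_minimal) auto
   thus ?thesis using e by auto
  qed
  then obtain B where B: "\<And>z. z \<in> chart w ` ball y (4 * e) \<Longrightarrow> norm z \<le> B"
   using bounded_chart_image bounded_iff by metis
  have wb: "w \<notin> ball y \<delta>" using \<delta>(2) e by auto
  define D where "D = chart w ` ball y \<delta>"
  define u where "u j z = chart w ((f ^^ m (j + J)) (par w z))" for j z
  have D: "open D" "connected D" unfolding D_def using wb connected_ball_sphere
   by (auto intro!: open_chart_image connected_continuous_image continuous_chart)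
  have Dball: "par w z \<in> ball y \<delta>" if zD: "z \<in> D" for z
  proof -
   obtain v where "v \<in> ball y \<delta>" "z = chart w v" using zD D_def by blast
   thus ?thesis using wb by (metis par_chart)
  qed
  have "u j holomorphic_on D" for j
   unfolding u_def by (rule chart_iterate_holomorphic [OF D(1)]) (use nw Dball in blast)
  moreover have "norm (u j z) \<le> B" if "z \<in> D" for j z using B near [OF Dball [OF that]] by (simp add: u_def)
  moreover have "open (chart w ` (ball y \<delta> \<inter> I))" using wb \<open>open I\<close> by (intro open_chart_image) auto
  moreover have "y' \<in> ball y \<delta> \<inter> I" using y' by (simp add: dist_commute)
  hence "chart w ` (ball y \<delta> \<inter> I) \<noteq> {}" by blast
  moreover have "chart w ` (ball y \<delta> \<inter> I) \<subseteq> D" by (auto simp: D_def)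
  moreover have "(\<lambda>j. u j z) \<longlonglongrightarrow> z" if zG: "z \<in> chart w ` (ball y \<delta> \<inter> I)" for z
  proof -
   obtain v where v: "v \<in> ball y \<delta>" "v \<in> I" "z = chart w v" using zG by blast
   have "v \<noteq> w" using v(1) wb by auto
   have "(\<lambda>j. (f ^^ m j) v) \<longlonglongrightarrow> v" using v(2) \<open>I \<subseteq> A\<close> by (auto simp: A_def)
   hence "(\<lambda>j. (f ^^ m (j + J)) v) \<longlonglongrightarrow> v" by (rule LIMSEQ_ignore_initial_segment)
   moreover have "continuous_on (- {w}) (chart w)" by (rule continuous_chart) simp
   ultimately have "(\<lambda>j. chart w ((f ^^ m (j + J)) v)) \<longlonglongrightarrow> chart w v"
    by (intro continuous_on_tendsto_compose [of "- {w}" "chart w"]) (use nw v(1) \<open>v \<noteq> w\<close> in auto)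
   thus ?thesis using v(3) \<open>v \<noteq> w\<close> by (simp add: u_def)
  qed
  ultimately have ul: "uniform_limit {z} u (\<lambda>z. z) sequentially" if "z \<in> D" for z
   by (intro vitali [OF D]) (use that in \<open>auto intro: holomorphic_on_ident\<close>)
  have "v \<in> A" if v: "v \<in> ball y \<delta>" for v
  proof -
   have vw: "v \<noteq> w" using v wb by auto
   have "(\<lambda>j. u j (chart w v)) \<longlonglongrightarrow> chart w v" using ul [of "chart w v"] v by (simp add: D_def)
   hence "(\<lambda>j. par w (u j (chart w v))) \<longlonglongrightarrow> par w (chart w v)"
    by (rule continuous_on_tendsto_compose [OF continuous_par [of UNIV]]) auto
   hence "(\<lambda>j. (f ^^ m (j + J)) v) \<longlonglongrightarrow> v" using nw [OF v] vw by (simp add: u_def)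
   hence "(\<lambda>j. (f ^^ m j) v) \<longlonglongrightarrow> v" by (rule LIMSEQ_offset)
   thus ?thesis using v \<delta>(4) by (auto simp: A_def)
  qed
  hence "ball y \<delta> \<subseteq> I" unfolding I_def by (intro interior_maximal) auto
  thus "y \<in> I" using \<delta>(1) by auto
 qed
 hence "I = V \<inter> closure I" using \<open>I \<subseteq> V\<close> closure_subset by blast
 hence "closedin (top_of_set V) I" using closedin_closed_Int [OF closed_closure] by metis
 moreover have "openin (top_of_set V) I" using \<open>open I\<close> \<open>I \<subseteq> V\<close> by (rule open_subset [rotated])
 moreover have "I \<noteq> {}" using G(2) \<open>G \<subseteq> I\<close> by blast
 ultimately have "I = V" using cV unfolding connected_clopen by blast
 thus ?thesis using \<open>x \<in> V\<close> \<open>I \<subseteq> A\<close> by (auto simp: A_def)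
qed

text \<open>Without contraction some limit \<open>h\<close> of iterates is not constant. By Hurwitz
  a value of \<open>h\<close> is attained by all late iterates of the subsequence, so these map
  \<open>U\<close> onto one component \<open>V\<close>. The differences of their times give iterates
  tending to the identity on an open set of values of \<open>h\<close>.\<close>

lemma contracting_or_recurrent:
 assumes U: "U \<in> components FS"
 shows "contracting U \<or> (\<exists>n. recurrent ((f ^^ n) ` U))"
proof (subst disj_imp, rule impI)
 assume "\<not> contracting U"
 then obtain C e where C: "compact C" "connected C" "C \<subseteq> U" "e > 0"
  and nf: "\<not> (\<exists>N. \<forall>n\<ge>N. \<forall>x\<in>C. \<forall>y\<in>C. dist ((f ^^ n) x) ((f ^^ n) y) < e)"
  unfolding contracting_def not_all not_imp by (elim exE conjE)
 have far: "\<exists>n\<ge>N. \<exists>x\<in>C. \<exists>y\<in>C. \<not> dist ((f ^^ n) x) ((f ^^ n) y) < e" for N using nf by meson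
 have oU: "open U" and UF: "U \<subseteq> FS" using open_fatou_component [OF U] in_components_subset [OF U] by auto
 define A where "A = {n. \<exists>x\<in>C. \<exists>y\<in>C. \<not> dist ((f ^^ n) x) ((f ^^ n) y) < e}"
 have "infinite A" unfolding infinite_nat_iff_unbounded_le using far by (auto simp: A_def)
 then obtain n :: "nat \<Rightarrow> nat" where n: "strict_mono n" "\<And>j. n j \<in> A" using infinite_enumerate by blast
 obtain \<rho> K where \<rho>: "\<rho> > 0" and cK: "compact K" and KU: "K \<subseteq> U" and bK: "\<And>x. x \<in> C \<Longrightarrow> cball x \<rho> \<subseteq> K"
  using compact_nbhd [OF C(1) oU C(3)] by blast
 have CK: "C \<subseteq> K" using bK \<rho> by fastforce
 obtain r h where r: "strict_mono (r :: nat \<Rightarrow> nat)" and ch: "continuous_on K h"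
  and ul: "uniform_limit K (\<lambda>j. f ^^ (n (r j))) h sequentially"
 proof (rule subsequence_uniform_limit [OF cK, of n])
  show "equicontinuous_at x" if "x \<in> K" for x using fatou_equicontinuous that KU UF by blast
 qed (rule that)
 define n' where "n' j = n (r j)" for j
 have n': "strict_mono n'" using n(1) r by (simp add: n'_def strict_mono_def)
 have ul': "\<exists>N. \<forall>j\<ge>N. \<forall>x\<in>K. dist ((f ^^ n' j) x) (h x) < \<epsilon>" if "\<epsilon> > 0" for \<epsilon>
  using ul that unfolding uniform_limit_iff eventually_sequentially n'_def by blast
 have "\<not> h constant_on C"
 proof
  assume "h constant_on C"
  then obtain c where c: "\<And>x. x \<in> C \<Longrightarrow> h x = c" unfolding constant_on_def by blast
  obtain N where N: "\<And>x. x \<in> K \<Longrightarrow> dist ((f ^^ n' N) x) (h x) < e / 2" using ul' [of "e / 2"] C(4) by auto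
  obtain x y where xy: "x \<in> C" "y \<in> C" "\<not> dist ((f ^^ n' N) x) ((f ^^ n' N) y) < e"
   using n(2) [of "r N"] by (auto simp: A_def n'_def)
  have "dist ((f ^^ n' N) x) c < e / 2" "dist ((f ^^ n' N) y) c < e / 2" using N [of x] N [of y] c xy CK by auto
  hence "dist ((f ^^ n' N) x) ((f ^^ n' N) y) < e" by metric
  thus False using xy by blast
 qed
 \<comment> \<open>The point is chosen where \<open>h\<close> is not locally constant along
   \<open>C\<close>, so that the chart expression of \<open>h\<close> around it is not constant
   either.\<close>
 hence "\<exists>a\<in>C. \<forall>T. openin (top_of_set C) T \<longrightarrow> a \<in> T \<longrightarrow> (\<exists>x\<in>T. h x \<noteq> h a)"
 proof (rule contrapos_np)
  assume neg: "\<not> (\<exists>a\<in>C. \<forall>T. openin (top_of_set C) T \<longrightarrow> a \<in> T \<longrightarrow> (\<exists>x\<in>T. h x \<noteq> h a))"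
  show "h constant_on C"
  proof (rule locally_constant_imp_constant [OF C(2)])
   show "\<exists>T. openin (top_of_set C) T \<and> a \<in> T \<and> (\<forall>x\<in>T. h x = h a)" if "a \<in> C" for a using neg that by meson
  qed
 qed
 then obtain x0 where x0: "x0 \<in> C" "\<And>T. openin (top_of_set C) T \<Longrightarrow> x0 \<in> T \<Longrightarrow> \<exists>x\<in>T. h x \<noteq> h x0" by blast
 obtain w where w: "x0 \<noteq> w" by (metis riemann_sphere.distinct(1))
 obtain w' where w': "h x0 \<noteq> w'" by (metis riemann_sphere.distinct(1))
 define \<epsilon> where "\<epsilon> = dist (h x0) w' / 4"
 have \<epsilon>: "\<epsilon> > 0" "4 * \<epsilon> = dist (h x0) w'" using w' by (auto simp: \<epsilon>_def)
 have "x0 \<in> K" using x0 CK by blast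
 then obtain \<delta> where \<delta>: "\<delta> > 0" "\<And>x. x \<in> K \<Longrightarrow> dist x x0 < \<delta> \<Longrightarrow> dist (h x) (h x0) < \<epsilon>"
  using ch \<epsilon>(1) unfolding continuous_on_iff by blast
 define \<rho>' where "\<rho>' = min \<delta> (min \<rho> (dist x0 w))"
 have \<rho>': "\<rho>' > 0" "\<rho>' \<le> \<delta>" "\<rho>' \<le> \<rho>" "\<rho>' \<le> dist x0 w" using \<delta> \<rho> w by (auto simp: \<rho>'_def)
 define b where "b = ball x0 \<rho>'"
 have b: "open b" "connected b" "x0 \<in> b" "w \<notin> b" using \<rho>' by (auto simp: b_def connected_ball_sphere)
 have bK': "b \<subseteq> K" using bK [OF x0(1)] \<rho>'(3) by (auto simp: b_def)
 have hb: "dist (h x0) (h x) < \<epsilon>" if "x \<in> b" for x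
  using \<delta>(2) [of x] that bK' \<rho>'(2) by (auto simp: b_def dist_commute)
 obtain J where J: "\<And>j x. j \<ge> J \<Longrightarrow> x \<in> K \<Longrightarrow> dist ((f ^^ n' j) x) (h x) < \<epsilon>" using ul' [OF \<epsilon>(1)] by blast
 have fb: "dist (h x0) ((f ^^ n' (j + J)) x) < 2 * \<epsilon>" if "x \<in> b" for j x
  using hb [OF that] J [of "j + J" x] bK' that by (intro le_less_trans [OF dist_triangle [of _ _ "h x"]]) (auto simp: dist_commute)
 define X where "X = cball (h x0) (2 * \<epsilon>)"
 have X: "compact X" "w' \<notin> X" using \<epsilon> by (auto simp: X_def closed_imp_compact_sphere)
 define D where "D = chart w ` b"
 have D: "open D" "connected D" "chart w x0 \<in> D"
  unfolding D_def using b by (auto intro!: open_chart_image connected_continuous_image continuous_chart)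
 have Db: "par w z \<in> b" if zD: "z \<in> D" for z
 proof -
  obtain v where "v \<in> b" "z = chart w v" using zD D_def by blast
  thus ?thesis using b(4) by (metis par_chart)
 qed
 define u where "u j z = chart w' ((f ^^ n' (j + J)) (par w z))" for j z
 define g where "g z = chart w' (h (par w z))" for z
 have hol: "u j holomorphic_on D" for j unfolding u_def
 proof (rule chart_iterate_holomorphic [OF D(1)])
  show "(f ^^ n' (j + J)) (par w z) \<noteq> w'" if "z \<in> D" for z using fb [OF Db [OF that], of j] \<epsilon> by auto
 qed
 have ulD: "uniform_limit D u g sequentially"
 proof -
  have ul1: "uniform_limit D (\<lambda>j z. (f ^^ n' (j + J)) (par w z)) (\<lambda>z. h (par w z)) sequentially"
   unfolding uniform_limit_iff eventually_sequentially
  proof (intro allI impI)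
   fix e :: real assume "e > 0"
   then obtain N where N: "\<forall>j\<ge>N. \<forall>x\<in>K. dist ((f ^^ n' j) x) (h x) < e" using ul' by blast
   have "dist ((f ^^ n' (j + J)) (par w z)) (h (par w z)) < e" if "j \<ge> N" "z \<in> D" for j z
    using N Db [OF that(2)] bK' that(1) by (meson subsetD trans_le_add1)
   thus "\<exists>N. \<forall>j\<ge>N. \<forall>z\<in>D. dist ((f ^^ n' (j + J)) (par w z)) (h (par w z)) < e" by blast
  qed
  have uc: "uniformly_continuous_on X (chart w')" using X by (intro compact_uniformly_continuous continuous_chart)
  have "\<forall>\<^sub>F j in sequentially. \<forall>z\<in>D. (f ^^ n' (j + J)) (par w z) \<in> X"
   using fb Db by (intro always_eventually allI) (auto simp: X_def less_imp_le)
  thus ?thesis unfolding u_def[abs_def] g_def[abs_def]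
   by (rule uniform_limit_compose_uniformly_continuous_on [OF ul1 uc]) (simp add: X_def)
 qed
 have holg: "g holomorphic_on D"
 proof (rule holomorphic_uniform_sequence [OF D(1) hol])
  fix z assume "z \<in> D"
  then obtain d where "d > 0" "cball z d \<subseteq> D" using D(1) open_contains_cball by blast
  thus "\<exists>d>0. cball z d \<subseteq> D \<and> uniform_limit (cball z d) u g sequentially"
   using uniform_limit_on_subset [OF ulD] by blast
 qed
 have hne: "h x \<noteq> w'" if "x \<in> b" for x using hb [OF that] \<epsilon> by auto
 have hg: "h x = par w' (g (chart w x))" if "x \<in> b" for x
 proof -
  have "x \<noteq> w" using that b(4) by auto
  thus ?thesis using hne [OF that] by (simp add: g_def)
 qed
 have ncg: "\<not> g constant_on D"
 proof
  assume "g constant_on D"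
  then obtain c where c: "\<And>z. z \<in> D \<Longrightarrow> g z = c" unfolding constant_on_def by blast
  have "openin (top_of_set C) (C \<inter> b)" "x0 \<in> C \<inter> b" using b x0 by (auto simp: openin_open_Int)
  then obtain x where "x \<in> C \<inter> b" "h x \<noteq> h x0" using x0(2) by blast
  thus False using hg [of x] hg [of x0] c b(3) by (auto simp: D_def)
 qed
 have ev: "\<forall>\<^sub>F j in sequentially. g (chart w x0) \<in> u j ` D"
  by (rule hurwitz_value [OF D(1,2) hol holg _ ncg D(3)]) (use uniform_limit_on_subset [OF ulD] in auto)
 then obtain N where N: "\<And>j. j \<ge> N \<Longrightarrow> g (chart w x0) \<in> u j ` D" unfolding eventually_sequentially by blast
 define n'' where "n'' j = n' (j + (N + J))" for j
 have n'': "strict_mono n''" using n' by (simp add: n''_def strict_mono_def)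
 have hit: "h x0 \<in> (f ^^ n'' j) ` U" for j
 proof -
  obtain z where z: "z \<in> D" "g (chart w x0) = u (j + N) z" using N [of "j + N"] by auto
  have fz: "(f ^^ n'' j) (par w z) \<noteq> w'" using fb [OF Db [OF z(1)], of "j + N"] \<epsilon> by (auto simp: n''_def add.assoc)
  have "h x0 = par w' (u (j + N) z)" using hg [OF b(3)] z(2) by simp
  also have "\<dots> = (f ^^ n'' j) (par w z)" using fz by (simp add: u_def n''_def add.assoc)
  finally show ?thesis using Db [OF z(1)] bK' KU by blast
 qed
 define V where "V = (f ^^ n'' 0) ` U"
 have Vc: "(f ^^ n'' j) ` U \<in> components FS" for j by (rule iterate_fatou_component [OF U])
 have Veq: "(f ^^ n'' j) ` U = V" for j
  using components_nonoverlap [OF Vc [of j] Vc [of 0]] hit [of j] hit [of 0] by (auto simp: V_def)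
 have oV: "open V" using open_fatou_component [OF Vc [of 0]] by (simp add: V_def)
 have VF: "V \<subseteq> FS" using in_components_subset [OF Vc [of 0]] by (simp add: V_def)
 \<comment> \<open>Since \<open>n''\<close> is strictly increasing, this difference is at least
   \<open>j\<close> and tends to infinity.\<close>
 define m where "m j = n'' (j + j) - n'' j" for j
 have grow: "n'' a + k \<le> n'' (a + k)" for a k
 proof (induction k)
  case (Suc k)
  have "n'' (a + k) < n'' (a + Suc k)" using n'' by (simp add: strict_mono_def)
  thus ?case using Suc by simp
 qed simp
 have mn: "m j + n'' j = n'' (j + j)" "j \<le> m j" for j using grow [of j j] by (auto simp: m_def)
 have mlim: "filterlim m at_top sequentially" by (rule filterlim_at_top_mono [OF filterlim_ident]) (simp add: mn(2))
 have hlim: "(\<lambda>j. (f ^^ n'' j) x) \<longlonglongrightarrow> h x" if "x \<in> b" for x unfolding lim_sequentially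
 proof (intro allI impI)
  fix e :: real assume "e > 0"
  then obtain M where M: "\<forall>j\<ge>M. \<forall>x\<in>K. dist ((f ^^ n' j) x) (h x) < e" using ul' by blast
  thus "\<exists>M. \<forall>j\<ge>M. dist ((f ^^ n'' j) x) (h x) < e" using that bK' by (intro exI [of _ M]) (auto simp: n''_def)
 qed
 \<comment> \<open>By equicontinuity at \<open>h x\<close>, the iterate \<open>f ^^ m j\<close> may
   be evaluated at the nearby point \<open>(f ^^ n'' j) x\<close> instead, and there it gives
   \<open>(f ^^ n'' (j + j)) x\<close>.\<close>
 have ret: "(\<lambda>j. (f ^^ m j) (h x)) \<longlonglongrightarrow> h x" if x: "x \<in> b" "h x \<in> V" for x unfolding lim_sequentially
 proof (intro allI impI)
  fix e :: real assume "e > 0"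
  hence e2: "e / 2 > 0" by simp
  have "h x \<in> FS" using x(2) VF by blast
  obtain \<delta> where \<delta>: "\<delta> > 0" "\<And>y n. dist (h x) y < \<delta> \<Longrightarrow> dist ((f ^^ n) (h x)) ((f ^^ n) y) < e / 2"
   using fatou_equicontinuousE [OF \<open>h x \<in> FS\<close> e2] by blast
  obtain M1 where M1: "\<And>j. j \<ge> M1 \<Longrightarrow> dist ((f ^^ n'' j) x) (h x) < \<delta>"
   using hlim [OF x(1)] \<delta>(1) unfolding lim_sequentially by blast
  obtain M2 where M2: "\<And>j. j \<ge> M2 \<Longrightarrow> dist ((f ^^ n'' j) x) (h x) < e / 2"
   using hlim [OF x(1)] e2 unfolding lim_sequentially by blast
  have "dist ((f ^^ m j) (h x)) (h x) < e" if "j \<ge> max M1 M2" for j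
  proof -
   have "dist ((f ^^ m j) (h x)) ((f ^^ m j) ((f ^^ n'' j) x)) < e / 2"
    using \<delta>(2) [of "(f ^^ n'' j) x" "m j"] M1 [of j] that by (simp add: dist_commute)
   moreover have "(f ^^ m j) ((f ^^ n'' j) x) = (f ^^ n'' (j + j)) x" by (simp flip: mn(1) add: funpow_add)
   moreover have "dist ((f ^^ n'' (j + j)) x) (h x) < e / 2" using M2 [of "j + j"] that by simp
   ultimately show ?thesis by metric
  qed
  thus "\<exists>M. \<forall>j\<ge>M. dist ((f ^^ m j) (h x)) (h x) < e" by blast
 qed
 define b' where "b' = b \<inter> h -` V"
 have "open b'" unfolding b'_def by (rule continuous_open_preimage [OF continuous_on_subset [OF ch bK'] b(1) oV])
 have "x0 \<in> b'" using b(3) hit [of 0] by (simp add: b'_def V_def)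
 define D' where "D' = chart w ` b'"
 have "open D'" "D' \<subseteq> D" using \<open>open b'\<close> b(4) by (auto simp: D'_def D_def b'_def intro!: open_chart_image)
 hence "open (g ` D')" by (intro open_mapping_thm [OF holg D(1,2) _ _ ncg])
 hence "open (par w' ` g ` D')" by (rule open_par_image)
 moreover have "par w' ` g ` D' = h ` b'"
  unfolding D'_def image_image using hg by (intro image_cong) (auto simp: b'_def)
 ultimately have opn: "open (h ` b')" by simp
 have "recurrent V" unfolding recurrent_def
 proof (intro conjI exI [of _ m] ballI mlim)
  show Vcomp: "V \<in> components FS" using Vc by (simp add: V_def)
  show "(\<lambda>j. (f ^^ m j) x) \<longlonglongrightarrow> x" if "x \<in> V" for x by (rule iterates_tendsto_self_spread [OF Vcomp opn _ _ _ that])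
    (use \<open>x0 \<in> b'\<close> ret in \<open>auto simp: b'_def\<close>)
 qed
 thus "\<exists>n. recurrent ((f ^^ n) ` U)" unfolding V_def by blast
qed

end

section \<open>Multiply connected components are eventually recurrent\<close>

lemma connected_Int_of_cover:
 fixes A B :: "riemann_sphere set"
 assumes "closed A" "closed B" "connected A" "connected B" "A \<union> B = UNIV"
 shows "connected (A \<inter> B)"
 by (rule unicoherentD [OF unicoherent_UNIV_sphere]) (use assms in auto)

lemma connected_frontier_sphere:
 fixes U :: "riemann_sphere set"
 assumes "open U" "connected U" "connected (- U)"
 shows "connected (frontier U)"
proof -
 have "frontier U = closure U \<inter> - U" using assms(1) by (simp add: frontier_def interior_open Diff_eq)
 thus ?thesis using assms closure_subset [of U]
  by (simp only:) (intro connected_Int_of_cover; auto intro: connected_imp_connected_closure)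
qed

context rational_map
begin

lemma frontier_component_julia:
 assumes "U \<in> components FS"
 shows "frontier U \<subseteq> JS"
proof
 fix x assume x: "x \<in> frontier U"
 have oU: "open U" using open_fatou_component [OF assms] .
 show "x \<in> JS"
 proof (rule ccontr)
  assume "x \<notin> JS"
  hence xF: "x \<in> FS" by (simp add: julia_set_def)
  then obtain C where C: "C \<in> components FS" "x \<in> C" by (metis UnionE Union_components)
  have "open C" using open_fatou_component [OF C(1)] .
  moreover have "x \<in> closure U" using x by (simp add: frontier_def)
  ultimately have "C \<inter> U \<noteq> {}" using C(2) by (metis closure_iff_nhds_not_empty inf_commute open_subset subset_refl)
  hence "C = U" using components_nonoverlap [OF C(1) assms] by blast
  thus False using x C(2) oU by (simp add: frontier_def interior_open)
 qed
qed

text \<open>A limit point in \<open>B\<close> would have a ball missing \<open>A\<close>. A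
  component from \<open>\<O>\<close> that meets the ball without containing its centre has a
  frontier point in it, and that point belongs to \<open>A\<close>.\<close>

lemma closed_fill:
 assumes A: "closed A" "closed B" "A \<inter> B = {}" "A \<union> B = JS"
  and \<O>: "\<O> \<subseteq> components FS" "\<And>U. U \<in> \<O> \<Longrightarrow> frontier U \<subseteq> A"
 shows "closed (A \<union> \<Union>\<O>)"
proof -
 have "y \<in> A \<union> \<Union>\<O>" if y: "y \<in> closure (A \<union> \<Union>\<O>)" for y
 proof (rule ccontr)
  assume ny: "y \<notin> A \<union> \<Union>\<O>"
  show False
  proof (cases "y \<in> FS")
   case True
   then obtain C where C: "C \<in> components FS" "y \<in> C" by (metis UnionE Union_components)
   have "open C" using open_fatou_component [OF C(1)] .
   hence "C \<inter> (A \<union> \<Union>\<O>) \<noteq> {}" using y C(2) by (metis closure_iff_nhds_not_empty inf_commute subset_refl)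
   moreover have "C \<inter> A = {}" using in_components_subset [OF C(1)] A(4) by (auto simp: julia_set_def)
   ultimately obtain U where U: "U \<in> \<O>" "C \<inter> U \<noteq> {}" by blast
   hence "C = U" using components_nonoverlap [OF C(1), of U] \<O>(1) by blast
   thus False using ny C(2) U(1) by blast
  next
   case False
   obtain r where r: "r > 0" "ball y r \<subseteq> - A" using ny openE [OF open_Compl [OF A(1)], of y] by blast
   have "ball y r \<inter> (A \<union> \<Union>\<O>) \<noteq> {}"
    using y r(1) by (metis centre_in_ball closure_iff_nhds_not_empty inf_commute open_ball subset_refl)
   then obtain U where U: "U \<in> \<O>" "ball y r \<inter> U \<noteq> {}" using r(2) by blast
   have "y \<in> ball y r - U" using r(1) ny U(1) by auto
   hence "ball y r \<inter> frontier U \<noteq> {}"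
    using U(2) by (intro connected_Int_frontier [OF connected_ball_sphere]) blast+
   thus False using \<O>(2) [OF U(1)] r(2) by blast
  qed
 qed
 hence "closure (A \<union> \<Union>\<O>) \<subseteq> A \<union> \<Union>\<O>" by blast
 thus ?thesis by (metis closure_subset closure_closed closed_closure subset_antisym)
qed

definition multiply_connected :: "riemann_sphere set \<Rightarrow> bool" where
 "multiply_connected U \<longleftrightarrow> U \<in> components FS \<and> \<not> connected (- U)"

lemma frontier_component:
 assumes U: "U \<in> components FS" and "\<not> multiply_connected U" "- U \<noteq> {}"
 shows "connected (frontier U)" "frontier U \<noteq> {}"
proof -
 have oU: "open U" using open_fatou_component [OF U] .
 show "connected (frontier U)" using assms oU in_components_connected [OF U]
  by (intro connected_frontier_sphere) (auto simp: multiply_connected_def)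
 show "frontier U \<noteq> {}" using clopen_sphere [of U] oU in_components_nonempty [OF U] assms(3) frontier_subset_closed
  by (metis Compl_UNIV_eq closure_closed closure_subset frontier_def interior_open Diff_eq_empty_iff subset_antisym closed_closure)
qed

text \<open>If every Fatou component had a connected complement, its frontier would be connected and
  lie in one part of a splitting of the Julia set. Each part together with its components would be
  closed, and the sphere itself would split.\<close>

lemma exists_multiply_connected:
 assumes "\<not> connected JS"
 obtains U where "multiply_connected U"
proof (cases "\<exists>U. multiply_connected U")
 case True
 thus thesis using that by blast
next
 case False
 hence no: "\<not> multiply_connected U" for U by blast
 obtain A B where AB: "closed A" "closed B" "A \<noteq> {}" "B \<noteq> {}" "A \<union> B = JS" "A \<inter> B = {}"
  using closed_not_connectedE [OF closed_julia assms] by blast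
 have fr: "connected (frontier U)" "frontier U \<noteq> {}" "frontier U \<subseteq> A \<union> B" if U: "U \<in> components FS" for U
 proof -
  have "- U \<noteq> {}" using in_components_subset [OF U] AB by (auto simp: julia_set_def)
  moreover have "\<not> multiply_connected U" by (rule no)
  ultimately show "connected (frontier U)" "frontier U \<noteq> {}" using frontier_component [OF U] by blast+
  show "frontier U \<subseteq> A \<union> B" using frontier_component_julia [OF U] AB(5) by simp
 qed
 define \<A> where "\<A> = {U \<in> components FS. frontier U \<subseteq> A}"
 define \<B> where "\<B> = {U \<in> components FS. frontier U \<subseteq> B}"
 have cl: "closed (A \<union> \<Union>\<A>)" "closed (B \<union> \<Union>\<B>)"
 proof -
  show "closed (A \<union> \<Union>\<A>)" by (rule closed_fill [OF AB(1,2,6,5)]) (auto simp: \<A>_def)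
  show "closed (B \<union> \<Union>\<B>)" by (rule closed_fill [OF AB(2,1)]) (use AB(5,6) in \<open>auto simp: \<B>_def\<close>)
 qed
 have "(A \<union> \<Union>\<A>) \<union> (B \<union> \<Union>\<B>) = UNIV"
 proof (intro equalityI subsetI UNIV_I)
  fix x
  show "x \<in> (A \<union> \<Union>\<A>) \<union> (B \<union> \<Union>\<B>)"
  proof (cases "x \<in> FS")
   case True
   then obtain C where C: "C \<in> components FS" "x \<in> C" by (metis UnionE Union_components)
   have "frontier C \<subseteq> A \<or> frontier C \<subseteq> B"
   proof (cases "frontier C \<inter> B = {}")
    case False
    thus ?thesis using connected_subset_closed_partition [OF fr(1,3) [OF C(1)] AB(1,2,6)] by blast
   qed (use fr(3) [OF C(1)] in blast)
   thus ?thesis using C unfolding \<A>_def \<B>_def by blast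
  next
   case False
   thus ?thesis using AB(5) by (auto simp: julia_set_def)
  qed
 qed
 moreover have "(A \<union> \<Union>\<A>) \<inter> (B \<union> \<Union>\<B>) = {}"
 proof -
  have F: "U \<subseteq> FS" if "U \<in> \<A> \<or> U \<in> \<B>" for U using that in_components_subset unfolding \<A>_def \<B>_def by blast
  have "U \<inter> U' = {}" if U: "U \<in> \<A>" "U' \<in> \<B>" for U U'
  proof (rule ccontr)
   assume "U \<inter> U' \<noteq> {}"
   hence "U = U'" using U components_nonoverlap unfolding \<A>_def \<B>_def by blast
   thus False using U fr(2) [of U] AB(6) unfolding \<A>_def \<B>_def by blast
  qed
  moreover have "A \<inter> FS = {}" "B \<inter> FS = {}" using AB(5) by (auto simp: julia_set_def)
  ultimately show ?thesis using F AB(6) by blast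
 qed
 moreover have compl_eq: "P = - Q" if "P \<union> Q = UNIV" "P \<inter> Q = {}" for P Q :: "riemann_sphere set" using that by blast
 ultimately have "A \<union> \<Union>\<A> = - (B \<union> \<Union>\<B>)" by (intro compl_eq)
 hence "open (A \<union> \<Union>\<A>)" using cl(2) by (metis open_Compl)
 thus thesis using clopen_sphere [OF _ cl(1)] \<open>A \<union> \<Union>\<A> = - (B \<union> \<Union>\<B>)\<close> AB by blast
qed

text \<open>\<open>U\<close> is a component of the preimage of its image, so a connected complement
  of the image would give \<open>U\<close> a connected complement.\<close>

lemma multiply_connected_image:
 assumes CVF: "CV \<inter> FS \<subseteq> {b}" and U: "multiply_connected U"
 shows "multiply_connected (f ` U)"
proof -
 have Uc: "U \<in> components FS" "\<not> connected (- U)" using U by (auto simp: multiply_connected_def)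
 have Vc: "f ` U \<in> components FS" by (rule image_fatou_component [OF Uc(1)])
 have V: "open (f ` U)" "connected (f ` U)" "f ` U \<subseteq> FS"
  using open_fatou_component [OF Vc] in_components_connected [OF Vc] in_components_subset [OF Vc] by auto
 have "- U \<noteq> {}" using Uc(2) by auto
 hence "JS \<noteq> {}" by (rule julia_nonempty [OF Uc(1)])
 hence "FS \<noteq> UNIV" by (auto simp: julia_set_def)
 hence "- (f ` U) \<noteq> {}" using V(3) by blast
 moreover have "U \<in> components (f -` (f ` U))"
 proof (rule components_intermediate_subset [OF Uc(1)])
  have "f -` f ` U \<subseteq> f -` FS" using V(3) by (rule vimage_mono)
  thus "f -` f ` U \<subseteq> FS" by (auto simp: subset_iff)
 qed auto
 ultimately have "connected (- (f ` U)) \<Longrightarrow> connected (- U)"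
  using connected_compl_preimage_component [OF V(1,2) _ _ _ \<open>U \<in> components (f -` (f ` U))\<close>, of b] CVF V(3) by blast
 thus ?thesis using Uc(2) Vc by (auto simp: multiply_connected_def)
qed

lemma multiply_connected_iterate:
 assumes CVF: "CV \<inter> FS \<subseteq> {b}" and U: "multiply_connected U"
 shows "multiply_connected ((f ^^ n) ` U)"
proof (induction n)
 case (Suc n)
 hence "multiply_connected (f ` (f ^^ n) ` U)" by (rule multiply_connected_image [OF CVF])
 thus ?case by (simp add: image_comp)
qed (simp add: U)

lemma multiply_connected_recurrent:
 assumes CVF: "CV \<inter> FS \<subseteq> {b}" and U: "multiply_connected U"
 obtains n where "recurrent ((f ^^ n) ` U)"
 using contracting_or_recurrent [of U] contracting_imp_connected_compl [OF _ _ CVF, of U] U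
 unfolding multiply_connected_def by blast

section \<open>Orbits in recurrent components\<close>

definition orbit :: "riemann_sphere set \<Rightarrow> riemann_sphere set" where
 "orbit V = (\<Union>n. (f ^^ n) ` V)"

lemma iterate_add: "(f ^^ (m + n)) x = (f ^^ m) ((f ^^ n) x)"
 by (simp add: funpow_add)

lemma iterate_commute: "(f ^^ m) ((f ^^ n) x) = (f ^^ n) ((f ^^ m) x)"
 by (metis add.commute iterate_add)

lemma uniformly_equicontinuous:
 assumes "compact K" "K \<subseteq> FS" "e > 0"
 obtains \<delta> where "\<delta> > 0" "\<And>x y n. x \<in> K \<Longrightarrow> y \<in> K \<Longrightarrow> dist x y < \<delta> \<Longrightarrow> dist ((f ^^ n) x) ((f ^^ n) y) < e"
proof (rule compact_uniformly_equicontinuous [OF assms(1) _ assms(3), of "range (\<lambda>n. f ^^ n)"])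
 fix x :: riemann_sphere and e' :: real assume x: "x \<in> K" and e': "0 < e'"
 have xF: "x \<in> FS" using x assms(2) by blast
 obtain \<delta> where \<delta>: "\<delta> > 0" "\<And>y n. dist x y < \<delta> \<Longrightarrow> dist ((f ^^ n) x) ((f ^^ n) y) < e'"
  using fatou_equicontinuousE [OF xF e'] by blast
 thus "\<exists>\<delta>>0. \<forall>g\<in>range (\<lambda>n. f ^^ n). \<forall>x'\<in>K. dist x' x < \<delta> \<longrightarrow> dist (g x') (g x) < e'"
  by (intro exI [of _ \<delta>]) (auto simp: dist_commute)
next
 fix \<delta> assume "0 < \<delta>" "\<And>g x x'. g \<in> range (\<lambda>n. f ^^ n) \<Longrightarrow> x \<in> K \<Longrightarrow> x' \<in> K \<Longrightarrow> dist x' x < \<delta> \<Longrightarrow> dist (g x') (g x) < e"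
 thus thesis by (intro that [of \<delta>]) (auto simp: dist_commute)
qed

context
 fixes V m
 assumes V: "V \<in> components FS" and m: "filterlim m at_top sequentially"
  and ret: "\<And>x. x \<in> V \<Longrightarrow> (\<lambda>j. (f ^^ m j) x) \<longlonglongrightarrow> x"
begin

lemma orbit_returns:
 assumes "x \<in> orbit V"
 shows "(\<lambda>j. (f ^^ m j) x) \<longlonglongrightarrow> x"
proof -
 obtain n y where y: "y \<in> V" "x = (f ^^ n) y" using assms by (auto simp: orbit_def)
 have "(\<lambda>j. (f ^^ n) ((f ^^ m j) y)) \<longlonglongrightarrow> (f ^^ n) y"
  by (rule continuous_on_tendsto_compose [OF continuous_iterate [of UNIV] ret [OF y(1)]]) auto
 thus ?thesis by (simp add: y(2) iterate_commute [of n])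
qed

lemma eventually_large: "\<forall>\<^sub>F j in sequentially. k \<le> m j"
 using m by (simp add: filterlim_at_top)

text \<open>For large \<open>j\<close> the iterate \<open>f ^^ m j\<close> factors through
  \<open>f ^^ k\<close>, and yet it tends to the identity.\<close>

lemma inj_orbit: "inj_on (f ^^ k) (orbit V)"
proof (rule inj_onI)
 fix x y assume xy: "x \<in> orbit V" "y \<in> orbit V" "(f ^^ k) x = (f ^^ k) y"
 have "\<forall>\<^sub>F j in sequentially. (f ^^ m j) x = (f ^^ m j) y" using eventually_large [of k]
 proof eventually_elim
  case (elim j)
  hence "(f ^^ m j) z = (f ^^ (m j - k)) ((f ^^ k) z)" for z by (simp flip: iterate_add)
  thus ?case using xy(3) by simp
 qed
 hence "(\<lambda>j. (f ^^ m j) x) \<longlonglongrightarrow> y"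
  using Lim_transform_eventually [OF orbit_returns [OF xy(2)], of "\<lambda>j. (f ^^ m j) x"] by (simp add: eq_commute)
 thus "x = y" using orbit_returns [OF xy(1)] LIMSEQ_unique by blast
qed

lemma orbit_fatou: "orbit V \<subseteq> FS" and open_orbit: "open (orbit V)"
 and subset_orbit: "V \<subseteq> orbit V"
proof -
 have *: "(f ^^ n) ` V \<in> components FS" for n by (rule iterate_fatou_component [OF V])
 show "orbit V \<subseteq> FS" using in_components_subset [OF *] by (auto simp: orbit_def)
 show "open (orbit V)" using open_fatou_component [OF *] by (auto simp: orbit_def)
 have "V = (f ^^ 0) ` V" by simp
 thus "V \<subseteq> orbit V" unfolding orbit_def by blast
qed

lemma eventually_image_eq: "\<forall>\<^sub>F j in sequentially. (f ^^ m j) ` V = V"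
proof -
 have oV: "open V" using open_fatou_component [OF V] .
 obtain x where x: "x \<in> V" using in_components_nonempty [OF V] by blast
 have "\<forall>\<^sub>F j in sequentially. (f ^^ m j) x \<in> V" using topological_tendstoD [OF ret [OF x] oV x] .
 thus ?thesis
 proof eventually_elim
  case (elim j)
  hence "(f ^^ m j) ` V \<inter> V \<noteq> {}" using x by blast
  thus ?case using components_nonoverlap [OF iterate_fatou_component [OF V] V] by blast
 qed
qed

lemma period: obtains k where "k \<ge> 1" "(f ^^ k) ` V = V"
proof -
 have "\<forall>\<^sub>F j in sequentially. (f ^^ m j) ` V = V \<and> 1 \<le> m j"
  using eventually_image_eq eventually_large [of 1] by (rule eventually_conj)
 then obtain j where "(f ^^ m j) ` V = V" "1 \<le> m j" unfolding eventually_sequentially by blast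
 thus thesis using that by blast
qed

lemma image_orbit: "f ` orbit V = orbit V"
proof
 have *: "f ` (f ^^ n) ` V = (f ^^ Suc n) ` V" for n by (simp add: image_comp)
 show "f ` orbit V \<subseteq> orbit V" unfolding orbit_def image_UN using * by blast
 obtain k where k: "k \<ge> 1" "(f ^^ k) ` V = V" using period by blast
 have "(f ^^ n) ` V \<subseteq> f ` orbit V" for n
 proof -
  have "(f ^^ n) ` V = (f ^^ n) ` (f ^^ k) ` V" by (simp only: k(2))
  also have "\<dots> = (f ^^ (n + k)) ` V" by (simp add: image_comp funpow_add)
  also have "\<dots> = f ` (f ^^ (n + k - 1)) ` V" using k(1) * [of "n + k - 1"] by simp
  also have "\<dots> \<subseteq> f ` orbit V" unfolding orbit_def by blast
  finally show ?thesis .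
 qed
 thus "orbit V \<subseteq> f ` orbit V" by (subst orbit_def) blast
qed

lemma image_iterate_orbit: "(f ^^ n) ` orbit V = orbit V"
proof (induction n)
 case (Suc n)
 have "(f ^^ Suc n) ` orbit V = f ` (f ^^ n) ` orbit V" by (simp add: image_comp)
 thus ?case using Suc image_orbit by simp
qed simp

text \<open>The inverse of an iterate on a recurrent component is a limit of iterates, hence has the same modulus
 of continuity.\<close>

lemma inverse_equicontinuous:
 assumes K: "compact K" "K \<subseteq> orbit V" and "e > 0"
 obtains \<delta> where "\<delta> > 0" "\<And>x y n. x \<in> orbit V \<Longrightarrow> y \<in> orbit V \<Longrightarrow> (f ^^ n) x \<in> K \<Longrightarrow> (f ^^ n) y \<in> K \<Longrightarrow>
  dist ((f ^^ n) x) ((f ^^ n) y) < \<delta> \<Longrightarrow> dist x y < e"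
proof -
 have KF: "K \<subseteq> FS" using K orbit_fatou by blast
 have e2: "e / 2 > 0" using assms(3) by simp
 obtain \<delta> where \<delta>: "\<delta> > 0" "\<And>x y n. x \<in> K \<Longrightarrow> y \<in> K \<Longrightarrow> dist x y < \<delta> \<Longrightarrow> dist ((f ^^ n) x) ((f ^^ n) y) < e / 2"
  using uniformly_equicontinuous [OF K(1) KF e2] by blast
 have "dist x y < e" if xy: "x \<in> orbit V" "y \<in> orbit V" "(f ^^ n) x \<in> K" "(f ^^ n) y \<in> K"
  "dist ((f ^^ n) x) ((f ^^ n) y) < \<delta>" for x y n
 proof -
  have "\<forall>\<^sub>F j in sequentially. dist ((f ^^ m j) x) ((f ^^ m j) y) \<le> e / 2" using eventually_large [of n]
  proof eventually_elim
   case (elim j)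
   hence "(f ^^ m j) z = (f ^^ (m j - n)) ((f ^^ n) z)" for z by (simp flip: iterate_add)
   thus ?case using \<delta>(2) [OF xy(3-5), of "m j - n"] by simp
  qed
  moreover have "(\<lambda>j. dist ((f ^^ m j) x) ((f ^^ m j) y)) \<longlonglongrightarrow> dist x y" by (intro tendsto_dist orbit_returns xy)
  ultimately have "dist x y \<le> e / 2" by (intro tendsto_upperbound) auto
  thus ?thesis using assms(3) by simp
 qed
 thus thesis using that \<delta>(1) by blast
qed

text \<open>Visits of an orbit to a compact ball recur with bounded gaps, because the differences of two close
 visits lead back to the ball.\<close>

lemma orbit_in_compact:
 assumes x: "x \<in> V"
 obtains K where "compact K" "K \<subseteq> orbit V" "\<And>n. (f ^^ n) x \<in> K"
proof -
 have oV: "open V" using open_fatou_component [OF V] .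
 obtain r where r: "r > 0" "cball x r \<subseteq> V" using oV x open_contains_cball by blast
 define R where "R = cball x r"
 have R: "compact R" "R \<subseteq> orbit V" using r subset_orbit by (auto simp: R_def closed_imp_compact_sphere)
 have orb: "(f ^^ n) x \<in> orbit V" for n using x by (auto simp: orbit_def)
 obtain \<delta> where \<delta>: "\<delta> > 0" "\<And>a b n. a \<in> orbit V \<Longrightarrow> b \<in> orbit V \<Longrightarrow> (f ^^ n) a \<in> R \<Longrightarrow> (f ^^ n) b \<in> R \<Longrightarrow>
  dist ((f ^^ n) a) ((f ^^ n) b) < \<delta> \<Longrightarrow> dist a b < r"
  using inverse_equicontinuous [OF R r(1)] by blast
 define Z where "Z = {n. 1 \<le> n \<and> (f ^^ n) x \<in> R}"
 have visit: "\<exists>n\<in>Z. N \<le> n" for N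
 proof -
  have "\<forall>\<^sub>F j in sequentially. (f ^^ m j) x \<in> ball x r"
   by (rule topological_tendstoD [OF ret [OF x]]) (use r in auto)
  hence "\<forall>\<^sub>F j in sequentially. (f ^^ m j) x \<in> ball x r \<and> max 1 N \<le> m j"
   using eventually_large by (rule eventually_conj)
  then obtain j where "(f ^^ m j) x \<in> ball x r \<and> max 1 N \<le> m j" unfolding eventually_sequentially by blast
  thus ?thesis by (intro bexI [of _ "m j"]) (auto simp: Z_def R_def)
 qed
 obtain I where I: "finite I" "I \<subseteq> Z" "\<And>n. n \<in> Z \<Longrightarrow> \<exists>i\<in>I. dist ((f ^^ n) x) ((f ^^ i) x) < \<delta>"
 proof -
  define S where "S = (\<lambda>n. (f ^^ n) x) ` Z"
  have "closure S \<subseteq> (\<Union>i\<in>Z. ball ((f ^^ i) x) \<delta>)" using \<delta>(1) by (fastforce simp: S_def closure_approachable)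
  moreover have "compact (closure S)" by (intro closed_imp_compact_sphere closed_closure)
  ultimately obtain I where I: "I \<subseteq> Z" "finite I" "closure S \<subseteq> (\<Union>i\<in>I. ball ((f ^^ i) x) \<delta>)"
   using compactE_image [of "closure S" Z "\<lambda>i. ball ((f ^^ i) x) \<delta>"] by auto
  show thesis
  proof (rule that [OF I(2,1)])
   fix n assume "n \<in> Z"
   hence "(f ^^ n) x \<in> closure S" by (intro subsetD [OF closure_subset]) (auto simp: S_def)
   then obtain i where "i \<in> I" "dist ((f ^^ i) x) ((f ^^ n) x) < \<delta>" using I(3) by auto
   thus "\<exists>i\<in>I. dist ((f ^^ n) x) ((f ^^ i) x) < \<delta>" by (auto simp: dist_commute)
  qed
 qed
 define M where "M = Max (insert 1 I)"
 have M: "i \<le> M" if "i \<in> I" for i using I(1) that by (simp add: M_def)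
 have gap: "\<exists>k\<le>M. n + k \<in> Z" for n
 proof -
  define n' where "n' = (LEAST n'. n' \<in> Z \<and> n \<le> n')"
  have n': "n' \<in> Z" "n \<le> n'"
  proof -
   have "n' \<in> Z \<and> n \<le> n'" unfolding n'_def by (rule LeastI_ex) (use visit [of n] in blast)
   thus "n' \<in> Z" "n \<le> n'" by auto
  qed
  show ?thesis
  proof (cases "n' \<le> n + M")
   case True
   thus ?thesis using n' by (intro exI [of _ "n' - n"]) auto
  next
   \<comment> \<open>The time \<open>n'\<close> is the first visit from \<open>n\<close> on. If it
     came later than \<open>n + M\<close>, a visit time \<open>i \<le> M\<close> with nearly the
     same position could be subtracted, and \<open>n' - i\<close> would be an earlier visit.\<close>
   case False
   obtain i where i: "i \<in> I" "dist ((f ^^ n') x) ((f ^^ i) x) < \<delta>" using I(3) [OF n'(1)] by blast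
   have iM: "i \<le> M" "1 \<le> i" "(f ^^ i) x \<in> R" using M i(1) I(2) by (auto simp: Z_def)
   have split: "(f ^^ n') x = (f ^^ i) ((f ^^ (n' - i)) x)" using iM(1) False by (simp flip: iterate_add)
   have "dist ((f ^^ (n' - i)) x) x < r"
   proof (rule \<delta>(2) [of _ _ i])
    show "(f ^^ i) ((f ^^ (n' - i)) x) \<in> R" using n'(1) split by (simp add: Z_def)
    show "dist ((f ^^ i) ((f ^^ (n' - i)) x)) ((f ^^ i) x) < \<delta>" using i(2) split by simp
    show "x \<in> orbit V" using orb [of 0] by simp
   qed (use orb iM in auto)
   hence "n' - i \<in> Z" using False iM(1) by (auto simp: Z_def R_def dist_commute)
   moreover have "n \<le> n' - i" using False iM(1) by simp
   ultimately have "n' \<le> n' - i" unfolding n'_def by (intro Least_le) simp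
   thus ?thesis using iM(2) False by simp
  qed
 qed
 \<comment> \<open>With gaps at most \<open>M\<close>, the whole orbit of \<open>x\<close> lies in
   the preimages of \<open>R\<close> under \<open>f ^^ k\<close> for \<open>k \<le> M\<close>. Taken
   inside the orbit of \<open>V\<close>, where \<open>f ^^ k\<close> is a homeomorphism, these are
   compact.\<close>
 define G where "G k = {y \<in> orbit V. (f ^^ k) y \<in> R}" for k
 have "compact (G k)" for k
 proof -
  have "openin (top_of_set (orbit V)) ((f ^^ k) ` T)" if T: "openin (top_of_set (orbit V)) T" for T
  proof -
   have "open T" "T \<subseteq> orbit V" using T open_orbit openin_open_trans openin_imp_subset by blast+
   thus ?thesis using open_iterate_image [of T k] image_iterate_orbit [of k] by (metis image_mono open_subset)
  qed
  then obtain g where g: "homeomorphism (orbit V) (orbit V) (f ^^ k) g"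
   using homeomorphism_injective_open_map [OF continuous_iterate image_iterate_orbit inj_orbit] by metis
  have "G k = g ` R"
  proof
   show "G k \<subseteq> g ` R"
   proof
    fix y assume y: "y \<in> G k"
    hence "y = g ((f ^^ k) y)" using g by (simp add: G_def homeomorphism_def)
    thus "y \<in> g ` R" using y by (auto simp: G_def)
   qed
   show "g ` R \<subseteq> G k" using g R(2) unfolding G_def homeomorphism_def by (clarsimp simp: subset_iff) blast
  qed
  moreover have "continuous_on R g" using g R(2) homeomorphism_cont2 continuous_on_subset by blast
  ultimately show ?thesis using R(1) compact_continuous_image by metis
 qed
 hence "compact (\<Union>k\<in>{..M}. G k)" by (intro compact_UN) auto
 moreover have "(\<Union>k\<in>{..M}. G k) \<subseteq> orbit V" by (auto simp: G_def)
 moreover have "(f ^^ n) x \<in> (\<Union>k\<in>{..M}. G k)" for n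
 proof -
  obtain k where k: "k \<le> M" "n + k \<in> Z" using gap by blast
  hence "(f ^^ k) ((f ^^ n) x) \<in> R" by (simp add: Z_def add.commute flip: iterate_add)
  thus ?thesis using k(1) orb by (auto simp: G_def)
 qed
 ultimately show thesis by (rule that)
qed

text \<open>Equicontinuity extends the statement for a single point to a ball around it, and
  finitely many such balls cover \<open>C\<close>.\<close>

lemma orbit_of_compact_in_compact:
 assumes C: "compact C" "C \<subseteq> V"
 obtains K where "compact K" "K \<subseteq> orbit V" "\<And>n x. x \<in> C \<Longrightarrow> (f ^^ n) x \<in> K"
proof -
 have "\<exists>\<delta> K. \<delta> > 0 \<and> compact K \<and> K \<subseteq> orbit V \<and> (\<forall>y n. dist x y < \<delta> \<longrightarrow> (f ^^ n) y \<in> K)" if x: "x \<in> C" for x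
 proof -
  obtain L where L: "compact L" "L \<subseteq> orbit V" "\<And>n. (f ^^ n) x \<in> L" using orbit_in_compact x C by blast
  have xF: "x \<in> FS" using x C in_components_subset [OF V] by blast
  obtain \<eta> K where K: "\<eta> > 0" "compact K" "K \<subseteq> orbit V" "\<And>a. a \<in> L \<Longrightarrow> cball a \<eta> \<subseteq> K"
   using compact_nbhd [OF L(1) open_orbit L(2)] by blast
  obtain \<delta> where \<delta>: "\<delta> > 0" "\<And>y n. dist x y < \<delta> \<Longrightarrow> dist ((f ^^ n) x) ((f ^^ n) y) < \<eta>"
   using fatou_equicontinuousE [OF xF K(1)] by blast
  have "(f ^^ n) y \<in> K" if "dist x y < \<delta>" for y n
   using K(4) [OF L(3) [of n]] \<delta>(2) [OF that, of n] by (simp add: less_imp_le subset_iff)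
  thus ?thesis using \<delta>(1) K(2,3) by blast
 qed
 then obtain \<delta> K where K: "\<And>x. x \<in> C \<Longrightarrow> \<delta> x > 0 \<and> compact (K x) \<and> K x \<subseteq> orbit V \<and> (\<forall>y n. dist x y < \<delta> x \<longrightarrow> (f ^^ n) y \<in> K x)"
  by metis
 obtain F where F: "F \<subseteq> C" "finite F" "C \<subseteq> (\<Union>x\<in>F. ball x (\<delta> x))" using compact_ball_cover [OF C(1), of \<delta>] K by metis
 show thesis
 proof (rule that [of "\<Union>x\<in>F. K x"])
  show "compact (\<Union>x\<in>F. K x)" using F K by (intro compact_UN) auto
  show "(\<Union>x\<in>F. K x) \<subseteq> orbit V" using F K by blast
  show "(f ^^ n) y \<in> (\<Union>x\<in>F. K x)" if y: "y \<in> C" for n y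
  proof -
   obtain x where x: "x \<in> F" "dist x y < \<delta> x" using F(3) y by auto
   hence "(f ^^ n) y \<in> K x" using K F(1) by blast
   thus ?thesis using x(1) by blast
  qed
 qed
qed

text \<open>Both orbits stay in a compact set, on which the inverse iterates are
  equicontinuous.\<close>

lemma not_contracted:
 assumes "a \<in> V" "b \<in> V" "a \<noteq> b"
 obtains \<delta> where "\<delta> > 0" "\<And>n. \<delta> \<le> dist ((f ^^ n) a) ((f ^^ n) b)"
proof -
 have ab: "compact {a, b}" "{a, b} \<subseteq> V" using assms by auto
 obtain K where K: "compact K" "K \<subseteq> orbit V" "\<And>n x. x \<in> {a, b} \<Longrightarrow> (f ^^ n) x \<in> K"
  using orbit_of_compact_in_compact [OF ab] by blast
 have d: "dist a b > 0" using assms(3) by simp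
 obtain \<delta> where \<delta>: "\<delta> > 0" "\<And>x y n. x \<in> orbit V \<Longrightarrow> y \<in> orbit V \<Longrightarrow> (f ^^ n) x \<in> K \<Longrightarrow> (f ^^ n) y \<in> K \<Longrightarrow>
  dist ((f ^^ n) x) ((f ^^ n) y) < \<delta> \<Longrightarrow> dist x y < dist a b"
  using inverse_equicontinuous [OF K(1,2) d] by blast
 have "\<delta> \<le> dist ((f ^^ n) a) ((f ^^ n) b)" for n
  using \<delta>(2) [of a b n] K(3) assms subset_orbit by (meson insertI1 insertI2 linorder_not_le order_less_irrefl subsetD)
 thus thesis using that \<delta>(1) by blast
qed

text \<open>As \<open>f\<close> is not injective on the preimage of \<open>V\<close> but injective
  on the orbit of \<open>V\<close>, some point of \<open>V\<close> has a preimage off the orbit. The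
  component \<open>W\<close> around it later provides the open set to be omitted, the base point of
  charts, and a point outside the closure of \<open>V\<close>.\<close>

lemma escaping_preimage:
 obtains W where "W \<in> components FS" "W \<inter> orbit V = {}" "f ` W \<subseteq> orbit V"
proof -
 obtain x y where xy: "x \<noteq> y" "f x = f y" "f x \<in> V"
  using two_preimages [OF open_fatou_component [OF V] in_components_nonempty [OF V]] by blast
 have fxV: "f x \<in> orbit V" using xy(3) subset_orbit by blast
 then obtain z where z: "z \<in> orbit V" "f z = f x" using image_orbit by (metis imageE)
 obtain u where u: "u \<noteq> z" "f u = f x" using xy by metis
 have unV: "u \<notin> orbit V"
  using inj_orbit [of 1] u z unfolding inj_on_def by (metis One_nat_def funpow_0 funpow_simps_right(2) comp_apply eq_id_iff id_apply funpow.simps)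
 have "f u \<in> FS" using u(2) fxV orbit_fatou by auto
 hence "u \<in> FS" by simp
 then obtain W where W: "W \<in> components FS" "u \<in> W" by (metis UnionE Union_components)
 have "W \<inter> (f ^^ n) ` V = {}" for n
 proof (rule ccontr)
  assume "W \<inter> (f ^^ n) ` V \<noteq> {}"
  hence "W = (f ^^ n) ` V" using components_nonoverlap [OF W(1) iterate_fatou_component [OF V]] by blast
  thus False using unV W(2) by (auto simp: orbit_def)
 qed
 hence "W \<inter> orbit V = {}" by (auto simp: orbit_def)
 moreover have "f ` W = V"
  using components_nonoverlap [OF image_fatou_component [OF W(1)] V] u(2) xy(3) W(2) by (metis IntI empty_iff imageI)
 ultimately show thesis using that W(1) subset_orbit by blast
qed

end

text \<open>Montel's theorem for an omitted open set: in the chart at a point \<open>w\<close> of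
  \<open>W\<close> all iterates are bounded. The point \<open>w'\<close> is taken out so that the
  source also lies in a single chart.\<close>

lemma omitting_imp_fatou:
 assumes D: "open D" and W: "open W" "W \<noteq> {}" and omit: "\<And>n. (f ^^ n) ` D \<inter> W = {}"
 shows "D \<subseteq> FS"
proof
 fix y assume y: "y \<in> D"
 obtain w where w: "w \<in> W" using W by blast
 obtain w' where w': "y \<noteq> w'" by (metis riemann_sphere.distinct(1))
 obtain B where B: "\<And>x. x \<notin> W \<Longrightarrow> norm (chart w x) \<le> B" using bounded_chart_compl [OF W(1) w] by metis
 define G where "G = par w' -` D"
 have oG: "open G" unfolding G_def by (rule open_par_vimage [OF D])
 define u where "u n z = chart w ((f ^^ n) (par w' z))" for n z
 have inW: "(f ^^ n) (par w' z) \<notin> W" if "z \<in> G" for n z using omit [of n] that by (auto simp: G_def)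
 have uB: "norm (u n z) \<le> B" if "z \<in> G" for n z unfolding u_def by (rule B [OF inW [OF that]])
 have hol: "u n holomorphic_on G" for n
  unfolding u_def by (rule chart_iterate_holomorphic [OF oG]) (use inW w in force)
 have uc: "uniformly_continuous_on (cball 0 B) (par w)"
  by (intro compact_uniformly_continuous continuous_par compact_cball)
 have "normal_family_on (range (\<lambda>n. f ^^ n)) (D - {w'})" unfolding normal_family_on_def
 proof (intro allI impI)
  fix g :: "nat \<Rightarrow> riemann_sphere \<Rightarrow> riemann_sphere" assume "\<forall>n. g n \<in> range (\<lambda>n. f ^^ n)"
  then obtain k where k: "\<And>n. g n = f ^^ k n" unfolding image_iff by metis
  obtain h r where r: "strict_mono (r :: nat \<Rightarrow> nat)"
   and lim: "\<And>K. compact K \<Longrightarrow> K \<subseteq> G \<Longrightarrow> uniform_limit K ((\<lambda>n. u (k n)) \<circ> r) h sequentially"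
   by (rule Montel [OF oG, of "range u" "\<lambda>n. u (k n)"]) (use hol uB in \<open>auto intro!: exI [of _ B]\<close>)
  have "uniform_limit K (g \<circ> r) (\<lambda>x. par w (h (chart w' x))) sequentially" if K: "compact K" "K \<subseteq> D - {w'}" for K
  proof -
   have KG: "chart w' ` K \<subseteq> G" using K(2) by (auto simp: G_def subset_iff)
   have "compact (chart w' ` K)" using K by (intro compact_continuous_image continuous_chart) auto
   hence "uniform_limit (chart w' ` K) (\<lambda>n z. par w (((\<lambda>n. u (k n)) \<circ> r) n z)) (\<lambda>z. par w (h z)) sequentially"
    using uB KG
    by (intro uniform_limit_compose_uniformly_continuous_on [OF lim [OF _ KG] uc] always_eventually) (auto simp: image_subset_iff)
   hence "uniform_limit K (\<lambda>n x. par w (u (k (r n)) (chart w' x))) (\<lambda>x. par w (h (chart w' x))) sequentially"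
    by (drule_tac uniform_limit_compose' [where h = "chart w'" and B = K]) auto
   moreover have "par w (u n (chart w' x)) = (f ^^ n) x" if "x \<in> K" for n x
   proof -
    have xw: "x \<noteq> w'" using that K(2) by blast
    moreover have "(f ^^ n) x \<noteq> w" using inW [of "chart w' x" n] KG w that xw by auto
    ultimately show ?thesis by (simp add: u_def)
   qed
   ultimately show ?thesis by (subst uniform_limit_cong') (auto simp: k)
  qed
  thus "\<exists>r h. strict_mono r \<and> (\<forall>K. compact K \<and> K \<subseteq> D - {w'} \<longrightarrow> uniform_limit K (g \<circ> r) h sequentially)"
   using r by blast
 qed
 thus "y \<in> FS" unfolding fatou_set_def using y w' D by (intro CollectI exI [of _ "D - {w'}"]) (auto intro: open_Diff)
qed

end

section \<open>Periods of loops in a plane domain\<close>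

text \<open>The primitive is the integral from a base point along chosen paths. Vanishing of loop
  integrals makes it differ from each local primitive by a constant.\<close>

lemma loops_primitive:
 assumes S: "open S" "connected S" and hol: "f holomorphic_on S"
  and zero: "\<And>\<gamma>. valid_path \<gamma> \<Longrightarrow> path_image \<gamma> \<subseteq> S \<Longrightarrow> pathfinish \<gamma> = pathstart \<gamma> \<Longrightarrow> contour_integral \<gamma> f = 0"
 obtains g where "\<And>z. z \<in> S \<Longrightarrow> (g has_field_derivative f z) (at z)"
proof (cases "S = {}")
 case False
 then obtain a where a: "a \<in> S" by blast
 have "\<exists>q. valid_path q \<and> path_image q \<subseteq> S \<and> pathstart q = a \<and> pathfinish q = z" if z: "z \<in> S" for z
  using connected_open_polynomial_connected [OF S a z] valid_path_polynomial_function by blast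
 then obtain q where q: "\<And>z. z \<in> S \<Longrightarrow> valid_path (q z)" "\<And>z. z \<in> S \<Longrightarrow> path_image (q z) \<subseteq> S"
  "\<And>z. z \<in> S \<Longrightarrow> pathstart (q z) = a" "\<And>z. z \<in> S \<Longrightarrow> pathfinish (q z) = z" by metis
 define g where "g z = contour_integral (q z) f" for z
 have int: "f contour_integrable_on \<gamma>" if "valid_path \<gamma>" "path_image \<gamma> \<subseteq> S" for \<gamma>
  using contour_integrable_holomorphic_simple [OF hol S(1)] that by blast
 have "(g has_field_derivative f x) (at x)" if x: "x \<in> S" for x
 proof -
  obtain r where r: "r > 0" "ball x r \<subseteq> S" using openE [OF S(1) x] by blast
  obtain h where h: "\<And>y. y \<in> ball x r \<Longrightarrow> (h has_field_derivative f y) (at y within ball x r)"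
   using holomorphic_convex_primitive' [OF convex_ball open_ball holomorphic_on_subset [OF hol r(2)]] by blast
  have gh: "g y = h y + (g x - h x)" if y: "y \<in> ball x r" for y
  proof -
   have yS: "y \<in> S" using y r by blast
   have seg: "closed_segment x y \<subseteq> ball x r" using y r(1) by (intro closed_segment_subset) auto
   have "(f has_contour_integral (h y - h x)) (linepath x y)"
    using contour_integral_primitive [OF h, of "linepath x y"] seg by simp
   hence lin: "contour_integral (linepath x y) f = h y - h x" by (rule contour_integral_unique)
   have "contour_integral (q x +++ linepath x y +++ reversepath (q y)) f = 0"
    using q [OF x] q [OF yS] seg r(2) by (intro zero) (auto simp: path_image_join subset_path_image_join)
   moreover have "contour_integral (q x +++ linepath x y +++ reversepath (q y)) f
    = contour_integral (q x) f + (contour_integral (linepath x y) f + contour_integral (reversepath (q y)) f)"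
   proof -
    have "f contour_integrable_on q x" "f contour_integrable_on linepath x y" "f contour_integrable_on reversepath (q y)"
     using q [OF x] q [OF yS] seg r(2) by (auto intro!: int)
    thus ?thesis using q [OF x] q [OF yS] by (simp add: contour_integrable_joinI)
   qed
   moreover have "contour_integral (reversepath (q y)) f = - contour_integral (q y) f"
    by (rule contour_integral_reversepath [OF q(1) [OF yS]])
   ultimately have "g x + (h y - h x - g y) = 0" using lin by (simp add: g_def)
   thus ?thesis by (simp add: algebra_simps)
  qed
  have "((\<lambda>y. h y + (g x - h x)) has_field_derivative f x) (at x)"
   using h [of x] r(1) by (auto simp: at_within_open [of x "ball x r"] intro!: derivative_eq_intros)
  moreover have "\<forall>\<^sub>F y in nhds x. g y = h y + (g x - h x)"
   unfolding eventually_nhds by (intro exI [of _ "ball x r"] conjI ballI gh) (use r(1) in auto)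
  ultimately show ?thesis by (simp add: DERIV_cong_ev)
 qed
 thus thesis using that by blast
qed (use that in auto)

lemma exp_eq_imp_diff_constant:
 fixes f g :: "'a::topological_space \<Rightarrow> complex"
 assumes S: "connected S" and cont: "continuous_on S f" "continuous_on S g"
  and eq: "\<And>x. x \<in> S \<Longrightarrow> exp (f x) = exp (g x)"
 shows "(\<lambda>x. f x - g x) constant_on S"
proof (rule continuous_discrete_range_constant [OF S])
 show "continuous_on S (\<lambda>x. f x - g x)" by (intro continuous_intros cont)
 fix x assume x: "x \<in> S"
 have "2 * pi \<le> norm ((f y - g y) - (f x - g x))" if y: "y \<in> S" "f y - g y \<noteq> f x - g x" for y
 proof -
  obtain m n :: int where "f y = g y + of_int (2 * m) * pi * \<i>" "f x = g x + of_int (2 * n) * pi * \<i>"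
   using eq [OF x] eq [OF y(1)] unfolding exp_eq by blast
  hence *: "(f y - g y) - (f x - g x) = of_int (m - n) * (2 * pi * \<i>)" by (simp add: algebra_simps)
  hence "m \<noteq> n" using y(2) by auto
  hence "1 \<le> \<bar>real_of_int (m - n)\<bar>" by linarith
  hence "1 * (2 * pi) \<le> \<bar>real_of_int (m - n)\<bar> * (2 * pi)" by (intro mult_right_mono) auto
  thus ?thesis unfolding * norm_mult norm_of_int by (simp add: norm_mult)
 qed
 thus "\<exists>e>0. \<forall>y. y \<in> S \<and> f y - g y \<noteq> f x - g x \<longrightarrow> e \<le> norm ((f y - g y) - (f x - g x))"
  using pi_gt_zero by (intro exI [of _ "2 * pi"]) auto
qed

text \<open>Both the behaviour at \<open>a\<close> and the behaviour at infinity determine the increment of a logarithm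
 of \<open>k (a + exp w)\<close> under \<open>w \<mapsto> w + 2 \<pi> \<i>\<close>.\<close>

lemma exponent_zero:
 fixes k G :: "complex \<Rightarrow> complex" and t :: int
 assumes k: "continuous_on (- {a}) k" "\<And>z. z \<noteq> a \<Longrightarrow> k z \<noteq> 0"
  and inf: "\<And>z. R \<le> norm (z - a) \<Longrightarrow> k z = 1"
  and r: "r > 0" "\<And>z. z \<noteq> a \<Longrightarrow> norm (z - a) < r \<Longrightarrow> k z = (z - a) powi t * G z"
  and G: "continuous_on (ball a r) G" "\<And>z. z \<in> ball a r \<Longrightarrow> G z \<noteq> 0"
 shows "t = 0"
proof -
 have "continuous_on UNIV (\<lambda>w. k (a + exp w))"
  by (rule continuous_on_compose2 [OF k(1)]) (auto intro!: continuous_intros)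
 moreover have "k (a + exp w) \<noteq> 0" for w by (rule k(2)) simp
 ultimately obtain l where l: "continuous_on UNIV l" "\<And>w. k (a + exp w) = exp (l w)"
  using continuous_logarithm_on_contractible [of UNIV "\<lambda>w. k (a + exp w)"] contractible_UNIV by (metis UNIV_I)
 define \<tau> where "\<tau> = 2 * pi * \<i>"
 have per: "exp (w + \<tau>) = exp w" for w by (simp add: \<tau>_def exp_add)
 have lc: "continuous_on A l" "continuous_on A (\<lambda>w. l (w + \<tau>))" for A
  by (auto intro!: continuous_on_compose2 [OF l(1)] continuous_intros)
 have "(\<lambda>w. l (w + \<tau>) - l w) constant_on UNIV"
  by (rule exp_eq_imp_diff_constant) (auto intro: lc simp flip: l(2) simp: per)
 then obtain D where D: "\<And>w. l (w + \<tau>) - l w = D" unfolding constant_on_def by blast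
 define M where "M = ln (max R 1)"
 have "(\<lambda>w. l w - 0) constant_on {w. Re w > M}"
 proof (rule exp_eq_imp_diff_constant)
  show "exp (l w) = exp 0" if "w \<in> {w. Re w > M}" for w
  proof -
   have "ln (max R 1) < Re w" using that by (simp add: M_def)
   hence "exp (ln (max R 1)) < exp (Re w)" by (simp only: exp_less_cancel_iff)
   hence "max R 1 < exp (Re w)" by simp
   hence "k (a + exp w) = 1" by (intro inf) simp
   thus ?thesis by (simp add: l(2))
  qed
 qed (auto intro: lc convex_connected convex_halfspace_Re_gt)
 hence "D = 0"
 proof -
  assume "(\<lambda>w. l w - 0) constant_on {w. Re w > M}"
  then obtain c where c: "\<And>w. Re w > M \<Longrightarrow> l w = c" unfolding constant_on_def by auto
  define w1 where "w1 = complex_of_real (M + 1)"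
  have "Re w1 > M" "Re (w1 + \<tau>) > M" by (simp_all add: w1_def \<tau>_def)
  thus "D = 0" using D [of w1] c by simp
 qed
 obtain L where L: "continuous_on (ball a r) L" "\<And>z. z \<in> ball a r \<Longrightarrow> G z = exp (L z)"
  using continuous_logarithm_on_ball [OF G] by blast
 have small: "a + exp w \<in> ball a r" "norm (a + exp w - a) < r" if "Re w < ln r" for w
 proof -
  have "exp (Re w) < r" using that r(1) by (metis exp_less_cancel_iff exp_ln)
  thus "a + exp w \<in> ball a r" "norm (a + exp w - a) < r" by (auto simp: dist_norm)
 qed
 have "(\<lambda>w. l w - (of_int t * w + L (a + exp w))) constant_on {w. Re w < ln r}"
 proof (rule exp_eq_imp_diff_constant)
  show "exp (l w) = exp (of_int t * w + L (a + exp w))" if "w \<in> {w. Re w < ln r}" for w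
  proof -
   have "k (a + exp w) = exp w powi t * exp (L (a + exp w))"
    using r(2) [of "a + exp w"] small [of w] that L(2) [of "a + exp w"] by simp
   also have "\<dots> = exp (of_int t * w + L (a + exp w))" by (simp add: exp_add exp_power_int mult.commute)
   finally show ?thesis by (simp add: l(2))
  qed
  have "continuous_on {w. Re w < ln r} (\<lambda>w. L (a + exp w))"
   by (rule continuous_on_compose2 [OF L(1)]) (use small in \<open>auto intro!: continuous_intros\<close>)
  thus "continuous_on {w. Re w < ln r} (\<lambda>w. of_int t * w + L (a + exp w))" by (intro continuous_intros)
 qed (auto intro: lc convex_connected convex_halfspace_Re_lt)
 then obtain c where c: "\<And>w. Re w < ln r \<Longrightarrow> l w = of_int t * w + L (a + exp w) + c"
  unfolding constant_on_def by (auto simp: algebra_simps)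
 define w0 where "w0 = complex_of_real (ln r - 1)"
 have w0: "Re w0 < ln r" "Re (w0 + \<tau>) < ln r" by (simp_all add: w0_def \<tau>_def)
 have "D = of_int t * \<tau>" using D [of w0] c [OF w0(1)] c [OF w0(2)] unfolding per by (simp add: algebra_simps)
 thus "t = 0" using \<open>D = 0\<close> by (simp add: \<tau>_def)
qed

text \<open>By means of \<open>u\<close>, the function (z - a)^t (z - a')^(-s) near \<open>Q\<close>
  can be joined to the constant 1 near \<open>P\<close>. The result is continuous and nonzero off
  \<open>a\<close>, and has exponent \<open>t\<close> at \<open>a\<close>.\<close>

lemma cut_exponent_zero:
 fixes u :: "complex \<Rightarrow> complex" and s t :: int
 assumes QP: "compact Q" "closed P" "Q \<inter> P = {}" "a \<in> Q" "a' \<in> P" "\<And>z. B \<le> norm z \<Longrightarrow> z \<in> P"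
  and u: "continuous_on (- (Q \<union> P)) u" "\<And>z. z \<notin> Q \<union> P \<Longrightarrow> (z - a) powi t = (z - a') powi s * exp (u z)"
 shows "t = 0"
proof -
 obtain \<rho> :: "complex \<Rightarrow> real" where \<rho>: "continuous_on UNIV \<rho>" "\<And>z. z \<in> Q \<Longrightarrow> \<rho> z = 1" "\<And>z. z \<in> P \<Longrightarrow> \<rho> z = 0"
  using Urysohn [OF compact_imp_closed [OF QP(1)] QP(2,3), of 1 "0 :: real"] by metis
 \<comment> \<open>The clamping makes \<open>\<psi>\<close> equal to 1 where
   \<open>\<rho> \<ge> 2/3\<close> and to 0 where \<open>\<rho> \<le> 1/3\<close>, hence constant on
   open neighbourhoods of \<open>Q\<close> and of \<open>P\<close>.\<close>
 define \<psi> where "\<psi> z = max 0 (min 1 (3 * \<rho> z - 1))" for z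
 have \<psi>: "continuous_on A \<psi>" for A
  unfolding \<psi>_def using continuous_on_subset [OF \<rho>(1)] by (intro continuous_intros) auto
 define g where "g z = (z - a) powi t * (z - a') powi (- s)" for z
 define k where "k z = (if z \<in> Q then g z else if z \<in> P then 1 else exp (of_real (\<psi> z) * u z))" for z
 have oQP: "open (- (Q \<union> P))" using QP by (auto intro: compact_imp_closed)
 define N where "N = {z. 2/3 < \<rho> z}"
 have N: "open N" "Q \<subseteq> N" "N \<inter> P = {}" using \<rho> by (auto simp: N_def intro!: open_Collect_less continuous_intros)
 define N' where "N' = {z. \<rho> z < 1/3}"
 have N': "open N'" "P \<subseteq> N'" "N' \<inter> Q = {}" using \<rho> by (auto simp: N'_def intro!: open_Collect_less continuous_intros)
 have kN: "k z = g z" if "z \<in> N" for z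
 proof (cases "z \<in> Q")
  case False
  hence z: "z \<notin> Q \<union> P" using that N(3) by blast
  hence "z \<noteq> a'" using QP(5) by blast
  hence "g z = exp (u z)" using u(2) [OF z] by (simp add: g_def power_int_minus field_simps)
  moreover have "\<psi> z = 1" using that by (simp add: N_def \<psi>_def)
  ultimately show ?thesis using z by (simp add: k_def)
 qed (simp add: k_def)
 have kN': "k z = 1" if "z \<in> N'" for z using that N'(3) by (auto simp: k_def N'_def \<psi>_def)
 have gc: "continuous_on (N - {a}) g" unfolding g_def using N(3) QP(5) by (intro continuous_intros) auto
 have "continuous_on ((N - {a}) \<union> (N' \<union> - (Q \<union> P))) k"
 proof (intro continuous_on_open_Un)
  show "continuous_on (N - {a}) k" using gc by (rule continuous_on_eq) (auto simp: kN)
  show "continuous_on N' k" by (rule continuous_on_eq [of _ "\<lambda>_. 1"]) (auto simp: kN')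
  have "continuous_on (- (Q \<union> P)) (\<lambda>z. exp (of_real (\<psi> z) * u z))" by (intro continuous_intros \<psi> u(1))
  thus "continuous_on (- (Q \<union> P)) k" by (rule continuous_on_eq) (auto simp: k_def)
 qed (use N N' oQP in auto)
 moreover have "(N - {a}) \<union> (N' \<union> - (Q \<union> P)) = - {a}" using N N' QP(4,3) by blast
 ultimately have kc: "continuous_on (- {a}) k" by simp
 obtain r where r: "r > 0" "ball a r \<subseteq> N" using openE [OF N(1)] N(2) QP(4) by blast
 show "t = 0"
 proof (rule exponent_zero [OF kc _ _ r(1), where R = "B + norm a" and G = "\<lambda>z. (z - a') powi (- s)"])
  show "k z \<noteq> 0" if "z \<noteq> a" for z using that QP(3,5) by (auto simp: k_def g_def)
  show "k z = 1" if "B + norm a \<le> norm (z - a)" for z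
  proof -
   have "B \<le> norm z" using that norm_triangle_ineq4 [of z a] by simp
   thus ?thesis using QP(6) N'(2) kN' by blast
  qed
  show "k z = (z - a) powi t * (z - a') powi - s" if "norm (z - a) < r" for z
  proof -
   have "z \<in> ball a r" using that by (simp add: dist_norm norm_minus_commute)
   thus ?thesis using kN r(2) by (auto simp: g_def)
  qed
  have "z \<noteq> a'" if "z \<in> ball a r" for z using that r(2) N(3) QP(5) by blast
  thus "continuous_on (ball a r) (\<lambda>z. (z - a') powi (- s))" "\<And>z. z \<in> ball a r \<Longrightarrow> (z - a') powi (- s) \<noteq> 0"
   by (auto intro!: continuous_intros)
 qed
qed

text \<open>Such a relation between the periods makes t dz / (z - a) - s dz / (z - a') exact on the
  domain, and a primitive provides the logarithm that forces \<open>t = 0\<close>. The compact part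
  \<open>Q\<close> of the complement is the one around \<open>a\<close>; the part \<open>P\<close>
  contains a neighbourhood of infinity.\<close>

lemma loop_periods_not_proportional:
 fixes s t :: int
 assumes QP: "compact Q" "closed P" "Q \<inter> P = {}" "a \<in> Q" "a' \<in> P" "\<And>z. B \<le> norm z \<Longrightarrow> z \<in> P"
  and U: "connected (- (Q \<union> P))"
  and per: "\<And>\<gamma>. valid_path \<gamma> \<Longrightarrow> path_image \<gamma> \<subseteq> - (Q \<union> P) \<Longrightarrow> pathfinish \<gamma> = pathstart \<gamma> \<Longrightarrow>
   of_int t * winding_number \<gamma> a = of_int s * winding_number \<gamma> a'"
 shows "t = 0"
proof -
 define f where "f z = of_int t * (1 / (z - a)) - of_int s * (1 / (z - a'))" for z
 have oU: "open (- (Q \<union> P))" using QP by (auto intro: compact_imp_closed)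
 have ne: "z \<noteq> a" "z \<noteq> a'" if "z \<in> - (Q \<union> P)" for z using that QP(4,5) by auto
 have hol: "f holomorphic_on - (Q \<union> P)" unfolding f_def using ne by (intro holomorphic_intros) auto
 have "contour_integral \<gamma> f = 0" if \<gamma>: "valid_path \<gamma>" "path_image \<gamma> \<subseteq> - (Q \<union> P)" "pathfinish \<gamma> = pathstart \<gamma>" for \<gamma>
 proof -
  have "((\<lambda>w. 1 / (w - x)) has_contour_integral 2 * pi * \<i> * winding_number \<gamma> x) \<gamma>" if "x \<notin> path_image \<gamma>" for x
   using has_contour_integral_winding_number [OF \<gamma>(1) that] .
  moreover have "a \<notin> path_image \<gamma>" "a' \<notin> path_image \<gamma>" using \<gamma>(2) ne by blast+
  ultimately have "(f has_contour_integral of_int t * (2 * pi * \<i> * winding_number \<gamma> a)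
    - of_int s * (2 * pi * \<i> * winding_number \<gamma> a')) \<gamma>"
   unfolding f_def by (intro has_contour_integral_diff has_contour_integral_lmul)
  hence "contour_integral \<gamma> f = 2 * pi * \<i> * (of_int t * winding_number \<gamma> a - of_int s * winding_number \<gamma> a')"
   by (simp add: contour_integral_unique algebra_simps)
  thus ?thesis using per [OF \<gamma>] by simp
 qed
 then obtain u where u: "\<And>z. z \<in> - (Q \<union> P) \<Longrightarrow> (u has_field_derivative f z) (at z)"
  using loops_primitive [OF oU U hol] by blast
 define F where "F z = (z - a) powi t * (z - a') powi (- s) * exp (- u z)" for z
 have "(F has_field_derivative 0) (at z)" if z: "z \<in> - (Q \<union> P)" for z
 proof -
  have "(F has_field_derivative (of_int t * (z - a) powi (t - 1) * 1 * ((z - a') powi (- s) * exp (- u z))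
    + (z - a) powi t * (of_int (- s) * (z - a') powi (- s - 1) * 1 * exp (- u z) + (z - a') powi (- s) * (exp (- u z) * (- f z))))) (at z)"
   unfolding F_def using u [OF z] ne [OF z] by (auto intro!: derivative_eq_intros simp: algebra_simps)
  moreover have "(z - a) powi (t - 1) = (z - a) powi t / (z - a)" "(z - a') powi (- s - 1) = (z - a') powi (- s) / (z - a')"
   using ne [OF z] by (simp_all add: power_int_diff)
  ultimately show ?thesis by (simp add: f_def algebra_simps)
 qed
 hence "F constant_on - (Q \<union> P)" using has_field_derivative_0_imp_constant_on [OF _ U oU] by blast
 then obtain C where C: "\<And>z. z \<in> - (Q \<union> P) \<Longrightarrow> F z = C" unfolding constant_on_def by blast
 define c where "c = Ln C"
 have uc: "continuous_on (- (Q \<union> P)) (\<lambda>z. u z + c)"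
  using u by (intro continuous_intros DERIV_continuous_on) (auto intro: has_field_derivative_at_within)
 have "(z - a) powi t = (z - a') powi s * exp (u z + c)" if z: "z \<notin> Q \<union> P" for z
 proof -
  have nz: "z \<noteq> a" "z \<noteq> a'" using ne z by auto
  have "F z \<noteq> 0" using nz by (simp add: F_def)
  hence "exp c = F z" using C z by (simp add: c_def)
  thus ?thesis using nz by (simp add: F_def exp_add exp_minus power_int_minus field_simps)
 qed
 thus "t = 0" by (intro cut_exponent_zero [OF QP uc])
qed

section \<open>Recurrent injective maps of a plane domain\<close>

lemma relatively_compact_connected_nbhd:
 fixes U :: "complex set"
 assumes U: "open U" "connected U" and K: "compact K" "K \<subseteq> U"
 obtains N where "open N" "connected N" "K \<subseteq> N" "compact (closure N)" "closure N \<subseteq> U"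
proof -
 have "path_connected U" using U connected_open_path_connected by blast
 then obtain D where D: "compact D" "connected D" "K \<subseteq> D" "D \<subseteq> U"
  using compact_connected_superset [OF connected_ball U(1) _ K] by metis
 obtain e where e: "e > 0" "(\<Union>x\<in>D. cball x e) \<subseteq> U"
  using compact_subset_open_imp_cball_epsilon_subset [OF D(1) U(1) D(4)] by blast
 define N where "N = (\<Union>x\<in>D. ball x e)"
 have cl: "closure N \<subseteq> (\<Union>x\<in>D. cball x e)"
  by (rule closure_minimal) (auto simp: N_def intro: compact_imp_closed compact_minkowski_sum_cball [OF D(1)])
 have "D \<subseteq> N" using e(1) by (auto simp: N_def intro!: bexI)
 show thesis
 proof (rule that)
  show "open N" by (auto simp: N_def)
  have "connected (D \<union> \<Union>((\<lambda>x. ball x e) ` D))" using D(2) e(1) by (intro connected_Un_UN) (auto intro!: exI)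
  moreover have "D \<union> \<Union>((\<lambda>x. ball x e) ` D) = N" using \<open>D \<subseteq> N\<close> by (auto simp: N_def)
  ultimately show "connected N" by simp
  show "K \<subseteq> N" using D(3) \<open>D \<subseteq> N\<close> by blast
  show "compact (closure N)"
   using cl compact_minkowski_sum_cball [OF D(1), of e] compact_imp_bounded bounded_subset compact_closure
   by (metis closure_closure closure_subset)
  show "closure N \<subseteq> U" using cl e(2) by blast
 qed
qed

section \<open>Contour integrals and winding numbers under holomorphic maps\<close>

lemma contour_integral_log_deriv:
 assumes "f holomorphic_on S" "open S" "valid_path \<gamma>" "path_image \<gamma> \<subseteq> S" "\<And>z. z \<in> path_image \<gamma> \<Longrightarrow> f z \<noteq> b"
 shows "contour_integral \<gamma> (\<lambda>z. deriv f z / (f z - b)) = 2 * pi * \<i> * winding_number (f \<circ> \<gamma>) b"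
proof -
 have "valid_path (f \<circ> \<gamma>)" by (rule valid_path_compose_holomorphic [OF assms(3,1,2,4)])
 moreover have "b \<notin> path_image (f \<circ> \<gamma>)" using assms(5) by (auto simp: path_image_compose)
 ultimately have "2 * pi * \<i> * winding_number (f \<circ> \<gamma>) b = contour_integral (f \<circ> \<gamma>) (\<lambda>w. 1 / (w - b))"
  by (simp add: winding_number_valid_path)
 also have "\<dots> = contour_integral \<gamma> (\<lambda>w. deriv f w * (1 / (f w - b)))"
  using assms by (intro contour_integral_comp_analyticW [of _ S]) (auto simp: analytic_on_open)
 finally show ?thesis by simp
qed

lemma contour_integral_pullback:
 assumes "f holomorphic_on S" "open S" "valid_path \<gamma>" "path_image \<gamma> \<subseteq> S"
 shows "contour_integral (f \<circ> \<gamma>) h = contour_integral \<gamma> (\<lambda>w. h (f w) * deriv f w)"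
 using contour_integral_comp_analyticW [of f S \<gamma> h] assms by (simp add: analytic_on_open mult.commute)

text \<open>The derivative of the integral from \<open>z\<close> to \<open>R z\<close> is h (R z)
  R'(z) - h(z), which vanishes by invariance. The radius \<open>2 * r\<close> leaves room for both
  endpoints when \<open>z\<close> varies in a ball of radius \<open>r\<close>.\<close>

lemma displacement_constant:
 fixes R h :: "complex \<Rightarrow> complex"
 assumes N: "open N" "connected N" and R: "R holomorphic_on N" and h: "h holomorphic_on M" "open M"
  and r: "r > 0" "\<And>z. z \<in> N \<Longrightarrow> ball z (2 * r) \<subseteq> M" "\<And>z. z \<in> N \<Longrightarrow> dist z (R z) < r"
  and inv: "\<And>z. z \<in> N \<Longrightarrow> h (R z) * deriv R z = h z"
 shows "(\<lambda>z. contour_integral (linepath z (R z)) h) constant_on N"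
proof (rule has_field_derivative_0_imp_constant_on [OF _ N(2,1)])
 fix z1 assume z1: "z1 \<in> N"
 obtain H where H: "\<And>y. y \<in> ball z1 (2 * r) \<Longrightarrow> (H has_field_derivative h y) (at y within ball z1 (2 * r))"
  using holomorphic_convex_primitive' [OF convex_ball open_ball holomorphic_on_subset [OF h(1) r(2) [OF z1]]] by blast
 have mem: "z \<in> ball z1 (2 * r)" "R z \<in> ball z1 (2 * r)" if "z \<in> N \<inter> ball z1 r" for z
 proof -
  have "dist z1 z < r" "dist z (R z) < r" using that r(3) by auto
  hence "dist z1 z < 2 * r" "dist z1 (R z) < 2 * r" using r(1) by metric+
  thus "z \<in> ball z1 (2 * r)" "R z \<in> ball z1 (2 * r)" by auto
 qed
 have D: "H (R z) - H z = contour_integral (linepath z (R z)) h" if z: "z \<in> N \<inter> ball z1 r" for z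
 proof -
  have "closed_segment z (R z) \<subseteq> ball z1 (2 * r)" using mem [OF z] by (intro closed_segment_subset) auto
  hence "(h has_contour_integral (H (R z) - H z)) (linepath z (R z))"
   using contour_integral_primitive [OF H, of "linepath z (R z)"] by simp
  thus ?thesis by (simp add: contour_integral_unique)
 qed
 have z1': "z1 \<in> N \<inter> ball z1 r" using z1 r(1) by simp
 have Hd: "(H has_field_derivative h y) (at y)" if "y \<in> ball z1 (2 * r)" for y
  using H [OF that] at_within_open [OF that] by simp
 have Rd: "(R has_field_derivative deriv R z1) (at z1)" using holomorphic_derivI [OF R N(1) z1] .
 have "((\<lambda>z. H (R z) - H z) has_field_derivative h (R z1) * deriv R z1 - h z1) (at z1)"
  using DERIV_chain2 [OF Hd [OF mem(2) [OF z1']] Rd] Hd [OF mem(1) [OF z1']] by (rule DERIV_diff)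
 hence "((\<lambda>z. H (R z) - H z) has_field_derivative 0) (at z1)" using inv [OF z1] by simp
 thus "((\<lambda>z. contour_integral (linepath z (R z)) h) has_field_derivative 0) (at z1)"
  by (rule has_field_derivative_transform_within_open [of _ _ _ "N \<inter> ball z1 r"]) (use N z1' D in auto)
qed

lemma continuous_difference_quotient:
 fixes T :: "complex \<Rightarrow> complex"
 assumes U: "open U" and T: "T holomorphic_on U"
 shows "continuous_on (U \<times> U) (\<lambda>(z, y). if z = y then deriv T y else (T z - T y) / (z - y))" (is "continuous_on _ ?q")
proof -
 have "isCont ?q (z0, y0)" if zy: "z0 \<in> U" "y0 \<in> U" for z0 y0
 proof (cases "z0 = y0")
  case False
  define W where "W = (U \<times> U) \<inter> {p. fst p \<noteq> snd p}"
  have W: "open W" "(z0, y0) \<in> W"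
   using U zy False by (auto simp: W_def intro!: open_Int open_Times open_Collect_neq continuous_intros)
  have Tc: "continuous_on U T" by (rule holomorphic_on_imp_continuous_on [OF T])
  have "continuous_on W (\<lambda>p. (T (fst p) - T (snd p)) / (fst p - snd p))"
   by (intro continuous_intros continuous_on_compose2 [OF Tc]) (auto simp: W_def)
  hence "continuous_on W ?q" by (rule continuous_on_eq) (auto simp: W_def)
  thus ?thesis using W continuous_on_eq_continuous_at by blast
 next
  case True
  have dT: "continuous_on U (deriv T)" by (intro holomorphic_on_imp_continuous_on holomorphic_deriv T U)
  show ?thesis unfolding continuous_at_eps_delta
  proof (intro allI impI)
   fix e :: real assume e: "e > 0"
   obtain d1 where d1: "d1 > 0" "ball z0 d1 \<subseteq> U" using openE [OF U zy(1)] by blast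
   have "isCont (deriv T) z0" using dT U zy(1) continuous_on_eq_continuous_at by blast
   then obtain d2 where d2: "d2 > 0" "\<And>v. dist v z0 < d2 \<Longrightarrow> dist (deriv T v) (deriv T z0) < e / 2"
    unfolding continuous_at_eps_delta using e half_gt_zero by metis
   define d where "d = min d1 d2"
   have d: "d > 0" "ball z0 d \<subseteq> U" using d1 d2 by (auto simp: d_def)
   have dd: "norm (deriv T v - deriv T z0) \<le> e / 2" if "v \<in> ball z0 d" for v
    using d2(2) [of v] that by (simp add: d_def dist_norm norm_minus_commute)
   have "dist (?q (z, y)) (?q (z0, y0)) < e" if zyb: "z \<in> ball z0 d" "y \<in> ball z0 d" for z y
   proof (cases "z = y")
    case True
    thus ?thesis using dd [OF zyb(2)] e \<open>z0 = y0\<close> by (simp add: dist_norm)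
   next
    case False
    have "norm ((T z - deriv T z0 * z) - (T y - deriv T z0 * y)) \<le> e / 2 * norm (z - y)"
    proof (rule field_differentiable_bound [OF convex_ball, of z0 d _ "\<lambda>v. deriv T v - deriv T z0"])
     fix v assume "v \<in> ball z0 d"
     hence "(T has_field_derivative deriv T v) (at v)" using d(2) holomorphic_derivI [OF T U] by blast
     thus "((\<lambda>z. T z - deriv T z0 * z) has_field_derivative deriv T v - deriv T z0) (at v within ball z0 d)"
      by (rule has_field_derivative_at_within [OF DERIV_diff [OF _ DERIV_cmult_Id]])
    qed (use dd zyb in auto)
    moreover have "(T z - deriv T z0 * z) - (T y - deriv T z0 * y) = (z - y) * ((T z - T y) / (z - y) - deriv T z0)"
     using False by (simp add: field_simps)
    ultimately have "norm (z - y) * norm ((T z - T y) / (z - y) - deriv T z0) \<le> norm (z - y) * (e / 2)"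
     by (simp only: norm_mult mult.commute)
    hence "norm ((T z - T y) / (z - y) - deriv T z0) \<le> e / 2" using False by simp
    thus ?thesis using False \<open>z0 = y0\<close> e by (simp add: dist_norm)
   qed
   moreover have "z \<in> ball z0 d \<and> y \<in> ball z0 d" if "dist (z, y) (z0, y0) < d" for z y
    using that dist_fst_le [of "(z, y)" "(z0, y0)"] dist_snd_le [of "(z, y)" "(z0, y0)"] True
    by (simp add: dist_commute)
   ultimately show "\<exists>d>0. \<forall>p. dist p (z0, y0) < d \<longrightarrow> dist (?q p) (?q (z0, y0)) < e"
    using d(1) by (intro exI [of _ d]) (auto simp del: split_paired_All simp: split_paired_all)
  qed
 qed
 thus ?thesis by (intro continuous_at_imp_continuous_on) auto
qed

text \<open>The difference quotient of an injective \<open>T\<close>, continued by the derivative on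
  the diagonal, never vanishes. Moving \<open>y\<close> along a path in \<open>U\<close>, possibly
  across the loop, is therefore a homotopy in the punctured plane.\<close>

lemma winding_number_image_difference:
 fixes T :: "complex \<Rightarrow> complex"
 assumes U: "open U" "connected U" and T: "T holomorphic_on U" "inj_on T U"
  and \<gamma>: "valid_path \<gamma>" "path_image \<gamma> \<subseteq> U" "pathfinish \<gamma> = pathstart \<gamma>"
  and y: "y1 \<in> U - path_image \<gamma>" "y2 \<in> U - path_image \<gamma>"
 shows "winding_number (T \<circ> \<gamma>) (T y1) - winding_number \<gamma> y1 = winding_number (T \<circ> \<gamma>) (T y2) - winding_number \<gamma> y2"
proof -
 define Q where "Q p = (case p of (z, y) \<Rightarrow> if z = y then deriv T y else (T z - T y) / (z - y))" for p
 have Qc: "continuous_on (U \<times> U) Q"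
  using continuous_difference_quotient [OF U(1) T(1)] by (simp add: Q_def [abs_def])
 have Q0: "Q (z, y) \<noteq> 0" if "z \<in> U" "y \<in> U" for z y
 proof (cases "z = y")
  case True
  thus ?thesis using holomorphic_injective_imp_regular [OF T(1) U(1) T(2)] that by (simp add: Q_def)
 next
  case False
  hence "T z \<noteq> T y" using T(2) that by (auto simp: inj_on_def)
  thus ?thesis using False by (simp add: Q_def)
 qed
 \<comment> \<open>The logarithmic derivative of the difference quotient is the difference of the
   integrands of the two winding numbers.\<close>
 have wind: "winding_number ((\<lambda>z. Q (z, y)) \<circ> \<gamma>) 0 = winding_number (T \<circ> \<gamma>) (T y) - winding_number \<gamma> y"
  if y: "y \<in> U - path_image \<gamma>" for y
 proof -
  define G where "G z = (T z - T y) / (z - y)" for z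
  have oU: "open (U - {y})" and sub: "path_image \<gamma> \<subseteq> U - {y}" using U(1) \<gamma>(2) y by auto
  have TU: "T holomorphic_on U - {y}" using T(1) by (rule holomorphic_on_subset) auto
  have Gh: "G holomorphic_on U - {y}" unfolding G_def using TU by (intro holomorphic_intros) auto
  have Tne: "T z \<noteq> T y" if "z \<in> U - {y}" for z using T(2) that y by (auto simp: inj_on_def)
  have "deriv G z / (G z - 0) = deriv T z / (T z - T y) - 1 / (z - y)" if z: "z \<in> U - {y}" for z
  proof -
   have "(T has_field_derivative deriv T z) (at z)" using holomorphic_derivI [OF TU oU z] .
   hence "(G has_field_derivative (deriv T z * (z - y) - (T z - T y) * 1) / ((z - y) * (z - y))) (at z)"
    unfolding G_def using z by (auto intro!: derivative_eq_intros)
   hence "deriv G z = (deriv T z * (z - y) - (T z - T y)) / ((z - y) * (z - y))" by (simp add: DERIV_imp_deriv)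
   moreover have "z - y \<noteq> 0" "T z - T y \<noteq> 0" using z Tne [OF z] by auto
   moreover have "((D * A - B) / (A * A)) / (B / A) = D / B - 1 / A" if "A \<noteq> 0" "B \<noteq> 0" for A B D :: complex
    using that by (simp add: field_simps)
   ultimately show ?thesis by (simp only: G_def diff_zero)
  qed
  hence "contour_integral \<gamma> (\<lambda>z. deriv G z / (G z - 0)) = contour_integral \<gamma> (\<lambda>z. deriv T z / (T z - T y) - 1 / (z - y))"
   using sub by (intro contour_integral_eq) blast
  also have "\<dots> = contour_integral \<gamma> (\<lambda>z. deriv T z / (T z - T y)) - contour_integral \<gamma> (\<lambda>z. 1 / (z - y))"
  proof (rule contour_integral_diff)
   have "(\<lambda>z. deriv T z / (T z - T y)) holomorphic_on U - {y}"
    using Tne by (intro holomorphic_intros holomorphic_deriv TU oU) auto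
   thus "(\<lambda>z. deriv T z / (T z - T y)) contour_integrable_on \<gamma>"
    using contour_integrable_holomorphic_simple oU \<gamma>(1) sub by blast
   show "(\<lambda>z. 1 / (z - y)) contour_integrable_on \<gamma>" using contour_integrable_inversediff [OF \<gamma>(1)] y by blast
  qed
  also have "contour_integral \<gamma> (\<lambda>z. deriv T z / (T z - T y)) = 2 * pi * \<i> * winding_number (T \<circ> \<gamma>) (T y)"
   using sub Tne by (intro contour_integral_log_deriv [OF TU oU \<gamma>(1)]) blast+
  also have "contour_integral \<gamma> (\<lambda>z. 1 / (z - y)) = 2 * pi * \<i> * winding_number \<gamma> y"
   using winding_number_valid_path [OF \<gamma>(1)] y by simp
  also have "contour_integral \<gamma> (\<lambda>z. deriv G z / (G z - 0)) = 2 * pi * \<i> * winding_number (G \<circ> \<gamma>) 0"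
   using sub Tne by (intro contour_integral_log_deriv [OF Gh oU \<gamma>(1)]) (auto simp: G_def)
  finally have "2 * pi * \<i> * winding_number (G \<circ> \<gamma>) 0 = 2 * pi * \<i> * (winding_number (T \<circ> \<gamma>) (T y) - winding_number \<gamma> y)"
   by (simp only: right_diff_distrib)
  hence "winding_number (G \<circ> \<gamma>) 0 = winding_number (T \<circ> \<gamma>) (T y) - winding_number \<gamma> y" by simp
  moreover have "winding_number ((\<lambda>z. Q (z, y)) \<circ> \<gamma>) 0 = winding_number (G \<circ> \<gamma>) 0"
   using y by (intro winding_number_cong) (auto simp: Q_def G_def path_image_def)
  ultimately show ?thesis by simp
 qed
 have "path_connected U" using U connected_open_path_connected by blast
 then obtain \<beta> where \<beta>: "path \<beta>" "path_image \<beta> \<subseteq> U" "pathstart \<beta> = y1" "pathfinish \<beta> = y2"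
  using y unfolding path_connected_def by blast
 have \<beta>U: "\<beta> s \<in> U" if "s \<in> {0..1}" for s using \<beta>(2) that by (auto simp: path_image_def)
 have \<gamma>U: "\<gamma> s \<in> U" if "s \<in> {0..1}" for s using \<gamma>(2) that by (auto simp: path_image_def)
 have "homotopic_loops (- {0}) ((\<lambda>z. Q (z, y1)) \<circ> \<gamma>) ((\<lambda>z. Q (z, y2)) \<circ> \<gamma>)" unfolding homotopic_loops
 proof (intro exI [of _ "\<lambda>(s, t). Q (\<gamma> t, \<beta> s)"] conjI ballI)
  have "continuous_on {0..1} \<gamma>" "continuous_on {0..1} \<beta>"
   using valid_path_imp_path [OF \<gamma>(1)] \<beta>(1) by (auto simp: path_def)
  hence "continuous_on ({0..1} \<times> {0..1}) (\<lambda>p. \<gamma> (snd p))" "continuous_on ({0..1} \<times> {0..1}) (\<lambda>p. \<beta> (fst p))"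
   by (auto intro: continuous_on_compose2 [OF _ continuous_on_snd] continuous_on_compose2 [OF _ continuous_on_fst])
  hence "continuous_on ({0..1} \<times> {0..1}) (\<lambda>p. (\<gamma> (snd p), \<beta> (fst p)))" by (rule continuous_on_Pair)
  hence "continuous_on ({0..1} \<times> {0..1}) (\<lambda>p. Q (\<gamma> (snd p), \<beta> (fst p)))"
   by (rule continuous_on_compose2 [OF Qc]) (auto intro: \<beta>U \<gamma>U)
  thus "continuous_on ({0..1} \<times> {0..1}) (\<lambda>(s, t). Q (\<gamma> t, \<beta> s))" by (simp add: case_prod_beta')
  show "(\<lambda>(s, t). Q (\<gamma> t, \<beta> s)) \<in> {0..1} \<times> {0..1} \<rightarrow> - {0}" using Q0 \<beta>U \<gamma>U by auto
 qed (use \<beta> \<gamma>(3) in \<open>auto simp: pathstart_def pathfinish_def\<close>)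
 hence "winding_number ((\<lambda>z. Q (z, y1)) \<circ> \<gamma>) 0 = winding_number ((\<lambda>z. Q (z, y2)) \<circ> \<gamma>) 0"
  by (rule winding_number_homotopic_loops)
 thus ?thesis by (simp only: wind [OF y(1)] wind [OF y(2)])
qed

text \<open>This abstracts a return map of a recurrent component, seen in a chart at a point outside
  it: orbits of compact sets stay in compact sets and come back uniformly, and the map has infinite
  order.\<close>

locale recurrent_plane_map =
 fixes U :: "complex set" and g :: "complex \<Rightarrow> complex" and k :: "nat \<Rightarrow> nat"
 assumes open_U: "open U" and connected_U: "connected U"
  and hol: "g holomorphic_on U" and image: "g ` U = U" and inj: "inj_on g U"
  and precompact: "\<And>C. compact C \<Longrightarrow> C \<subseteq> U \<Longrightarrow> \<exists>K. compact K \<and> K \<subseteq> U \<and> (\<forall>n. (g ^^ n) ` C \<subseteq> K)"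
  and returns: "\<And>C e. compact C \<Longrightarrow> C \<subseteq> U \<Longrightarrow> e > 0 \<Longrightarrow> \<forall>\<^sub>F j in sequentially. \<forall>z\<in>C. dist ((g ^^ k j) z) z < e"
  and k_at_top: "filterlim k at_top sequentially"
  and aperiodic: "\<And>n. 1 \<le> n \<Longrightarrow> \<exists>z\<in>U. (g ^^ n) z \<noteq> z"
begin

lemma image_iterate: "(g ^^ n) ` U = U"
proof (induction n)
 case (Suc n)
 have "(g ^^ Suc n) ` U = g ` (g ^^ n) ` U" by (simp add: image_comp)
 thus ?case using Suc image by simp
qed simp

lemma iterate_in: "z \<in> U \<Longrightarrow> (g ^^ n) z \<in> U"
 using image_iterate by blast

lemma iterate_holomorphic: "(g ^^ n) holomorphic_on U"
proof (induction n)
 case (Suc n)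
 have "g \<circ> (g ^^ n) holomorphic_on U" by (rule holomorphic_on_compose [OF Suc]) (simp add: image_iterate hol)
 thus ?case by (simp add: o_def)
qed (simp add: id_def)

lemma iterate_inj: "inj_on (g ^^ n) U"
proof (induction n)
 case (Suc n)
 have "inj_on (g \<circ> (g ^^ n)) U" by (rule comp_inj_on [OF Suc]) (simp add: image_iterate inj)
 thus ?case by (simp add: o_def)
qed simp

lemma iterate_has_derivative: "z \<in> U \<Longrightarrow> ((g ^^ n) has_field_derivative deriv (g ^^ n) z) (at z)"
 using holomorphic_derivI [OF iterate_holomorphic open_U] .

lemma iterate_deriv_nonzero: "z \<in> U \<Longrightarrow> deriv (g ^^ n) z \<noteq> 0"
 using holomorphic_injective_imp_regular [OF iterate_holomorphic open_U iterate_inj] .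

lemma deriv_iterate_add:
 assumes "z \<in> U"
 shows "deriv (g ^^ (m + n)) z = deriv (g ^^ m) ((g ^^ n) z) * deriv (g ^^ n) z"
proof -
 have "((g ^^ m \<circ> g ^^ n) has_field_derivative deriv (g ^^ m) ((g ^^ n) z) * deriv (g ^^ n) z) (at z)"
  using iterate_has_derivative assms iterate_in by (intro DERIV_chain) auto
 thus ?thesis by (simp add: funpow_add DERIV_imp_deriv)
qed

lemma compact_thickening:
 assumes "compact C" "C \<subseteq> U"
 obtains C' K r where "r > 0" "\<And>z. z \<in> C \<Longrightarrow> cball z r \<subseteq> C'" "C' \<subseteq> U" "compact K" "K \<subseteq> U"
  "\<And>n z. z \<in> C' \<Longrightarrow> (g ^^ n) z \<in> K"
proof -
 obtain r where r: "r > 0" "(\<Union>x\<in>C. cball x r) \<subseteq> U"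
  using compact_subset_open_imp_cball_epsilon_subset [OF assms(1) open_U assms(2)] by blast
 obtain K where "compact K" "K \<subseteq> U" "\<And>n. (g ^^ n) ` (\<Union>x\<in>C. cball x r) \<subseteq> K"
  using precompact [OF compact_minkowski_sum_cball [OF assms(1)] r(2)] by blast
 thus thesis using r that [of r "\<Union>x\<in>C. cball x r" K] by blast
qed

text \<open>The forms below are invariant only under the powers of a fixed \<open>g ^^ l\<close>, so
  the return times have to be multiples of \<open>l\<close>.\<close>

lemma returns_power:
 assumes C: "compact C" "C \<subseteq> U" "e > 0"
 shows "\<forall>\<^sub>F j in sequentially. \<forall>z\<in>C. dist ((g ^^ (l * k j)) z) z < e"
 using C(3)
proof (induction l arbitrary: e)
 case (Suc l)
 obtain K where K: "compact K" "K \<subseteq> U" "\<And>n. (g ^^ n) ` C \<subseteq> K" using precompact [OF C(1,2)] by blast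
 have e2: "e / 2 > 0" using Suc.prems by simp
 from Suc.IH [OF e2] returns [OF K(1,2) e2] show ?case
 proof eventually_elim
  case (elim j)
  show ?case
  proof
   fix z assume z: "z \<in> C"
   have zK: "(g ^^ (l * k j)) z \<in> K" using K(3) z by blast
   have "dist ((g ^^ k j) ((g ^^ (l * k j)) z)) ((g ^^ (l * k j)) z) < e / 2" "dist ((g ^^ (l * k j)) z) z < e / 2"
    using elim z zK by auto
   hence "dist ((g ^^ k j) ((g ^^ (l * k j)) z)) z < e" by metric
   thus "dist ((g ^^ (Suc l * k j)) z) z < e" by (simp add: funpow_add)
  qed
 qed
qed simp

text \<open>As no iterate is the identity, each equation \<open>(g ^^ n) z = z\<close> with
  \<open>1 \<le> n\<close> has at most countably many solutions in \<open>U\<close>.\<close>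

lemma aperiodic_point:
 assumes A: "open A" "A \<subseteq> U" "A \<noteq> {}"
 obtains x where "x \<in> A" "\<And>n. 1 \<le> n \<Longrightarrow> (g ^^ n) x \<noteq> x"
proof -
 obtain F :: "nat \<Rightarrow> complex set" where F: "\<And>n. compact (F n)" "\<Union>(range F) = U"
  using open_Union_compact_subsets [OF open_U] by metis
 have fs: "fsigma U" unfolding fsigma_Union_compact by (rule exI [of _ F]) (simp add: F image_subset_iff)
 have "countable {z \<in> U. (g ^^ n) z - z = 0}" if n: "1 \<le> n" for n
 proof (cases "(\<lambda>z. (g ^^ n) z - z) constant_on U")
  case True
  then obtain c where c: "\<And>z. z \<in> U \<Longrightarrow> (g ^^ n) z - z = c" unfolding constant_on_def by blast
  obtain z where "z \<in> U" "(g ^^ n) z \<noteq> z" using aperiodic [OF n] by blast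
  hence "c \<noteq> 0" using c by force
  hence "{z \<in> U. (g ^^ n) z - z = 0} = {}"
  proof (intro equals0I, clarify)
   fix z assume "z \<in> U" "(g ^^ n) z - z = 0"
   thus False using c [of z] \<open>c \<noteq> 0\<close> by (simp only:)
  qed
  thus ?thesis by (metis countable_empty)
 next
  case False
  thus ?thesis using open_U connected_U iterate_holomorphic
   by (intro holomorphic_countable_zeros holomorphic_intros) (auto intro: fs)
 qed
 hence "countable (\<Union>n\<in>{1..}. {z \<in> U. (g ^^ n) z - z = 0})" by (intro countable_UN) auto
 moreover obtain x0 where "x0 \<in> A" using A(3) by blast
 moreover obtain r where r: "r > 0" "ball x0 r \<subseteq> A" using openE [OF A(1) \<open>x0 \<in> A\<close>] by blast
 ultimately obtain x where "x \<in> ball x0 r" "x \<notin> (\<Union>n\<in>{1..}. {z \<in> U. (g ^^ n) z - z = 0})"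
  using ball_minus_countable_nonempty by blast
 thus thesis using that [of x] r A(2) by force
qed

text \<open>The invariant form is a limit of averages of the pullbacks of \<open>dz / (z - a)\<close>.\<close>

lemma invariant_form:
 assumes N: "open N" "\<And>z. z \<in> N \<Longrightarrow> cball z r \<subseteq> C" "r > 0" "C \<subseteq> U"
  and K: "compact K" "K \<subseteq> U" "\<And>n z. z \<in> C \<Longrightarrow> (g ^^ n) z \<in> K"
  and a: "a \<notin> U" and near: "\<And>z. z \<in> K \<Longrightarrow> norm ((g ^^ l) z - z) < norm (z - a)"
 obtains h where "h holomorphic_on N"
  "\<And>j z. z \<in> N \<Longrightarrow> (g ^^ (l * j)) z \<in> N \<Longrightarrow> h ((g ^^ (l * j)) z) * deriv (g ^^ (l * j)) z = h z"
  "\<And>\<gamma>. valid_path \<gamma> \<Longrightarrow> path_image \<gamma> \<subseteq> N \<Longrightarrow> pathfinish \<gamma> = pathstart \<gamma> \<Longrightarrow>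
   contour_integral \<gamma> h = 2 * pi * \<i> * winding_number \<gamma> a"
proof -
 define S where "S j = g ^^ (l * j)" for j
 have S_add: "S (i + j) z = S i (S j z)" for i j z by (simp add: S_def funpow_add distrib_left)
 have N_C: "z \<in> C" if "z \<in> N" for z using N(2) [OF that] N(3) centre_in_cball [of z r] by (auto simp del: centre_in_cball)
 have NU: "N \<subseteq> U" using N_C N(4) by blast
 have SK: "S j z \<in> K" if "z \<in> C" for j z unfolding S_def by (rule K(3) [OF that])
 have Shol: "S j holomorphic_on A" if "A \<subseteq> U" for j A
  unfolding S_def using iterate_holomorphic that by (rule holomorphic_on_subset)
 have dS_add: "deriv (S (i + j)) z = deriv (S i) (S j z) * deriv (S j) z" if "z \<in> U" for i j z
  using deriv_iterate_add [OF that, of "l * i" "l * j"] by (simp add: S_def distrib_left)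
 have SU: "S j z \<in> U" if "z \<in> U" for j z unfolding S_def by (rule iterate_in [OF that])
 obtain B where B: "\<And>z. z \<in> K \<Longrightarrow> norm z \<le> B" using compact_imp_bounded [OF K(1)] bounded_iff by metis
 have "a \<notin> K" using a K(2) by blast
 then obtain \<eta> where \<eta>: "\<eta> > 0" "\<And>z. z \<in> K \<Longrightarrow> \<eta> \<le> dist a z"
  using separate_point_closed [OF compact_imp_closed [OF K(1)]] by blast
 \<comment> \<open>The coefficient of the pullback of dz / (z - a) under \<open>S j\<close>.\<close>
 define A where "A j z = deriv (S j) z / (S j z - a)" for j z
 have ne: "S j z \<noteq> a" if "z \<in> C" for j z using SK [OF that] \<open>a \<notin> K\<close> by blast
 define M where "M = B / r / \<eta>"
 have A_le: "norm (A j z) \<le> M" if z: "z \<in> N" for j z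
 proof -
  have "norm ((deriv ^^ 1) (S j) z) \<le> fact 1 * B / r ^ 1"
  proof (rule Cauchy_inequality)
   show "S j holomorphic_on ball z r" by (rule Shol) (use N(2) [OF z] N(4) ball_subset_cball in blast)
   show "continuous_on (cball z r) (S j)"
    by (rule holomorphic_on_imp_continuous_on [OF Shol]) (use N(2) [OF z] N(4) in blast)
   show "norm (S j x) \<le> B" if "norm (z - x) = r" for x
   proof -
    have "x \<in> cball z r" using that by (simp add: dist_norm)
    thus ?thesis using N(2) [OF z] SK B by blast
   qed
  qed (rule N(3))
  hence 1: "norm (deriv (S j) z) \<le> B / r" by simp
  have "\<eta> \<le> norm (S j z - a)" using \<eta>(2) [OF SK [OF N_C [OF z]]] by (simp add: dist_norm norm_minus_commute)
  hence "norm (deriv (S j) z) / norm (S j z - a) \<le> (B / r) / \<eta>"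
   using 1 \<eta>(1) order_trans [OF norm_ge_zero 1] by (intro frac_le) auto
  thus ?thesis by (simp add: A_def M_def norm_divide)
 qed
 have A_hol: "A j holomorphic_on N" for j
  unfolding A_def using ne N_C by (intro holomorphic_intros Shol holomorphic_deriv N(1) NU) auto
 have A_shift: "A i (S j z) * deriv (S j) z = A (i + j) z" if "z \<in> U" for i j z
  using dS_add [OF that] by (simp add: A_def S_add)
 define H where "H n z = (\<Sum>i<Suc n. A i z) / of_nat (Suc n)" for n z
 have H_hol: "H n holomorphic_on N" for n unfolding H_def using A_hol by (intro holomorphic_intros) auto
 have H_le: "norm (H n z) \<le> M" if z: "z \<in> N" for n z
 proof -
  have "norm (\<Sum>i<Suc n. A i z) \<le> of_nat (card {..<Suc n}) * M" by (rule sum_norm_bound) (rule A_le [OF z])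
  thus ?thesis by (simp add: H_def norm_divide divide_le_eq mult.commute del: of_nat_Suc sum.lessThan_Suc)
 qed
 obtain h \<phi> where h: "h holomorphic_on N" "strict_mono (\<phi> :: nat \<Rightarrow> nat)"
  "\<And>x. x \<in> N \<Longrightarrow> (\<lambda>n. H (\<phi> n) x) \<longlonglongrightarrow> h x"
  "\<And>K. compact K \<Longrightarrow> K \<subseteq> N \<Longrightarrow> uniform_limit K (H \<circ> \<phi>) h sequentially"
 proof (rule Montel [OF N(1), of "range H" H])
  show "\<exists>B. \<forall>h\<in>range H. \<forall>z\<in>K. norm (h z) \<le> B" if "compact K" "K \<subseteq> N" for K using H_le that(2) by blast
 qed (use H_hol in auto)
 show thesis
 proof (rule that [OF h(1)])
  fix j z assume z: "z \<in> N" "(g ^^ (l * j)) z \<in> N"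
  have zU: "z \<in> U" using z NU by blast
  \<comment> \<open>A shift by one replaces a single term of the sum, which costs at most
    \<open>2 * M\<close>. After division by the number of terms this tends to 0, and the averages
    become invariant.\<close>
  have shift: "norm ((\<Sum>i<n. A (i + j) z) - (\<Sum>i<n. A i z)) \<le> of_nat j * (2 * M)" for n j
  proof (induction j)
   case (Suc j)
   have "(\<Sum>i<n. A (i + Suc j) z) - (\<Sum>i<n. A (i + j) z) = A (n + j) z - A (0 + j) z"
    using sum_lessThan_telescope [of "\<lambda>i. A (i + j) z" n] by (simp add: sum_subtractf)
   moreover have "norm (A (n + j) z - A (0 + j) z) \<le> M + M"
    using A_le [OF z(1)] by (intro norm_triangle_le_diff add_mono)
   ultimately have "norm (((\<Sum>i<n. A (i + j) z) - (\<Sum>i<n. A i z)) + ((\<Sum>i<n. A (i + Suc j) z) - (\<Sum>i<n. A (i + j) z)))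
     \<le> of_nat j * (2 * M) + (M + M)"
    using Suc by (intro norm_triangle_le add_mono) simp_all
   thus ?case by (simp add: algebra_simps)
  qed simp
  have "(\<lambda>n. H (\<phi> n) (S j z) * deriv (S j) z - H (\<phi> n) z) \<longlonglongrightarrow> h (S j z) * deriv (S j) z - h z"
   using h(3) [OF z(1)] h(3) [OF z(2)] by (intro tendsto_intros) (auto simp: S_def)
  moreover have "(\<lambda>n. H n (S j z) * deriv (S j) z - H n z) \<longlonglongrightarrow> 0"
  proof (rule Lim_null_comparison)
   show "\<forall>\<^sub>F n in sequentially. norm (H n (S j z) * deriv (S j) z - H n z) \<le> of_nat j * (2 * M) / of_nat (Suc n)"
   proof (rule always_eventually, rule allI)
    fix n
    have "H n (S j z) * deriv (S j) z = (\<Sum>i<Suc n. A (i + j) z) / of_nat (Suc n)"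
     unfolding H_def using A_shift [OF zU] by (simp add: sum_distrib_right del: of_nat_Suc sum.lessThan_Suc)
    hence "H n (S j z) * deriv (S j) z - H n z = ((\<Sum>i<Suc n. A (i + j) z) - (\<Sum>i<Suc n. A i z)) / of_nat (Suc n)"
     by (simp only: H_def diff_divide_distrib)
    thus "norm (H n (S j z) * deriv (S j) z - H n z) \<le> of_nat j * (2 * M) / of_nat (Suc n)"
     using divide_right_mono [OF shift [where n = "Suc n" and j = j], of "real (Suc n)"]
      by (simp add: norm_divide del: of_nat_Suc sum.lessThan_Suc)
   qed
   show "(\<lambda>n. of_nat j * (2 * M) / of_nat (Suc n)) \<longlonglongrightarrow> 0"
    using tendsto_mult_right_zero [OF LIMSEQ_inverse_real_of_nat, of "of_nat j * (2 * M)"] by (simp add: divide_inverse)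
  qed
  hence "((\<lambda>n. H n (S j z) * deriv (S j) z - H n z) \<circ> \<phi>) \<longlonglongrightarrow> 0" by (rule LIMSEQ_subseq_LIMSEQ [OF _ h(2)])
  ultimately have "h (S j z) * deriv (S j) z - h z = 0" by (intro LIMSEQ_unique) (auto simp: o_def)
  thus "h ((g ^^ (l * j)) z) * deriv (g ^^ (l * j)) z = h z" by (simp add: S_def)
 next
  fix \<gamma> assume \<gamma>: "valid_path \<gamma>" "path_image \<gamma> \<subseteq> N" "pathfinish \<gamma> = pathstart \<gamma>"
  \<comment> \<open>By \<open>near\<close>, each application of \<open>g ^^ l\<close> moves the
    points of the loop by less than their distance from \<open>a\<close>, so the winding number does
    not change.\<close>
  have wind: "winding_number (S j \<circ> \<gamma>) a = winding_number \<gamma> a" for j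
  proof (induction j)
   case (Suc j)
   have path: "path (S i \<circ> \<gamma>)" for i
    using valid_path_compose_holomorphic [OF \<gamma>(1) Shol [OF order_refl] open_U] \<gamma>(2) NU valid_path_imp_path by blast
   have "winding_number (S (Suc j) \<circ> \<gamma>) a = winding_number (S j \<circ> \<gamma>) a"
   proof (rule winding_number_nearby_loops_eq [OF path path])
    fix t :: real assume "t \<in> {0..1}"
    hence "\<gamma> t \<in> N" using \<gamma>(2) by (auto simp: path_image_def)
    hence "S j (\<gamma> t) \<in> K" by (rule SK [OF N_C])
    hence "norm ((g ^^ l) (S j (\<gamma> t)) - S j (\<gamma> t)) < norm (S j (\<gamma> t) - a)" by (rule near)
    moreover have "(g ^^ l) (S j (\<gamma> t)) = S (Suc j) (\<gamma> t)" by (simp add: S_def funpow_add)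
    ultimately show "norm ((S (Suc j) \<circ> \<gamma>) t - (S j \<circ> \<gamma>) t) < norm ((S j \<circ> \<gamma>) t - a)" by simp
   qed (use \<gamma>(3) in \<open>auto simp: pathfinish_def pathstart_def\<close>)
   thus ?case using Suc by (rule trans)
  qed (simp add: S_def o_def)
  have \<gamma>U: "path_image \<gamma> \<subseteq> U" using \<gamma>(2) NU by blast
  have "contour_integral \<gamma> (A j) = 2 * pi * \<i> * winding_number \<gamma> a" for j
  proof -
   have "S j z \<noteq> a" if "z \<in> path_image \<gamma>" for z using \<gamma>(2) that by (intro ne N_C) blast
   from contour_integral_log_deriv [OF Shol [OF order_refl] open_U \<gamma>(1) \<gamma>U this]
   show ?thesis by (simp only: A_def [abs_def] wind)
  qed
  moreover have Aint: "A j contour_integrable_on \<gamma>" for j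
   using contour_integrable_holomorphic_simple [OF A_hol N(1) \<gamma>(1,2)] .
  ultimately have Hint: "contour_integral \<gamma> (H n) = 2 * pi * \<i> * winding_number \<gamma> a" for n
  proof -
   have "contour_integral \<gamma> (H n) = contour_integral \<gamma> (\<lambda>z. \<Sum>i<Suc n. A i z) / of_nat (Suc n)"
    unfolding H_def [abs_def] by (rule contour_integral_div) (intro contour_integrable_sum Aint finite_lessThan)
   also have "contour_integral \<gamma> (\<lambda>z. \<Sum>i<Suc n. A i z) = (\<Sum>i<Suc n. contour_integral \<gamma> (A i))"
    by (intro contour_integral_sum Aint finite_lessThan)
   finally show ?thesis using \<open>\<And>j. contour_integral \<gamma> (A j) = 2 * pi * \<i> * winding_number \<gamma> a\<close>
    by (simp del: of_nat_Suc sum.lessThan_Suc)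
  qed
  have "compact (path_image \<gamma>)" by (rule compact_valid_path_image [OF \<gamma>(1)])
  then obtain e where e: "e > 0" "(\<Union>x\<in>path_image \<gamma>. cball x e) \<subseteq> N"
   using compact_subset_open_imp_cball_epsilon_subset [OF _ N(1) \<gamma>(2)] by blast
  define N' where "N' = (\<Union>x\<in>path_image \<gamma>. ball x e)"
  have N': "open N'" "path_image \<gamma> \<subseteq> N'" "N' \<subseteq> (\<Union>x\<in>path_image \<gamma>. cball x e)" "N' \<subseteq> N"
  proof -
   show "open N'" by (auto simp: N'_def)
   show "path_image \<gamma> \<subseteq> N'" using e(1) by (auto simp: N'_def)
   show "N' \<subseteq> (\<Union>x\<in>path_image \<gamma>. cball x e)" unfolding N'_def using ball_subset_cball by blast
   thus "N' \<subseteq> N" using e(2) by blast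
  qed
  obtain L where L: "L > 0" "\<And>f B. f holomorphic_on N' \<Longrightarrow> (\<And>z. z \<in> N' \<Longrightarrow> norm (f z) \<le> B) \<Longrightarrow> norm (contour_integral \<gamma> f) \<le> L * B"
   using contour_integral_bound_exists [OF N'(1) \<gamma>(1) N'(2)] by blast
  have ul: "uniform_limit (\<Union>x\<in>path_image \<gamma>. cball x e) (H \<circ> \<phi>) h sequentially"
   by (rule h(4) [OF compact_minkowski_sum_cball [OF compact_valid_path_image [OF \<gamma>(1)]] e(2)])
  have hint: "h contour_integrable_on \<gamma>" and Hi: "H n contour_integrable_on \<gamma>" for n
   using contour_integrable_holomorphic_simple [OF _ N(1) \<gamma>(1,2)] h(1) H_hol by blast+
  have "norm (2 * pi * \<i> * winding_number \<gamma> a - contour_integral \<gamma> h) \<le> \<epsilon>" if \<epsilon>: "\<epsilon> > 0" for \<epsilon>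
  proof -
   have "\<epsilon> / L > 0" using \<epsilon> L(1) by simp
   hence "\<forall>\<^sub>F n in sequentially. \<forall>z\<in>(\<Union>x\<in>path_image \<gamma>. cball x e). dist ((H \<circ> \<phi>) n z) (h z) < \<epsilon> / L"
    using ul unfolding uniform_limit_iff by blast
   then obtain n where n: "\<And>z. z \<in> (\<Union>x\<in>path_image \<gamma>. cball x e) \<Longrightarrow> dist (H (\<phi> n) z) (h z) < \<epsilon> / L"
    unfolding eventually_sequentially by force
   have "norm (contour_integral \<gamma> (\<lambda>z. H (\<phi> n) z - h z)) \<le> L * (\<epsilon> / L)"
   proof (rule L(2))
    show "(\<lambda>z. H (\<phi> n) z - h z) holomorphic_on N'"
     using H_hol h(1) N'(4) by (intro holomorphic_intros) (blast intro: holomorphic_on_subset)+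
    show "norm (H (\<phi> n) z - h z) \<le> \<epsilon> / L" if "z \<in> N'" for z using n [of z] N'(3) that by (force simp: dist_norm)
   qed
   thus ?thesis using contour_integral_diff [OF Hi hint, of "\<phi> n"] Hint L(1) by simp
  qed
  hence "norm (2 * pi * \<i> * winding_number \<gamma> a - contour_integral \<gamma> h) \<le> 0" by (rule field_le_epsilon) simp
  thus "contour_integral \<gamma> h = 2 * pi * \<i> * winding_number \<gamma> a" by simp
 qed
qed

text \<open>Invariance of h dz under the powers of \<open>g ^^ l\<close>, demanded only where the
  image point lies in \<open>N\<close> again, because \<open>N\<close> itself need not be
  invariant.\<close>

definition invariant_on :: "nat \<Rightarrow> complex set \<Rightarrow> (complex \<Rightarrow> complex) \<Rightarrow> bool" where
 "invariant_on l N h \<longleftrightarrow> h holomorphic_on N \<and>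
  (\<forall>j z. z \<in> N \<longrightarrow> (g ^^ (l * j)) z \<in> N \<longrightarrow> h ((g ^^ (l * j)) z) * deriv (g ^^ (l * j)) z = h z)"

text \<open>The factor is read off at an aperiodic point \<open>x\<close>. Then
  \<open>h1 - c h2\<close> vanishes at all returns of \<open>x\<close> to \<open>N\<close>, and
  these accumulate at \<open>x\<close> without being equal to it.\<close>

lemma ratio_constant:
 assumes N: "open N" "connected N" "N \<subseteq> U" and l: "1 \<le> l"
  and h: "invariant_on l N h1" "invariant_on l N h2" and z0: "z0 \<in> N" "h2 z0 \<noteq> 0"
 obtains c where "\<And>z. z \<in> N \<Longrightarrow> h1 z = c * h2 z"
proof -
 have hol: "h1 holomorphic_on N" "h2 holomorphic_on N" using h by (auto simp: invariant_on_def)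
 have "continuous_on N h2" by (rule holomorphic_on_imp_continuous_on [OF hol(2)])
 hence "open (N \<inter> h2 -` (- {0}))" by (rule continuous_open_preimage [OF _ N(1)]) auto
 then obtain x where x: "x \<in> N" "h2 x \<noteq> 0" "\<And>n. 1 \<le> n \<Longrightarrow> (g ^^ n) x \<noteq> x"
 proof (rule aperiodic_point [of "N \<inter> h2 -` (- {0})"])
  show "N \<inter> h2 -` (- {0}) \<noteq> {}" using z0 by blast
 qed (use N(3) in auto)
 define c where "c = h1 x / h2 x"
 define \<psi> where "\<psi> z = h1 z - c * h2 z" for z
 have "x \<in> U" using x(1) N(3) by blast
 have zero: "\<psi> ((g ^^ (l * j)) x) = 0" if "(g ^^ (l * j)) x \<in> N" for j
 proof -
  define D where "D = deriv (g ^^ (l * j)) x"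
  have "D \<noteq> 0" unfolding D_def by (rule iterate_deriv_nonzero [OF \<open>x \<in> U\<close>])
  have "h1 ((g ^^ (l * j)) x) * D = h1 x" "h2 ((g ^^ (l * j)) x) * D = h2 x"
   using h x(1) that unfolding invariant_on_def D_def by blast+
  hence "\<psi> ((g ^^ (l * j)) x) * D = h1 x - c * h2 x" by (simp add: \<psi>_def algebra_simps)
  thus ?thesis using x(2) \<open>D \<noteq> 0\<close> by (simp add: c_def)
 qed
 have "x islimpt {z \<in> N. \<psi> z = 0}" unfolding islimpt_approachable
 proof (intro allI impI)
  fix e :: real assume "e > 0"
  obtain r where r: "r > 0" "ball x r \<subseteq> N" using openE [OF N(1) x(1)] by blast
  have "\<forall>\<^sub>F j in sequentially. \<forall>z\<in>{x}. dist ((g ^^ (l * k j)) z) z < min e r"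
   by (rule returns_power) (use \<open>x \<in> U\<close> \<open>e > 0\<close> r(1) in auto)
  moreover have "\<forall>\<^sub>F j in sequentially. 1 \<le> k j" using k_at_top by (simp add: filterlim_at_top)
  ultimately have "\<forall>\<^sub>F j in sequentially. (\<forall>z\<in>{x}. dist ((g ^^ (l * k j)) z) z < min e r) \<and> 1 \<le> k j"
   by (rule eventually_conj)
  then obtain j where j: "dist ((g ^^ (l * k j)) x) x < min e r" "1 \<le> k j"
   unfolding eventually_sequentially by blast
  have "1 \<le> l * k j" using j(2) l by simp
  hence "(g ^^ (l * k j)) x \<noteq> x" by (rule x(3))
  moreover have "(g ^^ (l * k j)) x \<in> N" using j(1) r(2) by (auto simp: dist_commute)
  ultimately show "\<exists>y\<in>{z \<in> N. \<psi> z = 0}. y \<noteq> x \<and> dist y x < e" using zero j(1) by auto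
 qed
 moreover have "\<psi> holomorphic_on N" unfolding \<psi>_def by (intro holomorphic_intros hol)
 ultimately have "\<psi> z = 0" if "z \<in> N" for z
  using analytic_continuation [of \<psi> N "{z \<in> N. \<psi> z = 0}" x z] N(1,2) x(1) that by blast
 thus thesis using that [of c] by (simp add: \<psi>_def)
qed

text \<open>A late return time moves the points of a compact set by less than their distance from
  the complement of \<open>U\<close>; one such time \<open>l\<close> serves for all \<open>a\<close>
  outside \<open>U\<close>.\<close>

lemma invariant_form_nbhd:
 assumes K0: "compact K0" "K0 \<subseteq> U"
 obtains N l where "open N" "connected N" "K0 \<subseteq> N" "closure N \<subseteq> U" "1 \<le> l"
  "\<And>a. a \<notin> U \<Longrightarrow> \<exists>h. invariant_on l N h \<and> (\<forall>\<gamma>. valid_path \<gamma> \<and> path_image \<gamma> \<subseteq> N \<and> pathfinish \<gamma> = pathstart \<gamma> \<longrightarrow>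
   contour_integral \<gamma> h = 2 * pi * \<i> * winding_number \<gamma> a)"
proof -
 obtain N where N: "open N" "connected N" "K0 \<subseteq> N" "compact (closure N)" "closure N \<subseteq> U"
  using relatively_compact_connected_nbhd [OF open_U connected_U K0] by blast
 obtain r C K where K: "r > 0" "\<And>z. z \<in> closure N \<Longrightarrow> cball z r \<subseteq> C" "C \<subseteq> U" "compact K" "K \<subseteq> U"
  "\<And>n z. z \<in> C \<Longrightarrow> (g ^^ n) z \<in> K" by (rule compact_thickening [OF N(4,5)]) (rule that; assumption)
 obtain e where e: "e > 0" "(\<Union>x\<in>K. cball x e) \<subseteq> U"
  using compact_subset_open_imp_cball_epsilon_subset [OF K(4) open_U K(5)] by blast
 have "\<forall>\<^sub>F j in sequentially. (\<forall>z\<in>K. dist ((g ^^ k j) z) z < e) \<and> 1 \<le> k j"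
  using returns [OF K(4,5) e(1)] k_at_top by (intro eventually_conj) (auto simp: filterlim_at_top)
 then obtain j where j: "\<And>z. z \<in> K \<Longrightarrow> dist ((g ^^ k j) z) z < e" "1 \<le> k j" unfolding eventually_sequentially by blast
 have NC: "cball z r \<subseteq> C" if "z \<in> N" for z using K(2) closure_subset [of N] that by blast
 have "\<exists>h. invariant_on (k j) N h \<and> (\<forall>\<gamma>. valid_path \<gamma> \<and> path_image \<gamma> \<subseteq> N \<and> pathfinish \<gamma> = pathstart \<gamma> \<longrightarrow>
   contour_integral \<gamma> h = 2 * pi * \<i> * winding_number \<gamma> a)" if a: "a \<notin> U" for a
 proof -
  have near: "norm ((g ^^ k j) z - z) < norm (z - a)" if "z \<in> K" for z
  proof -
   have "a \<notin> cball z e" using e(2) a that by blast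
   thus ?thesis using j(1) [OF that] by (simp add: dist_norm)
  qed
  show ?thesis by (rule invariant_form [OF N(1) NC K(1,3-6) a near]) (auto simp: invariant_on_def)
 qed
 with N(1,2,3,5) j(2) that show thesis by blast
qed

text \<open>The invariant forms belonging to \<open>a\<close> and to \<open>b\<close> are
  proportional near both loops, unless the second one is zero, and their periods are the winding
  numbers.\<close>

lemma winding_numbers_proportional:
 assumes \<gamma>: "valid_path \<gamma>" "path_image \<gamma> \<subseteq> U" "pathfinish \<gamma> = pathstart \<gamma>"
  and \<beta>: "valid_path \<beta>" "path_image \<beta> \<subseteq> U" "pathfinish \<beta> = pathstart \<beta>"
  and ab: "a \<notin> U" "b \<notin> U"
 shows "winding_number \<gamma> a * winding_number \<beta> b = winding_number \<beta> a * winding_number \<gamma> b"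
proof -
 have "compact (path_image \<gamma> \<union> path_image \<beta>)" "path_image \<gamma> \<union> path_image \<beta> \<subseteq> U"
  using \<gamma>(1,2) \<beta>(1,2) compact_valid_path_image by auto
 then obtain N l where N: "open N" "connected N" "path_image \<gamma> \<union> path_image \<beta> \<subseteq> N" "closure N \<subseteq> U" "1 \<le> l"
  and ex: "\<And>a. a \<notin> U \<Longrightarrow> \<exists>h. invariant_on l N h \<and> (\<forall>\<gamma>. valid_path \<gamma> \<and> path_image \<gamma> \<subseteq> N \<and> pathfinish \<gamma> = pathstart \<gamma> \<longrightarrow>
   contour_integral \<gamma> h = 2 * pi * \<i> * winding_number \<gamma> a)"
  using invariant_form_nbhd by metis
 have NU: "N \<subseteq> U" using N(4) closure_subset by blast
 obtain h1 where h1: "invariant_on l N h1" "contour_integral \<gamma> h1 = 2 * pi * \<i> * winding_number \<gamma> a"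
  "contour_integral \<beta> h1 = 2 * pi * \<i> * winding_number \<beta> a"
  using ex [OF ab(1)] \<gamma> \<beta> N(3) by (metis le_sup_iff)
 obtain h2 where h2: "invariant_on l N h2" "contour_integral \<gamma> h2 = 2 * pi * \<i> * winding_number \<gamma> b"
  "contour_integral \<beta> h2 = 2 * pi * \<i> * winding_number \<beta> b"
  using ex [OF ab(2)] \<gamma> \<beta> N(3) by (metis le_sup_iff)
 show ?thesis
 proof (cases "\<forall>z\<in>N. h2 z = 0")
  case True
  hence "contour_integral \<gamma> h2 = contour_integral \<gamma> (\<lambda>_. 0)" "contour_integral \<beta> h2 = contour_integral \<beta> (\<lambda>_. 0)"
   using N(3) by (auto intro!: contour_integral_eq simp del: contour_integral_0)
  thus ?thesis using h2 by simp
 next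
  case False
  then obtain z0 where "z0 \<in> N" "h2 z0 \<noteq> 0" by blast
  then obtain c where c: "\<And>z. z \<in> N \<Longrightarrow> h1 z = c * h2 z" using ratio_constant [OF N(1,2) NU N(5) h1(1) h2(1)] by blast
  have "contour_integral \<delta> h1 = c * contour_integral \<delta> h2" if \<delta>: "valid_path \<delta>" "path_image \<delta> \<subseteq> N" for \<delta>
  proof -
   have "h2 contour_integrable_on \<delta>"
    using contour_integrable_holomorphic_simple [OF _ N(1) \<delta>] h2(1) by (auto simp: invariant_on_def)
   moreover have "contour_integral \<delta> h1 = contour_integral \<delta> (\<lambda>z. c * h2 z)"
    using c \<delta>(2) by (intro contour_integral_eq) blast
   ultimately show ?thesis by (simp add: contour_integral_lmul)
  qed
  from this [of \<gamma>] this [of \<beta>] have "winding_number \<gamma> a = c * winding_number \<gamma> b" "winding_number \<beta> a = c * winding_number \<beta> b"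
   using h1 h2 \<gamma>(1) \<beta>(1) N(3) by auto
  thus ?thesis by simp
 qed
qed

lemma loop_image:
 assumes "valid_path \<gamma>" "path_image \<gamma> \<subseteq> U" "pathfinish \<gamma> = pathstart \<gamma>"
 shows "valid_path (g ^^ n \<circ> \<gamma>)" "path_image (g ^^ n \<circ> \<gamma>) \<subseteq> U" "pathfinish (g ^^ n \<circ> \<gamma>) = pathstart (g ^^ n \<circ> \<gamma>)"
 using valid_path_compose_holomorphic [OF assms(1) iterate_holomorphic open_U assms(2)] assms(2,3) iterate_in
 by (auto simp: path_image_compose pathstart_def pathfinish_def)

text \<open>For \<open>R = g ^^ k j\<close> close to the identity, the displacement \<open>\<integral> h\<close> from \<open>z\<close> to \<open>R z\<close> does not depend
 on \<open>z\<close>. Since \<open>g\<close> commutes with \<open>R\<close>, the factor by which it multiplies \<open>h\<close> is 1.\<close>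

lemma winding_number_image:
 assumes \<gamma>: "valid_path \<gamma>" "path_image \<gamma> \<subseteq> U" "pathfinish \<gamma> = pathstart \<gamma>" and a: "a \<notin> U"
 shows "winding_number (g \<circ> \<gamma>) a = winding_number \<gamma> a"
proof (rule ccontr)
 assume ne: "winding_number (g \<circ> \<gamma>) a \<noteq> winding_number \<gamma> a"
 have g\<gamma>: "valid_path (g \<circ> \<gamma>)" "path_image (g \<circ> \<gamma>) \<subseteq> U" "pathfinish (g \<circ> \<gamma>) = pathstart (g \<circ> \<gamma>)"
  using loop_image [OF \<gamma>, of 1] by auto
 have cont_g: "continuous_on A g" if "A \<subseteq> U" for A
  using holomorphic_on_imp_continuous_on [OF hol] that continuous_on_subset by blast
 have "compact (path_image \<gamma> \<union> path_image (g \<circ> \<gamma>))" "path_image \<gamma> \<union> path_image (g \<circ> \<gamma>) \<subseteq> U"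
  using \<gamma>(1,2) g\<gamma>(1,2) compact_valid_path_image by auto
 \<comment> \<open>The form lives on \<open>N\<close>; its pullbacks under \<open>g\<close>, and
   under a return close to the identity, live on the smaller \<open>N1\<close>.\<close>
 then obtain N1 where N1: "open N1" "connected N1" "path_image \<gamma> \<union> path_image (g \<circ> \<gamma>) \<subseteq> N1" "compact (closure N1)" "closure N1 \<subseteq> U"
  using relatively_compact_connected_nbhd [OF open_U connected_U] by metis
 have "compact (closure N1 \<union> g ` closure N1)" "closure N1 \<union> g ` closure N1 \<subseteq> U"
  using N1(4,5) cont_g image by (auto intro!: compact_Un compact_continuous_image)
 then obtain N l where N: "open N" "connected N" "closure N1 \<union> g ` closure N1 \<subseteq> N" "closure N \<subseteq> U" "1 \<le> l"
  and ex: "\<And>a. a \<notin> U \<Longrightarrow> \<exists>h. invariant_on l N h \<and> (\<forall>\<gamma>. valid_path \<gamma> \<and> path_image \<gamma> \<subseteq> N \<and> pathfinish \<gamma> = pathstart \<gamma> \<longrightarrow>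
   contour_integral \<gamma> h = 2 * pi * \<i> * winding_number \<gamma> a)"
  using invariant_form_nbhd by metis
 obtain h where h: "invariant_on l N h"
  and per: "\<And>\<gamma>. valid_path \<gamma> \<Longrightarrow> path_image \<gamma> \<subseteq> N \<Longrightarrow> pathfinish \<gamma> = pathstart \<gamma> \<Longrightarrow>
   contour_integral \<gamma> h = 2 * pi * \<i> * winding_number \<gamma> a"
  using ex [OF a] by blast
 have hN: "h holomorphic_on N" using h by (simp add: invariant_on_def)
 have sub: "N1 \<subseteq> N" "N \<subseteq> U" "N1 \<subseteq> U" "N1 \<subseteq> closure N1" using N(3,4) N1(5) closure_subset by blast+
 have gN: "g z \<in> N" if "z \<in> N1" for z using N(3) sub(4) that by blast
 have pull: "invariant_on l N1 (\<lambda>z. h ((g ^^ m) z) * deriv (g ^^ m) z)"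
  if m: "\<And>z. z \<in> N1 \<Longrightarrow> (g ^^ m) z \<in> N" for m
  unfolding invariant_on_def
 proof (intro conjI allI impI)
  have "(h \<circ> g ^^ m) holomorphic_on N1"
  proof (rule holomorphic_on_compose)
   show "(g ^^ m) holomorphic_on N1" using iterate_holomorphic sub(3) by (rule holomorphic_on_subset)
   show "h holomorphic_on (g ^^ m) ` N1" using hN by (rule holomorphic_on_subset) (use m in blast)
  qed
  moreover have "deriv (g ^^ m) holomorphic_on N1"
   using iterate_holomorphic sub(3) N1(1) by (blast intro: holomorphic_deriv holomorphic_on_subset)
  ultimately show "(\<lambda>z. h ((g ^^ m) z) * deriv (g ^^ m) z) holomorphic_on N1"
   by (simp add: holomorphic_on_mult o_def)
  fix j z assume z: "z \<in> N1" "(g ^^ (l * j)) z \<in> N1"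
  have zU: "z \<in> U" using z(1) sub(3) by blast
  have comm: "(g ^^ m) ((g ^^ (l * j)) z) = (g ^^ (l * j)) ((g ^^ m) z)"
   by (metis add.commute comp_apply funpow_add)
  have "h ((g ^^ m) ((g ^^ (l * j)) z)) * (deriv (g ^^ m) ((g ^^ (l * j)) z) * deriv (g ^^ (l * j)) z)
    = h ((g ^^ (l * j)) ((g ^^ m) z)) * (deriv (g ^^ (l * j)) ((g ^^ m) z) * deriv (g ^^ m) z)"
   using deriv_iterate_add [OF zU, of m "l * j"] deriv_iterate_add [OF zU, of "l * j" m] comm by (simp add: add.commute)
  also have "\<dots> = h ((g ^^ m) z) * deriv (g ^^ m) z"
   using h m [OF z(1)] m [OF z(2)] comm unfolding invariant_on_def by (simp add: mult.assoc [symmetric])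
  finally show "h ((g ^^ m) ((g ^^ (l * j)) z)) * deriv (g ^^ m) ((g ^^ (l * j)) z) * deriv (g ^^ (l * j)) z
    = h ((g ^^ m) z) * deriv (g ^^ m) z" by (simp add: mult.assoc)
 qed
 have h': "invariant_on l N1 h" using h sub(1) unfolding invariant_on_def by (blast intro: holomorphic_on_subset)
 have winding_m: "winding_number (g ^^ m \<circ> \<beta>) a = c * winding_number \<beta> a"
  if m: "\<And>z. z \<in> N1 \<Longrightarrow> (g ^^ m) z \<in> N" and c: "\<And>z. z \<in> N1 \<Longrightarrow> h ((g ^^ m) z) * deriv (g ^^ m) z = c * h z"
   and \<beta>: "valid_path \<beta>" "path_image \<beta> \<subseteq> N1" "pathfinish \<beta> = pathstart \<beta>" for m c \<beta>
 proof -
  have \<beta>U: "path_image \<beta> \<subseteq> U" using \<beta>(2) sub(3) by blast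
  have "contour_integral (g ^^ m \<circ> \<beta>) h = 2 * pi * \<i> * winding_number (g ^^ m \<circ> \<beta>) a"
   using loop_image [OF \<beta>(1) \<beta>U \<beta>(3), of m] m \<beta>(2) by (intro per) (auto simp: path_image_compose)
  moreover have "contour_integral (g ^^ m \<circ> \<beta>) h = contour_integral \<beta> (\<lambda>z. h ((g ^^ m) z) * deriv (g ^^ m) z)"
   by (rule contour_integral_pullback [OF iterate_holomorphic open_U \<beta>(1) \<beta>U])
  moreover have "\<dots> = contour_integral \<beta> (\<lambda>z. c * h z)" using c \<beta>(2) by (intro contour_integral_eq) blast
  moreover have "\<dots> = c * contour_integral \<beta> h"
   using contour_integrable_holomorphic_simple [OF hN N(1) \<beta>(1)] \<beta>(2) sub(1) by (intro contour_integral_lmul) blast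
  moreover have "contour_integral \<beta> h = 2 * pi * \<i> * winding_number \<beta> a" using \<beta> sub(1) by (intro per) auto
  ultimately show ?thesis by simp
 qed
 have nz: "\<exists>z\<in>N1. h z \<noteq> 0"
 proof (rule ccontr)
  assume "\<not> (\<exists>z\<in>N1. h z \<noteq> 0)"
  hence "contour_integral \<gamma> h = contour_integral \<gamma> (\<lambda>_. 0)" "contour_integral (g \<circ> \<gamma>) h = contour_integral (g \<circ> \<gamma>) (\<lambda>_. 0)"
   using N1(3) by (auto intro!: contour_integral_eq simp del: contour_integral_0)
  moreover have "contour_integral \<gamma> h = 2 * pi * \<i> * winding_number \<gamma> a" "contour_integral (g \<circ> \<gamma>) h = 2 * pi * \<i> * winding_number (g \<circ> \<gamma>) a"
   using per \<gamma> g\<gamma> N1(3) sub(1) by auto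
  ultimately show False using ne by simp
 qed
 then obtain z1 where z1: "z1 \<in> N1" "h z1 \<noteq> 0" by blast
 have inv1: "invariant_on l N1 (\<lambda>z. h (g z) * deriv g z)" using pull [of 1] gN by simp
 \<comment> \<open>Pulling back by \<open>g\<close> multiplies the form, hence also its periods, by
   \<open>\<nu>\<close>. By the assumption to be refuted this factor is not 1.\<close>
 obtain \<nu> where \<nu>: "\<And>z. z \<in> N1 \<Longrightarrow> h (g z) * deriv g z = \<nu> * h z"
  by (rule ratio_constant [OF N1(1,2) sub(3) N(5) inv1 h' z1]) (rule that)
 have "winding_number (g \<circ> \<gamma>) a = \<nu> * winding_number \<gamma> a" using winding_m [of 1 \<nu> \<gamma>] gN \<nu> \<gamma> N1(3) by simp
 hence \<nu>1: "\<nu> \<noteq> 1" using ne by auto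
 \<comment> \<open>An aperiodic \<open>z0\<close> is wanted at which \<open>h\<close> is nonzero and
   for which \<open>z0\<close> and \<open>g z0\<close> both lie in \<open>N1\<close>; the starting
   point of the loop shows that \<open>W\<close> is not empty.\<close>
 define W where "W = N1 \<inter> g -` N1"
 have oW: "open W" unfolding W_def by (rule continuous_open_preimage [OF cont_g [OF sub(3)] N1(1,1)])
 have "pathstart \<gamma> \<in> W"
 proof -
  have "pathstart \<gamma> \<in> N1" "pathstart (g \<circ> \<gamma>) \<in> N1" using N1(3) pathstart_in_path_image by blast+
  thus ?thesis by (simp add: W_def pathstart_compose)
 qed
 have "\<exists>z\<in>W. h z \<noteq> 0"
 proof (rule ccontr)
  assume "\<not> (\<exists>z\<in>W. h z \<noteq> 0)"
  hence "\<And>z. z \<in> W \<Longrightarrow> h z = 0" by blast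
  moreover have "pathstart \<gamma> islimpt W" using oW \<open>pathstart \<gamma> \<in> W\<close> interior_limit_point interior_open by metis
  moreover have "h holomorphic_on N1" using hN sub(1) by (rule holomorphic_on_subset)
  ultimately have "h z1 = 0"
   using analytic_continuation [of h N1 W "pathstart \<gamma>" z1] N1(1,2) \<open>pathstart \<gamma> \<in> W\<close> z1(1) by (auto simp: W_def)
  thus False using z1(2) by simp
 qed
 moreover have "open (W \<inter> h -` (- {0}))"
 proof (rule continuous_open_preimage [OF _ oW])
  show "continuous_on W h"
   using holomorphic_on_imp_continuous_on [OF hN] by (rule continuous_on_subset) (use sub(1) in \<open>auto simp: W_def\<close>)
 qed auto
 ultimately have W: "open (W \<inter> h -` (- {0}))" "W \<inter> h -` (- {0}) \<subseteq> U" "W \<inter> h -` (- {0}) \<noteq> {}"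
  using sub(3) by (auto simp: W_def)
 obtain z0 where z0': "z0 \<in> W \<inter> h -` (- {0})" and z0_aper: "\<And>n. 1 \<le> n \<Longrightarrow> (g ^^ n) z0 \<noteq> z0"
  by (rule aperiodic_point [OF W]) (rule that)
 from z0' have z0: "z0 \<in> N1" "g z0 \<in> N1" "h z0 \<noteq> 0" by (auto simp: W_def)
 obtain r where r: "r > 0" "(\<Union>x\<in>closure N1. cball x r) \<subseteq> N"
  using compact_subset_open_imp_cball_epsilon_subset [OF N1(4) N(1)] N(3) by blast
 have rN: "ball z r \<subseteq> N" if "z \<in> N1" for z using r(2) sub(4) that ball_subset_cball by blast
 obtain H' where H': "\<And>y. y \<in> ball (g z0) r \<Longrightarrow> (H' has_field_derivative h y) (at y within ball (g z0) r)"
  using holomorphic_convex_primitive' [OF convex_ball open_ball holomorphic_on_subset [OF hN rN [OF z0(2)]]] by blast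
 have "z0 \<in> g -` ball (g z0) r \<inter> N1" using r(1) z0 by simp
 moreover have "open (g -` ball (g z0) r \<inter> N1)"
  using continuous_open_preimage [OF cont_g [OF sub(3)] N1(1) open_ball] by (simp add: Int_commute)
 ultimately obtain r1 where r1: "r1 > 0" "ball z0 r1 \<subseteq> g -` ball (g z0) r \<inter> N1" using openE by blast
 have hb: "h holomorphic_on ball z0 r1" using hN by (rule holomorphic_on_subset) (use r1(2) sub(1) in blast)
 obtain H where H: "\<And>y. y \<in> ball z0 r1 \<Longrightarrow> (H has_field_derivative h y) (at y within ball z0 r1)"
  using holomorphic_convex_primitive' [OF convex_ball open_ball hb] by blast
 have Hd: "(H has_field_derivative h y) (at y)" if "y \<in> ball z0 r1" for y
  using H [OF that] at_within_open [OF that] by simp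
 have H'd: "(H' has_field_derivative h y) (at y)" if "y \<in> ball (g z0) r" for y
  using H' [OF that] at_within_open [OF that] by simp
 have "H holomorphic_on ball z0 r1" using H unfolding holomorphic_on_def field_differentiable_def by blast
 moreover have "deriv H z0 \<noteq> 0" using Hd [of z0] r1(1) z0(3) by (simp add: DERIV_imp_deriv)
 ultimately obtain r2 where r2: "r2 > 0" "ball z0 r2 \<subseteq> ball z0 r1" "inj_on H (ball z0 r2)"
  using has_complex_derivative_locally_injective [of H "ball z0 r1" z0] r1(1) by (metis centre_in_ball open_ball)
 \<comment> \<open>\<open>H\<close> and \<open>H'\<close> are primitives of the form around
   \<open>z0\<close> and around \<open>g z0\<close>; they correspond under \<open>g\<close> up to
   the factor \<open>\<nu>\<close> and a constant.\<close>
 obtain c0 where c0: "\<And>z. z \<in> ball z0 r1 \<Longrightarrow> H' (g z) - \<nu> * H z = c0"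
 proof -
  have "(\<lambda>z. H' (g z) - \<nu> * H z) constant_on ball z0 r1"
  proof (rule has_field_derivative_0_imp_constant_on)
   fix z assume z: "z \<in> ball z0 r1"
   have zN1: "z \<in> N1" "g z \<in> ball (g z0) r" using z r1(2) by auto
   have "(g has_field_derivative deriv g z) (at z)" using holomorphic_derivI [OF hol open_U] zN1(1) sub(3) by blast
   hence "((\<lambda>z. H' (g z) - \<nu> * H z) has_field_derivative h (g z) * deriv g z - \<nu> * h z) (at z)"
    by (intro DERIV_diff DERIV_cmult DERIV_chain2 [where f = H' and g = g] H'd [OF zN1(2)] Hd [OF z])
   thus "((\<lambda>z. H' (g z) - \<nu> * H z) has_field_derivative 0) (at z)" using \<nu> [OF zN1(1)] by simp
  qed auto
  thus thesis using that unfolding constant_on_def by blast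
 qed
 obtain e where e: "e > 0" "(\<Union>x\<in>closure N1. cball x e) \<subseteq> U"
  using compact_subset_open_imp_cball_epsilon_subset [OF N1(4) open_U N1(5)] by blast
 define s where "s = min (r / 2) (min r2 e)"
 have s: "s > 0" "s \<le> r / 2" "s \<le> r2" "s \<le> e" using r(1) r2(1) e(1) by (auto simp: s_def)
 have "\<forall>\<^sub>F j in sequentially. (\<forall>z\<in>closure N1. dist ((g ^^ k j) z) z < s) \<and> 1 \<le> k j"
  using returns [OF N1(4,5) s(1)] k_at_top by (intro eventually_conj) (auto simp: filterlim_at_top)
 then obtain j where j: "\<And>z. z \<in> N1 \<Longrightarrow> dist ((g ^^ k j) z) z < s" "1 \<le> k j"
  using sub(4) unfolding eventually_sequentially by blast
 define R where "R = g ^^ k j"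
 have RN: "R z \<in> N" if "z \<in> N1" for z
  using j(1) [OF that] s(2) r(1) rN [OF that] by (auto simp: R_def dist_commute subset_iff)
 obtain \<mu> where \<mu>: "\<And>z. z \<in> N1 \<Longrightarrow> h (R z) * deriv R z = \<mu> * h z"
  using ratio_constant [OF N1(1,2) sub(3) N(5) pull h' z1, of "k j"] RN unfolding R_def by blast
 have wR: "winding_number (R \<circ> \<beta>) a = winding_number \<beta> a"
  if \<beta>: "valid_path \<beta>" "path_image \<beta> \<subseteq> N1" "pathfinish \<beta> = pathstart \<beta>" for \<beta>
 proof (rule winding_number_nearby_loops_eq)
  have \<beta>U: "path_image \<beta> \<subseteq> U" using \<beta>(2) sub(3) by blast
  show "path \<beta>" "path (R \<circ> \<beta>)" "pathfinish (R \<circ> \<beta>) = pathstart (R \<circ> \<beta>)"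
   using loop_image [OF \<beta>(1) \<beta>U \<beta>(3), of "k j"] valid_path_imp_path \<beta>(1) by (auto simp: R_def)
  fix t :: real assume "t \<in> {0..1}"
  hence "\<beta> t \<in> N1" using \<beta>(2) by (auto simp: path_image_def)
  hence "a \<notin> cball (\<beta> t) e" using e(2) a sub(4) by blast
  thus "norm ((R \<circ> \<beta>) t - \<beta> t) < norm (\<beta> t - a)" using j(1) [OF \<open>\<beta> t \<in> N1\<close>] s(4) by (simp add: R_def dist_norm)
 qed (rule \<beta>(3))
 \<comment> \<open>\<open>R\<close> is close to the identity and preserves winding numbers around
   \<open>a\<close>, and at least one of the two loops has a nonzero one.\<close>
 have "\<mu> = 1"
 proof (cases "winding_number \<gamma> a = 0")
  case True
  hence "winding_number (g \<circ> \<gamma>) a \<noteq> 0" using ne by simp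
  moreover have "winding_number (R \<circ> (g \<circ> \<gamma>)) a = \<mu> * winding_number (g \<circ> \<gamma>) a"
   unfolding R_def by (rule winding_m) (use RN \<mu> g\<gamma> N1(3) in \<open>auto simp: R_def\<close>)
  ultimately show ?thesis using wR [of "g \<circ> \<gamma>"] g\<gamma> N1(3) by simp
 next
  case False
  moreover have "winding_number (R \<circ> \<gamma>) a = \<mu> * winding_number \<gamma> a"
   unfolding R_def by (rule winding_m) (use RN \<mu> \<gamma> N1(3) in \<open>auto simp: R_def\<close>)
  ultimately show ?thesis using wR [of \<gamma>] \<gamma> N1(3) by simp
 qed
 have "(\<lambda>z. contour_integral (linepath z (R z)) h) constant_on N1"
 proof (rule displacement_constant [OF N1(1,2) _ hN N(1), of R "r / 2"])
  show "R holomorphic_on N1" unfolding R_def using iterate_holomorphic sub(3) by (rule holomorphic_on_subset)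
  show "dist z (R z) < r / 2" if "z \<in> N1" for z using j(1) [OF that] s(2) by (simp add: R_def dist_commute)
  show "h (R z) * deriv R z = h z" if "z \<in> N1" for z using \<mu> [OF that] \<open>\<mu> = 1\<close> by simp
 qed (use r(1) rN in auto)
 hence D: "contour_integral (linepath z0 (R z0)) h = contour_integral (linepath (g z0) (R (g z0))) h"
  using z0 unfolding constant_on_def by metis
 have z0b: "z0 \<in> ball z0 r2" "R z0 \<in> ball z0 r2" using r2(1) j(1) [OF z0(1)] s(3) by (auto simp: R_def dist_commute)
 have gz0b: "g z0 \<in> ball (g z0) r" "R (g z0) \<in> ball (g z0) r"
  using r(1) j(1) [OF z0(2)] s(2) by (auto simp: R_def dist_commute)
 have "(h has_contour_integral (H (R z0) - H z0)) (linepath z0 (R z0))"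
  using contour_integral_primitive [OF H, of "linepath z0 (R z0)"] closed_segment_subset [OF z0b convex_ball] r2(2) by auto
 hence D1: "contour_integral (linepath z0 (R z0)) h = H (R z0) - H z0" by (rule contour_integral_unique)
 have "(h has_contour_integral (H' (R (g z0)) - H' (g z0))) (linepath (g z0) (R (g z0)))"
  using contour_integral_primitive [OF H', of "linepath (g z0) (R (g z0))"] closed_segment_subset [OF gz0b convex_ball] by auto
 hence D2: "contour_integral (linepath (g z0) (R (g z0))) h = H' (R (g z0)) - H' (g z0)" by (rule contour_integral_unique)
 \<comment> \<open>As \<open>g\<close> commutes with \<open>R\<close>, it carries the displacement
   at \<open>z0\<close> to that at \<open>g z0\<close>, with factor \<open>\<nu>\<close>. The two
   are equal, and nonzero because \<open>z0\<close> is aperiodic and \<open>H\<close> is injective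
   near it.\<close>
 have "R (g z0) = g (R z0)" unfolding R_def by (metis funpow_swap1)
 hence "H' (R (g z0)) - H' (g z0) = \<nu> * (H (R z0) - H z0)"
 proof -
  have "z0 \<in> ball z0 r1" "R z0 \<in> ball z0 r1" using z0b r2(2) by blast+
  hence "H' (g z0) - \<nu> * H z0 = c0" "H' (g (R z0)) - \<nu> * H (R z0) = c0" using c0 by blast+
  thus ?thesis unfolding \<open>R (g z0) = g (R z0)\<close> by (simp add: algebra_simps)
 qed
 hence "H (R z0) - H z0 = \<nu> * (H (R z0) - H z0)" using D by (simp only: D1 D2)
 hence "(\<nu> - 1) * (H (R z0) - H z0) = 0" by (simp only: left_diff_distrib mult_1 diff_self flip: )
 moreover have "H (R z0) \<noteq> H z0" using r2(3) z0b z0_aper [OF j(2)] unfolding R_def inj_on_def by metis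
 ultimately show False using \<nu>1 by simp
qed

end

section \<open>The two sides of a recurrent component\<close>

lemma par_vimage: "w \<notin> A \<Longrightarrow> par w -` A = chart w ` A"
proof (intro equalityI subsetI)
 fix z assume "z \<in> par w -` A"
 thus "z \<in> chart w ` A" by (intro image_eqI [of _ _ "par w z"]) auto
next
 fix z assume w: "w \<notin> A" and "z \<in> chart w ` A"
 then obtain x where x: "x \<in> A" "z = chart w x" by blast
 moreover have "x \<noteq> w" using w x(1) by blast
 ultimately show "z \<in> par w -` A" by simp
qed

context rational_map
begin

section \<open>Fixed points of iterates\<close>

lemma fixed_points_limpt_interior:
 assumes x: "x islimpt {x. (f ^^ n) x = x}"
 shows "x \<in> interior {x. (f ^^ n) x = x}"
proof -
 define F where "F = {x. (f ^^ n) x = x}"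
 have "closed F" unfolding F_def by (intro closed_Collect_eq continuous_iterate continuous_on_id)
 hence "x \<in> F" using x by (simp add: closed_limpt F_def)
 obtain w where w: "w \<noteq> x" by (metis riemann_sphere.distinct(1))
 define c where "c = chart w x"
 have "open (- {w} \<inter> (f ^^ n) -` (- {w}))" by (intro open_Int open_vimage continuous_iterate) auto
 hence "open (par w -` (- {w} \<inter> (f ^^ n) -` (- {w})))" by (rule open_par_vimage)
 moreover have "c \<in> par w -` (- {w} \<inter> (f ^^ n) -` (- {w}))" using w \<open>x \<in> F\<close> by (auto simp: c_def F_def)
 ultimately obtain r where r: "r > 0" "ball c r \<subseteq> par w -` (- {w} \<inter> (f ^^ n) -` (- {w}))" by (rule openE)
 define \<psi> where "\<psi> z = chart w ((f ^^ n) (par w z)) - z" for z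
 have hol: "\<psi> holomorphic_on ball c r"
  unfolding \<psi>_def using r(2) by (intro holomorphic_intros chart_iterate_holomorphic) auto
 have fix_iff: "\<psi> z = 0 \<longleftrightarrow> par w z \<in> F" if "z \<in> ball c r" for z
 proof -
  have "(f ^^ n) (par w z) \<noteq> w" using r(2) that by auto
  hence "chart w ((f ^^ n) (par w z)) = z \<longleftrightarrow> (f ^^ n) (par w z) = par w z" by (metis chart_par par_chart)
  thus ?thesis by (simp add: \<psi>_def F_def)
 qed
 have lim: "c islimpt {z \<in> ball c r. \<psi> z = 0}" unfolding islimpt_approachable
 proof (intro allI impI)
  fix e :: real assume "e > 0"
  define s where "s = min e r"
  have "open (par w ` ball c s)" by (intro open_par_image open_ball)
  moreover have "x \<in> par w ` ball c s" using w \<open>e > 0\<close> r(1) by (intro image_eqI [of _ _ c]) (auto simp: c_def s_def)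
  ultimately obtain y where y: "y \<in> F" "y \<in> par w ` ball c s" "y \<noteq> x" using x unfolding islimpt_def F_def by blast
  then obtain z where z: "z \<in> ball c s" "y = par w z" by blast
  hence "z \<noteq> c" using y(3) w by (auto simp: c_def)
  moreover have "z \<in> ball c r" "dist z c < e" using z(1) by (auto simp: s_def dist_commute)
  ultimately show "\<exists>z\<in>{z \<in> ball c r. \<psi> z = 0}. z \<noteq> c \<and> dist z c < e"
   using fix_iff y(1) z(2) by (intro bexI [of _ z]) auto
 qed
 have "\<psi> z = 0" if "z \<in> ball c r" for z
  by (rule analytic_continuation [OF hol open_ball connected_ball _ _ lim]) (use r(1) that in auto)
 hence "par w ` ball c r \<subseteq> F" using fix_iff by auto
 moreover have "open (par w ` ball c r)" "x \<in> par w ` ball c r"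
  using r(1) w by (auto simp: c_def intro!: open_par_image image_eqI [of _ _ "chart w x"])
 ultimately show ?thesis unfolding F_def by (metis interior_maximal subsetD)
qed

text \<open>The interior of the set of fixed points of \<open>f ^^ n\<close> is open and closed, so
  it would be the whole sphere; but \<open>f\<close> is not injective.\<close>

lemma iterate_not_identity:
 assumes G: "open G" "G \<noteq> {}" and id: "\<And>x. x \<in> G \<Longrightarrow> (f ^^ n) x = x" and n: "1 \<le> n"
 shows False
proof -
 define F where "F = {x. (f ^^ n) x = x}"
 have "closure (interior F) \<subseteq> interior F"
  using fixed_points_limpt_interior [of _ n] islimpt_subset [OF _ interior_subset [of F]]
  by (auto simp: closure_def F_def)
 hence "interior F = {} \<or> interior F = UNIV" by (intro clopen_sphere) (auto simp: closure_subset_eq)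
 moreover have "G \<subseteq> interior F" using id G(1) by (intro interior_maximal) (auto simp: F_def)
 ultimately have "F = UNIV" using G(2) interior_subset by blast
 obtain x y where xy: "x \<noteq> y" "f x = f y" using two_preimages [OF open_UNIV UNIV_not_empty] by blast
 have "(f ^^ n) z = (f ^^ (n - 1)) (f z)" for z using n by (cases n) (simp_all add: funpow_swap1)
 hence "(f ^^ n) x = (f ^^ n) y" using xy(2) by simp
 moreover have "x \<in> F" "y \<in> F" using \<open>F = UNIV\<close> by auto
 ultimately show False using xy(1) by (simp add: F_def)
qed

lemma finite_fixed_points:
 assumes n: "1 \<le> n"
 shows "finite {x. (f ^^ n) x = x}"
proof (rule ccontr)
 assume "infinite {x. (f ^^ n) x = x}"
 then obtain x where "x islimpt {x. (f ^^ n) x = x}"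
  using Heine_Borel_imp_Bolzano_Weierstrass [OF compact_UNIV_sphere] by blast
 thus False using iterate_not_identity [OF open_interior _ _ n] fixed_points_limpt_interior interior_subset by blast
qed

lemma frontier_side_closure:
 assumes AB: "closed A" "closed B" "A \<inter> B = {}" "A \<union> B = - V"
 shows "frontier A \<subseteq> closure V"
proof
 fix x assume x: "x \<in> frontier A"
 hence "x \<in> A" using AB(1) frontier_subset_closed by blast
 show "x \<in> closure V" unfolding closure_iff_nhds_not_empty
 proof (intro allI impI)
  fix S T assume ST: "T \<subseteq> S" "open T" "x \<in> T"
  have "open (T \<inter> - B)" "x \<in> T \<inter> - B" using ST AB \<open>x \<in> A\<close> by auto
  hence "\<not> T \<inter> - B \<subseteq> A" using x interior_maximal [of "T \<inter> - B" A] by (auto simp: frontier_def)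
  thus "V \<inter> S \<noteq> {}" using ST(1) AB(4) by blast
 qed
qed

context
 fixes V m
 assumes V: "V \<in> components FS" and m: "filterlim m at_top sequentially"
  and ret: "\<And>x. x \<in> V \<Longrightarrow> (\<lambda>j. (f ^^ m j) x) \<longlonglongrightarrow> x"
begin

lemma returns_multiple:
 assumes x: "x \<in> V"
 shows "(\<lambda>i. (f ^^ (l * m i)) x) \<longlonglongrightarrow> x"
proof (induction l)
 case (Suc l)
 have xF: "x \<in> FS" using x in_components_subset [OF V] by blast
 show ?case
 proof (rule metric_LIMSEQ_I)
  fix e :: real assume "e > 0"
  hence e2: "e / 2 > 0" by simp
  obtain \<delta> where \<delta>: "\<delta> > 0" "\<And>y n. dist x y < \<delta> \<Longrightarrow> dist ((f ^^ n) x) ((f ^^ n) y) < e / 2"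
   using fatou_equicontinuousE [OF xF e2] by blast
  have "\<forall>\<^sub>F i in sequentially. dist ((f ^^ (l * m i)) x) x < \<delta> \<and> dist ((f ^^ m i) x) x < e / 2"
   using tendstoD [OF Suc \<delta>(1)] tendstoD [OF ret [OF x] e2] by (rule eventually_conj)
  hence "\<forall>\<^sub>F i in sequentially. dist ((f ^^ (Suc l * m i)) x) x < e"
  proof eventually_elim
   case (elim i)
   have "dist ((f ^^ m i) x) ((f ^^ m i) ((f ^^ (l * m i)) x)) < e / 2" by (rule \<delta>(2)) (use elim in \<open>simp add: dist_commute\<close>)
   hence "dist ((f ^^ m i) ((f ^^ (l * m i)) x)) x < e" using elim by metric
   thus ?case by (simp add: funpow_add)
  qed
  thus "\<exists>no. \<forall>n\<ge>no. dist ((f ^^ (Suc l * m n)) x) x < e" by (simp add: eventually_sequentially)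
 qed
qed simp

lemma uniform_returns:
 assumes C: "compact C" "C \<subseteq> V" "e > 0"
 shows "\<forall>\<^sub>F i in sequentially. \<forall>x\<in>C. dist ((f ^^ (l * m i)) x) x < e"
proof -
 have CF: "C \<subseteq> FS" using C(2) in_components_subset [OF V] by blast
 have e3: "e / 3 > 0" using C(3) by simp
 obtain \<delta> where \<delta>: "\<delta> > 0" "\<And>x y n. x \<in> C \<Longrightarrow> y \<in> C \<Longrightarrow> dist x y < \<delta> \<Longrightarrow> dist ((f ^^ n) x) ((f ^^ n) y) < e / 3"
  using uniformly_equicontinuous [OF C(1) CF e3] by blast
 define s where "s = min \<delta> (e / 3)"
 have "s > 0" using \<delta>(1) e3 by (simp add: s_def)
 obtain F where F: "F \<subseteq> C" "finite F" "C \<subseteq> (\<Union>x\<in>F. ball x s)"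
  using compact_ball_cover [OF C(1), of "\<lambda>_. s"] \<open>s > 0\<close> by metis
 have "\<forall>\<^sub>F i in sequentially. \<forall>x\<in>F. dist ((f ^^ (l * m i)) x) x < e / 3"
  using F(1,2) C(2) by (intro eventually_ball_finite ballI tendstoD [OF returns_multiple e3]) auto
 thus ?thesis
 proof eventually_elim
  case (elim i)
  show ?case
  proof
   fix x assume x: "x \<in> C"
   then obtain c where c: "c \<in> F" "dist c x < s" using F(3) by auto
   hence "dist x c < \<delta>" "dist c x < e / 3" by (auto simp: s_def dist_commute)
   moreover have "dist ((f ^^ (l * m i)) x) ((f ^^ (l * m i)) c) < e / 3"
    using x c(1) F(1) \<open>dist x c < \<delta>\<close> by (intro \<delta>(2)) auto
   moreover have "dist ((f ^^ (l * m i)) c) c < e / 3" using elim c(1) by blast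
   ultimately show "dist ((f ^^ (l * m i)) x) x < e" by metric
  qed
 qed
qed

text \<open>The iterates of the return map are \<open>f ^^ (j * n)\<close>, so the times
  \<open>m\<close> remain return times by convergence along the multiples
  \<open>j * m i\<close>.\<close>

lemma recurrent_plane_map_chart:
 assumes w: "w \<notin> V" and j: "1 \<le> j" "(f ^^ j) ` V = V"
 shows "recurrent_plane_map (par w -` V) (\<lambda>z. chart w ((f ^^ j) (par w z))) m"
proof -
 define U where "U = par w -` V"
 define g where "g z = chart w ((f ^^ j) (par w z))" for z
 have oV: "open V" "connected V" using open_fatou_component [OF V] in_components_connected [OF V] by auto
 have UV: "U = chart w ` V" unfolding U_def by (rule par_vimage [OF w])
 have VU: "par w ` U = V"
 proof (intro equalityI subsetI)
  fix x assume "x \<in> V"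
  hence "x \<noteq> w" "chart w x \<in> U" using w by (metis, simp add: UV)
  thus "x \<in> par w ` U" by (intro image_eqI [of _ _ "chart w x"]) auto
 qed (auto simp: U_def)
 have fV: "(f ^^ (j * n)) x \<in> V" if "x \<in> V" for x n using that
 proof (induction n)
  case (Suc n)
  hence "(f ^^ j) ((f ^^ (j * n)) x) \<in> V" using j(2) by blast
  thus ?case by (simp add: funpow_add)
 qed simp
 have gn: "(g ^^ n) z = chart w ((f ^^ (j * n)) (par w z))" if "z \<in> U" for z n
 proof (induction n)
  case (Suc n)
  have "(f ^^ (j * n)) (par w z) \<in> V" using that by (intro fV) (simp add: U_def)
  hence "(f ^^ (j * n)) (par w z) \<noteq> w" using w by metis
  thus ?case using Suc by (simp add: g_def funpow_add)
 qed simp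
 have "recurrent_plane_map U g m"
 proof
  show "open U" unfolding U_def by (rule open_par_vimage [OF oV(1)])
  thus "g holomorphic_on U" unfolding g_def
  proof (rule chart_iterate_holomorphic)
   fix z assume "z \<in> U"
   hence "(f ^^ j) (par w z) \<in> V" using fV [of _ 1] by (simp add: U_def)
   thus "(f ^^ j) (par w z) \<noteq> w" using w by metis
  qed
  show "connected U" unfolding UV by (rule connected_continuous_image [OF continuous_chart [OF w] oV(2)])
  have "g ` U = chart w ` (f ^^ j) ` par w ` U" by (auto simp: g_def)
  thus "g ` U = U" using VU j(2) UV by simp
  show "inj_on g U"
  proof (rule inj_onI)
   fix y z assume yz: "y \<in> U" "z \<in> U" "g y = g z"
   have V': "par w y \<in> V" "par w z \<in> V" using yz by (auto simp: U_def)
   hence "(f ^^ j) (par w y) \<in> V" "(f ^^ j) (par w z) \<in> V" using fV [of _ 1] by auto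
   hence "(f ^^ j) (par w y) \<noteq> w" "(f ^^ j) (par w z) \<noteq> w" using w by metis+
   hence "(f ^^ j) (par w y) = (f ^^ j) (par w z)" using yz(3) unfolding g_def by (metis par_chart)
   hence "par w y = par w z" using inj_onD [OF inj_orbit [OF V m ret]] V' subset_orbit [OF V m ret] by blast
   thus "y = z" by simp
  qed
  show "filterlim m at_top sequentially" by (rule m)
  show "\<exists>z\<in>U. (g ^^ n) z \<noteq> z" if n: "1 \<le> n" for n
  proof (rule ccontr)
   assume "\<not> (\<exists>z\<in>U. (g ^^ n) z \<noteq> z)"
   hence id: "(g ^^ n) z = z" if "z \<in> U" for z using that by blast
   have "(f ^^ (j * n)) x = x" if x: "x \<in> V" for x
   proof -
    have "x \<noteq> w" "(f ^^ (j * n)) x \<noteq> w" using w x fV by blast+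
    have "chart w x \<in> U" using x UV by blast
    hence "chart w ((f ^^ (j * n)) x) = chart w x" using gn [of "chart w x" n] id \<open>x \<noteq> w\<close> by simp
    thus ?thesis using \<open>x \<noteq> w\<close> \<open>(f ^^ (j * n)) x \<noteq> w\<close> by (metis par_chart)
   qed
   thus False using iterate_not_identity [OF oV(1) in_components_nonempty [OF V]] n j(1) by (metis One_nat_def mult_le_mono nat_mult_1)
  qed
  show pre: "\<exists>K. compact K \<and> K \<subseteq> U \<and> (\<forall>n. (g ^^ n) ` C \<subseteq> K)" if C: "compact C" "C \<subseteq> U" for C
  proof -
   define C' where "C' = par w ` C"
   have C': "compact C'" "C' \<subseteq> V"
    using compact_continuous_image [OF continuous_par C(1)] C(2) by (auto simp: C'_def U_def)
   obtain K where K: "compact K" "K \<subseteq> orbit V" "\<And>n x. x \<in> C' \<Longrightarrow> (f ^^ n) x \<in> K"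
    using orbit_of_compact_in_compact [OF V m ret C'] by blast
   have KF: "K \<subseteq> FS" using K(2) orbit_fatou [OF V m ret] by blast
   \<comment> \<open>The points of \<open>K\<close> in the other Fatou components form a relatively
     open subset of \<open>K\<close>; removing it leaves a compact subset of
     \<open>V\<close>.\<close>
   have "FS - V = \<Union>(components FS - {V})"
    using components_nonoverlap [OF _ V] Union_components [of "FS"] V by blast
   moreover have "open (\<Union>(components FS - {V}))" using open_fatou_component by (intro open_Union) auto
   ultimately have "open (FS - V)" by simp
   hence KV: "compact (K - (FS - V))" by (rule compact_diff [OF K(1)])
   moreover have "K - (FS - V) = K \<inter> V" using KF by blast
   ultimately have KV: "compact (K \<inter> V)" by simp
   have "w \<notin> K \<inter> V" using w by blast
   hence "compact (chart w ` (K \<inter> V))" by (intro compact_continuous_image continuous_chart KV)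
   moreover have "chart w ` (K \<inter> V) \<subseteq> U" using UV by blast
   moreover have "\<forall>n. (g ^^ n) ` C \<subseteq> chart w ` (K \<inter> V)"
   proof (intro allI image_subsetI)
    fix n z assume z: "z \<in> C"
    have "z \<in> U" "par w z \<in> C'" using z C(2) by (auto simp: C'_def)
    thus "(g ^^ n) z \<in> chart w ` (K \<inter> V)" using gn [of z n] K(3) fV [of "par w z" n] C'(2) by auto
   qed
   ultimately show ?thesis by (intro exI [of _ "chart w ` (K \<inter> V)"]) simp
  qed
  show "\<forall>\<^sub>F i in sequentially. \<forall>z\<in>C. dist ((g ^^ m i) z) z < e" if C: "compact C" "C \<subseteq> U" "e > 0" for C e
  proof -
   obtain K where K: "compact K" "K \<subseteq> U" "\<And>n. (g ^^ n) ` C \<subseteq> K" using pre [OF C(1,2)] by blast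
   define K' where "K' = par w ` K"
   have K': "compact K'" "K' \<subseteq> V"
    using compact_continuous_image [OF continuous_par K(1)] K(2) by (auto simp: K'_def U_def)
   have "w \<notin> K'" using K'(2) w by blast
   hence "uniformly_continuous_on K' (chart w)" by (intro compact_uniformly_continuous continuous_chart K'(1))
   then obtain \<delta> where \<delta>: "\<delta> > 0" "\<And>x y. x \<in> K' \<Longrightarrow> y \<in> K' \<Longrightarrow> dist y x < \<delta> \<Longrightarrow> dist (chart w y) (chart w x) < e"
    using C(3) unfolding uniformly_continuous_on_def by metis
   show ?thesis using uniform_returns [OF K' \<delta>(1), of j]
   proof eventually_elim
    case (elim i)
    show ?case
    proof
     fix z assume z: "z \<in> C"
     have zU: "z \<in> U" using z C(2) by blast
     have zK: "z \<in> K" using K(3) [of 0] z by auto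
     have gK: "(g ^^ m i) z \<in> K" using K(3) z by blast
     have eq: "par w ((g ^^ m i) z) = (f ^^ (j * m i)) (par w z)"
     proof -
      have "(f ^^ (j * m i)) (par w z) \<noteq> w" using fV [of "par w z" "m i"] zU w by (auto simp: U_def)
      thus ?thesis using gn [OF zU] by simp
     qed
     have "dist (chart w ((f ^^ (j * m i)) (par w z))) (chart w (par w z)) < e"
     proof (rule \<delta>(2))
      show "par w z \<in> K'" "(f ^^ (j * m i)) (par w z) \<in> K'" using zK gK by (auto simp: K'_def simp flip: eq)
      thus "dist ((f ^^ (j * m i)) (par w z)) (par w z) < \<delta>" using elim by blast
     qed
     thus "dist ((g ^^ m i) z) z < e" using gn [OF zU] by simp
    qed
   qed
  qed
 qed
 thus ?thesis unfolding U_def g_def .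
qed

lemma connected_plane_domain: "w \<notin> V \<Longrightarrow> connected (par w -` V)"
 using connected_continuous_image [OF continuous_chart in_components_connected [OF V]] by (simp add: par_vimage)

text \<open>The hypotheses make \<open>w\<close> an interior point of \<open>B\<close>. In its chart
  the side \<open>A\<close> is compact, and \<open>B\<close> contains a neighbourhood of
  infinity.\<close>

lemma side_periods:
 fixes s t :: int
 assumes AB: "closed A" "closed B" "A \<inter> B = {}" "A \<union> B = - V" and w: "w \<in> B" "w \<notin> closure V"
  and ab: "par w a \<in> A" "s = 0 \<or> par w b \<in> B"
  and per: "\<And>\<gamma>. valid_path \<gamma> \<Longrightarrow> path_image \<gamma> \<subseteq> par w -` V \<Longrightarrow> pathfinish \<gamma> = pathstart \<gamma> \<Longrightarrow>
   of_int t * winding_number \<gamma> a = of_int s * winding_number \<gamma> b"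
 shows "t = 0"
proof -
 have wA: "w \<notin> A" using AB(3) w(1) by blast
 have cl: "closed (par w -` A)" "closed (par w -` B)"
  using AB(1,2) continuous_closed_vimage [of _ "par w"] continuous_par [of UNIV w]
  by (auto simp: continuous_on_eq_continuous_at)
 moreover have "bounded (par w -` A)"
  using bounded_chart_image [of w A] wA AB(1) by (simp add: par_vimage closure_closed)
 ultimately have co: "compact (par w -` A)" by (simp add: compact_eq_bounded_closed)
 have "- B = V \<union> A" using AB(3,4) by blast
 hence "w \<notin> closure (- B)" using wA w(2) AB(1) by (simp add: closure_closed)
 then obtain R where R: "\<And>z. z \<in> chart w ` (- B) \<Longrightarrow> norm z \<le> R" using bounded_chart_image bounded_iff by metis
 have far: "z \<in> par w -` B" if "R + 1 \<le> norm z" for z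
 proof (rule ccontr)
  assume "z \<notin> par w -` B"
  hence "z \<in> chart w ` (- B)" by (intro image_eqI [of _ _ "par w z"]) auto
  thus False using R [of z] that by simp
 qed
 have compl: "- (par w -` A \<union> par w -` B) = par w -` V" using AB(4) by blast
 \<comment> \<open>If \<open>b\<close> does not represent a point of \<open>B\<close>, then
   \<open>s = 0\<close>, and a point of large modulus takes its place.\<close>
 define b' where "b' = (if par w b \<in> B then b else of_real (max (R + 1) 0))"
 have b': "par w b' \<in> B" using far [of "of_real (max (R + 1) 0)"] by (auto simp: b'_def)
 show ?thesis
 proof (rule loop_periods_not_proportional [OF co cl(2) _ _ _ far, of a b'])
  show "connected (- (par w -` A \<union> par w -` B))"
   unfolding compl by (rule connected_plane_domain) (use w closure_subset in blast)
  show "of_int t * winding_number \<gamma> a = of_int s * winding_number \<gamma> b'"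
   if "valid_path \<gamma>" "path_image \<gamma> \<subseteq> - (par w -` A \<union> par w -` B)" "pathfinish \<gamma> = pathstart \<gamma>" for \<gamma>
   using per [of \<gamma>] that ab(2) unfolding compl by (auto simp: b'_def)
 qed (use AB(3) ab(1) b' in auto)
qed

text \<open>If all winding numbers around \<open>a\<close> vanished, \<open>side_periods\<close>
  with \<open>t = 1\<close> and \<open>s = 0\<close> would give 1 = 0.\<close>

lemma obtain_loop_around:
 assumes AB: "closed A" "closed B" "A \<inter> B = {}" "A \<union> B = - V" and w: "w \<in> B" "w \<notin> closure V" and a: "par w a \<in> A"
 obtains \<gamma> where "valid_path \<gamma>" "path_image \<gamma> \<subseteq> par w -` V" "pathfinish \<gamma> = pathstart \<gamma>" "winding_number \<gamma> a \<noteq> 0"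
proof -
 have "\<exists>\<gamma>. valid_path \<gamma> \<and> path_image \<gamma> \<subseteq> par w -` V \<and> pathfinish \<gamma> = pathstart \<gamma> \<and> winding_number \<gamma> a \<noteq> 0"
 proof (rule ccontr)
  assume no: "\<not> ?thesis"
  have "(1::int) = 0" by (rule side_periods [OF AB w a, of 0 a]) (use no in auto)
  thus False by simp
 qed
 thus thesis using that by blast
qed

lemma exterior_point: obtains w where "w \<notin> closure V"
proof -
 obtain W where W: "W \<in> components FS" "W \<inter> orbit V = {}" "f ` W \<subseteq> orbit V" using escaping_preimage [OF V m ret] .
 obtain w where "w \<in> W" using in_components_nonempty [OF W(1)] by blast
 moreover have "W \<inter> closure V = {}"
  using open_fatou_component [OF W(1)] W(2) subset_orbit [OF V m ret] by (simp add: open_Int_closure_eq_empty) blast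
 ultimately show thesis using that by blast
qed

text \<open>Three sides would give independent periods around \<open>A\<close> and around
  \<open>B\<close>, whereas invariant forms are unique up to a factor. A loop around
  \<open>b\<close> supplies the coefficients of the relation that \<open>side_periods\<close>
  excludes.\<close>

lemma three_sides_aux:
 assumes ABC: "closed A" "closed B" "closed C" "A \<inter> B = {}" "A \<inter> C = {}" "B \<inter> C = {}" "A \<union> B \<union> C = - V"
  and ne: "A \<noteq> {}" "B \<noteq> {}" and w: "w \<in> C" "w \<notin> closure V"
 shows False
proof -
 have wV: "w \<notin> V" using w(2) closure_subset by blast
 obtain k where k: "1 \<le> k" "(f ^^ k) ` V = V" using period [OF V m ret] by blast
 define U where "U = par w -` V"
 interpret recurrent_plane_map U "\<lambda>z. chart w ((f ^^ k) (par w z))" m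
  unfolding U_def by (rule recurrent_plane_map_chart [OF wV k])
 obtain x y where xy: "x \<in> A" "y \<in> B" using ne by blast
 hence "x \<noteq> w" "y \<noteq> w" using w(1) ABC(5,6) by blast+
 then obtain a b where ab: "par w a \<in> A" "par w b \<in> B" using xy by (metis par_chart)
 have abU: "a \<notin> U" "b \<notin> U" using ab ABC(7) by (auto simp: U_def)
 have 1: "closed (A \<union> C)" "B \<inter> (A \<union> C) = {}" "B \<union> (A \<union> C) = - V" "w \<in> A \<union> C" using ABC w(1) by auto
 have 2: "closed (B \<union> C)" "A \<inter> (B \<union> C) = {}" "A \<union> (B \<union> C) = - V" "w \<in> B \<union> C" using ABC w(1) by auto
 obtain \<beta> where \<beta>: "valid_path \<beta>" "path_image \<beta> \<subseteq> U" "pathfinish \<beta> = pathstart \<beta>" "winding_number \<beta> b \<noteq> 0"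
  using obtain_loop_around [OF ABC(2) 1 w(2) ab(2)] unfolding U_def by metis
 have int: "winding_number \<beta> z \<in> \<int>" if "z \<notin> U" for z
  using \<beta> that by (intro integer_winding_number valid_path_imp_path) auto
 obtain s t :: int where st: "winding_number \<beta> a = of_int s" "winding_number \<beta> b = of_int t"
  using int abU by (metis Ints_cases)
 have "t = 0"
 proof (rule side_periods [OF ABC(1) 2 w(2) ab(1), of s b])
  show "of_int t * winding_number \<gamma> a = of_int s * winding_number \<gamma> b"
   if "valid_path \<gamma>" "path_image \<gamma> \<subseteq> par w -` V" "pathfinish \<gamma> = pathstart \<gamma>" for \<gamma>
   using winding_numbers_proportional [OF that(1) _ that(3) \<beta>(1-3) abU] that(2) st unfolding U_def by (simp add: mult.commute)
 qed (use ab(2) in simp)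
 thus False using \<beta>(4) st by simp
qed

lemma three_sides:
 assumes ABC: "closed A" "closed B" "closed C" "A \<inter> B = {}" "A \<inter> C = {}" "B \<inter> C = {}" "A \<union> B \<union> C = - V"
  and ne: "A \<noteq> {}" "B \<noteq> {}" "C \<noteq> {}"
 shows False
proof -
 obtain w where w: "w \<notin> closure V" by (rule exterior_point)
 hence "w \<in> - V" using closure_subset by blast
 then consider "w \<in> A" | "w \<in> B" | "w \<in> C" using ABC(7) by blast
 thus False
 proof cases
  case 1
  thus False using three_sides_aux [of B C A w] ABC ne w by (simp add: Int_commute Un_ac)
 next
  case 2
  thus False using three_sides_aux [of A C B w] ABC ne w by (simp add: Int_commute Un_ac)
 next
  case 3
  thus False using three_sides_aux [of A B C w] ABC ne w by blast
 qed
qed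

lemma two_sides:
 assumes "\<not> connected (- V)"
 obtains A B where "closed A" "closed B" "connected A" "connected B" "A \<noteq> {}" "B \<noteq> {}" "A \<inter> B = {}" "A \<union> B = - V"
proof -
 have "closed (- V)" using open_fatou_component [OF V] by (simp add: closed_Compl)
 then obtain A B where AB: "closed A" "closed B" "A \<noteq> {}" "B \<noteq> {}" "A \<union> B = - V" "A \<inter> B = {}"
  using closed_not_connectedE assms by blast
 have con: "connected A" if AB: "closed A" "closed B" "B \<noteq> {}" "A \<union> B = - V" "A \<inter> B = {}" for A B
 proof (rule ccontr)
  assume "\<not> connected A"
  then obtain C D where CD: "closed C" "closed D" "C \<noteq> {}" "D \<noteq> {}" "C \<union> D = A" "C \<inter> D = {}"
   using closed_not_connectedE [OF AB(1)] by blast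
  thus False using three_sides [OF CD(1,2) AB(2) CD(6)] AB by blast
 qed
 show thesis using that [OF AB(1,2) con con AB(3,4,6,5)] AB by (simp add: Int_commute Un_commute)
qed

text \<open>Exchanging the sides would reverse the sense in which a loop surrounds \<open>A\<close>.
  The difference of winding numbers in \<open>winding_number_image_difference\<close> is compared at
  one point near each side, and \<open>winding_number_image\<close> fixes the number around
  \<open>a\<close>.\<close>

lemma no_swap_aux:
 assumes AB: "closed A" "closed B" "connected A" "connected B" "A \<noteq> {}" "A \<inter> B = {}" "A \<union> B = - V"
  and j: "1 \<le> j" "(f ^^ j) ` V = V" and swap: "(f ^^ j) ` frontier A \<subseteq> B" "(f ^^ j) ` frontier B \<subseteq> A"
  and w: "w \<in> B" "w \<notin> closure V"
 shows False
proof -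
 have wV: "w \<notin> V" using w(2) closure_subset by blast
 define U where "U = par w -` V"
 define T where "T z = chart w ((f ^^ j) (par w z))" for z
 interpret recurrent_plane_map U T m
  unfolding U_def T_def by (rule recurrent_plane_map_chart [OF wV j])
 obtain x where "x \<in> A" using AB(5) by blast
 moreover have "x \<noteq> w" using \<open>x \<in> A\<close> w(1) AB(6) by blast
 ultimately obtain a where a: "par w a \<in> A" by (metis par_chart)
 have aU: "a \<notin> U" using a AB(7) by (auto simp: U_def)
 obtain \<gamma> where \<gamma>: "valid_path \<gamma>" "path_image \<gamma> \<subseteq> U" "pathfinish \<gamma> = pathstart \<gamma>" "winding_number \<gamma> a \<noteq> 0"
  using obtain_loop_around [OF AB(1,2,6,7) w a] unfolding U_def by metis
 have T\<gamma>: "valid_path (T \<circ> \<gamma>)" "path_image (T \<circ> \<gamma>) \<subseteq> U" "pathfinish (T \<circ> \<gamma>) = pathstart (T \<circ> \<gamma>)"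
  using loop_image [OF \<gamma>(1-3), of 1] by auto
 \<comment> \<open>Winding numbers are locally constant and \<open>A\<close> is connected, so the
   value at \<open>a\<close> persists near all of \<open>A\<close>. In \<open>outer\<close> the
   value is 0, and \<open>w\<close>, the point at infinity of the chart, is left out.\<close>
 have inner: "\<exists>N. open N \<and> A \<subseteq> N \<and> (\<forall>x\<in>N. chart w x \<notin> path_image \<beta> \<and> winding_number \<beta> (chart w x) = winding_number \<beta> a)"
  if \<beta>: "valid_path \<beta>" "path_image \<beta> \<subseteq> U" "pathfinish \<beta> = pathstart \<beta>" for \<beta>
 proof -
  define Z where "Z = {z. z \<notin> path_image \<beta> \<and> winding_number \<beta> z = winding_number \<beta> a}"
  have "open Z" unfolding Z_def by (rule open_winding_number_levelsets [OF valid_path_imp_path [OF \<beta>(1)] \<beta>(3)])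
  hence "open (par w ` Z)" by (rule open_par_image)
  moreover have "A \<subseteq> par w ` Z"
  proof
   fix x assume x: "x \<in> A"
   have xw: "x \<noteq> w" using x w(1) AB(6) by blast
   have "w \<notin> A" using w(1) AB(6) by blast
   hence "connected (chart w ` A)" by (intro connected_continuous_image continuous_chart AB(3))
   moreover have "a \<in> chart w ` A" using a by (metis chart_par imageI)
   moreover have "chart w ` A \<inter> path_image \<beta> = {}"
    using \<beta>(2) AB(7) \<open>w \<notin> A\<close> by (auto simp: U_def simp flip: par_vimage)
   ultimately have "winding_number \<beta> (chart w x) = winding_number \<beta> a" "chart w x \<notin> path_image \<beta>"
    using winding_number_eq [OF valid_path_imp_path [OF \<beta>(1)] \<beta>(3), of "chart w x" "chart w ` A" a] x by auto
   thus "x \<in> par w ` Z" using xw by (intro image_eqI [of _ _ "chart w x"]) (auto simp: Z_def)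
  qed
  ultimately show ?thesis by (intro exI [of _ "par w ` Z"]) (auto simp: Z_def)
 qed
 have outer: "\<exists>N. open N \<and> B \<subseteq> N \<and> (\<forall>x\<in>N - {w}. chart w x \<notin> path_image \<beta> \<and> winding_number \<beta> (chart w x) = 0)"
  if \<beta>: "valid_path \<beta>" "path_image \<beta> \<subseteq> U" "pathfinish \<beta> = pathstart \<beta>" for \<beta>
 proof -
  have pb: "path \<beta>" by (rule valid_path_imp_path [OF \<beta>(1)])
  define Z where "Z = {z. z \<notin> path_image \<beta> \<and> winding_number \<beta> z = 0}"
  have oZ: "open Z" unfolding Z_def by (rule open_winding_number_levelsets [OF pb \<beta>(3)])
  obtain L1 where L1: "\<And>z. L1 \<le> norm z \<Longrightarrow> winding_number \<beta> z = 0" using winding_number_zero_at_infinity [OF pb \<beta>(3)] by blast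
  obtain L2 where L2: "\<And>z. z \<in> path_image \<beta> \<Longrightarrow> norm z \<le> L2" using bounded_path_image [OF pb] bounded_iff by metis
  have "norm z \<le> max L1 L2" if "z \<in> - Z" for z
   using that L1 [of z] L2 [of z] by (cases "L1 \<le> norm z") (auto simp: Z_def)
  hence "bounded (- Z)" unfolding bounded_iff by blast
  hence cZ: "compact (- Z)" using oZ by (simp add: compact_eq_bounded_closed closed_Compl)
  define N where "N = - (par w ` (- Z))"
  have "closed (par w ` (- Z))" by (rule compact_imp_closed [OF compact_continuous_image [OF continuous_par cZ]])
  hence oN: "open N" by (simp add: N_def open_Compl)
  have Nw: "w \<in> N" by (auto simp: N_def)
  have NZ: "chart w x \<in> Z" if "x \<in> N" "x \<noteq> w" for x
  proof (rule ccontr)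
   assume "chart w x \<notin> Z"
   hence "x \<in> par w ` (- Z)" using that(2) by (intro image_eqI [of _ _ "chart w x"]) auto
   thus False using that(1) by (simp add: N_def)
  qed
  define M where "M = par w ` (- path_image \<beta> - Z)"
  have "- path_image \<beta> - Z = (\<Union>k\<in>- {0}. {z. z \<notin> path_image \<beta> \<and> winding_number \<beta> z = k})" by (auto simp: Z_def)
  moreover have "open (\<Union>k\<in>- {0}. {z. z \<notin> path_image \<beta> \<and> winding_number \<beta> z = k})"
   by (intro open_UN ballI open_winding_number_levelsets [OF pb \<beta>(3)])
  ultimately have "open M" unfolding M_def by (metis open_par_image)
  have "B \<subseteq> N"
  proof (rule connected_subset_open_partition [OF AB(4) _ \<open>open M\<close> oN])
   show "B \<subseteq> M \<union> N"
   proof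
    fix x assume x: "x \<in> B"
    show "x \<in> M \<union> N"
    proof (rule ccontr)
     assume nx: "x \<notin> M \<union> N"
     hence "x \<in> par w ` (- Z)" by (simp add: N_def)
     then obtain z where z: "z \<notin> Z" "x = par w z" by blast
     hence "z \<in> path_image \<beta>" using nx by (auto simp: M_def)
     hence "x \<in> V" using \<beta>(2) z(2) by (auto simp: U_def)
     thus False using x AB(7) by blast
    qed
   qed
   show "M \<inter> N = {}" by (auto simp: M_def N_def)
   show "B \<inter> N \<noteq> {}" using w(1) Nw by blast
  qed
  thus ?thesis using oN NZ by (intro exI [of _ N]) (auto simp: Z_def)
 qed
 have meet: "\<exists>y\<in>V. y \<in> N" if "b \<in> closure V" "open N" "b \<in> N" for b N
  using that closure_iff_nhds_not_empty [of b V] by blast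
 have cl: "frontier A \<subseteq> closure V" "frontier B \<subseteq> closure V"
  using frontier_side_closure [of A B] frontier_side_closure [of B A] AB by (simp_all add: Int_commute Un_commute)
 have fr: "frontier A \<noteq> {}" "frontier B \<noteq> {}" "frontier A \<subseteq> A" "frontier B \<subseteq> B"
 proof -
  have "A \<noteq> UNIV" "B \<noteq> UNIV" "B \<noteq> {}" using AB w(1) by auto
  thus "frontier A \<noteq> {}" "frontier B \<noteq> {}"
   using AB(5) clopen_sphere [of A] clopen_sphere [of B] AB(1,2) by (auto simp: frontier_def closure_closed interior_eq) (metis interior_eq interior_subset subset_antisym)+
  show "frontier A \<subseteq> A" "frontier B \<subseteq> B" using AB(1,2) by (simp_all add: frontier_subset_closed)
 qed
 have TV: "chart w x \<in> U" "T (chart w x) = chart w ((f ^^ j) x)" "(f ^^ j) x \<noteq> w" if "x \<in> V" for x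
 proof -
  have "x \<noteq> w" "(f ^^ j) x \<in> V" using that wV j(2) by blast+
  thus "chart w x \<in> U" "T (chart w x) = chart w ((f ^^ j) x)" "(f ^^ j) x \<noteq> w" using wV that by (auto simp: U_def T_def)
 qed
 obtain N1 where N1: "open N1" "A \<subseteq> N1" "\<And>x. x \<in> N1 \<Longrightarrow> chart w x \<notin> path_image \<gamma> \<and> winding_number \<gamma> (chart w x) = winding_number \<gamma> a"
  using inner [OF \<gamma>(1-3)] by blast
 obtain N1' where N1': "open N1'" "A \<subseteq> N1'" "\<And>x. x \<in> N1' \<Longrightarrow> winding_number (T \<circ> \<gamma>) (chart w x) = winding_number (T \<circ> \<gamma>) a"
  using inner [OF T\<gamma>] by blast
 obtain N2 where N2: "open N2" "B \<subseteq> N2" "\<And>x. x \<in> N2 \<Longrightarrow> x \<noteq> w \<Longrightarrow> chart w x \<notin> path_image \<gamma> \<and> winding_number \<gamma> (chart w x) = 0"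
  using outer [OF \<gamma>(1-3)] by blast
 obtain N2' where N2': "open N2'" "B \<subseteq> N2'" "\<And>x. x \<in> N2' \<Longrightarrow> x \<noteq> w \<Longrightarrow> winding_number (T \<circ> \<gamma>) (chart w x) = 0"
  using outer [OF T\<gamma>] by blast
 have ov: "open ((f ^^ j) -` N)" if "open N" for N by (intro open_vimage that continuous_iterate)
 obtain b1 where b1: "b1 \<in> frontier A" using fr(1) by blast
 have "open (N1 \<inter> (f ^^ j) -` N2')" "b1 \<in> N1 \<inter> (f ^^ j) -` N2'" using N1(1,2) N2'(1,2) ov b1 fr(3) swap(1) by auto
 then obtain y1 where y1: "y1 \<in> V" "y1 \<in> N1" "(f ^^ j) y1 \<in> N2'" using meet [of b1] cl(1) b1 by blast
 obtain b2 where b2: "b2 \<in> frontier B" using fr(2) by blast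
 have "open (N2 \<inter> (f ^^ j) -` N1')" "b2 \<in> N2 \<inter> (f ^^ j) -` N1'" using N2(1,2) N1'(1,2) ov b2 fr(4) swap(2) by auto
 then obtain y2 where y2: "y2 \<in> V" "y2 \<in> N2" "(f ^^ j) y2 \<in> N1'" using meet [of b2] cl(2) b2 by blast
 have "y2 \<noteq> w" using y2(1) wV by blast
 \<comment> \<open>At \<open>y1\<close> the difference is 0 minus the number around
   \<open>a\<close>; at \<open>y2\<close> it is the number around \<open>a\<close> minus 0.\<close>
 have "winding_number (T \<circ> \<gamma>) (T (chart w y1)) - winding_number \<gamma> (chart w y1)
   = winding_number (T \<circ> \<gamma>) (T (chart w y2)) - winding_number \<gamma> (chart w y2)"
  using TV [OF y1(1)] TV [OF y2(1)] N1(3) [OF y1(2)] N2(3) [OF y2(2) \<open>y2 \<noteq> w\<close>]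
  by (intro winding_number_image_difference [OF open_U connected_U hol inj \<gamma>(1-3)]) auto
 moreover have "winding_number (T \<circ> \<gamma>) a = winding_number \<gamma> a" by (rule winding_number_image [OF \<gamma>(1-3) aU])
 ultimately have "- winding_number \<gamma> a = winding_number \<gamma> a"
  using TV [OF y1(1)] TV [OF y2(1)] N1(3) [OF y1(2)] N2(3) [OF y2(2) \<open>y2 \<noteq> w\<close>] N1'(3) [OF y2(3)] N2'(3) [OF y1(3)] by simp
 thus False using \<gamma>(4) by simp
qed

lemma no_swap:
 assumes AB: "closed A" "closed B" "connected A" "connected B" "A \<noteq> {}" "B \<noteq> {}" "A \<inter> B = {}" "A \<union> B = - V"
  and j: "1 \<le> j" "(f ^^ j) ` V = V" and swap: "(f ^^ j) ` frontier A \<subseteq> B" "(f ^^ j) ` frontier B \<subseteq> A"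
 shows False
proof -
 obtain w where w: "w \<notin> closure V" by (rule exterior_point)
 hence "w \<in> A \<or> w \<in> B" using AB(8) closure_subset by blast
 thus False
  using no_swap_aux [OF AB(1-5,7,8) j swap _ w] no_swap_aux [OF AB(2,1,4,3,6) _ _ j swap(2,1) _ w] AB(7,8) by blast
qed

end

end

section \<open>Periodic Julia components at the sides of a recurrent component\<close>

context rational_map
begin

lemma image_julia: "f ` (O' \<inter> JS) = f ` O' \<inter> JS"
 by auto

text \<open>Let \<open>C\<close> be the component around the image and \<open>y\<close> a further
  point of it. A clopen neighbourhood of \<open>K\<close> in the Julia set that misses the preimages
  of \<open>y\<close> has an image that is open and closed relative to \<open>C\<close>, yet misses
  \<open>y\<close>.\<close>

lemma image_julia_component:
 assumes K: "K \<in> components JS"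
 shows "f ` K \<in> components JS"
proof -
 have K': "connected K" "K \<subseteq> JS" "K \<noteq> {}"
  using in_components_connected [OF K] in_components_subset [OF K] in_components_nonempty [OF K] by auto
 have fK: "connected (f ` K)" "f ` K \<subseteq> JS" "f ` K \<noteq> {}"
  using K' connected_continuous_image [OF continuous_f K'(1)] by auto
 then obtain C where C: "C \<in> components JS" "f ` K \<subseteq> C"
  using exists_component_superset [of "f ` K" "JS"] K'(2) by blast
 have "y \<in> f ` K" if y: "y \<in> C" for y
 proof (rule ccontr)
  assume ny: "y \<notin> f ` K"
  have "open (- (f -` {y}))" by (intro open_Compl closed_vimage continuous_f) auto
  moreover have "K \<subseteq> - (f -` {y})" using ny by auto
  ultimately obtain A where A: "openin (top_of_set JS) A" "closed A" "K \<subseteq> A" "A \<subseteq> - (f -` {y})"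
   by (rule clopen_neighbourhood_sphere [OF closed_julia K])
  obtain T where T: "open T" "A = T \<inter> JS" using A(1) by (auto simp: openin_open)
  have "f ` A \<inter> C = C \<inter> f ` T" unfolding T(2) image_julia using in_components_subset [OF C(1)] by blast
  hence 1: "openin (top_of_set C) (f ` A \<inter> C)" using openin_open_Int [OF open_image [OF T(1)]] by simp
  have 2: "closedin (top_of_set C) (f ` A \<inter> C)" using closed_image [OF A(2)] by (simp add: closedin_closed_Int Int_commute)
  have "f ` A \<inter> C = {} \<or> f ` A \<inter> C = C"
   using in_components_connected [OF C(1)] 1 2 unfolding connected_clopen by blast
  moreover have "f ` A \<inter> C \<noteq> {}" using C(2) A(3) fK(3) by blast
  ultimately have "y \<in> f ` A" using y by blast
  thus False using A(4) by blast
 qed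
 hence "f ` K = C" using C(2) by blast
 thus ?thesis using C(1) by simp
qed

lemma iterate_julia_component:
 assumes "K \<in> components JS"
 shows "(f ^^ n) ` K \<in> components JS"
proof (induction n)
 case (Suc n)
 hence "f ` (f ^^ n) ` K \<in> components JS" by (rule image_julia_component)
 thus ?case by (simp add: image_comp)
qed (simp add: assms)

lemma julia_component_eq:
 assumes "K \<in> components JS" "L \<in> components JS" "K \<inter> L \<noteq> {}"
 shows "K = L"
 using components_nonoverlap [OF assms(1,2)] assms(3) by blast

lemma frontier_image:
 assumes V: "V \<in> components FS"
 shows "f ` frontier V = frontier (f ` V)"
proof -
 have fV: "f ` V \<in> components FS" by (rule image_fatou_component [OF V])
 have oV: "open V" "open (f ` V)" using open_fatou_component V fV by auto
 have cl: "f ` closure V = closure (f ` V)"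
 proof
  show "f ` closure V \<subseteq> closure (f ` V)"
   using image_closure_subset [OF continuous_f closed_closure closure_subset] by blast
  show "closure (f ` V) \<subseteq> f ` closure V" by (intro closure_minimal closed_image image_mono closure_subset) auto
 qed
 have fr: "frontier V = closure V \<inter> JS" if "V \<in> components FS" "open V" for V
 proof
  show "frontier V \<subseteq> closure V \<inter> JS" using frontier_component_julia [OF that(1)] by (auto simp: frontier_def)
  show "closure V \<inter> JS \<subseteq> frontier V"
   using in_components_subset [OF that(1)] that(2) by (auto simp: frontier_def interior_open julia_set_def)
 qed
 show ?thesis by (simp add: fr [OF V oV(1)] fr [OF fV oV(2)] image_julia cl)
qed

text \<open>As an unordered pair the sides are determined by \<open>V\<close>; the order is a
  labelling, which is transported along the orbit.\<close>

definition sides :: "riemann_sphere set \<Rightarrow> riemann_sphere set \<Rightarrow> riemann_sphere set \<Rightarrow> bool" where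
 "sides V A B \<longleftrightarrow> closed A \<and> closed B \<and> connected A \<and> connected B \<and> A \<noteq> {} \<and> B \<noteq> {} \<and> A \<inter> B = {} \<and> A \<union> B = - V"

lemma sidesD:
 assumes "sides V A B"
 shows "closed A" "closed B" "connected A" "connected B" "A \<noteq> {}" "B \<noteq> {}" "A \<inter> B = {}" "A \<union> B = - V" "sides V B A"
 using assms by (auto simp: sides_def)

lemma sides_frontier_nonempty: "sides V A B \<Longrightarrow> frontier A \<noteq> {}"
proof
 assume s: "sides V A B" and "frontier A = {}"
 hence "A \<subseteq> interior A" using sidesD(1) [OF s] by (simp add: frontier_def closure_closed)
 hence "open A" using interior_subset [of A] by (metis open_interior subset_antisym)
 hence "A = UNIV" using clopen_sphere [of A] sidesD [OF s] by blast
 thus False using sidesD(6,7) [OF s] by auto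
qed

lemma sides_frontier:
 assumes V: "V \<in> components FS" and s: "sides V A B"
 shows "frontier A = A \<inter> closure V" "frontier V = frontier A \<union> frontier B" "frontier A \<subseteq> JS"
  "frontier A \<subseteq> A" "connected (frontier A)"
proof -
 note D = sidesD [OF s]
 have oV: "open V" "connected V" using open_fatou_component [OF V] in_components_connected [OF V] by auto
 have fr: "frontier A = A \<inter> closure V" if s: "sides V A B" for A B
 proof
  note D = sidesD [OF s]
  show "frontier A \<subseteq> A \<inter> closure V"
   using frontier_side_closure [OF D(1,2,7,8)] frontier_subset_closed [OF D(1)] by blast
  show "A \<inter> closure V \<subseteq> frontier A"
  proof
   fix x assume x: "x \<in> A \<inter> closure V"
   have "interior A \<inter> V = {}" using interior_subset [of A] D(8) by blast
   hence "interior A \<inter> closure V = {}" by (simp add: open_Int_closure_eq_empty)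
   thus "x \<in> frontier A" using x closure_subset [of A] by (auto simp: frontier_def)
  qed
 qed
 show A: "frontier A = A \<inter> closure V" by (rule fr [OF s])
 have B: "frontier B = B \<inter> closure V" by (rule fr [OF D(9)])
 have "frontier V = closure V \<inter> - V" using oV(1) by (auto simp: frontier_def interior_open)
 thus frV: "frontier V = frontier A \<union> frontier B" using A B D(8) by blast
 show "frontier A \<subseteq> JS" using frV frontier_component_julia [OF V] by blast
 show "frontier A \<subseteq> A" using A by blast
 \<comment> \<open>The frontier of \<open>A\<close> is the intersection of \<open>A\<close> with
   this connected closed set, and the two cover the sphere, so unicoherence applies.\<close>
 have "connected (closure V \<union> B)"
  using oV(2) D(4) sides_frontier_nonempty [OF D(9)] B by (intro connected_Un connected_imp_connected_closure) auto
 moreover have "A \<union> (closure V \<union> B) = UNIV" using D(8) closure_subset [of V] by blast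
 ultimately have "connected (A \<inter> (closure V \<union> B))" using D by (intro connected_Int_of_cover) auto
 moreover have "A \<inter> (closure V \<union> B) = frontier A" using A D(7) by blast
 ultimately show "connected (frontier A)" by simp
qed

lemma sides_image:
 assumes V: "V \<in> components FS" and s: "sides V A B" and s': "sides (f ` V) A' B'"
 shows "f ` frontier A = frontier A' \<and> f ` frontier B = frontier B' \<or> f ` frontier A = frontier B' \<and> f ` frontier B = frontier A'"
proof -
 have fV: "f ` V \<in> components FS" by (rule image_fatou_component [OF V])
 note A = sides_frontier [OF V s] and B = sides_frontier [OF V sidesD(9) [OF s]]
 note A' = sides_frontier [OF fV s'] and B' = sides_frontier [OF fV sidesD(9) [OF s']]
 have eq: "f ` frontier A \<union> f ` frontier B = frontier A' \<union> frontier B'"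
  using frontier_image [OF V] A(2) A'(2) by (simp add: image_Un)
 have disj: "frontier A' \<inter> frontier B' = {}" using A'(4) B'(4) sidesD(7) [OF s'] by blast
 have one: "f ` X \<subseteq> frontier A' \<or> f ` X \<subseteq> frontier B'" if "connected X" "f ` X \<subseteq> frontier A' \<union> frontier B'" for X
 proof (cases "f ` X \<inter> frontier B' = {}")
  case False
  thus ?thesis
   using connected_subset_closed_partition [OF connected_continuous_image [OF continuous_f that(1)] that(2) frontier_closed frontier_closed disj] by blast
 qed (use that(2) in blast)
 have "f ` frontier A \<subseteq> frontier A' \<or> f ` frontier A \<subseteq> frontier B'" "f ` frontier B \<subseteq> frontier A' \<or> f ` frontier B \<subseteq> frontier B'"
  using one A(5) B(5) eq by blast+
 moreover have "frontier A' \<noteq> {}" "frontier B' \<noteq> {}" using sides_frontier_nonempty s' sidesD(9) by blast+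
 moreover have "X = P \<and> Y = Q \<or> X = Q \<and> Y = P" if "X \<subseteq> P \<or> X \<subseteq> Q" "Y \<subseteq> P \<or> Y \<subseteq> Q" "P \<noteq> {}" "Q \<noteq> {}"
  "X \<union> Y = P \<union> Q" "P \<inter> Q = {}" for X Y P Q :: "riemann_sphere set"
  using that(1,2) by (elim disjE) (use that(3-6) in blast)+
 ultimately show ?thesis using eq disj by presburger
qed

text \<open>The set \<open>K\<close> links the \<open>B\<close>-side of \<open>V\<close> with the
  \<open>A'\<close>-side of \<open>V'\<close>. Hence \<open>V'\<close> lies within \<open>B\<close>,
  and all that is left, \<open>V\<close> and \<open>A\<close>, lies within
  \<open>A'\<close>.\<close>

lemma sides_nested:
 assumes V: "V \<in> components FS" "sides V A B" and V': "V' \<in> components FS" "sides V' A' B'"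
  and ne: "V \<noteq> V'" and K: "connected K" "K \<subseteq> JS" "frontier B \<subseteq> K" "frontier A' \<subseteq> K"
 shows "A \<union> V \<subseteq> A'"
proof -
 note D = sidesD [OF V(2)] and D' = sidesD [OF V'(2)]
 have KF: "K \<inter> FS = {}" using K(2) by (auto simp: julia_set_def)
 have disj: "V \<inter> V' = {}" using components_nonoverlap [OF V(1) V'(1)] ne by blast
 have c: "connected V" "connected V'" using in_components_connected V(1) V'(1) by auto
 have F: "V \<subseteq> FS" "V' \<subseteq> FS" using in_components_subset V(1) V'(1) by auto
 note fA = sides_frontier [OF V] and fB = sides_frontier [OF V(1) D(9)] and fA' = sides_frontier [OF V']
 have part: "X \<subseteq> Q" if "connected X" "X \<subseteq> - W" "sides W P Q" "X \<inter> Q \<noteq> {}" for X W P Q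
  using connected_subset_closed_partition [OF that(1) _ sidesD(1,2,7) [OF that(3)] that(4)] sidesD(8) [OF that(3)] that(2) by simp
 have "K \<subseteq> B" using part [OF K(1) _ V(2)] K(3) fB(4) sides_frontier_nonempty [OF D(9)] KF F by blast
 have "K \<subseteq> A'" using part [OF K(1) _ D'(9)] K(4) fA'(4) sides_frontier_nonempty [OF V'(2)] KF F by blast
 have "V' \<subseteq> B"
 proof (rule part [OF c(2) _ V(2)])
  have "closure V' \<inter> B \<noteq> {}" using fA'(1) K(4) \<open>K \<subseteq> B\<close> sides_frontier_nonempty [OF V'(2)] by blast
  show "V' \<inter> B \<noteq> {}"
  proof
   assume "V' \<inter> B = {}"
   hence "V' \<subseteq> A" using disj D(8) by blast
   hence "closure V' \<subseteq> A" by (rule closure_minimal [OF _ D(1)])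
   thus False using \<open>closure V' \<inter> B \<noteq> {}\<close> D(7) by blast
  qed
 qed (use disj in blast)
 have "V \<subseteq> A'"
 proof (rule part [OF c(1) _ D'(9)])
  have "closure V \<inter> A' \<noteq> {}" using fB(1) K(3) \<open>K \<subseteq> A'\<close> sides_frontier_nonempty [OF D(9)] by blast
  show "V \<inter> A' \<noteq> {}"
  proof
   assume "V \<inter> A' = {}"
   hence "V \<subseteq> B'" using disj D'(8) by blast
   hence "closure V \<subseteq> B'" by (rule closure_minimal [OF _ D'(2)])
   thus False using \<open>closure V \<inter> A' \<noteq> {}\<close> D'(7) by blast
  qed
 qed (use disj in blast)
 moreover have "A \<subseteq> A'"
 proof (rule part [OF D(3) _ D'(9)])
  show "A \<subseteq> - V'" using \<open>V' \<subseteq> B\<close> D(7) by blast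
  have "closure V \<subseteq> A'" by (rule closure_minimal [OF \<open>V \<subseteq> A'\<close> D'(1)])
  thus "A \<inter> A' \<noteq> {}" using fA(1) sides_frontier_nonempty [OF V(2)] by blast
 qed
 ultimately show ?thesis by blast
qed

lemma sides_unique:
 assumes "sides V A B" "sides V A' B'"
 shows "A' = A \<and> B' = B \<or> A' = B \<and> B' = A"
proof -
 note D = sidesD [OF assms(1)] and D' = sidesD [OF assms(2)]
 have part: "X \<subseteq> P \<or> X \<subseteq> Q" if "connected X" "X \<subseteq> - V" "sides V P Q" for X P Q
 proof (cases "X \<inter> Q = {}")
  case False
  thus ?thesis
   using connected_subset_closed_partition [OF that(1) _ sidesD(1,2,7) [OF that(3)]] sidesD(8) [OF that(3)] that(2) by simp
 qed (use sidesD(8) [OF that(3)] that(2) in blast)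
 have "A' \<subseteq> A \<or> A' \<subseteq> B" "B' \<subseteq> A \<or> B' \<subseteq> B" using part [OF D'(3) _ assms(1)] part [OF D'(4) _ assms(1)] D'(8) by blast+
 moreover have "A \<subseteq> A' \<or> A \<subseteq> B'" "B \<subseteq> A' \<or> B \<subseteq> B'" using part [OF D(3) _ assms(2)] part [OF D(4) _ assms(2)] D(8) by blast+
 ultimately show ?thesis using D(5-7) D'(5-7) by blast
qed

context
 fixes V m b
 assumes V: "V \<in> components FS" and m: "filterlim m at_top sequentially"
  and ret: "\<And>x. x \<in> V \<Longrightarrow> (\<lambda>j. (f ^^ m j) x) \<longlonglongrightarrow> x"
  and CVF: "CV \<inter> FS \<subseteq> {b}" and mc: "\<not> connected (- V)"
begin

lemma image_sides:
 obtains A B where "sides ((f ^^ n) ` V) A B"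
proof -
 have n: "multiply_connected ((f ^^ n) ` V)"
  by (rule multiply_connected_iterate [OF CVF]) (simp add: multiply_connected_def V mc)
 have c: "(f ^^ n) ` V \<in> components FS" using n by (simp add: multiply_connected_def)
 have nc: "\<not> connected (- (f ^^ n) ` V)" using n by (simp add: multiply_connected_def)
 have r: "(\<lambda>j. (f ^^ m j) x) \<longlonglongrightarrow> x" if "x \<in> (f ^^ n) ` V" for x
  using orbit_returns [OF V m ret] that by (auto simp: orbit_def)
 show thesis using two_sides [OF c m r nc] that unfolding sides_def by metis
qed

text \<open>The labels follow the two frontiers along the orbit, so that a return to
  \<open>V\<close> can only keep or exchange them.\<close>

lemma side_sequence:
 assumes AB: "sides V A B"
 obtains S T where "\<And>n. sides ((f ^^ n) ` V) (S n) (T n)"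
  "\<And>n. (f ^^ n) ` frontier A = frontier (S n)" "\<And>n. (f ^^ n) ` frontier B = frontier (T n)"
proof -
 have "\<exists>S T. sides ((f ^^ n) ` V) S T \<and> (f ^^ n) ` frontier A = frontier S \<and> (f ^^ n) ` frontier B = frontier T" for n
 proof (induction n)
  case 0
  thus ?case using AB by auto
 next
  case (Suc n)
  then obtain S T where ST: "sides ((f ^^ n) ` V) S T" "(f ^^ n) ` frontier A = frontier S" "(f ^^ n) ` frontier B = frontier T" by blast
  obtain S' T' where ST': "sides ((f ^^ Suc n) ` V) S' T'" by (rule image_sides)
  have im: "(f ^^ Suc n) ` X = f ` (f ^^ n) ` X" for X by (simp add: image_comp)
  have "sides (f ` (f ^^ n) ` V) S' T'" using ST' unfolding im .
  thus ?case
   using sides_image [OF iterate_fatou_component [OF V] ST(1)] ST(2,3) ST' sidesD(9) [OF ST'] unfolding im by metis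
 qed
 thus thesis using that by metis
qed

lemma sides_return:
 assumes AB: "sides V A B" and j: "(f ^^ j) ` V = V"
 shows "(f ^^ j) ` frontier A = frontier A"
proof (cases "j = 0")
 case False
 obtain S T where ST: "\<And>n. sides ((f ^^ n) ` V) (S n) (T n)"
  "\<And>n. (f ^^ n) ` frontier A = frontier (S n)" "\<And>n. (f ^^ n) ` frontier B = frontier (T n)"
  using side_sequence [OF AB] by metis
 note D = sidesD [OF AB]
 have "S j = A \<and> T j = B \<or> S j = B \<and> T j = A" using sides_unique [OF AB] ST(1) [of j] j by metis
 moreover have False if "S j = B" "T j = A"
 proof (rule no_swap [OF V m ret D(1-8) _ j])
  show "(f ^^ j) ` frontier A \<subseteq> B" using ST(2) [of j] that(1) D(2) frontier_subset_closed by auto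
  show "(f ^^ j) ` frontier B \<subseteq> A" using ST(3) [of j] that(2) D(1) frontier_subset_closed by auto
 qed (use False in auto)
 ultimately show ?thesis using ST(2) [of j] by metis
qed simp

lemma return_multiple: "(f ^^ k) ` V = V \<Longrightarrow> (f ^^ (k * n)) ` V = V"
proof (induction n)
 case (Suc n)
 have "(f ^^ (k * Suc n)) ` V = (f ^^ k) ` (f ^^ (k * n)) ` V" by (simp add: image_comp funpow_add)
 thus ?case using Suc by simp
qed simp

lemma side_component_return:
 assumes AB: "sides V A B" and j: "(f ^^ j) ` V = V" and K: "K \<in> components JS" "frontier A \<subseteq> K"
 shows "(f ^^ j) ` K = K"
proof (rule julia_component_eq [OF iterate_julia_component [OF K(1)] K(1)])
 show "(f ^^ j) ` K \<inter> K \<noteq> {}" using sides_return [OF AB j] sides_frontier_nonempty [OF AB] K(2) by blast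
qed

lemma side_components_periodic:
 assumes AB: "sides V A B" and K: "K \<in> components JS" "frontier A \<subseteq> K"
 shows "(f ^^ i) ` K \<in> periodic_julia_components f"
proof -
 obtain k where k: "k \<ge> 1" "(f ^^ k) ` V = V" using period [OF V m ret] by blast
 have "(f ^^ k) ` (f ^^ i) ` K = (f ^^ i) ` (f ^^ k) ` K" by (simp only: image_comp comp_def iterate_commute)
 hence "(f ^^ k) ` (f ^^ i) ` K = (f ^^ i) ` K" by (simp only: side_component_return [OF AB k(2) K])
 thus ?thesis using iterate_julia_component [OF K(1)] k(1) by (auto simp: periodic_julia_components_def)
qed

text \<open>If the cycles met, some \<open>f ^^ l\<close> would take \<open>K\<close> to
  \<open>L\<close>. If it maps \<open>V\<close> to itself, \<open>L\<close> touches both sides of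
  \<open>V\<close>. Otherwise the images of \<open>L\<close> link successive images of
  \<open>V\<close>, each of which lies in a side of the next, and this chain of nested sides closes
  up after \<open>k\<close> steps.\<close>

lemma side_cycles_disjoint:
 assumes AB: "sides V A B" and K: "K \<in> components JS" "frontier A \<subseteq> K"
  and L: "L \<in> components JS" "frontier B \<subseteq> L"
 shows "(f ^^ i) ` K \<inter> (f ^^ j) ` L = {}"
proof (rule ccontr)
 assume "(f ^^ i) ` K \<inter> (f ^^ j) ` L \<noteq> {}"
 hence eq: "(f ^^ i) ` K = (f ^^ j) ` L" by (intro julia_component_eq iterate_julia_component K(1) L(1))
 note D = sidesD [OF AB]
 obtain k where k: "k \<ge> 1" "(f ^^ k) ` V = V" using period [OF V m ret] by blast
 \<comment> \<open>The \<open>k * j - j\<close> further steps complete the \<open>j\<close> steps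
   made from \<open>L\<close> to a multiple of the period \<open>k\<close>.\<close>
 define l where "l = k * j - j + i"
 have im: "(f ^^ (a + c)) ` X = (f ^^ a) ` (f ^^ c) ` X" for a c X by (simp add: image_comp funpow_add)
 have "(f ^^ l) ` K = (f ^^ (k * j - j)) ` (f ^^ j) ` L" by (simp only: l_def im eq)
 also have "\<dots> = (f ^^ (k * j)) ` L" using k(1) by (simp flip: im)
 also have "\<dots> = L" by (rule side_component_return [OF D(9) return_multiple [OF k(2)] L])
 finally have KL: "(f ^^ l) ` K = L" .
 have Lc: "connected L" "L \<subseteq> JS" using in_components_connected [OF L(1)] in_components_subset [OF L(1)] by auto
 show False
 proof (cases "(f ^^ l) ` V = V")
  case True
  hence "frontier A \<subseteq> L" using sides_return [OF AB True] K(2) KL by blast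
  moreover have "L \<subseteq> A \<union> B" using Lc(2) in_components_subset [OF V] D(8) by (auto simp: julia_set_def)
  moreover have "frontier A \<subseteq> A" "frontier B \<subseteq> B" using D(1,2) by (simp_all add: frontier_subset_closed)
  ultimately have "L \<subseteq> B"
   using L(2) sides_frontier_nonempty [OF D(9)] by (intro connected_subset_closed_partition [OF Lc(1) _ D(1,2,7)]) blast+
  thus False using \<open>frontier A \<subseteq> L\<close> \<open>frontier A \<subseteq> A\<close> D(7) sides_frontier_nonempty [OF AB] by blast
 next
  case False
  obtain S T where ST: "\<And>n. sides ((f ^^ n) ` V) (S n) (T n)"
   "\<And>n. (f ^^ n) ` frontier A = frontier (S n)" "\<And>n. (f ^^ n) ` frontier B = frontier (T n)"
   using side_sequence [OF AB] by metis
  have step: "S (n * l) \<union> (f ^^ (n * l)) ` V \<subseteq> S (Suc n * l)" for n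
  proof (rule sides_nested [OF iterate_fatou_component [OF V] ST(1) iterate_fatou_component [OF V] ST(1)])
   show "(f ^^ (n * l)) ` V \<noteq> (f ^^ (Suc n * l)) ` V"
   proof
    assume e: "(f ^^ (n * l)) ` V = (f ^^ (Suc n * l)) ` V"
    \<comment> \<open>These steps complete \<open>n * l\<close> to a multiple of \<open>k\<close>,
      so equality of two consecutive images would give \<open>V = (f ^^ l) V\<close>.\<close>
    define c where "c = k * (n * l) - n * l"
    have c: "c + n * l = k * (n * l)" using k(1) by (simp add: c_def)
    have "c + Suc n * l = l + k * (n * l)" using c by simp
    hence "(f ^^ c) ` (f ^^ (Suc n * l)) ` V = (f ^^ l) ` (f ^^ (k * (n * l))) ` V" by (simp only: im [symmetric])
    moreover have "(f ^^ c) ` (f ^^ (n * l)) ` V = (f ^^ (k * (n * l))) ` V" by (simp only: im [symmetric] c)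
    ultimately have "V = (f ^^ l) ` V" using e by (simp only: return_multiple [OF k(2)])
    thus False using False by simp
   qed
   show "connected ((f ^^ (n * l)) ` L)" by (rule connected_continuous_image [OF continuous_iterate Lc(1)])
   show "(f ^^ (n * l)) ` L \<subseteq> JS" using Lc(2) by auto
   show "frontier (T (n * l)) \<subseteq> (f ^^ (n * l)) ` L" using ST(3) [of "n * l"] L(2) by blast
   have "(f ^^ (Suc n * l)) ` frontier A = (f ^^ (n * l)) ` (f ^^ l) ` frontier A" by (simp add: add.commute flip: im)
   moreover have "(f ^^ (n * l)) ` (f ^^ l) ` frontier A \<subseteq> (f ^^ (n * l)) ` (f ^^ l) ` K" by (intro image_mono K(2))
   ultimately show "frontier (S (Suc n * l)) \<subseteq> (f ^^ (n * l)) ` L" using ST(2) [of "Suc n * l"] KL by simp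
  qed
  have "V \<subseteq> S (Suc n * l)" for n
  proof (induction n)
   case 0
   thus ?case using step [of 0] by simp
  next
   case (Suc n)
   thus ?case using step [of "Suc n"] by blast
  qed
  from this [of "k - 1"] have "V \<subseteq> S (k * l)" using k(1) by simp
  moreover have "V \<inter> S (k * l) = {}" using sidesD(8) [OF ST(1) [of "k * l"]] return_multiple [OF k(2), of l] by blast
  ultimately show False using in_components_nonempty [OF V] by blast
 qed
qed

end

end

section \<open>Inverse branches near the Julia set\<close>

lemma continuous_image_closure_point:
 assumes "open G" "H \<subseteq> G" "continuous_on G h" "y \<in> G" "y \<in> closure H" "h ` H \<subseteq> C"
 shows "h y \<in> closure C"
proof (rule ccontr)
 assume n: "h y \<notin> closure C"
 have "open (G \<inter> h -` (- closure C))" by (rule continuous_open_preimage [OF assms(3,1)]) auto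
 moreover have "y \<in> G \<inter> h -` (- closure C)" using n assms(4) by simp
 ultimately obtain u where "u \<in> H" "h u \<notin> closure C" using assms(5) closure_iff_nhds_not_empty [of y H] by blast
 thus False using assms(6) closure_subset [of C] by blast
qed

section \<open>Tame points and barriers in the Fatou set\<close>

context rational_map
begin

text \<open>The orbit of a neighbourhood of such a point stays in a compact part of the Fatou set,
  so the point can be enclosed in a closed forward invariant subset.\<close>

definition tame :: "riemann_sphere \<Rightarrow> bool" where
 "tame x \<longleftrightarrow> (\<exists>U\<in>components FS. x \<in> U \<and> (\<exists>n. recurrent ((f ^^ n) ` U)))"

lemma recurrentE:
 assumes "recurrent V"
 obtains m where "V \<in> components FS" "filterlim m at_top sequentially" "\<And>x. x \<in> V \<Longrightarrow> (\<lambda>j. (f ^^ m j) x) \<longlonglongrightarrow> x"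
 using assms unfolding recurrent_def by blast

lemma tame_orbit_nbhd:
 assumes "tame x"
 obtains r K where "r > 0" "compact K" "K \<subseteq> FS" "\<And>n y. y \<in> cball x r \<Longrightarrow> (f ^^ n) y \<in> K"
proof -
 obtain U n where U: "U \<in> components FS" "x \<in> U" "recurrent ((f ^^ n) ` U)" using assms by (auto simp: tame_def)
 obtain m where m: "(f ^^ n) ` U \<in> components FS" "filterlim m at_top sequentially"
  "\<And>x. x \<in> (f ^^ n) ` U \<Longrightarrow> (\<lambda>j. (f ^^ m j) x) \<longlonglongrightarrow> x"
  by (rule recurrentE [OF U(3)]) (rule that)
 obtain r where r: "r > 0" "cball x r \<subseteq> U" using open_fatou_component [OF U(1)] U(2) open_contains_cball by blast
 have cb: "compact (cball x r)" by (intro closed_imp_compact_sphere closed_cball)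
 have cn: "compact ((f ^^ n) ` cball x r)" by (rule compact_continuous_image [OF continuous_iterate cb])
 have sub: "(f ^^ n) ` cball x r \<subseteq> (f ^^ n) ` U" by (rule image_mono [OF r(2)])
 obtain K where K: "compact K" "K \<subseteq> orbit ((f ^^ n) ` U)" "\<And>i y. y \<in> (f ^^ n) ` cball x r \<Longrightarrow> (f ^^ i) y \<in> K"
  using orbit_of_compact_in_compact [OF m cn sub] by blast
 define L where "L = K \<union> (\<Union>i\<in>{..<n}. (f ^^ i) ` cball x r)"
 have "cball x r \<subseteq> FS" using r(2) in_components_subset [OF U(1)] by blast
 show thesis
 proof (rule that [OF r(1)])
  show "compact L"
   unfolding L_def by (intro compact_Un K(1) compact_UN compact_continuous_image continuous_iterate cb) auto
  show "L \<subseteq> FS" using K(2) orbit_fatou [OF m] \<open>cball x r \<subseteq> FS\<close> by (auto simp: L_def subset_iff)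
  fix i y assume y: "y \<in> cball x r"
  show "(f ^^ i) y \<in> L"
  proof (cases "i < n")
   case True
   thus ?thesis using y unfolding L_def by blast
  next
   case False
   hence "(f ^^ i) y = (f ^^ (i - n)) ((f ^^ n) y)" by (simp flip: iterate_add)
   thus ?thesis using K(3) y by (simp add: L_def)
  qed
 qed
qed

text \<open>\<open>E\<close> is the closure of the forward orbit of \<open>C\<close>; the compact
  bounds for orbits near finitely many points keep it in the Fatou set.\<close>

lemma tame_closure:
 assumes C: "compact C" "\<And>x. x \<in> C \<Longrightarrow> tame x"
 obtains E where "closed E" "C \<subseteq> E" "E \<subseteq> FS" "f ` E \<subseteq> E"
proof -
 have "\<exists>r K. r > 0 \<and> compact K \<and> K \<subseteq> FS \<and> (\<forall>n. \<forall>y\<in>cball x r. (f ^^ n) y \<in> K)" if "x \<in> C" for x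
  by (rule tame_orbit_nbhd [OF C(2) [OF that]]) blast
 then obtain r K where rK: "\<And>x. x \<in> C \<Longrightarrow> r x > 0 \<and> compact (K x) \<and> K x \<subseteq> FS \<and> (\<forall>n. \<forall>y\<in>cball x (r x). (f ^^ n) y \<in> K x)"
  by metis
 obtain F where F: "F \<subseteq> C" "finite F" "C \<subseteq> (\<Union>x\<in>F. ball x (r x))" using compact_ball_cover [OF C(1), of r] rK by metis
 define L where "L = (\<Union>x\<in>F. K x)"
 have "compact L" unfolding L_def using rK F by (intro compact_UN) auto
 hence L: "closed L" "L \<subseteq> FS" using rK F by (auto simp: L_def compact_imp_closed subset_iff)
 define Q where "Q = (\<Union>n. (f ^^ n) ` C)"
 have "Q \<subseteq> L"
 proof -
  have "(f ^^ n) y \<in> L" if y: "y \<in> C" for n y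
  proof -
   obtain x where x: "x \<in> F" "y \<in> ball x (r x)" using F(3) y by blast
   hence "y \<in> cball x (r x)" "x \<in> C" using F(1) by auto
   hence "(f ^^ n) y \<in> K x" using rK by blast
   thus ?thesis using x(1) unfolding L_def by blast
  qed
  thus ?thesis by (auto simp: Q_def)
 qed
 have "f ` Q \<subseteq> Q"
 proof -
  have "f ` (f ^^ n) ` C = (f ^^ Suc n) ` C" for n by (simp add: image_comp)
  thus ?thesis unfolding Q_def image_UN by blast
 qed
 show thesis
 proof (rule that)
  have "C = (f ^^ 0) ` C" by simp
  hence "C \<subseteq> Q" unfolding Q_def by blast
  thus "C \<subseteq> closure Q" using closure_subset by blast
  show "closure Q \<subseteq> FS" using closure_minimal [OF \<open>Q \<subseteq> L\<close> L(1)] L(2) by blast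
  show "f ` closure Q \<subseteq> closure Q"
   using \<open>f ` Q \<subseteq> Q\<close> closure_subset [of Q] by (intro image_closure_subset continuous_f closed_closure) blast
 qed (rule closed_closure)
qed

lemma tame_multiply_connected:
 assumes "CV \<inter> FS \<subseteq> {b}" "multiply_connected U" "x \<in> U"
 shows "tame x"
 using multiply_connected_recurrent [OF assms(1,2)] assms(2,3) unfolding tame_def multiply_connected_def by metis

text \<open>The complement of \<open>E\<close> is invariant under preimages and falls into two open
  parts around \<open>A\<close> and around \<open>B\<close>. Components that are not multiply
  connected go with their frontier; what is left over lies in multiply connected components, is
  tame, and can be put into \<open>E\<close>.\<close>

lemma barrier:
 assumes CVF: "CV \<inter> FS \<subseteq> {b}"
  and AB: "closed A" "closed B" "A \<inter> B = {}" "A \<union> B = JS" and ne: "JS \<noteq> {}"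
  and C: "compact C" "\<And>x. x \<in> C \<Longrightarrow> tame x"
 obtains E NA NB where "closed E" "C \<subseteq> E" "E \<subseteq> FS" "f ` E \<subseteq> E"
  "open NA" "open NB" "NA \<inter> NB = {}" "- E \<subseteq> NA \<union> NB" "A \<subseteq> NA" "B \<subseteq> NB"
  "\<And>U. U \<in> components FS \<Longrightarrow> \<not> multiply_connected U \<Longrightarrow> frontier U \<subseteq> B \<Longrightarrow> U \<subseteq> NB"
proof -
 define \<A> where "\<A> = {U \<in> components FS. \<not> multiply_connected U \<and> frontier U \<subseteq> A}"
 define \<B> where "\<B> = {U \<in> components FS. \<not> multiply_connected U \<and> frontier U \<subseteq> B}"
 have "closed (A \<union> \<Union>\<A>)" by (rule closed_fill [OF AB]) (auto simp: \<A>_def)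
 moreover have "closed (B \<union> \<Union>\<B>)" by (rule closed_fill [OF AB(2,1)]) (use AB in \<open>auto simp: \<B>_def\<close>)
 moreover have "(A \<union> \<Union>\<A>) \<inter> (B \<union> \<Union>\<B>) = {}"
 proof -
  have "U \<inter> U' = {}" if U: "U \<in> \<A>" "U' \<in> \<B>" for U U'
  proof (rule ccontr)
   assume "U \<inter> U' \<noteq> {}"
   hence "U = U'" using U components_nonoverlap unfolding \<A>_def \<B>_def by blast
   hence fr: "U \<in> components FS" "\<not> multiply_connected U" "frontier U = {}"
    using U AB(3) unfolding \<A>_def \<B>_def by auto
   have "- U \<noteq> {}" using in_components_subset [OF fr(1)] ne by (auto simp: julia_set_def)
   thus False using frontier_component [OF fr(1,2)] fr(3) by blast
  qed
  moreover have "U \<inter> (A \<union> B) = {}" if "U \<in> \<A> \<union> \<B>" for U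
   using that in_components_subset AB(4) unfolding \<A>_def \<B>_def julia_set_def by blast
  ultimately show ?thesis using AB(3) by blast
 qed
 ultimately obtain NA NB where N: "open NA" "open NB" "A \<union> \<Union>\<A> \<subseteq> NA" "B \<union> \<Union>\<B> \<subseteq> NB" "NA \<inter> NB = {}"
  by (rule separation_sphere)
 have "tame x" if x: "x \<in> - (NA \<union> NB)" for x
 proof -
  have "x \<in> FS" using x N(3,4) AB(4) by (auto simp: julia_set_def)
  then obtain U where U: "U \<in> components FS" "x \<in> U" by (metis UnionE Union_components)
  show ?thesis
  proof (cases "multiply_connected U")
   case True
   thus ?thesis using tame_multiply_connected [OF CVF True U(2)] by simp
  next
   case False
   have "- U \<noteq> {}" using in_components_subset [OF U(1)] ne by (auto simp: julia_set_def)
   hence fr: "connected (frontier U)" "frontier U \<subseteq> A \<union> B"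
    using frontier_component [OF U(1) False] frontier_component_julia [OF U(1)] AB(4) by auto
   have "frontier U \<subseteq> A \<or> frontier U \<subseteq> B"
   proof (cases "frontier U \<inter> B = {}")
    case False
    thus ?thesis using connected_subset_closed_partition [OF fr AB(1-3)] by blast
   qed (use fr(2) in blast)
   hence "U \<in> \<A> \<or> U \<in> \<B>" using U(1) False by (auto simp: \<A>_def \<B>_def)
   thus ?thesis using U(2) N(3,4) x by blast
  qed
 qed
 moreover have "compact (- (NA \<union> NB))" using N(1,2) by (intro closed_imp_compact_sphere) auto
 ultimately have "compact (C \<union> - (NA \<union> NB))" "\<And>x. x \<in> C \<union> - (NA \<union> NB) \<Longrightarrow> tame x" using C by auto
 then obtain E where E: "closed E" "C \<union> - (NA \<union> NB) \<subseteq> E" "E \<subseteq> FS" "f ` E \<subseteq> E" using tame_closure by metis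
 show thesis
 proof (rule that [OF E(1) _ E(3,4) N(1,2,5)])
  show "U \<subseteq> NB" if "U \<in> components FS" "\<not> multiply_connected U" "frontier U \<subseteq> B" for U
   using that N(4) unfolding \<B>_def by blast
 qed (use E N in blast)+
qed

lemma forward_invariant_iterate:
 assumes "f ` E \<subseteq> E" "x \<in> E"
 shows "(f ^^ n) x \<in> E"
 using assms by (induction n) auto

section \<open>Holomorphic inverse branches\<close>

lemma holomorphic_lift:
 assumes G: "open G" and h: "continuous_on G h" "\<And>u. u \<in> G \<Longrightarrow> f (h u) = g u"
  and hol: "(\<lambda>u. chart w (g u)) holomorphic_on G"
  and avoid: "\<And>u. u \<in> G \<Longrightarrow> h u \<noteq> w" "\<And>u. u \<in> G \<Longrightarrow> g u \<noteq> w" "\<And>u. u \<in> G \<Longrightarrow> g u \<notin> CV"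
 shows "(\<lambda>u. chart w (h u)) holomorphic_on G"
proof -
 have "(\<lambda>u. chart w (h u)) field_differentiable (at u0)" if u0: "u0 \<in> G" for u0
 proof -
  have "\<not> critical_point f (h u0)" using avoid(3) [OF u0] h(2) [OF u0] unfolding critical_values_def by (metis image_eqI mem_Collect_eq)
  then obtain D where D: "open D" "h u0 \<in> D" "inj_on f D" using locally_injective by blast
  define D' where "D' = D \<inter> - {w} \<inter> f -` (- {w})"
  have D': "open D'" "h u0 \<in> D'"
   using D avoid(1,2) [OF u0] h(2) [OF u0] by (auto simp: D'_def intro!: open_Int open_vimage continuous_f)
  define Z where "Z = par w -` D'"
  have oZ: "open Z" unfolding Z_def by (rule open_par_vimage [OF D'(1)])
  define F where "F z = chart w ((f ^^ 1) (par w z))" for z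
  have Fh: "F holomorphic_on Z"
   unfolding F_def using oZ by (rule chart_iterate_holomorphic) (auto simp: Z_def D'_def)
  have "inj_on F Z"
  proof (rule inj_onI)
   fix y z assume yz: "y \<in> Z" "z \<in> Z" "F y = F z"
   hence "f (par w y) \<noteq> w" "f (par w z) \<noteq> w" by (auto simp: Z_def D'_def)
   hence "f (par w y) = f (par w z)" using arg_cong [OF yz(3), of "par w"] by (simp add: F_def)
   moreover have "par w y \<in> D" "par w z \<in> D" using yz(1,2) by (auto simp: Z_def D'_def)
   ultimately have "par w y = par w z" using D(3) by (simp only: inj_on_def)
   thus "y = z" by simp
  qed
  then obtain Fi where Fi: "Fi holomorphic_on (F ` Z)" "\<And>z. z \<in> Z \<Longrightarrow> Fi (F z) = z"
   using holomorphic_has_inverse [OF Fh oZ] by metis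
  define G' where "G' = G \<inter> h -` D'"
  have oG': "open G'" unfolding G'_def by (rule continuous_open_preimage [OF h(1) G D'(1)])
  have key: "chart w (h u) \<in> Z" "F (chart w (h u)) = chart w (g u)" if "u \<in> G'" for u
  proof -
   have "u \<in> G" "h u \<in> D'" using that by (auto simp: G'_def)
   thus "chart w (h u) \<in> Z" "F (chart w (h u)) = chart w (g u)" using avoid(1) h(2) by (auto simp: Z_def F_def)
  qed
  have hol': "(\<lambda>u. chart w (g u)) holomorphic_on G'" using hol by (rule holomorphic_on_subset) (auto simp: G'_def)
  have "(\<lambda>u. chart w (g u)) ` G' \<subseteq> F ` Z"
  proof (rule image_subsetI)
   fix u assume "u \<in> G'"
   thus "chart w (g u) \<in> F ` Z" using key by (intro image_eqI [of _ _ "chart w (h u)"]) auto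
  qed
  hence "(Fi \<circ> (\<lambda>u. chart w (g u))) holomorphic_on G'"
   by (intro holomorphic_on_compose [OF hol'] holomorphic_on_subset [OF Fi(1)])
  hence "(\<lambda>u. chart w (h u)) holomorphic_on G'"
   by (rule holomorphic_transform) (use Fi(2) key in \<open>auto simp flip: key(2)\<close>)
  thus ?thesis using oG' u0 D'(2) by (auto simp: G'_def intro!: holomorphic_on_imp_differentiable_at)
 qed
 thus ?thesis by (simp add: holomorphic_on_def field_differentiable_at_within)
qed

text \<open>The branches follow a prescribed backward orbit \<open>x\<close>. Forward invariance of
  \<open>E\<close> keeps them off \<open>E\<close>, hence in the chart at \<open>w\<close>. Avoiding
  critical values is left to \<open>step\<close>, which may use all that is known of the current
  branch.\<close>

lemma tracked_branches:
 assumes G: "open G" "simply_connected G" and u0: "u0 \<in> G"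
  and \<phi>: "continuous_on G \<phi>" "(\<lambda>u. chart w (\<phi> u)) holomorphic_on G" "\<And>u. u \<in> G \<Longrightarrow> \<phi> u \<notin> E"
  and E: "f ` E \<subseteq> E" "w \<in> E"
  and x: "x 0 = \<phi> u0" "\<And>i. i < N \<Longrightarrow> f (x (Suc i)) = x i"
  and step: "\<And>i h. i < N \<Longrightarrow> continuous_on G h \<Longrightarrow> h u0 = x i \<Longrightarrow> (\<And>u. u \<in> G \<Longrightarrow> (f ^^ i) (h u) = \<phi> u) \<Longrightarrow>
   (\<And>u. u \<in> G \<Longrightarrow> h u \<notin> E) \<Longrightarrow> h ` G \<inter> CV = {}"
  and n: "n \<le> N"
 shows "\<exists>h. continuous_on G h \<and> h u0 = x n \<and> (\<forall>u\<in>G. (f ^^ n) (h u) = \<phi> u) \<and> (\<forall>u\<in>G. h u \<notin> E) \<and> (\<lambda>u. chart w (h u)) holomorphic_on G"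
 using n
proof (induction n)
 case 0
 thus ?case using \<phi> x(1) by (intro exI [of _ \<phi>]) auto
next
 case (Suc n)
 hence nN: "n < N" by simp
 obtain h where h: "continuous_on G h" "h u0 = x n" "\<And>u. u \<in> G \<Longrightarrow> (f ^^ n) (h u) = \<phi> u" "\<And>u. u \<in> G \<Longrightarrow> h u \<notin> E"
  "(\<lambda>u. chart w (h u)) holomorphic_on G"
  using Suc nN by auto
 have avoid: "h u \<notin> CV" if "u \<in> G" for u using step [OF nN h(1-4)] that by blast
 have "f (x (Suc n)) = h u0" using x(2) [OF nN] h(2) by simp
 then obtain h' where h': "continuous_on G h'" "h' u0 = x (Suc n)" "\<And>u. u \<in> G \<Longrightarrow> f (h' u) = h u"
  using lift [OF G(2) open_imp_locally_path_connected [OF G(1)] h(1) avoid u0] by metis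
 have eq: "(f ^^ Suc n) (h' u) = \<phi> u" if "u \<in> G" for u
  using h(3) [OF that] h'(3) [OF that] by (simp add: funpow_Suc_right del: funpow.simps)
 have E': "h' u \<notin> E" if "u \<in> G" for u
  using forward_invariant_iterate [OF E(1), of "h' u" "Suc n"] eq [OF that] \<phi>(3) [OF that] by auto
 have "(\<lambda>u. chart w (h' u)) holomorphic_on G"
  using E' h(4) avoid E(2) by (intro holomorphic_lift [OF G(1) h'(1,3) h(5)]) auto
 thus ?case using h'(1,2) eq E' by blast
qed

lemma branch_frontier:
 assumes U: "U \<in> components FS" and G: "open G" "H \<subseteq> G" "continuous_on G h"
  and H: "connected H" "\<And>u. u \<in> H \<Longrightarrow> (f ^^ i) (h u) \<in> FS" "u0 \<in> H" "h u0 \<in> U"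
  and y: "y \<in> G" "y \<in> closure H" "(f ^^ i) (h y) \<in> JS"
 shows "h ` H \<subseteq> U" "h y \<in> frontier U"
proof -
 show *: "h ` H \<subseteq> U"
 proof (rule components_maximal [OF U])
  show "connected (h ` H)" using G(2,3) H(1) by (blast intro: connected_continuous_image continuous_on_subset)
  show "h ` H \<subseteq> FS" using H(2) by auto
 qed (use H(3,4) in blast)
 have "h y \<in> closure U" by (rule continuous_image_closure_point [OF G y(1,2) *])
 moreover have "h y \<in> JS" using y(3) by simp
 ultimately show "h y \<in> frontier U"
  using in_components_subset [OF U] open_fatou_component [OF U] by (auto simp: frontier_def interior_open julia_set_def)
qed

text \<open>The image of the branch is connected and misses the barrier, so it stays in
  \<open>NA\<close>, while the critical values in the Julia set are in \<open>NB\<close>. Only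
  \<open>b\<close> remains.\<close>

lemma branch_avoids_critical_values:
 assumes NN: "open NA" "open NB" "NA \<inter> NB = {}" "- E \<subseteq> NA \<union> NB" and CVJ: "CV \<inter> JS \<subseteq> NB" and CVF: "CV \<inter> FS \<subseteq> {b}"
  and G: "connected G" and h: "continuous_on G h" "\<And>u. u \<in> G \<Longrightarrow> h u \<notin> E" and y: "y \<in> G" "h y \<in> NA"
  and b: "\<And>u. u \<in> G \<Longrightarrow> h u = b \<Longrightarrow> b \<in> NA - E \<Longrightarrow> False"
 shows "h ` G \<inter> CV = {}"
proof -
 have NA: "h ` G \<subseteq> NA"
 proof (rule connected_subset_open_partition [OF connected_continuous_image [OF h(1) G] _ NN(2,1)])
  show "h ` G \<subseteq> NB \<union> NA" using h(2) NN(4) by blast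
 qed (use NN(3) y in blast)+
 have False if u: "u \<in> G" "h u \<in> CV" for u
 proof -
  have "h u \<in> NA" using NA u(1) by blast
  hence "h u \<in> FS" using CVJ NN(3) u(2) by (auto simp: julia_set_def)
  hence "h u = b" using CVF u(2) by blast
  thus False using b [OF u(1)] h(2) [OF u(1)] \<open>h u \<in> NA\<close> by blast
 qed
 thus ?thesis by blast
qed

text \<open>Around a point of \<open>V\<close> close to the frontier, the largest disc inside
  \<open>V\<close> touches the complement at a nearest point \<open>y\<close>.\<close>

lemma accessible_frontier_point:
 assumes V: "V \<in> components FS" and s: "sides V A B" and N: "open N" "N \<inter> frontier A \<noteq> {}"
  and w: "w \<in> FS"
 obtains x y where "x \<noteq> y" "ball x (dist x y) \<subseteq> par w -` V" "par w y \<in> N \<inter> frontier A"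
proof -
 note D = sidesD [OF s] and fA = sides_frontier [OF V s]
 obtain b where b: "b \<in> N" "b \<in> frontier A" using N(2) by blast
 have "b \<noteq> w" using b(2) fA(3) w by (auto simp: julia_set_def)
 define c where "c = chart w b"
 have cb: "par w c = b" using \<open>b \<noteq> w\<close> by (simp add: c_def)
 have "b \<notin> B" using b(2) fA(4) D(7) by blast
 have "open (par w -` (N \<inter> - B))" using N(1) D(2) by (intro open_par_vimage) auto
 moreover have "c \<in> par w -` (N \<inter> - B)" using b(1) \<open>b \<notin> B\<close> cb by simp
 ultimately obtain r where r: "r > 0" "ball c r \<subseteq> par w -` (N \<inter> - B)" by (rule openE)
 have "open (par w ` ball c (r / 2))" by (intro open_par_image open_ball)
 moreover have "b \<in> par w ` ball c (r / 2)" using cb r(1) by (intro image_eqI [of _ _ c]) auto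
 moreover have "b \<in> closure V" using b(2) fA(1) by blast
 ultimately obtain x where x: "x \<in> ball c (r / 2)" "par w x \<in> V" using closure_iff_nhds_not_empty [of b V] by blast
 have cl: "closed (- (par w -` V))"
  using open_par_vimage [OF open_fatou_component [OF V]] by (simp add: closed_Compl)
 have "b \<notin> V" using b(2) fA(4) D(8) by blast
 hence c': "c \<in> - (par w -` V)" using cb by simp
 then obtain y where y: "y \<in> - (par w -` V)" "\<And>z. z \<in> - (par w -` V) \<Longrightarrow> dist x y \<le> dist x z"
  using distance_attains_inf [OF cl, of x] by blast
 have sub: "ball x (dist x y) \<subseteq> par w -` V" using y(2) by force
 have "x \<noteq> y" using x(2) y(1) by auto
 have "dist x y \<le> dist x c" by (rule y(2) [OF c'])
 moreover have "dist c x < r / 2" using x(1) by simp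
 ultimately have "dist c y < r" by metric
 hence yN: "par w y \<in> N" "par w y \<notin> B" using r(2) by auto
 hence "par w y \<in> A" using y(1) D(8) by auto
 moreover have "par w y \<in> closure V"
 proof -
  have "y \<in> closure (ball x (dist x y))" using \<open>x \<noteq> y\<close> by simp
  hence "par w y \<in> par w ` closure (ball x (dist x y))" by (rule imageI)
  also have "\<dots> \<subseteq> closure V"
  proof (rule image_closure_subset [OF continuous_par closed_closure])
   show "par w ` ball x (dist x y) \<subseteq> closure V" using sub closure_subset [of V] by blast
  qed
  finally show ?thesis .
 qed
 ultimately show thesis using that [of x y] \<open>x \<noteq> y\<close> sub yN(1) fA(1) by blast
qed

context
 fixes V m b
 assumes V: "V \<in> components FS" and m: "filterlim m at_top sequentially"
  and ret: "\<And>x. x \<in> V \<Longrightarrow> (\<lambda>j. (f ^^ m j) x) \<longlonglongrightarrow> x"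
  and CVF: "CV \<inter> FS \<subseteq> {b}" and mc: "\<not> connected (- V)"
begin

text \<open>At an accessible point \<open>y0\<close> of the frontier of \<open>A\<close> the inverse branches along \<open>V\<close> extend to a neighbourhood.
 Those of \<open>f ^^ m j\<close> tend to the identity, hence so does \<open>f ^^ m j\<close> near \<open>y0\<close>.\<close>

lemma tracked_frontier_contradiction:
 assumes AB: "sides V A B" and Kc: "\<And>a. (f ^^ a) ` frontier A \<subseteq> Kc" "Kc \<subseteq> NA"
  and E: "closed E" "E \<subseteq> FS" "f ` E \<subseteq> E"
  and NN: "open NA" "open NB" "NA \<inter> NB = {}" "- E \<subseteq> NA \<union> NB" and CVJ: "CV \<inter> JS \<subseteq> NB"
  and W: "W \<in> components FS" "W \<inter> orbit V = {}" "f ` W \<subseteq> orbit V" and w: "\<rho> > 0" "cball w \<rho> \<subseteq> E" "w \<in> W"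
  and N: "open N" "N \<inter> frontier A \<noteq> {}" and orb: "\<And>i. b \<in> NA - E \<Longrightarrow> (f ^^ i) b \<notin> N"
 shows False
proof -
 note D = sidesD [OF AB] and fA = sides_frontier [OF V AB] and fB = sides_frontier [OF V sidesD(9) [OF AB]]
 have wF: "w \<in> FS" using w(3) in_components_subset [OF W(1)] by blast
 have wE: "w \<in> E" using w(1,2) by auto
 obtain x y0 where xy: "x \<noteq> y0" "ball x (dist x y0) \<subseteq> par w -` V" "par w y0 \<in> N \<inter> frontier A"
  using accessible_frontier_point [OF V AB N wF] by blast
 have y0J: "par w y0 \<in> JS" using xy(3) fA(3) by blast
 have "open (par w -` (N \<inter> - E))" using N(1) E(1) by (intro open_par_vimage) auto
 moreover have "y0 \<in> par w -` (N \<inter> - E)" using xy(3) y0J E(2) by (auto simp: julia_set_def)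
 ultimately obtain r where r: "r > 0" "ball y0 r \<subseteq> par w -` (N \<inter> - E)" by (rule openE)
 define G where "G = ball y0 r"
 \<comment> \<open>A lens inside \<open>V\<close> with \<open>y0\<close> in its closure. On
   \<open>H\<close> the branches invert iterates along the orbit of \<open>V\<close>; they are to be
   continued over all of \<open>G\<close>.\<close>
 define H where "H = G \<inter> ball x (dist x y0)"
 have H: "open H" "connected H" "H \<subseteq> G" by (auto simp: H_def G_def intro: convex_connected convex_Int)
 have y0H: "y0 \<in> closure H" unfolding closure_approachable
 proof (intro allI impI)
  fix e :: real assume e: "e > 0"
  define s where "s = dist x y0"
  have s: "s > 0" using xy(1) by (simp add: s_def)
  define t where "t = min (1 / 2) (min e r / (2 * s))"
  have t: "0 < t" "t < 1" "t * s < e" "t * s < r"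
  proof -
   have "t * s \<le> min e r / (2 * s) * s" using s by (intro mult_right_mono) (auto simp: t_def)
   thus "t * s < e" "t * s < r" using s e r(1) by auto
   show "0 < t" "t < 1" using s e r(1) by (auto simp: t_def)
  qed
  define z where "z = y0 + of_real t * (x - y0)"
  have "dist z y0 = t * s" using t(1) by (simp add: z_def s_def dist_norm norm_mult)
  moreover have "x - z = of_real (1 - t) * (x - y0)" by (simp add: z_def algebra_simps)
  hence "dist x z = \<bar>1 - t\<bar> * s" by (simp only: dist_norm norm_mult norm_of_real s_def)
  hence "dist x z = (1 - t) * s" using t(2) by simp
  moreover have "(1 - t) * s < s" using t(1) s by (simp add: algebra_simps)
  ultimately have "z \<in> H" "dist z y0 < e" using t s by (auto simp: H_def G_def s_def [symmetric] dist_commute)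
  thus "\<exists>z\<in>H. dist z y0 < e" by blast
 qed
 then obtain u0 where u0: "u0 \<in> H" by fastforce
 have HV: "par w u \<in> V" if "u \<in> H" for u using that xy(2) by (auto simp: H_def)
 have VF: "V \<subseteq> FS" by (rule in_components_subset [OF V])
 have "\<exists>z\<in>orbit V. f z = y" if "y \<in> orbit V" for y using image_orbit [OF V m ret] that by (metis imageE)
 \<comment> \<open>Preimages are chosen inside the orbit of \<open>V\<close>, so that the backward
   orbit \<open>\<xi>\<close> never leaves it.\<close>
 then obtain g where g: "\<And>y. y \<in> orbit V \<Longrightarrow> g y \<in> orbit V \<and> f (g y) = y" by metis
 define \<xi> where "\<xi> i = (g ^^ i) (par w u0)" for i
 have \<xi>_in: "\<xi> i \<in> orbit V" for i
 proof (induction i)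
  case 0
  thus ?case using HV [OF u0] subset_orbit [OF V m ret] by (auto simp: \<xi>_def)
 qed (use g in \<open>simp add: \<xi>_def\<close>)
 have \<xi>: "\<xi> 0 = par w u0" "\<And>i. f (\<xi> (Suc i)) = \<xi> i" using g \<xi>_in by (simp_all add: \<xi>_def)
 have iter_\<xi>: "(f ^^ i) (\<xi> i) = par w u0" for i
 proof (induction i)
  case (Suc i)
  thus ?case using \<xi>(2) by (simp add: funpow_Suc_right del: funpow.simps)
 qed (simp add: \<xi>)
 obtain S T where ST: "\<And>n. sides ((f ^^ n) ` V) (S n) (T n)"
  "\<And>n. (f ^^ n) ` frontier A = frontier (S n)" "\<And>n. (f ^^ n) ` frontier B = frontier (T n)"
  using side_sequence [OF V m ret CVF mc AB] by metis
 \<comment> \<open>At \<open>y0\<close> the branch arrives at the side coming from \<open>A\<close>.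
   If it arrived at the other one, the iterate would return to \<open>V\<close> and take the
   frontier of \<open>B\<close> to that of \<open>A\<close>, against
   \<open>sides_return\<close>.\<close>
 have branch: "(\<forall>u\<in>H. h u \<in> orbit V) \<and> h y0 \<in> Kc"
  if h: "continuous_on G h" "h u0 = \<xi> i" "\<And>u. u \<in> G \<Longrightarrow> (f ^^ i) (h u) = par w u" for i h
 proof -
  obtain a where a: "\<xi> i \<in> (f ^^ a) ` V" using \<xi>_in [of i] unfolding orbit_def by blast
  have Va: "(f ^^ a) ` V \<in> components FS" by (rule iterate_fatou_component [OF V])
  have y0G: "y0 \<in> G" using r(1) by (simp add: G_def)
  have "h ` H \<subseteq> (f ^^ a) ` V" "h y0 \<in> frontier ((f ^^ a) ` V)"
   by (rule branch_frontier [OF Va _ H(3) h(1) H(2) _ u0 _ y0G y0H, of i];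
     use h(2,3) a y0G y0J H(3) HV VF in \<open>auto simp: G_def subset_iff\<close>)+
  hence "h y0 \<in> frontier (S a) \<union> frontier (T a)" "h ` H \<subseteq> (f ^^ a) ` V" using sides_frontier(2) [OF Va ST(1)] by simp_all
  moreover have "h y0 \<notin> frontier (T a)"
  proof
   assume "h y0 \<in> frontier (T a)"
   hence "par w y0 \<in> (f ^^ i) ` (f ^^ a) ` frontier B" using ST(3) [of a] h(3) [OF y0G] by (metis imageI)
   hence 1: "par w y0 \<in> (f ^^ (i + a)) ` frontier B" by (simp add: image_comp funpow_add)
   have "(f ^^ i) (\<xi> i) \<in> (f ^^ i) ` (f ^^ a) ` V" using a by (rule imageI)
   hence "par w u0 \<in> (f ^^ (i + a)) ` V" by (simp add: iter_\<xi> image_comp funpow_add)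
   hence "(f ^^ (i + a)) ` V = V"
    using components_nonoverlap [OF iterate_fatou_component [OF V] V] HV [OF u0] by blast
   hence "(f ^^ (i + a)) ` frontier B = frontier B" using sides_return [OF V m ret CVF mc D(9), of "i + a"] by blast
   thus False using 1 xy(3) fA(4) fB(4) D(7) by blast
  qed
  ultimately have "h y0 \<in> Kc" using ST(2) [of a] Kc(1) [of a] by blast
  thus ?thesis using \<open>h ` H \<subseteq> (f ^^ a) ` V\<close> unfolding orbit_def by blast
 qed
 have step: "h ` G \<inter> CV = {}"
  if h: "continuous_on G h" "h u0 = \<xi> i" "\<And>u. u \<in> G \<Longrightarrow> (f ^^ i) (h u) = par w u" "\<And>u. u \<in> G \<Longrightarrow> h u \<notin> E" for i h
 proof -
  have y0: "y0 \<in> G" "h y0 \<in> NA" using branch [OF h(1-3)] Kc(2) r(1) by (auto simp: G_def)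
  show ?thesis
  proof (rule branch_avoids_critical_values [OF NN CVJ CVF _ h(1,4) y0])
   show False if "u \<in> G" "h u = b" "b \<in> NA - E" for u
    using orb [OF that(3), of i] h(3) [OF that(1)] that(1,2) r(2) by (auto simp: G_def)
  qed (simp add: G_def)
 qed
 have GE: "par w u \<notin> E" if "u \<in> G" for u using that r(2) by (auto simp: G_def)
 have scG: "open G" "simply_connected G" by (auto simp: G_def convex_imp_simply_connected)
 have "\<exists>h. continuous_on G h \<and> h u0 = \<xi> n \<and> (\<forall>u\<in>G. (f ^^ n) (h u) = par w u) \<and> (\<forall>u\<in>G. h u \<notin> E) \<and> (\<lambda>u. chart w (h u)) holomorphic_on G" for n
 proof -
  have u0G: "u0 \<in> G" using u0 H(3) by blast
  have hol: "(\<lambda>u. chart w (par w u)) holomorphic_on G" by simp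
  show ?thesis
  proof (rule tracked_branches [OF scG u0G continuous_par hol GE E(3) wE \<xi>(1) \<xi>(2) _ order_refl, of n])
   show "h ` G \<inter> CV = {}" if "continuous_on G h" "h u0 = \<xi> i" "\<And>u. u \<in> G \<Longrightarrow> (f ^^ i) (h u) = par w u"
    "\<And>u. u \<in> G \<Longrightarrow> h u \<notin> E" for i h
    by (rule step [OF that])
  qed
 qed
 then obtain h where h: "\<And>n. continuous_on G (h n)" "\<And>n. h n u0 = \<xi> n" "\<And>n u. u \<in> G \<Longrightarrow> (f ^^ n) (h n u) = par w u"
  "\<And>n u. u \<in> G \<Longrightarrow> h n u \<notin> E" "\<And>n. (\<lambda>u. chart w (h n u)) holomorphic_on G" by metis
 define \<upsilon> where "\<upsilon> j u = chart w (h (m j) u)" for j u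
 have "w \<in> ball w \<rho>" using w(1) by simp
 then obtain M where M: "\<And>x. x \<notin> ball w \<rho> \<Longrightarrow> norm (chart w x) \<le> M" using bounded_chart_compl [OF open_ball] by metis
 \<comment> \<open>On the lens the branches of \<open>f ^^ m j\<close> tend to the identity, because
   \<open>f ^^ m j\<close> does and inverse iterates are equicontinuous on the orbit of
   \<open>V\<close>.\<close>
 have conv: "(\<lambda>j. \<upsilon> j u) \<longlonglongrightarrow> u" if u: "u \<in> H" for u
 proof -
  define y where "y = par w u"
  have yV: "y \<in> V" using HV [OF u] by (simp add: y_def)
  have uG: "u \<in> G" using u H(3) by blast
  obtain \<sigma> where \<sigma>: "\<sigma> > 0" "cball y \<sigma> \<subseteq> V" using open_fatou_component [OF V] yV open_contains_cball by blast
  have cb: "compact (cball y \<sigma>)" "cball y \<sigma> \<subseteq> orbit V"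
   using \<sigma>(2) subset_orbit [OF V m ret] by (auto intro: closed_imp_compact_sphere)
  have "(\<lambda>j. h (m j) u) \<longlonglongrightarrow> y"
  proof (rule metric_LIMSEQ_I)
   fix e :: real assume e: "e > 0"
   obtain \<delta> where \<delta>: "\<delta> > 0" "\<And>x y' n. x \<in> orbit V \<Longrightarrow> y' \<in> orbit V \<Longrightarrow> (f ^^ n) x \<in> cball y \<sigma> \<Longrightarrow> (f ^^ n) y' \<in> cball y \<sigma> \<Longrightarrow>
     dist ((f ^^ n) x) ((f ^^ n) y') < \<delta> \<Longrightarrow> dist x y' < e"
    using inverse_equicontinuous [OF V m ret cb e] by blast
   have "\<forall>\<^sub>F j in sequentially. dist ((f ^^ m j) y) y < min \<delta> \<sigma>"
    by (rule tendstoD [OF ret [OF yV]]) (use \<delta>(1) \<sigma>(1) in simp)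
   hence "\<forall>\<^sub>F j in sequentially. dist (h (m j) u) y < e"
   proof eventually_elim
    case (elim j)
    show ?case
    proof (rule \<delta>(2) [of _ _ "m j"])
     show "h (m j) u \<in> orbit V" using branch [OF h(1-3)] u by blast
     show "y \<in> orbit V" using yV subset_orbit [OF V m ret] by blast
    qed (use elim h(3) [OF uG] \<sigma>(1) in \<open>auto simp: y_def dist_commute\<close>)
   qed
   thus "\<exists>no. \<forall>n\<ge>no. dist (h (m n) u) y < e" by (simp add: eventually_sequentially)
  qed
  moreover have "\<forall>\<^sub>F j in sequentially. h (m j) u \<in> - {w}" using h(4) [OF uG] wE by (intro always_eventually) auto
  moreover have "y \<in> - {w}" by (simp add: y_def)
  ultimately have "(\<lambda>j. chart w (h (m j) u)) \<longlonglongrightarrow> chart w y"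
   by (intro continuous_on_tendsto_compose [OF continuous_chart [of w "- {w}"]]) auto
  thus ?thesis by (simp add: \<upsilon>_def y_def)
 qed
 have ul: "uniform_limit K \<upsilon> (\<lambda>u. u) sequentially" if "compact K" "K \<subseteq> G" for K
 proof (rule vitali [OF scG(1) _ _ _ _ H(1) _ H(3) conv that])
  show "connected G" by (simp add: G_def)
  show "\<upsilon> j holomorphic_on G" for j unfolding \<upsilon>_def by (rule h(5))
  show "norm (\<upsilon> j z) \<le> M" if "z \<in> G" for j z
   unfolding \<upsilon>_def using h(4) [OF that] w(2) ball_subset_cball [of w \<rho>] by (intro M) blast
  show "H \<noteq> {}" using u0 by blast
 qed (auto intro: holomorphic_on_ident)
 \<comment> \<open>By Hurwitz the branches on \<open>G1\<close> all cover a fixed disc around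
   \<open>y0\<close>; there \<open>f ^^ m j\<close> inverts a map close to the identity.\<close>
 define G1 where "G1 = ball y0 (r / 2)"
 have G1: "open G1" "connected G1" "y0 \<in> G1" "G1 \<subseteq> cball y0 (r / 2)" "cball y0 (r / 2) \<subseteq> G"
  using r(1) by (auto simp: G1_def G_def)
 have nc: "\<not> (\<lambda>u. u) constant_on G1"
 proof
  assume "(\<lambda>u. u) constant_on G1"
  moreover have "y0 + of_real (r / 4) \<in> G1" using r(1) by (simp add: G1_def dist_norm)
  ultimately have "y0 + of_real (r / 4) = y0" using G1(3) unfolding constant_on_def by metis
  thus False using r(1) by simp
 qed
 have G1G: "G1 \<subseteq> G" using G1(4,5) by blast
 have \<upsilon>h: "\<upsilon> j holomorphic_on G1" for j unfolding \<upsilon>_def using h(5) G1G by (rule holomorphic_on_subset)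
 have ul1: "uniform_limit K \<upsilon> (\<lambda>u. u) sequentially" if "compact K" "K \<subseteq> G1" for K
  by (rule ul [OF that(1) subset_trans [OF that(2) G1G]])
 obtain \<eta> where \<eta>: "\<eta> > 0" "\<forall>\<^sub>F j in sequentially. ball y0 \<eta> \<subseteq> \<upsilon> j ` G1"
  using hurwitz_ball [OF G1(1,2) \<upsilon>h holomorphic_on_ident ul1 nc G1(3)] by blast
 have near_id: "(\<lambda>j. (f ^^ m j) Y) \<longlonglongrightarrow> Y" if Y: "Y \<in> par w ` ball y0 \<eta>" for Y
 proof -
  obtain z where z: "z \<in> ball y0 \<eta>" "Y = par w z" using Y by blast
  have "(\<lambda>j. chart w ((f ^^ m j) Y)) \<longlonglongrightarrow> z \<and> (\<forall>\<^sub>F j in sequentially. (f ^^ m j) Y \<noteq> w)"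
  proof
   have ev: "\<forall>\<^sub>F j in sequentially. \<exists>u\<in>G1. z = \<upsilon> j u" using \<eta>(2) by eventually_elim (use z(1) in blast)
   have key: "(f ^^ m j) Y = par w u" if "u \<in> G1" "z = \<upsilon> j u" for j u
   proof -
    have "u \<in> G" using that(1) G1G by blast
    hence "h (m j) u \<noteq> w" using h(4) wE by blast
    hence "Y = h (m j) u" using that(2) z(2) by (simp add: \<upsilon>_def)
    thus ?thesis using h(3) [OF \<open>u \<in> G\<close>] by simp
   qed
   show "\<forall>\<^sub>F j in sequentially. (f ^^ m j) Y \<noteq> w" using ev
   proof eventually_elim
    case (elim j)
    thus ?case using key [of _ j] by (metis par_neq(1))
   qed
   show "(\<lambda>j. chart w ((f ^^ m j) Y)) \<longlonglongrightarrow> z"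
   proof (rule tendstoI)
    fix e :: real assume "e > 0"
    hence "\<forall>\<^sub>F j in sequentially. \<forall>u\<in>cball y0 (r / 2). dist (\<upsilon> j u) u < e"
     using ul [OF compact_cball G1(5)] unfolding uniform_limit_iff by blast
    with ev show "\<forall>\<^sub>F j in sequentially. dist (chart w ((f ^^ m j) Y)) z < e"
    proof eventually_elim
     case (elim j)
     then obtain u where u: "u \<in> G1" "z = \<upsilon> j u" by blast
     hence "dist (\<upsilon> j u) u < e" using elim(2) G1(4) by blast
     thus ?case using key [OF u] u(2) by (simp add: dist_commute)
    qed
   qed
  qed
  hence lim: "(\<lambda>j. par w (chart w ((f ^^ m j) Y))) \<longlonglongrightarrow> par w z"
   and ne: "\<forall>\<^sub>F j in sequentially. (f ^^ m j) Y \<noteq> w"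
   by (auto intro: continuous_on_tendsto_compose [OF continuous_par [of UNIV]])
  have "\<forall>\<^sub>F j in sequentially. par w (chart w ((f ^^ m j) Y)) = (f ^^ m j) Y" using ne by eventually_elim simp
  thus ?thesis using Lim_transform_eventually [OF lim] z(2) by simp
 qed
 \<comment> \<open>A point near \<open>y0\<close> whose orbit entered \<open>W\<close> would go on
   into the orbit of \<open>V\<close>. Its returns then put its own component, and with it the whole
   orbit, into the orbit of \<open>V\<close>, which is disjoint from \<open>W\<close>.\<close>
 have "par w ` ball y0 \<eta> \<subseteq> FS"
 proof (rule omitting_imp_fatou)
  show "open (par w ` ball y0 \<eta>)" by (intro open_par_image open_ball)
  show "open W" "W \<noteq> {}" using open_fatou_component [OF W(1)] w(3) by auto
  have False if Y: "Y \<in> par w ` ball y0 \<eta>" "(f ^^ n) Y \<in> W" for n Y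
  proof -
   have "(f ^^ n) Y \<in> FS" using Y(2) in_components_subset [OF W(1)] by blast
   hence "Y \<in> FS" by simp
   then obtain U where U: "U \<in> components FS" "Y \<in> U" by (metis UnionE Union_components)
   have "\<forall>\<^sub>F j in sequentially. (f ^^ m j) Y \<in> U \<and> Suc n \<le> m j"
    using topological_tendstoD [OF near_id [OF Y(1)] open_fatou_component [OF U(1)] U(2)] eventually_large [OF V m ret]
    by (rule eventually_conj)
   then obtain j where j: "(f ^^ m j) Y \<in> U" "Suc n \<le> m j" unfolding eventually_sequentially by blast
   have "(f ^^ m j) Y = (f ^^ (m j - Suc n)) ((f ^^ Suc n) Y)" using j(2) by (simp only: le_add_diff_inverse2 flip: iterate_add)
   moreover have "(f ^^ Suc n) Y \<in> orbit V" using Y(2) W(3) by auto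
   ultimately have "(f ^^ m j) Y \<in> orbit V" using image_iterate_orbit [OF V m ret] by (metis imageI)
   then obtain a where "(f ^^ m j) Y \<in> (f ^^ a) ` V" by (auto simp: orbit_def)
   hence "U = (f ^^ a) ` V" using components_nonoverlap [OF U(1) iterate_fatou_component [OF V]] j(1) by blast
   hence "Y \<in> orbit V" using U(2) by (auto simp: orbit_def)
   hence "(f ^^ n) Y \<in> orbit V" using image_iterate_orbit [OF V m ret] by (metis imageI)
   thus False using Y(2) W(2) by blast
  qed
  thus "(f ^^ n) ` par w ` ball y0 \<eta> \<inter> W = {}" for n by blast
 qed
 moreover have "par w y0 \<in> par w ` ball y0 \<eta>" using \<eta>(1) by simp
 ultimately show False using y0J by (auto simp: julia_set_def)
qed

end

end

section \<open>A critical orbit accumulating on a whole side\<close>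

lemma open_sphere_two_points:
 fixes S :: "riemann_sphere set"
 assumes "open S" "S \<noteq> {}"
 obtains x y where "x \<in> S" "y \<in> S" "x \<noteq> y"
proof -
 obtain x where x: "x \<in> S" using assms(2) by blast
 have "S \<noteq> {x}"
 proof
  assume "S = {x}"
  hence "{x} = UNIV" using clopen_sphere [of "{x}"] assms(1) by auto
  hence "Infty = x" "Fin 0 = x" by auto
  thus False by simp
 qed
 thus thesis using that x by blast
qed

context rational_map
begin

lemma frontier_iterate_image:
 assumes V: "V \<in> components FS"
 shows "(f ^^ n) ` frontier V = frontier ((f ^^ n) ` V)"
proof (induction n)
 case (Suc n)
 have "(f ^^ Suc n) ` X = f ` (f ^^ n) ` X" for X by (simp add: image_comp)
 thus ?case using frontier_image [OF iterate_fatou_component [OF V], of n] Suc by simp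
qed simp

context
 fixes V m
 assumes V: "V \<in> components FS" and m: "filterlim m at_top sequentially"
  and ret: "\<And>x. x \<in> V \<Longrightarrow> (\<lambda>j. (f ^^ m j) x) \<longlonglongrightarrow> x"
begin

text \<open>A finite connected frontier is a single point \<open>z\<close>, and then
  \<open>A\<close> is this point. So \<open>V\<close> together with \<open>z\<close> is open, its
  iterates omit \<open>W\<close>, and \<open>z\<close> would belong to the Fatou set.\<close>

lemma infinite_frontier_side:
 assumes AB: "sides V A B"
 shows "infinite (frontier A)"
proof
 assume fin: "finite (frontier A)"
 note D = sidesD [OF AB] and fA = sides_frontier [OF V AB]
 obtain z where z: "frontier A = {z}"
  using connected_finite_iff_sing [OF fA(5)] fin sides_frontier_nonempty [OF AB] by blast
 have VF: "V \<subseteq> FS" by (rule in_components_subset [OF V])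
 have zJ: "z \<in> JS" using z fA(3) by simp
 have int: "A - {z} = interior A" using z D(1) fA(4) interior_subset [of A] by (auto simp: frontier_def closure_closed)
 have "interior A = {}"
 proof (rule ccontr)
  assume ne: "interior A \<noteq> {}"
  have "connected (UNIV - {z})" by (rule connected_open_delete_sphere) (auto simp: connected_UNIV_sphere)
  hence "UNIV - {z} \<subseteq> interior A"
  proof (rule connected_subset_open_partition)
   show "UNIV - {z} \<subseteq> - A \<union> interior A" using int by blast
   show "(UNIV - {z}) \<inter> interior A \<noteq> {}" using int ne by blast
   show "- A \<inter> interior A = {}" using interior_subset [of A] by blast
  qed (use D(1) in auto)
  hence "V \<subseteq> A" using interior_subset [of A] VF zJ by (auto simp: julia_set_def)
  thus False using D(8) in_components_nonempty [OF V] by blast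
 qed
 hence A: "A = {z}" using int D(5) by blast
 obtain W where W: "W \<in> components FS" "W \<inter> orbit V = {}" "f ` W \<subseteq> orbit V" using escaping_preimage [OF V m ret] .
 have "- B \<subseteq> FS"
 proof (rule omitting_imp_fatou)
  show "open (- B)" using D(2) by auto
  show "open W" "W \<noteq> {}" using open_fatou_component [OF W(1)] in_components_nonempty [OF W(1)] by auto
  show "(f ^^ n) ` (- B) \<inter> W = {}" for n
  proof -
   have "- B = insert z V" using A D(7,8) by blast
   moreover have "(f ^^ n) z \<notin> W" using zJ in_components_subset [OF W(1)] by (auto simp: julia_set_def)
   moreover have "(f ^^ n) ` V \<subseteq> orbit V" unfolding orbit_def by blast
   hence "(f ^^ n) ` V \<inter> W = {}" using W(2) by blast
   ultimately show ?thesis by (simp only: image_insert) blast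
  qed
 qed
 moreover have "z \<in> - B" using A D(7) by blast
 ultimately show False using zJ by (auto simp: julia_set_def)
qed

text \<open>Contraction makes \<open>f ^^ P\<close> move late points of the orbit of
  \<open>b\<close> less and less, so the limit points in the frontier of \<open>A\<close> are fixed
  by \<open>f ^^ P\<close>. They are infinitely many, but the fixed points are only finitely
  many.\<close>

lemma preperiodic_contradiction:
 assumes AB: "sides V A B" and U: "U \<in> components FS" "b \<in> U" "contracting U"
  and per: "(f ^^ N) ` U = (f ^^ (N + P)) ` U" "1 \<le> P" and cl: "frontier A \<subseteq> closure (range (\<lambda>n. (f ^^ n) b))"
 shows False
proof -
 note fA = sides_frontier [OF V AB]
 have "(f ^^ (N + P)) b \<in> (f ^^ N) ` U" using per(1) U(2) by blast
 then obtain b' where b': "b' \<in> U" "(f ^^ N) b' = (f ^^ (N + P)) b" by (metis imageE)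
 obtain C where C: "compact C" "connected C" "{b, b'} \<subseteq> C" "C \<subseteq> U"
 proof (rule compact_connected_superset_sphere [OF open_fatou_component [OF U(1)] open_fatou_component [OF U(1)] in_components_connected [OF U(1)]])
  show "compact {b, b'}" "{b, b'} \<subseteq> U" using U(2) b'(1) by auto
 qed
 have bF: "b \<in> FS" using U(1,2) in_components_subset by blast
 have contr: "\<exists>M. \<forall>n\<ge>M. dist ((f ^^ n) b) ((f ^^ P) ((f ^^ n) b)) < e" if e: "e > 0" for e
 proof -
  obtain M where M: "\<And>n x y. M \<le> n \<Longrightarrow> x \<in> C \<Longrightarrow> y \<in> C \<Longrightarrow> dist ((f ^^ n) x) ((f ^^ n) y) < e"
   using U(3) C(1,2,4) e unfolding contracting_def by metis
  have "dist ((f ^^ n) b) ((f ^^ P) ((f ^^ n) b)) < e" if n: "max M N \<le> n" for n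
  proof -
   have "(f ^^ n) b' = (f ^^ (n - N)) ((f ^^ N) b')" using n by (simp flip: iterate_add)
   also have "\<dots> = (f ^^ (P + n)) b" using n by (simp add: b'(2) add.commute flip: iterate_add)
   finally have "(f ^^ n) b' = (f ^^ P) ((f ^^ n) b)" by (simp add: iterate_add)
   thus ?thesis using M [of n b b'] n C(3) by simp
  qed
  thus ?thesis by blast
 qed
 have "(f ^^ P) z = z" if z: "z \<in> frontier A" for z
 proof (rule ccontr)
  assume ne: "(f ^^ P) z \<noteq> z"
  define e where "e = dist ((f ^^ P) z) z / 3"
  have e: "e > 0" using ne by (simp add: e_def)
  have "isCont (f ^^ P) z" using continuous_iterate [of UNIV P] by (simp add: continuous_on_eq_continuous_at)
  then obtain d where d: "d > 0" "\<And>y. dist y z < d \<Longrightarrow> dist ((f ^^ P) y) ((f ^^ P) z) < e"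
   unfolding continuous_at_eps_delta using e by blast
  obtain M where M: "\<And>n. M \<le> n \<Longrightarrow> dist ((f ^^ n) b) ((f ^^ P) ((f ^^ n) b)) < e" using contr [OF e] by blast
  define X where "X = ball z (min d e) - (\<lambda>n. (f ^^ n) b) ` {..<M}"
  have zJ: "z \<in> JS" using z fA(3) by blast
  have "z \<notin> (\<lambda>n. (f ^^ n) b) ` {..<M}" using zJ bF by (auto simp: julia_set_def)
  hence "open X" "z \<in> X" using d(1) e by (auto simp: X_def intro!: open_Diff finite_imp_closed)
  then obtain n where n: "(f ^^ n) b \<in> X" using cl z closure_iff_nhds_not_empty [of z "range (\<lambda>n. (f ^^ n) b)"] by blast
  hence "M \<le> n" by (auto simp: X_def not_le)
  have "dist ((f ^^ n) b) z < min d e" using n by (auto simp: X_def dist_commute)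
  hence "dist ((f ^^ P) ((f ^^ n) b)) ((f ^^ P) z) < e" "dist ((f ^^ n) b) z < e" using d(2) by auto
  hence "dist ((f ^^ P) z) z < 3 * e" using M [OF \<open>M \<le> n\<close>] by metric
  thus False by (simp add: e_def)
 qed
 hence "frontier A \<subseteq> {x. (f ^^ P) x = x}" by blast
 thus False using finite_fixed_points [OF per(2)] infinite_frontier_side [OF AB] finite_subset by blast
qed

text \<open>The records are the times at which the orbit of \<open>b\<close> gets closer to \<open>Kc\<close> than ever before; the branch back to
 \<open>b\<close> extends over the union of two balls, one of which is centred on \<open>Kc\<close>.\<close>

lemma wandering_contradiction:
 assumes AB: "sides V A B" and CVF: "CV \<inter> FS \<subseteq> {b}"
  and Kc: "closed Kc" "Kc \<subseteq> JS" "f ` Kc \<subseteq> Kc" "frontier A \<subseteq> Kc" "Kc \<subseteq> NA"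
  and E: "closed E" "E \<subseteq> FS" "f ` E \<subseteq> E"
  and NN: "open NA" "open NB" "NA \<inter> NB = {}" "- E \<subseteq> NA \<union> NB" and CVJ: "CV \<inter> JS \<subseteq> NB"
  and W: "W \<in> components FS" "W \<inter> orbit V = {}" "f ` W \<subseteq> orbit V" and w: "\<rho> > 0" "cball w \<rho> \<subseteq> E" "w \<in> W"
  and U: "U \<in> components FS" "b \<in> U" "frontier U \<subseteq> Kc"
  and wander: "\<And>i j. i < j \<Longrightarrow> (f ^^ i) ` U \<noteq> (f ^^ j) ` U"
  and cl: "frontier A \<subseteq> closure (range (\<lambda>n. (f ^^ n) b))"
 shows False
proof -
 have wE: "w \<in> E" using w(1,2) by auto
 have wF: "w \<in> FS" using wE E(2) by blast
 have wKc: "w \<notin> Kc" using wF Kc(2) by (auto simp: julia_set_def)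
 define v where "v n = (f ^^ n) b" for n
 have Uc: "(f ^^ n) ` U \<in> components FS" for n by (rule iterate_fatou_component [OF U(1)])
 have vU: "v n \<in> (f ^^ n) ` U" for n using U(2) by (simp add: v_def)
 have vF: "v n \<in> FS" for n using vU [of n] in_components_subset [OF Uc] by blast
 have U_disj: "(f ^^ i) ` U \<inter> (f ^^ j) ` U = {}" if "i < j" for i j
  using wander [OF that] components_nonoverlap [OF Uc Uc] by blast
 have frU: "frontier ((f ^^ n) ` U) \<subseteq> Kc" for n
 proof -
  have "(f ^^ n) ` Kc \<subseteq> Kc" using forward_invariant_iterate [OF Kc(3)] by blast
  thus ?thesis using frontier_iterate_image [OF U(1), of n] U(3) by blast
 qed
 \<comment> \<open>\<open>W\<close> is mapped into the periodic orbit of \<open>V\<close>, so a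
   wandering component never reaches it.\<close>
 have vw: "v n \<noteq> w" for n
 proof
  assume "v n = w"
  hence "(f ^^ n) ` U = W" using vU [of n] w(3) components_nonoverlap [OF Uc W(1)] by blast
  hence "v (Suc n) \<in> orbit V" using W(3) \<open>v n = w\<close> w(3) by (auto simp: v_def)
  then obtain a where "v (Suc n) \<in> (f ^^ a) ` V" unfolding orbit_def by blast
  hence eq: "(f ^^ Suc n) ` U = (f ^^ a) ` V"
   using vU [of "Suc n"] components_nonoverlap [OF Uc iterate_fatou_component [OF V]] by blast
  obtain k where k: "k \<ge> 1" "(f ^^ k) ` V = V" using period [OF V m ret] by blast
  have im: "(f ^^ (i + j)) ` X = (f ^^ i) ` (f ^^ j) ` X" for i j X by (simp add: image_comp funpow_add)
  have "(f ^^ (k + Suc n)) ` U = (f ^^ (a + k)) ` V" by (simp only: im eq add.commute [of a k])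
  also have "\<dots> = (f ^^ Suc n) ` U" by (simp only: im k(2) eq)
  finally show False using wander [of "Suc n" "k + Suc n"] k(1) by simp
 qed
 define z where "z n = chart w (v n)" for n
 have vz: "par w (z n) = v n" for n using vw by (simp add: z_def)
 define Kp where "Kp = par w -` Kc"
 have "closed Kp" unfolding Kp_def using open_par_vimage [OF open_Compl [OF Kc(1)], of w] by (simp add: closed_def vimage_Compl)
 moreover have "bounded Kp"
  unfolding Kp_def par_vimage [OF wKc] using bounded_chart_image [of w Kc] wKc Kc(1) by (simp add: closure_closed)
 ultimately have cK: "compact Kp" by (simp add: compact_eq_bounded_closed)
 obtain b0 where b0: "b0 \<in> frontier A" using sides_frontier_nonempty [OF AB] by blast
 hence b0K: "b0 \<in> Kc" "b0 \<noteq> w" using Kc(4) wKc by blast+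
 have c0: "chart w b0 \<in> Kp" using b0K by (simp add: Kp_def)
 hence Kne: "Kp \<noteq> {}" by blast
 define s where "s n = infdist (z n) Kp" for n
 have s_pos: "s n > 0" for n
 proof -
  have "z n \<notin> Kp" using vF [of n] vz Kc(2) by (auto simp: Kp_def julia_set_def)
  thus ?thesis using infdist_pos_not_in_closed [OF \<open>closed Kp\<close> Kne] by (simp add: s_def)
 qed
 have s_small: "\<exists>n. s n < e" if "e > 0" for e
 proof -
  have "open (par w ` ball (chart w b0) e)" by (intro open_par_image open_ball)
  moreover have "b0 \<in> par w ` ball (chart w b0) e" using b0K(2) that by (intro image_eqI [of _ _ "chart w b0"]) auto
  ultimately obtain n where "(f ^^ n) b \<in> par w ` ball (chart w b0) e"
   using cl b0 closure_iff_nhds_not_empty [of b0 "range (\<lambda>n. (f ^^ n) b)"] by blast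
  then obtain z' where "z' \<in> ball (chart w b0) e" "v n = par w z'" by (auto simp: v_def)
  hence "dist (z n) (chart w b0) < e" by (simp add: z_def dist_commute)
  thus ?thesis using infdist_le [OF c0, of "z n"] unfolding s_def by (intro exI [of _ n]) simp
 qed
 have "Kp \<subseteq> par w -` (- E)" using Kc(2) E(2) by (auto simp: Kp_def julia_set_def)
 then obtain \<delta>0 where \<delta>0: "\<delta>0 > 0" "(\<Union>x\<in>Kp. cball x \<delta>0) \<subseteq> par w -` (- E)"
  using compact_subset_open_imp_cball_epsilon_subset [OF cK open_par_vimage [OF open_Compl [OF E(1)]]] by blast
 \<comment> \<open>The factor 2 allows for points at distance up to \<open>2 * s (n j)\<close> from
   \<open>\<zeta> j\<close>, which the domain \<open>G\<close> below produces;
   \<open>\<delta>0\<close> keeps them off \<open>E\<close>.\<close>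
 define \<epsilon> where "\<epsilon> j = \<delta>0 / (2 * of_nat (Suc j))" for j
 have \<epsilon>: "\<epsilon> j > 0" "2 * \<epsilon> j \<le> \<delta>0" for j using \<delta>0(1) by (auto simp: \<epsilon>_def divide_le_eq)
 have \<epsilon>0: "\<epsilon> \<longlonglongrightarrow> 0"
 proof -
  have "(\<lambda>j. \<delta>0 / 2 * inverse (of_nat (Suc j))) \<longlonglongrightarrow> 0"
   by (rule tendsto_mult_right_zero [OF LIMSEQ_inverse_real_of_nat])
  moreover have "\<epsilon> = (\<lambda>j. \<delta>0 / 2 * inverse (of_nat (Suc j)))" by (rule ext) (simp add: \<epsilon>_def field_simps)
  ultimately show ?thesis by (simp only:)
 qed
 define n where "n j = (LEAST n. s n < \<epsilon> j)" for j
 have n: "s (n j) < \<epsilon> j" "\<And>i. i < n j \<Longrightarrow> \<epsilon> j \<le> s i" for j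
  unfolding n_def using LeastI_ex [OF s_small [OF \<epsilon>(1)]] not_less_Least by (blast, meson not_less not_less_Least)
 have "\<exists>\<zeta>\<in>Kp. s (n j) = dist (z (n j)) \<zeta>" for j
  unfolding s_def using infdist_attains_inf [OF \<open>closed Kp\<close> Kne] by metis
 then obtain \<zeta> where \<zeta>: "\<And>j. \<zeta> j \<in> Kp" "\<And>j. s (n j) = dist (z (n j)) (\<zeta> j)" by metis
 \<comment> \<open>The centres 0 and 1 stand for \<open>z (n j)\<close> and its nearest point
   \<open>\<zeta> j\<close> in \<open>Kp\<close>. The rescaling gives all branches a common domain,
   which is starlike about 1/2.\<close>
 define G where "G = ball (0::complex) 1 \<union> ball 1 1"
 have G: "open G" "simply_connected G" "connected G" "0 \<in> G" "1 \<in> G"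
 proof -
  have "starlike G" unfolding starlike_def
  proof (intro bexI [of _ "1 / 2"] ballI)
   fix x assume "x \<in> G"
   then consider "x \<in> ball 0 1" | "x \<in> ball 1 1" by (auto simp: G_def)
   thus "closed_segment (1 / 2) x \<subseteq> G"
   proof cases
    case 1
    hence "closed_segment (1 / 2) x \<subseteq> ball 0 1" by (intro closed_segment_subset) auto
    thus ?thesis by (auto simp: G_def)
   next
    case 2
    hence "closed_segment (1 / 2) x \<subseteq> ball 1 1" by (intro closed_segment_subset) (auto simp: dist_norm)
    thus ?thesis by (auto simp: G_def)
   qed
  qed (auto simp: G_def)
  thus "simply_connected G" "connected G" using starlike_imp_simply_connected starlike_imp_connected by blast+
 qed (auto simp: G_def)
 define \<phi> where "\<phi> j u = par w (z (n j) + (\<zeta> j - z (n j)) * u)" for j u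
 have \<phi>_near: "dist (\<zeta> j) (z (n j) + (\<zeta> j - z (n j)) * u) = s (n j) * norm (u - 1)" for j u
 proof -
  have "z (n j) + (\<zeta> j - z (n j)) * u - \<zeta> j = (\<zeta> j - z (n j)) * (u - 1)" by (simp add: algebra_simps)
  hence "norm (z (n j) + (\<zeta> j - z (n j)) * u - \<zeta> j) = norm (\<zeta> j - z (n j)) * norm (u - 1)" by (simp only: norm_mult)
  thus ?thesis by (simp add: \<zeta>(2) dist_norm norm_minus_commute)
 qed
 have u2: "norm (u - 1) \<le> 2" if "u \<in> G" for u
 proof -
  have "norm (u - 1) \<le> norm u + 1" using norm_triangle_ineq4 [of u 1] by simp
  thus ?thesis using that by (auto simp: G_def dist_norm norm_minus_commute)
 qed
 have near2: "dist (\<zeta> j) (z (n j) + (\<zeta> j - z (n j)) * u) \<le> 2 * \<epsilon> j" if "u \<in> G" for u j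
 proof -
  have "s (n j) * norm (u - 1) \<le> \<epsilon> j * 2" using n(1) [of j] s_pos [of "n j"] u2 [OF that] by (intro mult_mono) auto
  thus ?thesis unfolding \<phi>_near by simp
 qed
 have \<phi>E: "\<phi> j u \<notin> E" if "u \<in> G" for j u
 proof -
  have "z (n j) + (\<zeta> j - z (n j)) * u \<in> cball (\<zeta> j) \<delta>0" using near2 [OF that, of j] \<epsilon>(2) [of j] by simp
  hence "z (n j) + (\<zeta> j - z (n j)) * u \<in> par w -` (- E)" using \<delta>0(2) \<zeta>(1) [of j] by blast
  thus ?thesis by (simp add: \<phi>_def)
 qed
 \<comment> \<open>No point of \<open>Kp\<close> is nearer to \<open>z (n j)\<close> than
   \<open>\<zeta> j\<close>, and the frontier of the component lies in \<open>Kc\<close>, so the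
   first disc is mapped into the component.\<close>
 have \<phi>U: "\<phi> j u \<in> (f ^^ n j) ` U" if u: "u \<in> ball 0 1" for j u
 proof -
  define Q where "Q = par w ` ball (z (n j)) (s (n j))"
  have "connected Q" unfolding Q_def by (intro connected_continuous_image continuous_par) auto
  moreover have "v (n j) \<in> Q" unfolding Q_def using s_pos vz by (intro image_eqI [of _ _ "z (n j)"]) auto
  moreover have "Q \<inter> Kc = {}"
  proof (rule ccontr)
   assume "Q \<inter> Kc \<noteq> {}"
   then obtain y where y: "y \<in> ball (z (n j)) (s (n j))" "y \<in> Kp" by (auto simp: Q_def Kp_def)
   thus False using infdist_le [OF y(2), of "z (n j)"] by (simp add: s_def)
  qed
  ultimately have "Q \<subseteq> (f ^^ n j) ` U"
   using connected_Int_frontier [of Q "(f ^^ n j) ` U"] vU [of "n j"] frU [of "n j"] by blast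
  moreover have "z (n j) + (\<zeta> j - z (n j)) * u \<in> ball (z (n j)) (s (n j))"
  proof -
   have "norm (\<zeta> j - z (n j)) * norm u < norm (\<zeta> j - z (n j)) * 1"
    using u s_pos [of "n j"] \<zeta>(2) [of j] by (intro mult_strict_left_mono) (auto simp: dist_norm norm_minus_commute)
   thus ?thesis by (simp add: \<zeta>(2) dist_norm norm_mult norm_minus_commute)
  qed
  ultimately show ?thesis unfolding Q_def \<phi>_def by blast
 qed
 have \<phi>0: "\<phi> j 0 = v (n j)" for j by (simp add: \<phi>_def vz)
 have branch: "h 1 \<in> Kc" if i: "i \<le> n j" and h: "continuous_on G h" "h 0 = v (n j - i)" "\<And>u. u \<in> G \<Longrightarrow> (f ^^ i) (h u) = \<phi> j u" for i j h
 proof -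
  have sub: "ball 0 1 \<subseteq> G" by (auto simp: G_def)
  have "\<phi> j u \<in> FS" if "u \<in> ball 0 1" for u using \<phi>U [OF that, of j] in_components_subset [OF Uc [of "n j"]] by blast
  moreover have "\<phi> j 1 \<in> JS" using \<zeta>(1) [of j] Kc(2) by (auto simp: \<phi>_def Kp_def)
  ultimately have "h 1 \<in> frontier ((f ^^ (n j - i)) ` U)"
   using sub G(5) h(2,3) vU by (intro branch_frontier(2) [OF Uc G(1) sub h(1), of i 0]) (auto simp: subset_iff)
  thus ?thesis using frU by blast
 qed
 have step: "h ` G \<inter> CV = {}"
  if i: "i < n j" and h: "continuous_on G h" "h 0 = v (n j - i)" "\<And>u. u \<in> G \<Longrightarrow> (f ^^ i) (h u) = \<phi> j u" "\<And>u. u \<in> G \<Longrightarrow> h u \<notin> E" for i j h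
 proof -
  have h1: "h 1 \<in> NA" using branch [OF less_imp_le [OF i] h(1-3)] Kc(5) by blast
  show ?thesis
  proof (rule branch_avoids_critical_values [OF NN CVJ CVF G(3) h(1,4) G(5) h1])
   fix u assume u: "u \<in> G" "h u = b"
   hence vi: "v i = \<phi> j u" using h(3) [OF u(1)] by (simp add: v_def)
   show False
   \<comment> \<open>In the first disc, meeting \<open>b\<close> would make two different images of
     the wandering component intersect. In the second, the orbit would have been nearer to
     \<open>Kp\<close> at the earlier time \<open>i\<close>, against the choice of
     \<open>n j\<close>.\<close>
   proof (cases "u \<in> ball 0 1")
    case True
    have "v i \<in> (f ^^ i) ` U \<inter> (f ^^ n j) ` U" using \<phi>U [OF True, of j] vi vU [of i] by simp
    thus False using U_disj [OF i] by (simp only: empty_iff)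
   next
    case False
    hence "norm (u - 1) < 1" using u(1) by (auto simp: G_def dist_norm norm_minus_commute)
    moreover have zi: "z i = z (n j) + (\<zeta> j - z (n j)) * u" unfolding z_def [of i] vi \<phi>_def by simp
    ultimately have "dist (\<zeta> j) (z i) < s (n j)" unfolding zi \<phi>_near using s_pos [of "n j"] by simp
    hence "s i < s (n j)" using infdist_le [OF \<zeta>(1) [of j], of "z i"] by (simp add: s_def dist_commute)
    thus False using n(1) [of j] n(2) [OF i] by simp
   qed
  qed
 qed
 have "\<exists>h. continuous_on G h \<and> h 0 = v (n j - n j) \<and> (\<forall>u\<in>G. (f ^^ n j) (h u) = \<phi> j u) \<and> (\<forall>u\<in>G. h u \<notin> E) \<and> (\<lambda>u. chart w (h u)) holomorphic_on G" for j
 proof (rule tracked_branches [OF G(1,2,4) _ _ \<phi>E E(3) wE, where x = "\<lambda>i. v (n j - i)" and N = "n j"])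
  show "continuous_on G (\<phi> j)" unfolding \<phi>_def by (intro continuous_on_compose2 [OF continuous_par [of UNIV]] continuous_intros) auto
  show "(\<lambda>u. chart w (\<phi> j u)) holomorphic_on G" unfolding \<phi>_def chart_par by (intro holomorphic_intros)
  show "f (v (n j - Suc i)) = v (n j - i)" if "i < n j" for i
  proof -
   have "n j - i = Suc (n j - Suc i)" using that by simp
   thus ?thesis by (simp add: v_def)
  qed
  show "h ` G \<inter> CV = {}" if "i < n j" "continuous_on G h" "h 0 = v (n j - i)" "\<And>u. u \<in> G \<Longrightarrow> (f ^^ i) (h u) = \<phi> j u" "\<And>u. u \<in> G \<Longrightarrow> h u \<notin> E" for i h
   by (rule step [OF that])
 qed (auto simp: \<phi>0)
 then obtain h where h: "\<And>j. continuous_on G (h j)" "\<And>j. h j 0 = v 0" "\<And>j u. u \<in> G \<Longrightarrow> (f ^^ n j) (h j u) = \<phi> j u"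
  "\<And>j u. u \<in> G \<Longrightarrow> h j u \<notin> E" "\<And>j. (\<lambda>u. chart w (h j u)) holomorphic_on G"
  unfolding diff_self_eq_0 by metis
 have h1: "h j 1 \<in> Kc" for j by (rule branch [OF order_refl h(1) _ h(3)]) (simp_all add: h(2))
 define \<kappa> where "\<kappa> j u = chart w (h j u)" for j u
 have "w \<in> ball w \<rho>" using w(1) by simp
 then obtain M where M: "\<And>x. x \<notin> ball w \<rho> \<Longrightarrow> norm (chart w x) \<le> M" using bounded_chart_compl [OF open_ball] by metis
 have \<kappa>_le: "norm (\<kappa> j u) \<le> M" if "u \<in> G" for j u
  unfolding \<kappa>_def using h(4) [OF that] w(2) ball_subset_cball [of w \<rho>] by (intro M) blast
 have \<kappa>_hol: "\<kappa> j holomorphic_on G" for j unfolding \<kappa>_def by (rule h(5))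
 obtain k r where k: "k holomorphic_on G" "strict_mono (r :: nat \<Rightarrow> nat)" "\<And>x. x \<in> G \<Longrightarrow> (\<lambda>j. \<kappa> (r j) x) \<longlonglongrightarrow> k x"
  "\<And>K. compact K \<Longrightarrow> K \<subseteq> G \<Longrightarrow> uniform_limit K (\<kappa> \<circ> r) k sequentially"
 proof (rule Montel [OF G(1), of "range \<kappa>" \<kappa>])
  show "\<exists>B. \<forall>h\<in>range \<kappa>. \<forall>z\<in>K. norm (h z) \<le> B" if "compact K" "K \<subseteq> G" for K using \<kappa>_le that(2) by blast
 qed (use \<kappa>_hol in auto)
 have "(\<lambda>j. \<kappa> (r j) 0) = (\<lambda>_. z 0)" by (simp add: \<kappa>_def h(2) z_def)
 hence k0: "k 0 = z 0" using k(3) [OF G(4)] LIMSEQ_unique tendsto_const by metis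
 have "\<kappa> (r j) 1 \<in> Kp" for j
 proof -
  have "h (r j) 1 \<noteq> w" using h1 [of "r j"] wKc by blast
  thus ?thesis using h1 [of "r j"] by (simp add: \<kappa>_def Kp_def)
 qed
 hence k1: "k 1 \<in> Kp" using closed_sequentially [OF \<open>closed Kp\<close> _ k(3) [OF G(5)]] by blast
 have "z 0 \<notin> Kp" using s_pos [of 0] by (auto simp: s_def)
 \<comment> \<open>The limit maps 0 to the chart of \<open>b\<close>, which is not in
   \<open>Kp\<close>, and 1 into \<open>Kp\<close>.\<close>
 hence nc: "\<not> k constant_on G" using k0 k1 G(4,5) unfolding constant_on_def by metis
 obtain \<eta> where \<eta>: "\<eta> > 0" "\<forall>\<^sub>F j in sequentially. ball (k 1) \<eta> \<subseteq> (\<kappa> \<circ> r) j ` G"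
  by (rule hurwitz_ball [OF G(1,3) _ k(1,4) nc G(5)]) (auto simp: \<kappa>_hol)
 define Y where "Y = par w ` ball (k 1) \<eta>"
 have oY: "open Y" unfolding Y_def by (intro open_par_image open_ball)
 have "par w (k 1) \<in> Y" "par w (k 1) \<in> JS" using \<eta>(1) k1 Kc(2) by (auto simp: Y_def Kp_def)
 hence "\<not> Y \<subseteq> FS" by (auto simp: julia_set_def)
 have oW: "open W" "W \<noteq> {}" using open_fatou_component [OF W(1)] w(3) by auto
 obtain N where N: "(f ^^ N) ` Y \<inter> W \<noteq> {}" using omitting_imp_fatou [OF oY oW] \<open>\<not> Y \<subseteq> FS\<close> by blast
 \<comment> \<open>\<open>Y\<close> contains a Julia point, so one of its iterates meets
   \<open>W\<close> and the next one the orbit of \<open>V\<close>. Two points of \<open>Y\<close>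
   that arrive there stay apart for ever, while the branches show that the iterates
   \<open>f ^^ n (r j)\<close> shrink \<open>Y\<close> to small sets.\<close>
 define P where "P = (f ^^ Suc N) ` (Y \<inter> (f ^^ N) -` W)"
 have oP: "open P" unfolding P_def by (intro open_iterate_image open_Int oY open_vimage oW(1) continuous_iterate)
 obtain p0 where p0: "p0 \<in> P" using N by (auto simp: P_def)
 have "P \<subseteq> orbit V" using W(3) by (auto simp: P_def)
 then obtain a where a: "p0 \<in> (f ^^ a) ` V" using p0 unfolding orbit_def by blast
 have Va: "(f ^^ a) ` V \<in> components FS" by (rule iterate_fatou_component [OF V])
 have reta: "(\<lambda>j. (f ^^ m j) x) \<longlonglongrightarrow> x" if "x \<in> (f ^^ a) ` V" for x
  using orbit_returns [OF V m ret] that by (auto simp: orbit_def)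
 have "open (P \<inter> (f ^^ a) ` V)" "P \<inter> (f ^^ a) ` V \<noteq> {}" using oP open_fatou_component [OF Va] p0 a by auto
 then obtain p p' where p: "p \<in> P \<inter> (f ^^ a) ` V" "p' \<in> P \<inter> (f ^^ a) ` V" "p \<noteq> p'" by (rule open_sphere_two_points)
 obtain y y' where y: "y \<in> Y" "p = (f ^^ Suc N) y" "y' \<in> Y" "p' = (f ^^ Suc N) y'" using p(1,2) unfolding P_def by blast
 obtain \<delta> where \<delta>: "\<delta> > 0" "\<And>i. \<delta> \<le> dist ((f ^^ i) p) ((f ^^ i) p')"
  using not_contracted [OF Va m reta, of p p'] p by blast
 define L where "L = (\<Union>x\<in>Kp. cball x \<delta>0)"
 have "uniformly_continuous_on L (par w)"
  unfolding L_def by (intro compact_uniformly_continuous continuous_par compact_minkowski_sum_cball cK)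
 then obtain d where d: "d > 0" "\<And>x y. x \<in> L \<Longrightarrow> y \<in> L \<Longrightarrow> dist y x < d \<Longrightarrow> dist (par w y) (par w x) < \<delta>"
  using \<delta>(1) unfolding uniformly_continuous_on_def by metis
 define S where "S = Min (s ` {..N})"
 have S: "S > 0" "\<And>i. i \<le> N \<Longrightarrow> S \<le> s i" using s_pos by (auto simp: S_def)
 have "(\<lambda>j. \<epsilon> (r j)) \<longlonglongrightarrow> 0" using LIMSEQ_subseq_LIMSEQ [OF \<epsilon>0 k(2)] by (simp add: o_def)
 hence "\<forall>\<^sub>F j in sequentially. \<epsilon> (r j) < min S (d / 4)" by (rule order_tendstoD) (use S(1) d(1) in simp)
 hence "\<forall>\<^sub>F j in sequentially. \<epsilon> (r j) < min S (d / 4) \<and> ball (k 1) \<eta> \<subseteq> (\<kappa> \<circ> r) j ` G" using \<eta>(2) by (rule eventually_conj)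
 then obtain j where j: "\<epsilon> (r j) < min S (d / 4)" "ball (k 1) \<eta> \<subseteq> \<kappa> (r j) ` G"
  unfolding eventually_sequentially by (auto simp: o_def)
 \<comment> \<open>Up to time \<open>N\<close> the orbit of \<open>b\<close> keeps distance at least
   \<open>S\<close> from \<open>Kp\<close>, so a record below \<open>S\<close> comes later.\<close>
 have "N < n (r j)"
 proof (rule ccontr)
  assume "\<not> N < n (r j)"
  thus False using S(2) [of "n (r j)"] n(1) [of "r j"] j(1) by simp
 qed
 have img: "\<exists>u\<in>G. (f ^^ n (r j)) y = \<phi> (r j) u" if yY: "y \<in> Y" for y
 proof -
  obtain z' where z': "z' \<in> ball (k 1) \<eta>" "y = par w z'" using yY by (auto simp: Y_def)
  then obtain u where u: "u \<in> G" "z' = \<kappa> (r j) u" using j(2) by blast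
  have "h (r j) u \<noteq> w" using h(4) [OF u(1)] wE by blast
  hence "y = h (r j) u" using z'(2) u(2) by (simp add: \<kappa>_def)
  thus ?thesis using h(3) [OF u(1)] u(1) by blast
 qed
 obtain u u' where u: "u \<in> G" "(f ^^ n (r j)) y = \<phi> (r j) u" "u' \<in> G" "(f ^^ n (r j)) y' = \<phi> (r j) u'"
  using img y(1,3) by blast
 define \<theta> where "\<theta> u = z (n (r j)) + (\<zeta> (r j) - z (n (r j))) * u" for u
 have \<theta>: "dist (\<zeta> (r j)) (\<theta> u) \<le> 2 * \<epsilon> (r j)" if "u \<in> G" for u unfolding \<theta>_def by (rule near2 [OF that])
 have \<theta>L: "\<theta> u \<in> L" if "u \<in> G" for u
  using \<theta> [OF that] \<epsilon>(2) [of "r j"] \<zeta>(1) [of "r j"] by (auto simp: L_def intro!: bexI [of _ "\<zeta> (r j)"])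
 have "dist (\<theta> u) (\<theta> u') \<le> 4 * \<epsilon> (r j)" using \<theta> [OF u(1)] \<theta> [OF u(3)] by metric
 hence "dist (\<theta> u) (\<theta> u') < d" using j(1) by simp
 hence "dist (par w (\<theta> u)) (par w (\<theta> u')) < \<delta>" by (intro d(2) \<theta>L u)
 hence lt: "dist ((f ^^ n (r j)) y) ((f ^^ n (r j)) y') < \<delta>" using u(2,4) by (simp add: \<phi>_def \<theta>_def)
 have "(f ^^ n (r j)) x = (f ^^ (n (r j) - Suc N)) ((f ^^ Suc N) x)" for x
  using \<open>N < n (r j)\<close> by (simp only: Suc_leI le_add_diff_inverse2 flip: iterate_add)
 thus False using lt \<delta>(2) [of "n (r j) - Suc N"] y(2,4) by (metis not_less)
qed

end

end

section \<open>Critical values in the cycles of the two sides\<close>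

context rational_map
begin

lemma clopen_around_components:
 assumes K: "finite I" "\<And>i. i \<in> I \<Longrightarrow> L i \<in> components JS" and T: "open T" "(\<Union>i\<in>I. L i) \<subseteq> T"
 obtains A B where "closed A" "closed B" "A \<inter> B = {}" "A \<union> B = JS" "(\<Union>i\<in>I. L i) \<subseteq> A" "A \<subseteq> T"
proof -
 have "\<exists>A. openin (top_of_set JS) A \<and> closed A \<and> L i \<subseteq> A \<and> A \<subseteq> T" if "i \<in> I" for i
 proof -
  have "L i \<subseteq> T" using T(2) that by blast
  thus ?thesis by (rule clopen_neighbourhood_sphere [OF closed_julia K(2) [OF that] T(1)]) blast
 qed
 then obtain A where A: "\<And>i. i \<in> I \<Longrightarrow> openin (top_of_set JS) (A i) \<and> closed (A i) \<and> L i \<subseteq> A i \<and> A i \<subseteq> T" by metis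
 define A' where "A' = (\<Union>i\<in>I. A i)"
 have "openin (top_of_set JS) A'" unfolding A'_def using A by (intro openin_Union) auto
 then obtain S where S: "open S" "A' = JS \<inter> S" by (auto simp: openin_open)
 show thesis
 proof (rule that)
  show "closed A'" unfolding A'_def using A K(1) by (intro closed_UN) auto
  show "closed (JS - S)" using closed_julia S(1) by (intro closed_Diff)
  show "A' \<inter> (JS - S) = {}" "A' \<union> (JS - S) = JS" using S(2) by blast+
  show "(\<Union>i\<in>I. L i) \<subseteq> A'" "A' \<subseteq> T" using A unfolding A'_def by blast+
 qed
qed

context
 fixes V m
 assumes V: "V \<in> components FS" and m: "filterlim m at_top sequentially"
  and ret: "\<And>x. x \<in> V \<Longrightarrow> (\<lambda>j. (f ^^ m j) x) \<longlonglongrightarrow> x" and mc: "\<not> connected (- V)"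
begin

text \<open>Only \<open>b\<close> can stop the branches along \<open>V\<close>. If it is tame, it is
  put into the barrier. If the frontier of its component \<open>U\<close> misses the cycle,
  \<open>U\<close> is placed beyond the barrier. Otherwise that frontier lies in the cycle, and
  either the orbit of \<open>b\<close> leaves a part of the side free, or \<open>U\<close> is
  preperiodic or wandering with an orbit accumulating on the whole side.\<close>

lemma side_cycle_critical_value:
 assumes CVF: "CV \<inter> FS \<subseteq> {b}" and AB: "sides V A B" and K: "K \<in> components JS" "frontier A \<subseteq> K"
 shows "\<exists>n. (f ^^ n) ` K \<inter> CV \<noteq> {}"
proof (rule ccontr)
 assume no: "\<nexists>n. (f ^^ n) ` K \<inter> CV \<noteq> {}"
 obtain k where k: "k \<ge> 1" "(f ^^ k) ` V = V" using period [OF V m ret] by blast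
 have im: "(f ^^ (i + j)) ` X = (f ^^ i) ` (f ^^ j) ` X" for i j X by (simp add: image_comp funpow_add)
 have Kk: "(f ^^ k) ` K = K" by (rule side_component_return [OF V m ret CVF mc AB k(2) K])
 define L where "L i = (f ^^ i) ` K" for i
 have Lc: "L i \<in> components JS" for i unfolding L_def by (rule iterate_julia_component [OF K(1)])
 define Kc where "Kc = (\<Union>i\<in>{..<k}. L i)"
 have fL: "f ` L i = L (Suc i)" for i by (simp add: L_def image_comp)
 have L_Kc: "L i \<subseteq> Kc" for i
 proof -
  have "L (k * q' + r) = L r" for q' r
  proof (induction q')
   case (Suc q')
   have "L (k * Suc q' + r) = (f ^^ (k * q' + r)) ` (f ^^ k) ` K" unfolding L_def by (simp flip: im add: add_ac)
   thus ?case using Suc by (simp add: Kk L_def)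
  qed simp
  from this [of "i div k" "i mod k"] have "L i = L (i mod k)" by simp
  thus ?thesis using k(1) unfolding Kc_def by (metis UN_upper lessThan_iff mod_less_divisor less_eq_Suc_le One_nat_def)
 qed
 have fKc: "f ` Kc \<subseteq> Kc" unfolding Kc_def image_UN fL using L_Kc unfolding Kc_def by blast
 have "closed (L i)" for i using Lc [of i] closed_julia by (metis closed_components)
 hence cKc: "closed Kc" unfolding Kc_def by (intro closed_UN) auto
 have KcJ: "Kc \<subseteq> JS" using in_components_subset [OF Lc] unfolding Kc_def by blast
 have KcCV: "Kc \<inter> CV = {}" using no unfolding Kc_def L_def by blast
 have L0: "L 0 = K" by (simp add: L_def)
 have frKc: "(f ^^ a) ` frontier A \<subseteq> Kc" for a using K(2) L_Kc [of a] unfolding L_def by blast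
 have frA: "frontier A \<subseteq> Kc" using K(2) L_Kc [of 0] L0 by blast
 obtain W where W: "W \<in> components FS" "W \<inter> orbit V = {}" "f ` W \<subseteq> orbit V" using escaping_preimage [OF V m ret] .
 obtain w where w: "w \<in> W" using in_components_nonempty [OF W(1)] by blast
 obtain \<rho> where \<rho>: "\<rho> > 0" "cball w \<rho> \<subseteq> W" using open_fatou_component [OF W(1)] w open_contains_cball by blast
 have wF: "w \<in> FS" using w in_components_subset [OF W(1)] by blast
 have tameW: "tame x" if x: "x \<in> W" for x
 proof -
  obtain a where "f x \<in> (f ^^ a) ` V" using W(3) x unfolding orbit_def by blast
  hence eq: "f ` W = (f ^^ a) ` V"
   using x components_nonoverlap [OF image_fatou_component [OF W(1)] iterate_fatou_component [OF V, of a]] by blast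
  have "recurrent ((f ^^ a) ` V)" unfolding recurrent_def
  proof (intro conjI exI [of _ m] ballI m)
   show "(f ^^ a) ` V \<in> components FS" by (rule iterate_fatou_component [OF V])
   show "(\<lambda>j. (f ^^ m j) y) \<longlonglongrightarrow> y" if "y \<in> (f ^^ a) ` V" for y
    by (rule orbit_returns [OF V m ret]) (use that in \<open>auto simp: orbit_def\<close>)
  qed
  hence "recurrent ((f ^^ 1) ` W)" using eq by simp
  thus ?thesis using x W(1) unfolding tame_def by blast
 qed
 have Jne: "JS \<noteq> {}" using frA KcJ sides_frontier_nonempty [OF AB] by blast
 have cb: "compact (cball w \<rho>)" by (intro closed_imp_compact_sphere closed_cball)
 text \<open>\<open>T\<close> restricts the part of the Julia set near \<open>Kc\<close>, and \<open>C\<close> is to be part of the barrier.\<close>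
 have at_barrier: R
  if T: "open T" "Kc \<subseteq> T" "T \<inter> CV = {}" and C: "compact C" "\<And>x. x \<in> C \<Longrightarrow> tame x" and b: "CV \<inter> FS \<subseteq> {c}"
   and concl: "\<And>E NA NB. closed E \<Longrightarrow> E \<subseteq> FS \<Longrightarrow> f ` E \<subseteq> E \<Longrightarrow> open NA \<Longrightarrow> open NB \<Longrightarrow> NA \<inter> NB = {} \<Longrightarrow>
    - E \<subseteq> NA \<union> NB \<Longrightarrow> CV \<inter> JS \<subseteq> NB \<Longrightarrow> Kc \<subseteq> NA \<Longrightarrow> cball w \<rho> \<union> C \<subseteq> E \<Longrightarrow>
    (\<And>U. U \<in> components FS \<Longrightarrow> \<not> multiply_connected U \<Longrightarrow> frontier U \<inter> T = {} \<Longrightarrow> U \<subseteq> NB) \<Longrightarrow> R"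
  for T C c R
 proof -
  obtain P Q where PQ: "closed P" "closed Q" "P \<inter> Q = {}" "P \<union> Q = JS" "Kc \<subseteq> P" "P \<subseteq> T"
   using clopen_around_components [of "{..<k}" L T] Lc T(1,2) unfolding Kc_def by blast
  have "compact (cball w \<rho> \<union> C)" "\<And>x. x \<in> cball w \<rho> \<union> C \<Longrightarrow> tame x" using cb C tameW \<rho>(2) by auto
  then obtain E NA NB where E: "closed E" "cball w \<rho> \<union> C \<subseteq> E" "E \<subseteq> FS" "f ` E \<subseteq> E"
   "open NA" "open NB" "NA \<inter> NB = {}" "- E \<subseteq> NA \<union> NB" "P \<subseteq> NA" "Q \<subseteq> NB"
   "\<And>U. U \<in> components FS \<Longrightarrow> \<not> multiply_connected U \<Longrightarrow> frontier U \<subseteq> Q \<Longrightarrow> U \<subseteq> NB"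
   using barrier [OF b PQ(1-4) Jne] by metis
  show R
  proof (rule concl [OF E(1,3,4,5,6,7,8) _ _ E(2)])
   show "CV \<inter> JS \<subseteq> NB" using PQ(4,6) T(3) E(10) by blast
   show "Kc \<subseteq> NA" using PQ(5) E(9) by blast
   show "U \<subseteq> NB" if "U \<in> components FS" "\<not> multiply_connected U" "frontier U \<inter> T = {}" for U
    using E(11) [OF that(1,2)] frontier_component_julia [OF that(1)] PQ(4,6) that(3) by blast
  qed
 qed
 have CVc: "open (- CV)" "Kc \<subseteq> - CV" "- CV \<inter> CV = {}"
  using finite_critical_values KcCV by (auto intro: finite_imp_closed)
 have frA_ne: "UNIV \<inter> frontier A \<noteq> {}" using sides_frontier_nonempty [OF AB] by simp
 show False
 proof (cases "b \<in> CV \<inter> FS \<and> \<not> tame b")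
  case False
  \<comment> \<open>If \<open>b\<close> is not a critical value in the Fatou set, there is none
    there, and the tame point \<open>w\<close> takes its place.\<close>
  define c where "c = (if b \<in> CV \<inter> FS then b else w)"
  have c: "CV \<inter> FS \<subseteq> {c}" "tame c" using CVF False tameW [OF w] by (auto simp: c_def)
  show False
  proof (rule at_barrier [OF CVc, of "{c}" c])
   fix E NA NB
   assume E: "closed E" "E \<subseteq> FS" "f ` E \<subseteq> E" "open NA" "open NB" "NA \<inter> NB = {}" "- E \<subseteq> NA \<union> NB"
    "CV \<inter> JS \<subseteq> NB" "Kc \<subseteq> NA" "cball w \<rho> \<union> {c} \<subseteq> E"
   hence wE: "cball w \<rho> \<subseteq> E" and cE: "c \<notin> NA - E" by auto
   show False
    using tracked_frontier_contradiction [OF V m ret c(1) mc AB frKc E(9,1-8) W \<rho>(1) wE w open_UNIV frA_ne] cE by blast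
  qed (use c in auto)
 next
  case True
  then obtain U where U: "U \<in> components FS" "b \<in> U" by (metis IntD2 UnionE Union_components)
  have "contracting U" using contracting_or_recurrent [OF U(1)] True U unfolding tame_def by blast
  have smc: "\<not> multiply_connected U" using tame_multiply_connected [OF CVF _ U(2)] True by blast
  have "- U \<noteq> {}" using in_components_subset [OF U(1)] Jne by (auto simp: julia_set_def)
  hence fr: "connected (frontier U)" "frontier U \<noteq> {}" using frontier_component [OF U(1) smc] by auto
  show False
  proof (cases "frontier U \<inter> Kc = {}")
   case True
   show False
   \<comment> \<open>Removing the frontier of \<open>U\<close> from \<open>T\<close> forces
     \<open>U\<close>, and with it \<open>b\<close>, into \<open>NB\<close>.\<close>
   proof (rule at_barrier [of "- (CV \<union> frontier U)" "{}" b])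
    show "open (- (CV \<union> frontier U))" using finite_critical_values by (auto intro!: open_Compl closed_Un finite_imp_closed)
    show "Kc \<subseteq> - (CV \<union> frontier U)" using True KcCV by blast
    fix E NA NB
    assume E: "closed E" "E \<subseteq> FS" "f ` E \<subseteq> E" "open NA" "open NB" "NA \<inter> NB = {}" "- E \<subseteq> NA \<union> NB"
     "CV \<inter> JS \<subseteq> NB" "Kc \<subseteq> NA" "cball w \<rho> \<union> {} \<subseteq> E"
     and NB: "\<And>U'. U' \<in> components FS \<Longrightarrow> \<not> multiply_connected U' \<Longrightarrow> frontier U' \<inter> - (CV \<union> frontier U) = {} \<Longrightarrow> U' \<subseteq> NB"
    have wE: "cball w \<rho> \<subseteq> E" using E(10) by blast
    have "U \<subseteq> NB" by (rule NB [OF U(1) smc]) blast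
    hence bNA: "b \<notin> NA - E" using U(2) E(6) by blast
    show False
     using tracked_frontier_contradiction [OF V m ret CVF mc AB frKc E(9,1-8) W \<rho>(1) wE w open_UNIV frA_ne] bNA by blast
   qed (use CVF in auto)
  next
   case False
   then obtain i where i: "frontier U \<inter> L i \<noteq> {}" unfolding Kc_def by blast
   have "frontier U \<subseteq> L i"
    by (rule components_maximal [OF Lc fr(1) frontier_component_julia [OF U(1)]]) (use i in blast)
   hence frU: "frontier U \<subseteq> Kc" using L_Kc by blast
   show False
   proof (rule at_barrier [OF CVc, of "{}" b])
    fix E NA NB
    assume E: "closed E" "E \<subseteq> FS" "f ` E \<subseteq> E" "open NA" "open NB" "NA \<inter> NB = {}" "- E \<subseteq> NA \<union> NB"
     "CV \<inter> JS \<subseteq> NB" "Kc \<subseteq> NA" "cball w \<rho> \<union> {} \<subseteq> E"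
    have wE: "cball w \<rho> \<subseteq> E" using E(10) by blast
    define X where "X = closure (range (\<lambda>n. (f ^^ n) b))"
    show False
    \<comment> \<open>If a part of the frontier of \<open>A\<close> lies off the closure of the
      orbit of \<open>b\<close>, branches started there never meet \<open>b\<close>.\<close>
    proof (cases "frontier A \<subseteq> X")
     case False
     hence N: "open (- X)" "- X \<inter> frontier A \<noteq> {}" by (auto simp: X_def)
     have "(f ^^ n) b \<notin> - X" for n unfolding X_def using closure_subset [of "range (\<lambda>n. (f ^^ n) b)"] by blast
     thus False using tracked_frontier_contradiction [OF V m ret CVF mc AB frKc E(9,1-8) W \<rho>(1) wE w N] by blast
    next
     case True
     hence cl: "frontier A \<subseteq> closure (range (\<lambda>n. (f ^^ n) b))" by (simp add: X_def)
     show False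
     proof (cases "\<exists>i j. i < j \<and> (f ^^ i) ` U = (f ^^ j) ` U")
      case True
      then obtain i j where ij: "i < j" "(f ^^ i) ` U = (f ^^ j) ` U" by blast
      hence per: "(f ^^ i) ` U = (f ^^ (i + (j - i))) ` U" "1 \<le> j - i" by auto
      show False by (rule preperiodic_contradiction [OF V m ret AB U \<open>contracting U\<close> per cl])
     next
      case False
      hence wander: "\<And>i j. i < j \<Longrightarrow> (f ^^ i) ` U \<noteq> (f ^^ j) ` U" by blast
      show False
       by (rule wandering_contradiction [OF V m ret AB CVF cKc KcJ fKc frA E(9,1-8) W \<rho>(1) wE w U frU wander cl])
     qed
    qed
   qed (use CVF in auto)
  qed
 qed
qed

end

lemma two_critical_values_in_periodic_components:
 assumes J: "\<not> connected JS" and CVF: "CV \<inter> FS \<subseteq> {b}"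
 shows "\<exists>v w. v \<noteq> w \<and> {v, w} \<subseteq> CV \<inter> \<Union> (periodic_julia_components f)"
proof -
 obtain U where U: "multiply_connected U" by (rule exists_multiply_connected [OF J])
 obtain n where "recurrent ((f ^^ n) ` U)" by (rule multiply_connected_recurrent [OF CVF U])
 define V where "V = (f ^^ n) ` U"
 have "recurrent V" unfolding V_def by fact
 then obtain m where m: "V \<in> components FS" "filterlim m at_top sequentially" "\<And>x. x \<in> V \<Longrightarrow> (\<lambda>j. (f ^^ m j) x) \<longlonglongrightarrow> x"
  unfolding recurrent_def by blast
 have mc: "\<not> connected (- V)"
  using multiply_connected_iterate [OF CVF U, of n] by (simp add: multiply_connected_def V_def)
 obtain A B where AB: "sides V A B" using two_sides [OF m mc] unfolding sides_def by metis
 have comp: "\<exists>K\<in>components JS. frontier A \<subseteq> K" if "sides V A B" for A B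
  using exists_component_superset [OF sides_frontier(3) [OF m(1) that] _ sides_frontier(5) [OF m(1) that]]
   sides_frontier(3) [OF m(1) that] sides_frontier_nonempty [OF that] by blast
 note BA = sidesD(9) [OF AB]
 obtain K L where K: "K \<in> components JS" "frontier A \<subseteq> K" and L: "L \<in> components JS" "frontier B \<subseteq> L"
  using comp [OF AB] comp [OF BA] by blast
 obtain i v where v: "v \<in> (f ^^ i) ` K" "v \<in> CV" using side_cycle_critical_value [OF m mc CVF AB K] by blast
 obtain j w where w: "w \<in> (f ^^ j) ` L" "w \<in> CV" using side_cycle_critical_value [OF m mc CVF BA L] by blast
 have "v \<noteq> w" using side_cycles_disjoint [OF m CVF mc AB K L, of i j] v(1) w(1) by blast
 moreover have "(f ^^ i) ` K \<in> periodic_julia_components f" "(f ^^ j) ` L \<in> periodic_julia_components f"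
  using side_components_periodic [OF m CVF mc AB K] side_components_periodic [OF m CVF mc BA L] by blast+
 ultimately show ?thesis using v w by blast
qed

end

theorem theorem3p1:
  fixes f :: "riemann_sphere \<Rightarrow> riemann_sphere" and d :: nat
  assumes "rational_map_of_degree d f"
    and "d \<ge> 2"
    and "\<not> connected (julia_set f)"
  shows "(\<exists>v w. v \<noteq> w \<and> {v, w} \<subseteq> critical_values f \<inter> fatou_set f) \<or>
         (\<exists>v w. v \<noteq> w \<and> {v, w} \<subseteq> critical_values f \<inter> \<Union> (periodic_julia_components f))"
proof (cases "\<exists>v w. v \<noteq> w \<and> {v, w} \<subseteq> critical_values f \<inter> fatou_set f")
  case False
  obtain p q where pq: "coprime p q" "f = ratfun p q" "d = max (degree p) (degree q)"
    using assms(1) unfolding rational_map_of_degree_def by blast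
  interpret rational_map f p q d by standard (use pq assms(2) in auto)
  obtain b where b: "critical_values f \<inter> fatou_set f \<subseteq> {b}"
  proof (cases "critical_values f \<inter> fatou_set f = {}")
    case True
    then show thesis using that by blast
  next
    case nonempty: False
    then obtain b where "b \<in> critical_values f \<inter> fatou_set f" by blast
    then show thesis using that [of b] False by blast
  qed
  show ?thesis by (rule disjI2 [OF two_critical_values_in_periodic_components [OF assms(3) b]])
qed (rule disjI1)

end
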